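(* For $\alpha \in \left\{\frac{1}{2},2\right\}$, for every partition $\pi$ and every Young diagram $\lambda$, \[\mathrm{Ch}_\pi^{(\alpha)} (\lambda) = (-1)^{\ell(\pi)} \sum_M \left(- \frac{1}{\sqrt{\alpha}}\right)^{|V_\bullet(M)|} \left( {\sqrt{\alpha}}\right)^{|V_\circ(M)|} \operatorname{wt}_M\, N_M(\lambda),\] where the summation runs over all maps with face-type $\pi$.
   Context: Jack characters: with $J^{(\alpha)}_\lambda$ the Jack symmetric function in Macdonald's $J$-normalization, write $J_\lambda^{(\alpha)}=\sum_{|\rho|=|\lambda|}\theta_{\rho}^{(\alpha)}(\lambda)\,p_{\rho}$ and set $\mathrm{Ch}_{\pi}^{(\alpha)}(\lambda)=\alpha^{-\frac{|\pi|-\ell(\pi)}{2}}\binom{|\lambda|-|\pi|+m_1(\pi)}{m_1(\pi)}\,z_\pi\,\theta^{(\alpha)}_{\pi \cup 1^{|\lambda|-|\pi|}}(\lambda)$, where $z_\pi=\pi_1\pi_2\cdots m_1(\pi)!m_2(\pi)!\cdots$ and $m_i(\pi)$ is the multiplicity of $i$ in $\pi$. Maps: a map is a triple $M=(\mathcal{B},\mathcal{W},\mathcal{E})$ of pairings of a finite set $S$. For pairings $P,P'$ of $S$, $\mathcal{L}(P,P')$ is the bipartite graph with vertices the pairs of $P$ and $P'$ and edges the elements of $S$; it is a union of polygons of lengths $2\ell_1\ge2\ell_2\ge\cdots$, and $(\ell_1,\ell_2,\dots)$ is the type of $(P,P')$. Faces of $M$ are polygons of $\mathcal{L}(\mathcal{B},\mathcal{W})$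 and the face-type of $M$ is the type of $(\mathcal{B},\mathcal{W})$; summing over maps of face-type $\pi$ means fixing $(\mathcal{B},\mathcal{W})$ of type $\pi$ and summing over all pairings $\mathcal{E}$ of the ground set. Black (resp. white) vertices $V_\bullet(M)$ (resp. $V_\circ(M)$) are polygons of $\mathcal{L}(\mathcal{B},\mathcal{E})$ (resp. $\mathcal{L}(\mathcal{W},\mathcal{E})$); edges are the pairs of $\mathcal{E}$. For a bipartite graph $G$, $N_G(\lambda)$ is the number of maps sending white vertices to columns of $\lambda$, black vertices to rows, edges to boxes, compatibly with incidence; $N_M:=N_G$ for the underlying graph of $M$. Weight: with $\gamma=\frac{1-\alpha}{\sqrt\alpha}$, an edge $\{s_1,s_2\}$ is straight (weight $1$) if $s_1,s_2$ lie in the same face at even distance along the polygon, twisted (weight $\gamma$) if in the same face at odd distance, interface (weight $\tfrac12$) if in different faces. Removing an edge $E=\{s_1,s_2\}$: for each pairing $P$ of the triple, $P_E=P\setminus\{E\}$ if $E\in P$, otherwise replace the pairs $\{s_1,t_1\},\{s_2,t_2\}$ by $\{t_1,t_2\}$. For a history $E_1\prec\dots\prec E_n$, $\operatorname{wt}_{M,\prec}$ is the product over $i$ of the weight of $E_{i+1}$ in $M\setminus\{E_1,\dots,E_i\}$, and $\operatorname{wt}_M$ is its average over all $n!$ histories. *)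

theory Defs
  imports
    Complex_Main
    "HOL-Library.Poly_Mapping"
    "HOL-Library.Disjoint_Sets"
    "HOL-Library.FuncSet"
    "HOL-Combinatorics.Multiset_Permutations"
begin

section \<open>Partitions and Young diagrams\<close>

text \<open>Partitions are weakly decreasing lists of positive integers; \<open>|\<lambda>|\<close> is
  \<^term>\<open>sum_list\<close> and \<open>\<ell>(\<lambda>)\<close> is \<^term>\<open>length\<close>. Rows, columns and boxes of Young diagrams
  are indexed from 0.\<close>

definition is_partition :: "nat list \<Rightarrow> bool" where
  "is_partition l \<longleftrightarrow> sorted_wrt (\<ge>) l \<and> 0 \<notin> set l"

definition part_z :: "nat list \<Rightarrow> nat" where
  "part_z r = prod_list r * (\<Prod>i\<in>set r. fact (count_list r i))"

definition dominates :: "nat list \<Rightarrow> nat list \<Rightarrow> bool" where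
  "dominates l m \<longleftrightarrow> sum_list m = sum_list l \<and> (\<forall>k. sum_list (take k m) \<le> sum_list (take k l))"

definition rows :: "nat list \<Rightarrow> nat set" where
  "rows l = {i. i < length l}"

definition col_length :: "nat list \<Rightarrow> nat \<Rightarrow> nat" where
  "col_length l j = card {i. i < length l \<and> j < l ! i}"

definition columns :: "nat list \<Rightarrow> nat set" where
  "columns l = {j. 0 < col_length l j}"

definition boxes :: "nat list \<Rightarrow> (nat \<times> nat) set" where
  "boxes l = {(i, j). i < length l \<and> j < l ! i}"

definition arm :: "nat list \<Rightarrow> nat \<times> nat \<Rightarrow> nat" where
  "arm l = (\<lambda>(i, j). l ! i - j - 1)"

definition leg :: "nat list \<Rightarrow> nat \<times> nat \<Rightarrow> nat" where
  "leg l = (\<lambda>(i, j). col_length l j - i - 1)"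


section \<open>Symmetric functions\<close>

text \<open>A formal power series in the variables \<open>x\<^sub>0, x\<^sub>1, \<dots>\<close> is given by its coefficients;
  a monomial is its finitely supported exponent vector.\<close>

type_synonym series = "(nat \<Rightarrow>\<^sub>0 nat) \<Rightarrow> real"

definition series_one :: series where
  "series_one = (\<lambda>b. if b = 0 then 1 else 0)"

definition series_times :: "series \<Rightarrow> series \<Rightarrow> series" where
  "series_times f g = (\<lambda>b. \<Sum>(c, d)\<in>{(c, d). c + d = b}. f c * g d)"

definition monomial_sym :: "nat list \<Rightarrow> series" where
  "monomial_sym m = (\<lambda>b.
     if image_mset (Poly_Mapping.lookup b) (mset_set (Poly_Mapping.keys b)) = mset m then 1 else 0)"

definition power_sum :: "nat \<Rightarrow> series" where
  "power_sum k = (\<lambda>b. if \<exists>i. b = Poly_Mapping.single i k then 1 else 0)"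

definition power_sums :: "nat list \<Rightarrow> series" where
  "power_sums r = foldr series_times (map power_sum r) series_one"

definition power_coeff :: "series \<Rightarrow> nat list \<Rightarrow> real" where
  "power_coeff f = (THE a. finite {r. a r \<noteq> 0} \<and> (\<forall>r. a r \<noteq> 0 \<longrightarrow> is_partition r)
      \<and> f = (\<lambda>b. \<Sum>r | a r \<noteq> 0. a r * power_sums r b))"

text \<open>The bilinear form with \<open>\<langle>p\<^sub>\<rho>, p\<^sub>\<sigma>\<rangle> = \<delta>\<^bsub>\<rho>\<sigma>\<^esub> z\<^sub>\<rho> \<alpha>\<^bsup>\<ell>(\<rho>)\<^esup>\<close>.\<close>

definition jack_form :: "real \<Rightarrow> series \<Rightarrow> series \<Rightarrow> real" where
  "jack_form \<alpha> f g = (\<Sum>r | power_coeff f r \<noteq> 0.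
     power_coeff f r * power_coeff g r * real (part_z r) * \<alpha> ^ length r)"


section \<open>Jack symmetric functions and Jack characters\<close>

definition jack_P_family :: "real \<Rightarrow> (nat list \<Rightarrow> series) \<Rightarrow> bool" where
  "jack_P_family \<alpha> P \<longleftrightarrow>
     (\<forall>l. is_partition l \<longrightarrow> (\<exists>u. P l = (\<lambda>b. monomial_sym l b
        + (\<Sum>m | is_partition m \<and> dominates l m \<and> m \<noteq> l. u m * monomial_sym m b)))) \<and>
     (\<forall>l m. is_partition l \<and> is_partition m \<and> l \<noteq> m \<longrightarrow> jack_form \<alpha> (P l) (P m) = 0)"

text \<open>For \<open>\<alpha> > 0\<close> the conditions determine the values of the family on partitions; only
  these values are used.\<close>

definition jack_P :: "real \<Rightarrow> nat list \<Rightarrow> series" where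
  "jack_P \<alpha> = (SOME P. jack_P_family \<alpha> P)"

definition jack_J :: "real \<Rightarrow> nat list \<Rightarrow> series" where
  "jack_J \<alpha> l = (\<lambda>b. (\<Prod>s\<in>boxes l. \<alpha> * real (arm l s) + real (leg l s) + 1) * jack_P \<alpha> l b)"

definition jack_theta :: "real \<Rightarrow> nat list \<Rightarrow> nat list \<Rightarrow> real" where
  "jack_theta \<alpha> r l = power_coeff (jack_J \<alpha> l) r"

text \<open>As usual, the character vanishes on diagrams with fewer than \<open>|\<pi>|\<close> boxes, where
  \<open>1\<^bsup>|\<lambda>|-|\<pi>|\<^esup>\<close> makes no sense.\<close>

definition jack_Ch :: "real \<Rightarrow> nat list \<Rightarrow> nat list \<Rightarrow> real" where
  "jack_Ch \<alpha> p l = (if sum_list p \<le> sum_list l then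
      \<alpha> powr (- ((real (sum_list p) - real (length p)) / 2))
      * real ((sum_list l - sum_list p + count_list p 1) choose count_list p 1)
      * real (part_z p)
      * jack_theta \<alpha> (p @ replicate (sum_list l - sum_list p) 1) l
    else 0)"


section \<open>Pairings and maps\<close>

definition pairings :: "'a set \<Rightarrow> 'a set set set" where
  "pairings S = {P. partition_on S P \<and> (\<forall>p\<in>P. card p = 2)}"

text \<open>In the graph \<open>\<L>(P,Q)\<close> the elements of the ground set are the edges, and two of them
  share an end vertex iff they lie in a common pair of \<open>P\<close> or of \<open>Q\<close>. A polygon (connected
  component) is represented by its set of edges.\<close>

definition next_to :: "'a set set \<Rightarrow> 'a set set \<Rightarrow> ('a \<times> 'a) set" where
  "next_to P Q = {(s, t). s \<noteq> t \<and> (\<exists>p\<in>P \<union> Q. s \<in> p \<and> t \<in> p)}"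

definition polygons :: "'a set set \<Rightarrow> 'a set set \<Rightarrow> 'a set set" where
  "polygons P Q = (\<Union>P \<union> \<Union>Q) // (next_to P Q)\<^sup>*"

definition pairs_type :: "'a set set \<Rightarrow> 'a set set \<Rightarrow> nat list" where
  "pairs_type P Q =
     rev (sorted_list_of_multiset (image_mset (\<lambda>L. card L div 2) (mset_set (polygons P Q))))"

record 'a gmap =
  blacks :: "'a set set"
  whites :: "'a set set"
  edges :: "'a set set"

definition faces :: "'a gmap \<Rightarrow> 'a set set" where
  "faces M = polygons (blacks M) (whites M)"

definition black_vertices :: "'a gmap \<Rightarrow> 'a set set" where
  "black_vertices M = polygons (blacks M) (edges M)"

definition white_vertices :: "'a gmap \<Rightarrow> 'a set set" where
  "white_vertices M = polygons (whites M) (edges M)"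


section \<open>The weight of a map\<close>

text \<open>The distance of two distinct elements of a face is the number of polygon edges lying
  strictly between them, on the shorter arc. So neighbouring elements have distance 0; the
  parity does not depend on the arc, since the polygon has even length.\<close>

definition face_distance :: "'a gmap \<Rightarrow> 'a \<Rightarrow> 'a \<Rightarrow> nat" where
  "face_distance M s t = (LEAST k. (s, t) \<in> next_to (blacks M) (whites M) ^^ Suc k)"

definition straight_edge :: "'a gmap \<Rightarrow> 'a set \<Rightarrow> bool" where
  "straight_edge M E \<longleftrightarrow> (\<exists>F\<in>faces M. \<exists>s\<in>F. \<exists>t\<in>F. s \<noteq> t \<and> E = {s, t} \<and> even (face_distance M s t))"

definition twisted_edge :: "'a gmap \<Rightarrow> 'a set \<Rightarrow> bool" where
  "twisted_edge M E \<longleftrightarrow> (\<exists>F\<in>faces M. \<exists>s\<in>F. \<exists>t\<in>F. s \<noteq> t \<and> E = {s, t} \<and> odd (face_distance M s t))"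

definition jack_gamma :: "real \<Rightarrow> real" where
  "jack_gamma \<alpha> = (1 - \<alpha>) / sqrt \<alpha>"

text \<open>The remaining case is that of an interface edge.\<close>

definition edge_weight :: "real \<Rightarrow> 'a gmap \<Rightarrow> 'a set \<Rightarrow> real" where
  "edge_weight \<alpha> M E =
     (if straight_edge M E then 1 else if twisted_edge M E then jack_gamma \<alpha> else 1 / 2)"

definition remove_pair :: "'a set \<Rightarrow> 'a set set \<Rightarrow> 'a set set" where
  "remove_pair E P = (if E \<in> P then P - {E}
     else {p \<in> P. p \<inter> E = {}} \<union> {\<Union>{p \<in> P. p \<inter> E \<noteq> {}} - E})"

definition remove_edge :: "'a set \<Rightarrow> 'a gmap \<Rightarrow> 'a gmap" where
  "remove_edge E M = \<lparr>blacks = remove_pair E (blacks M), whites = remove_pair E (whites M),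
     edges = remove_pair E (edges M)\<rparr>"

text \<open>A history is the list of the edges in the order of removal.\<close>

fun history_weight :: "real \<Rightarrow> 'a gmap \<Rightarrow> 'a set list \<Rightarrow> real" where
  "history_weight \<alpha> M [] = 1"
| "history_weight \<alpha> M (E # h) = edge_weight \<alpha> M E * history_weight \<alpha> (remove_edge E M) h"

definition map_weight :: "real \<Rightarrow> 'a gmap \<Rightarrow> real" where
  "map_weight \<alpha> M =
     (\<Sum>h\<in>permutations_of_set (edges M). history_weight \<alpha> M h) / fact (card (edges M))"


section \<open>Embeddings of bipartite graphs into Young diagrams\<close>

record ('b, 'w, 'e) bigraph =
  bverts :: "'b set"
  wverts :: "'w set"
  gedges :: "'e set"
  binc :: "'b \<Rightarrow> 'e \<Rightarrow> bool"
  winc :: "'w \<Rightarrow> 'e \<Rightarrow> bool"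

definition embeddings ::
  "('b, 'w, 'e) bigraph \<Rightarrow> nat list \<Rightarrow> (('w \<Rightarrow> nat) \<times> ('b \<Rightarrow> nat) \<times> ('e \<Rightarrow> nat \<times> nat)) set" where
  "embeddings G l = {(c, r, x).
      c \<in> wverts G \<rightarrow>\<^sub>E columns l \<and> r \<in> bverts G \<rightarrow>\<^sub>E rows l \<and> x \<in> gedges G \<rightarrow>\<^sub>E boxes l \<and>
      (\<forall>e\<in>gedges G. (\<forall>v\<in>bverts G. binc G v e \<longrightarrow> fst (x e) = r v) \<and>
                    (\<forall>v\<in>wverts G. winc G v e \<longrightarrow> snd (x e) = c v))}"

definition graph_N :: "('b, 'w, 'e) bigraph \<Rightarrow> nat list \<Rightarrow> nat" where
  "graph_N G l = card (embeddings G l)"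

definition underlying_graph :: "'a gmap \<Rightarrow> ('a set, 'a set, 'a set) bigraph" where
  "underlying_graph M = \<lparr>bverts = black_vertices M, wverts = white_vertices M, gedges = edges M,
     binc = (\<lambda>v e. e \<subseteq> v), winc = (\<lambda>v e. e \<subseteq> v)\<rparr>"

definition map_N :: "'a gmap \<Rightarrow> nat list \<Rightarrow> nat" where
  "map_N M l = graph_N (underlying_graph M) l"

end

theory Submission
  imports Defs
begin

text \<open>For \<open>\<alpha> \<in> {1/2, 2}\<close> one has \<open>\<gamma>\<^sup>2 = 1/2\<close>, and then all histories of a map have the same weight
  \<open>\<gamma>\<close> to the power edges + faces - vertices. Hence the right-hand side is, up to a constant, the sum of
  \<open>(-2)\<close> to the number of white (for \<open>\<alpha> = 1/2\<close>: black) vertices over all pairings \<open>E\<close> of the ground set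
  and all maps \<open>f\<close> from the ground set to the boxes that are compatible with \<open>B\<close>, \<open>W\<close> and \<open>E\<close>. Summing over
  \<open>E\<close> first kills every \<open>f\<close> with a fibre of more than two elements, and the remaining \<open>f\<close> are
  counted by isomorphisms of pairs of pairings: this gives the zonal character formula
  \<open>t\<^sub>\<rho>(\<lambda>) = \<Sum> sgn \<sigma>\<close>, over row preserving pairings of two copies of \<open>\<lambda>\<close> and column preserving
  permutations \<open>\<sigma>\<close> whose union has type \<open>\<rho>\<close>.

  That \<open>t\<close> (for \<open>\<alpha> = 1/2\<close> with rows and columns exchanged, and rescaled) is the power sum expansion of the
  Jack function follows from the characterisation of the latter: triangularity and orthogonality come
  from sign reversing involutions, and the leading coefficient is the Gaussian expectation of a product of
  minors of a real (quaternionic) matrix. Integrating the rows of one column of the diagram by parts,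
  a Capelli type argument produces the factors of the hook product one after the other.\<close>

section \<open>Pairings and polygons\<close>

text \<open>The constant -2 comes from comparing vertex weights with \<gamma>. For
  \<open>\<alpha> = 2\<close> one has \<open>- (1 / sqrt \<alpha>) = \<gamma>\<close> and
  \<open>sqrt \<alpha> = -2 * \<gamma>\<close>; for \<open>\<alpha> = 1 / 2\<close> the two values
  are exchanged. After division by \<gamma> to the number of vertices only one colour of vertices
  keeps a factor -2. The power (-2)^n then splits into a sign (-1)^n and the number 2^n of proper
  2-colourings of n polygons: the colourings refine a two-to-one labelling by boxes to bijections
  onto two copies of the diagram, the signs become signs of permutations. Polygons are counted by
  one move, the contraction of a pair of one pairing in the other, which loses a polygon exactly
  when the pair is common. Jack functions are given by a choice operator and their coefficients by a
  description operator, so power sums have to be independent and the orthogonal triangular family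
  unique. Gaussian expectation is purely algebraic: Wick's formula on polynomials, whose recursion
  is integration by parts. Diagrams with more than |\<pi>| boxes are reached by deleting one box in
  all possible ways; this is the source of the binomial coefficient.\<close>

definition mate :: "'a set set \<Rightarrow> 'a \<Rightarrow> 'a" where
 "mate P s = (THE t. {s, t} \<in> P)"

definition pairs_of :: "'a set \<Rightarrow> ('a \<Rightarrow> 'a) \<Rightarrow> 'a set set" where
 "pairs_of S m = (\<lambda>s. {s, m s}) ` S"

text \<open>Functions constant on the pairs of a pairing take the place of paths: a polygon is later
  recognised as the smallest set through a point whose indicator is constant on both
  pairings.\<close>

definition const_on :: "'a set set \<Rightarrow> ('a \<Rightarrow> 'b) \<Rightarrow> bool" where
 "const_on P f \<longleftrightarrow> (\<forall>s t. {s, t} \<in> P \<longrightarrow> f s = f t)"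

definition alternating_on :: "'a set set \<Rightarrow> ('a \<Rightarrow> bool) \<Rightarrow> bool" where
 "alternating_on P f \<longleftrightarrow> (\<forall>s t. {s, t} \<in> P \<longrightarrow> f s \<noteq> f t)"

lemma pairings_pairE:
 assumes "P \<in> pairings S" "p \<in> P"
 obtains s t where "s \<noteq> t" "p = {s, t}" "s \<in> S" "t \<in> S"
proof -
 from assms have "card p = 2" and sub: "p \<subseteq> S" by (auto simp: pairings_def partition_on_def)
 then obtain s t where "p = {s, t}" "s \<noteq> t" by (meson card_2_iff)
 with sub that show ?thesis by blast
qed

lemma pairings_uniq:
 assumes "P \<in> pairings S" "p \<in> P" "q \<in> P" "s \<in> p" "s \<in> q"
 shows "p = q" using assms by (auto simp: pairings_def partition_on_def disjoint_def)

lemma pairings_cover: "P \<in> pairings S \<Longrightarrow> \<Union>P = S"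
 by (auto simp: pairings_def partition_on_def)

lemma pair_neq: "P \<in> pairings S \<Longrightarrow> {s, t} \<in> P \<Longrightarrow> s \<noteq> t"
 by (auto simp: pairings_def)

lemma pair_in: "P \<in> pairings S \<Longrightarrow> {s, t} \<in> P \<Longrightarrow> s \<in> S \<and> t \<in> S"
 by (auto simp: pairings_def partition_on_def)

lemma mate_eqI:
 assumes "P \<in> pairings S" "{s, t} \<in> P"
 shows "mate P s = t" unfolding mate_def
proof (rule the_equality)
 fix u assume "{s, u} \<in> P"
 with assms have "{s, u} = {s, t}" by (meson pairings_uniq insertI1)
 with pair_neq[OF assms(1) \<open>{s, u} \<in> P\<close>] show "u = t" by (auto simp: doubleton_eq_iff)
qed (fact assms(2))

lemma mate_pair:
 assumes "P \<in> pairings S" "s \<in> S"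
 shows "{s, mate P s} \<in> P"
proof -
 from assms obtain p where "p \<in> P" "s \<in> p" by (metis UnionE pairings_cover)
 obtain u v where "p = {u, v}" using assms(1) \<open>p \<in> P\<close> by (auto elim: pairings_pairE)
 with \<open>s \<in> p\<close> obtain t where "p = {s, t}" by blast
 with \<open>p \<in> P\<close> mate_eqI[OF assms(1)] show ?thesis by metis
qed

lemma pair_iff: "P \<in> pairings S \<Longrightarrow> {s, t} \<in> P \<longleftrightarrow> s \<in> S \<and> t = mate P s"
 by (metis mate_eqI mate_pair pair_in)

lemma mate_in: "P \<in> pairings S \<Longrightarrow> s \<in> S \<Longrightarrow> mate P s \<in> S"
 by (metis mate_pair pair_in)

lemma mate_neq: "P \<in> pairings S \<Longrightarrow> s \<in> S \<Longrightarrow> mate P s \<noteq> s"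
 by (metis mate_pair pair_neq)

lemma mate_mate: "P \<in> pairings S \<Longrightarrow> s \<in> S \<Longrightarrow> mate P (mate P s) = s"
 by (metis insert_commute mate_pair mate_eqI)

lemma mate_inj: "P \<in> pairings S \<Longrightarrow> s \<in> S \<Longrightarrow> t \<in> S \<Longrightarrow> mate P s = mate P t \<Longrightarrow> s = t"
 by (metis mate_mate)

lemma pairs_of_mate:
 assumes "P \<in> pairings S" shows "pairs_of S (mate P) = P"
proof
 show "pairs_of S (mate P) \<subseteq> P" using mate_pair[OF assms] by (auto simp: pairs_of_def)
 show "P \<subseteq> pairs_of S (mate P)"
 proof
  fix p assume "p \<in> P"
  with assms obtain s t where "p = {s, t}" "s \<in> S" by (metis pairings_pairE)
  with \<open>p \<in> P\<close> show "p \<in> pairs_of S (mate P)" using mate_eqI[OF assms, of s t]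
   by (auto simp: pairs_of_def)
 qed
qed

lemma pairings_eqI:
 assumes "P \<in> pairings S" "Q \<in> pairings S" "\<And>s. s \<in> S \<Longrightarrow> mate P s = mate Q s"
 shows "P = Q" using pairs_of_mate[OF assms(1)] pairs_of_mate[OF assms(2)] assms(3)
 by (metis (no_types, lifting) image_cong pairs_of_def)

lemma finite_pairings: "finite S \<Longrightarrow> finite (pairings S)"
 by (rule finite_subset[of _ "Pow (Pow S)"]) (auto simp: pairings_def partition_on_def)

lemma finite_pairing: "finite S \<Longrightarrow> P \<in> pairings S \<Longrightarrow> finite P"
 by (auto simp: pairings_def intro: finite_elements)

lemma card_pairing: "finite S \<Longrightarrow> P \<in> pairings S \<Longrightarrow> card S = 2 * card P"
 using card_partition[of P 2] finite_pairing[of S P] pairings_cover[of P S]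
 by (auto simp: pairings_def partition_on_def disjoint_def)

lemma pairings_empty [simp]: "pairings {} = {{}}" by (auto simp: pairings_def partition_on_empty)

lemma pairings_diff:
 assumes "P \<in> pairings S" "{a, b} \<in> P"
 shows "P - {{a, b}} \<in> pairings (S - {a, b})"
proof -
 have "p \<inter> {a, b} = {}" if "p \<in> P - {{a, b}}" for p
  using pairings_uniq[OF assms(1) _ assms(2), of p] that by blast
 then have "\<Union>(P - {{a, b}}) = S - {a, b}" using pairings_cover[OF assms(1)] by blast
 with assms(1) show ?thesis unfolding pairings_def partition_on_def disjoint_def by auto
qed

lemma pairings_insert:
 assumes "P \<in> pairings S" "a \<notin> S" "b \<notin> S" "a \<noteq> b"
 shows "insert {a, b} P \<in> pairings (insert a (insert b S))"
 using assms unfolding pairings_def partition_on_def disjoint_def by (auto simp: card_insert_if)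

lemma pairings_insert':
 assumes "P \<in> pairings (S - {a, b})" "a \<in> S" "b \<in> S" "a \<noteq> b"
 shows "insert {a, b} P \<in> pairings S"
proof -
 have "insert a (insert b (S - {a, b})) = S" using assms by auto
 with pairings_insert[OF assms(1), of a b] assms(4) show ?thesis by simp
qed

lemma mate_diff:
 assumes "P \<in> pairings S" "{a, b} \<in> P" "s \<in> S" "s \<noteq> a" "s \<noteq> b"
 shows "mate (P - {{a, b}}) s = mate P s"
 using assms by (intro mate_eqI[OF pairings_diff]) (auto simp: pair_iff doubleton_eq_iff)

text \<open>A pairing is the choice of the partner \<open>b\<close> of a fixed \<open>a\<close>
  together with a pairing of the rest. The recursions for \<open>pairing_sum\<close> and for Wick's
  formula are both instances.\<close>

lemma sum_pairings:
 assumes "finite S" "a \<in> S"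
 shows "(\<Sum>B\<in>pairings S. \<phi> B) = (\<Sum>b\<in>S - {a}. \<Sum>B\<in>pairings (S - {a, b}). \<phi> (insert {a, b} B))"
proof -
 have "(\<Sum>b\<in>S - {a}. \<Sum>B\<in>pairings (S - {a, b}). \<phi> (insert {a, b} B))
   = (\<Sum>(b, B)\<in>(SIGMA b:S - {a}. pairings (S - {a, b})). \<phi> (insert {a, b} B))"
  using assms by (subst sum.Sigma) (auto simp: finite_pairings)
 also have "\<dots> = (\<Sum>B\<in>pairings S. \<phi> B)"
 proof (rule sum.reindex_bij_witness[where j = "\<lambda>(b, B). insert {a, b} B"
    and i = "\<lambda>B. (mate B a, B - {{a, mate B a}})"])
  fix bB assume "bB \<in> (SIGMA b:S - {a}. pairings (S - {a, b}))"
  then obtain b B where [simp]: "bB = (b, B)" and b: "b \<in> S" "b \<noteq> a" and B: "B \<in> pairings (S - {a, b})"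
   by auto
  have I: "insert {a, b} B \<in> pairings S" using pairings_insert'[OF B] assms(2) b by auto
  then have m: "mate (insert {a, b} B) a = b" by (auto intro: mate_eqI)
  have "{a, b} \<notin> B" using pair_in[OF B] by blast
  then show "(mate (case bB of (b, B) \<Rightarrow> insert {a, b} B) a,
     (case bB of (b, B) \<Rightarrow> insert {a, b} B) -
     {{a, mate (case bB of (b, B) \<Rightarrow> insert {a, b} B) a}}) = bB" using m by simp
  show "(case bB of (b, B) \<Rightarrow> insert {a, b} B) \<in> pairings S" using I by simp
 next
  fix B assume B: "B \<in> pairings S"
  show "(mate B a, B - {{a, mate B a}}) \<in> (SIGMA b:S - {a}. pairings (S - {a, b}))"
   using pairings_diff[OF B] mate_pair[OF B assms(2)] mate_in[OF B assms(2)] mate_neq[OF B assms(2)] by auto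
  show "(case (mate B a, B - {{a, mate B a}}) of (b, B) \<Rightarrow> insert {a, b} B) = B"
   using mate_pair[OF B assms(2)] by auto
 qed auto
 finally show ?thesis by simp
qed

lemma remove_pair_notin:
 assumes "Q \<in> pairings S" "a \<in> S" "b \<in> S" "{a, b} \<notin> Q" "a \<noteq> b"
 shows "remove_pair {a, b} Q = {p \<in> Q. a \<notin> p \<and> b \<notin> p} \<union> {{mate Q a, mate Q b}}"
proof -
 have "{p \<in> Q. p \<inter> {a, b} \<noteq> {}} = {{a, mate Q a}, {b, mate Q b}}"
 proof (intro equalityI subsetI)
  fix p assume "p \<in> {p \<in> Q. p \<inter> {a, b} \<noteq> {}}"
  then have "p \<in> Q" "a \<in> p \<or> b \<in> p" by auto
  then show "p \<in> {{a, mate Q a}, {b, mate Q b}}"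
   using assms(1) pairings_uniq[OF assms(1), of p "{a, mate Q a}" a] pairings_uniq[OF assms(1), of p "{b, mate Q b}" b]
    mate_pair[OF assms(1)] assms(2,3) by auto
 qed (use mate_pair[OF assms(1)] assms(2,3) in auto)
 moreover have "mate Q a \<noteq> a" "mate Q a \<noteq> b" "mate Q b \<noteq> a" "mate Q b \<noteq> b"
  using assms mate_pair[OF assms(1)] mate_neq[OF assms(1)] by (metis insert_commute)+
 ultimately show ?thesis using assms(4) unfolding remove_pair_def by auto
qed

lemma remove_pair_in: "{a, b} \<in> Q \<Longrightarrow> remove_pair {a, b} Q = Q - {{a, b}}"
 by (simp add: remove_pair_def)

lemma mate_off:
 assumes "Q \<in> pairings S" "a \<in> S" "b \<in> S" "{a, b} \<notin> Q" "a \<noteq> b"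
 shows "mate Q a \<in> S - {a, b}" "mate Q b \<in> S - {a, b}" "mate Q a \<noteq> mate Q b"
 using assms mate_pair[OF assms(1,2)] mate_pair[OF assms(1,3)] mate_neq[OF assms(1,2)] mate_neq[OF assms(1,3)]
  mate_in[OF assms(1,2)] mate_in[OF assms(1,3)] mate_inj[OF assms(1-3)] by (auto simp: insert_commute)

lemma remove_pair_pairings:
 assumes "Q \<in> pairings S" "a \<in> S" "b \<in> S" "a \<noteq> b"
 shows "remove_pair {a, b} Q \<in> pairings (S - {a, b})"
proof (cases "{a, b} \<in> Q")
 case True then show ?thesis using pairings_diff[OF assms(1)] by (simp add: remove_pair_in)
next
 case False
 let ?Q' = "{p \<in> Q. a \<notin> p \<and> b \<notin> p}"
 have "?Q' = Q - {{a, mate Q a}} - {{b, mate Q b}}"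
  using pairings_uniq[OF assms(1) _ mate_pair[OF assms(1,2)], of _ a]
   pairings_uniq[OF assms(1) _ mate_pair[OF assms(1,3)], of _ b] by blast
 moreover have "{b, mate Q b} \<in> Q - {{a, mate Q a}}"
  using mate_pair[OF assms(1,3)] False assms by (auto simp: doubleton_eq_iff insert_commute)
 ultimately have "?Q' \<in> pairings (S - {a, mate Q a} - {b, mate Q b})"
  using pairings_diff[OF pairings_diff[OF assms(1) mate_pair[OF assms(1,2)]], of b "mate Q b"] by simp
 moreover have "S - {a, mate Q a} - {b, mate Q b} = (S - {a, b}) - {mate Q a, mate Q b}" by auto
 ultimately show ?thesis using mate_off[OF assms(1-3) False assms(4)] remove_pair_notin[OF assms(1-3) False assms(4)]
  by (simp add: pairings_insert')
qed

lemma const_on_mate: "P \<in> pairings S \<Longrightarrow> const_on P f \<longleftrightarrow> (\<forall>s\<in>S. f (mate P s) = f s)"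
 unfolding const_on_def by (metis pair_iff)

lemma alternating_on_mate:
 "P \<in> pairings S \<Longrightarrow> alternating_on P f \<longleftrightarrow> (\<forall>s\<in>S. f (mate P s) = (\<not> f s))"
 unfolding alternating_on_def by (metis pair_iff)

lemma const_on_cong:
 "P \<in> pairings S \<Longrightarrow> (\<And>s. s \<in> S \<Longrightarrow> f s = g s) \<Longrightarrow> const_on P f = const_on P g"
 by (simp add: const_on_mate mate_in)

lemma alternating_on_cong:
 "P \<in> pairings S \<Longrightarrow> (\<And>s. s \<in> S \<Longrightarrow> f s = g s) \<Longrightarrow> alternating_on P f = alternating_on P g"
 by (simp add: alternating_on_mate mate_in)

lemma const_on_remove:
 assumes "Q \<in> pairings S" "a \<in> S" "b \<in> S" "{a, b} \<notin> Q" "a \<noteq> b"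
 shows "const_on (remove_pair {a, b} Q) f \<longleftrightarrow>
  f (mate Q a) = f (mate Q b) \<and> (\<forall>s\<in>S - {a, b, mate Q a, mate Q b}. f (mate Q s) = f s)"
proof -
 have "{s, t} \<in> remove_pair {a, b} Q \<longleftrightarrow>
   {s, t} = {mate Q a, mate Q b} \<or> (s \<in> S - {a, b, mate Q a, mate Q b} \<and> t = mate Q s)" for s t
  unfolding remove_pair_notin[OF assms] using mate_off[OF assms] mate_mate[OF assms(1)] assms
  by (auto simp: pair_iff[OF assms(1)])
 then show ?thesis unfolding const_on_def by (metis doubleton_eq_iff)
qed

lemma alternating_on_remove:
 assumes "Q \<in> pairings S" "a \<in> S" "b \<in> S" "{a, b} \<notin> Q" "a \<noteq> b"
 shows "alternating_on (remove_pair {a, b} Q) f \<longleftrightarrow>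
  f (mate Q a) \<noteq> f (mate Q b) \<and> (\<forall>s\<in>S - {a, b, mate Q a, mate Q b}. f (mate Q s) \<noteq> f s)"
proof -
 have "{s, t} \<in> remove_pair {a, b} Q \<longleftrightarrow>
   {s, t} = {mate Q a, mate Q b} \<or> (s \<in> S - {a, b, mate Q a, mate Q b} \<and> t = mate Q s)" for s t
  unfolding remove_pair_notin[OF assms] using mate_off[OF assms] mate_mate[OF assms(1)] assms
  by (auto simp: pair_iff[OF assms(1)])
 then show ?thesis unfolding alternating_on_def by (metis doubleton_eq_iff)
qed

section \<open>Connectivity and the polygons of two pairings\<close>

definition conn :: "'a set set \<Rightarrow> 'a set set \<Rightarrow> ('a \<times> 'a) set" where
 "conn P Q = (next_to P Q)\<^sup>*"

abbreviation npoly :: "'a set set \<Rightarrow> 'a set set \<Rightarrow> nat" where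
 "npoly P Q \<equiv> card (polygons P Q)"

lemma polygons_commute: "polygons P Q = polygons Q P" by (simp add: polygons_def next_to_def Un_commute)

lemma conn_refl [simp]: "(s, s) \<in> conn P Q" by (simp add: conn_def)

lemma conn_sym: "(s, t) \<in> conn P Q \<Longrightarrow> (t, s) \<in> conn P Q"
proof -
 have "sym (next_to P Q)" by (auto simp: sym_def next_to_def)
 then show "(s, t) \<in> conn P Q \<Longrightarrow> (t, s) \<in> conn P Q"
  unfolding conn_def by (meson sym_rtrancl symD)
qed

lemma conn_trans: "(s, t) \<in> conn P Q \<Longrightarrow> (t, u) \<in> conn P Q \<Longrightarrow> (s, u) \<in> conn P Q"
 by (simp add: conn_def)

lemma next_to_iff:
 assumes "P \<in> pairings S" "Q \<in> pairings S"
 shows "(s, t) \<in> next_to P Q \<longleftrightarrow> s \<in> S \<and> (t = mate P s \<or> t = mate Q s)"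
proof
 assume "(s, t) \<in> next_to P Q"
 then obtain p where p: "p \<in> P \<union> Q" "s \<in> p" "t \<in> p" "s \<noteq> t" by (auto simp: next_to_def)
 then obtain R where R: "R \<in> pairings S" "R = P \<or> R = Q" "p \<in> R" using assms by auto
 obtain u v where "p = {u, v}" using R by (auto elim: pairings_pairE)
 then have "p = {s, t}" using p by auto
 with R show "s \<in> S \<and> (t = mate P s \<or> t = mate Q s)" by (metis pair_iff)
next
 assume "s \<in> S \<and> (t = mate P s \<or> t = mate Q s)"
 then obtain R where "R \<in> pairings S" "R = P \<or> R = Q" "s \<in> S" "t = mate R s" using assms by auto
 with mate_pair[of R S s] mate_neq[of R S s] show "(s, t) \<in> next_to P Q"
  by (auto simp: next_to_def intro!: bexI[of _ "{s, mate R s}"])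
qed

lemma conn_const:
 assumes "P \<in> pairings S" "Q \<in> pairings S" "(s, t) \<in> conn P Q" "const_on P f" "const_on Q f"
 shows "f s = f t" using assms(3) unfolding conn_def
proof (induction rule: rtrancl_induct)
 case (step y z)
 then show ?case using assms by (auto simp: next_to_iff const_on_mate)
qed auto

lemma conn_mate:
 assumes "P \<in> pairings S" "Q \<in> pairings S" "s \<in> S"
 shows "(s, mate P s) \<in> conn P Q" "(s, mate Q s) \<in> conn P Q"
 unfolding conn_def using assms by (auto intro!: r_into_rtrancl simp: next_to_iff)

text \<open>The class of \<open>s\<close> is the smallest set containing \<open>s\<close> and closed
  under both involutions. In this form connectivity is carried from one pair of pairings to another
  by restricting and extending functions, without induction along paths.\<close>

lemma conn_iff:
 assumes "P \<in> pairings S" "Q \<in> pairings S"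
 shows "(s, t) \<in> conn P Q \<longleftrightarrow>
  (\<forall>X. const_on P (\<lambda>u. u \<in> X) \<and> const_on Q (\<lambda>u. u \<in> X) \<longrightarrow> s \<in> X \<longrightarrow> t \<in> X)"
proof
 assume "(s, t) \<in> conn P Q"
 then show "\<forall>X. const_on P (\<lambda>u. u \<in> X) \<and> const_on Q (\<lambda>u. u \<in> X) \<longrightarrow> s \<in> X \<longrightarrow> t \<in> X"
  using conn_const[OF assms] by blast
next
 assume *: "\<forall>X. const_on P (\<lambda>u. u \<in> X) \<and> const_on Q (\<lambda>u. u \<in> X) \<longrightarrow> s \<in> X \<longrightarrow> t \<in> X"
 let ?X = "{u. (s, u) \<in> conn P Q}"
 have "const_on P (\<lambda>u. u \<in> ?X)" "const_on Q (\<lambda>u. u \<in> ?X)"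
  using assms conn_mate[OF assms] by (auto simp: const_on_mate intro: conn_trans) (meson conn_trans conn_sym)+
 then have "s \<in> ?X \<longrightarrow> t \<in> ?X" using * by blast
 then show "(s, t) \<in> conn P Q" by simp
qed

lemma conn_in: "P \<in> pairings S \<Longrightarrow> Q \<in> pairings S \<Longrightarrow> (s, t) \<in> conn P Q \<Longrightarrow> s \<in> S \<Longrightarrow> t \<in> S"
 using conn_const[of P S Q s t "\<lambda>u. u \<in> S"] by (auto simp: const_on_mate mate_in)

lemma polygons_eq: "P \<in> pairings S \<Longrightarrow> Q \<in> pairings S \<Longrightarrow> polygons P Q = (\<lambda>s. conn P Q `` {s}) ` S"
 by (auto simp: polygons_def quotient_def conn_def pairings_cover)

lemma polygons_class_eq:
 assumes "(s, t) \<in> conn P Q" shows "conn P Q `` {s} = conn P Q `` {t}"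
 using assms by (auto intro: conn_trans conn_sym)

lemma partition_on_polygons:
 assumes "P \<in> pairings S" "Q \<in> pairings S" shows "partition_on S (polygons P Q)"
proof -
 have "p \<inter> q = {}" if h: "p \<in> polygons P Q" "q \<in> polygons P Q" "p \<noteq> q" for p q
 proof (rule ccontr)
  assume "p \<inter> q \<noteq> {}"
  then obtain x where "x \<in> p" "x \<in> q" by auto
  moreover obtain s t where "p = conn P Q `` {s}" "q = conn P Q `` {t}"
   using h(1,2) unfolding polygons_eq[OF assms] by blast
  ultimately have "p = conn P Q `` {x}" "q = conn P Q `` {x}"
   using polygons_class_eq[of s x P Q] polygons_class_eq[of t x P Q] by auto
  with h(3) show False by simp
 qed
 moreover have "\<Union>(polygons P Q) = S" "{} \<notin> polygons P Q"
  unfolding polygons_eq[OF assms] using conn_in[OF assms] by (auto intro: conn_refl)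
 ultimately show ?thesis by (auto simp: partition_on_def disjoint_def)
qed

lemma polygonD:
 assumes "P \<in> pairings S" "Q \<in> pairings S" "L \<in> polygons P Q" "s \<in> L"
 shows "L = conn P Q `` {s}" "s \<in> S"
 using assms polygons_class_eq conn_in[OF assms(1,2)] by (fastforce simp: polygons_eq)+

lemma finite_polygons: "finite S \<Longrightarrow> P \<in> pairings S \<Longrightarrow> Q \<in> pairings S \<Longrightarrow> finite (polygons P Q)"
 by (simp add: polygons_eq)

lemma pair_facts:
 assumes "P \<in> pairings S" "{a, b} \<in> P"
 shows "a \<in> S" "b \<in> S" "a \<noteq> b" "mate P a = b" "mate P b = a"
 using pair_in[OF assms] pair_neq[OF assms] mate_eqI[OF assms] mate_eqI[OF assms(1), of b a] assms(2)
 by (auto simp: insert_commute)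

section \<open>Contracting a pair of one pairing in the other\<close>

context
 fixes P Q :: "'a set set" and S :: "'a set" and a b :: 'a
 assumes P: "P \<in> pairings S" and Q: "Q \<in> pairings S" and ab: "{a, b} \<in> P"
begin

lemmas contract_in = pair_facts[OF P ab]

lemma contract_pairings:
 "P - {{a, b}} \<in> pairings (S - {a, b})" "remove_pair {a, b} Q \<in> pairings (S - {a, b})"
 using pairings_diff[OF P ab] remove_pair_pairings[OF Q] contract_in by auto

lemma const_on_contract:
 assumes "const_on P f" "const_on Q f"
 shows "const_on (P - {{a, b}}) f" "const_on (remove_pair {a, b} Q) f"
proof -
 show "const_on (P - {{a, b}}) f" using assms(1) by (auto simp: const_on_def)
 show "const_on (remove_pair {a, b} Q) f"
 proof (cases "{a, b} \<in> Q")
  case True then show ?thesis using assms(2) by (auto simp: remove_pair_in const_on_def)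
 next
  case False
  have "f a = f b" using assms(1) ab by (auto simp: const_on_def)
  with False contract_in assms(2) show ?thesis by (subst const_on_remove[OF Q]) (auto simp: const_on_mate[OF Q])
 qed
qed

lemma alternating_on_contract:
 assumes "alternating_on P f" "alternating_on Q f"
 shows "alternating_on (P - {{a, b}}) f" "alternating_on (remove_pair {a, b} Q) f"
proof -
 show "alternating_on (P - {{a, b}}) f" using assms(1) by (auto simp: alternating_on_def)
 show "alternating_on (remove_pair {a, b} Q) f"
 proof (cases "{a, b} \<in> Q")
  case True then show ?thesis using assms(2) by (auto simp: remove_pair_in alternating_on_def)
 next
  case False
  have "f a \<noteq> f b" using assms(1) ab by (auto simp: alternating_on_def)
  with False contract_in assms(2) show ?thesis
   by (subst alternating_on_remove[OF Q]) (auto simp: alternating_on_mate[OF Q])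
 qed
qed

text \<open>Converse of \<open>const_on_contract\<close>. Reinserting the pair subdivides the
  spliced pair \<open>{mate Q a, mate Q b}\<close>, so \<open>a\<close> and \<open>b\<close> have to
  inherit the common value of these two points.\<close>

lemma const_on_expand:
 assumes "{a, b} \<notin> Q" "const_on (P - {{a, b}}) f" "const_on (remove_pair {a, b} Q) f"
 shows "const_on P (f(a := f (mate Q a), b := f (mate Q a)))" (is "const_on P ?g")
  "const_on Q (f(a := f (mate Q a), b := f (mate Q a)))"
proof -
 note off = mate_off[OF Q contract_in(1,2) assms(1) contract_in(3)]
 show "const_on P ?g" unfolding const_on_mate[OF P]
 proof
  fix s assume "s \<in> S"
  show "?g (mate P s) = ?g s"
  proof (cases "s = a \<or> s = b")
   case True then show ?thesis using contract_in by auto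
  next
   case False
   then have "mate P s \<noteq> a" "mate P s \<noteq> b" using contract_in mate_mate[OF P \<open>s \<in> S\<close>] by auto
   moreover have "f (mate P s) = f s"
    using assms(2) False \<open>s \<in> S\<close> mate_diff[OF P ab \<open>s \<in> S\<close>]
    by (metis const_on_mate[OF contract_pairings(1)] DiffI empty_iff insert_iff)
   ultimately show ?thesis using False by auto
  qed
 qed
 have f: "f (mate Q a) = f (mate Q b)"
  and f2: "\<And>s. s \<in> S - {a, b, mate Q a, mate Q b} \<Longrightarrow> f (mate Q s) = f s"
  using assms(3) by (auto simp: const_on_remove[OF Q contract_in(1,2) assms(1) contract_in(3)])
 show "const_on Q ?g" unfolding const_on_mate[OF Q]
 proof
  fix s assume "s \<in> S"
  consider "s = a" | "s = b" | "s = mate Q a" | "s = mate Q b" | "s \<in> S - {a, b, mate Q a, mate Q b}"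
   using \<open>s \<in> S\<close> by blast
  then show "?g (mate Q s) = ?g s"
  proof cases
   case 5
   then have "mate Q s \<noteq> a" "mate Q s \<noteq> b" using mate_mate[OF Q \<open>s \<in> S\<close>] by auto
   with 5 f2[OF 5] show ?thesis by auto
  qed (use off f mate_mate[OF Q] contract_in in auto)
 qed
qed

lemma conn_contract:
 assumes "s \<in> S - {a, b}" "t \<in> S - {a, b}"
 shows "(s, t) \<in> conn (P - {{a, b}}) (remove_pair {a, b} Q) \<longleftrightarrow> (s, t) \<in> conn P Q"
proof
 assume "(s, t) \<in> conn (P - {{a, b}}) (remove_pair {a, b} Q)"
 then show "(s, t) \<in> conn P Q"
  unfolding conn_iff[OF P Q] conn_iff[OF contract_pairings] using const_on_contract by blast
next
 assume *: "(s, t) \<in> conn P Q"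
 show "(s, t) \<in> conn (P - {{a, b}}) (remove_pair {a, b} Q)" unfolding conn_iff[OF contract_pairings]
 proof (intro allI impI, elim conjE)
  fix X assume X: "const_on (P - {{a, b}}) (\<lambda>u. u \<in> X)" "const_on (remove_pair {a, b} Q) (\<lambda>u. u \<in> X)" "s \<in> X"
  show "t \<in> X"
  proof (cases "{a, b} \<in> Q")
   case True
   let ?g = "\<lambda>u. u \<in> X \<and> u \<noteq> a \<and> u \<noteq> b"
   have "const_on R ?g" if "R \<in> pairings S" "{a, b} \<in> R" "const_on (R - {{a, b}}) (\<lambda>u. u \<in> X)" for R
    unfolding const_on_def
   proof (intro allI impI)
    fix u v assume uv: "{u, v} \<in> R"
    show "?g u = ?g v"
    proof (cases "{u, v} = {a, b}")
     case False
     then have "{u, v} \<inter> {a, b} = {}" using pairings_uniq[OF that(1) uv that(2)] by blast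
     then show ?thesis using that(3) uv False by (auto simp: const_on_def)
    qed (auto simp: doubleton_eq_iff)
   qed
   then have "const_on P ?g" "const_on Q ?g" using P Q ab True X by (auto simp: remove_pair_in)
   from conn_const[OF P Q * this] X(3) assms show ?thesis by auto
  next
   case False
   from conn_const[OF P Q * const_on_expand[OF False X(1,2)]] X(3) assms show ?thesis by auto
  qed
 qed
qed

lemma conn_contract_class:
 assumes "s \<in> S - {a, b}"
 shows "conn (P - {{a, b}}) (remove_pair {a, b} Q) `` {s} = conn P Q `` {s} - {a, b}"
 using conn_contract[OF assms] conn_in[OF contract_pairings _ assms] conn_in[OF P Q, of s] assms by blast

lemma polygons_contract_in:
 assumes "{a, b} \<in> Q"
 shows "{a, b} \<in> polygons P Q" "polygons (P - {{a, b}}) (remove_pair {a, b} Q) = polygons P Q - {{a, b}}"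
proof -
 have "const_on R (\<lambda>u. u \<in> {a, b})" if R: "R \<in> pairings S" "{a, b} \<in> R" for R
  unfolding const_on_def
 proof (intro allI impI)
  fix u v assume uv: "{u, v} \<in> R"
  show "(u \<in> {a, b}) = (v \<in> {a, b})"
   using pairings_uniq[OF R(1) uv R(2), of u] pairings_uniq[OF R(1) uv R(2), of v] by blast
 qed
 then have "const_on P (\<lambda>u. u \<in> {a, b})" "const_on Q (\<lambda>u. u \<in> {a, b})" using P Q ab assms by auto
 then have c: "(s, t) \<in> conn P Q \<Longrightarrow> s \<in> {a, b} \<longleftrightarrow> t \<in> {a, b}" for s t
  using conn_const[OF P Q, of s t "\<lambda>u. u \<in> {a, b}"] by blast
 have "(a, b) \<in> conn P Q" using conn_mate[OF P Q contract_in(1)] contract_in by auto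
 then have cls: "conn P Q `` {s} = {a, b}" if "s \<in> {a, b}" for s
 proof -
  have "conn P Q `` {s} = conn P Q `` {a}"
   using that \<open>(a, b) \<in> conn P Q\<close> polygons_class_eq[of a b P Q] by auto
  then show ?thesis using c[of a] \<open>(a, b) \<in> conn P Q\<close> by auto
 qed
 then show "{a, b} \<in> polygons P Q" using contract_in by (auto simp: polygons_eq[OF P Q])
 have ne: "conn P Q `` {s} - {a, b} = conn P Q `` {s}" if "s \<notin> {a, b}" for s using c[of s] that by auto
 have ne': "conn P Q `` {s} \<noteq> {a, b}" if "s \<notin> {a, b}" for s using that by (metis ImageI conn_refl singletonI)
 have "polygons (P - {{a, b}}) (remove_pair {a, b} Q) = (\<lambda>s. conn P Q `` {s}) ` (S - {a, b})"
  unfolding polygons_eq[OF contract_pairings] by (rule image_cong[OF refl]) (use conn_contract_class ne in auto)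
 also have "\<dots> = polygons P Q - {{a, b}}" unfolding polygons_eq[OF P Q]
 proof (intro equalityI subsetI)
  fix L assume "L \<in> (\<lambda>s. conn P Q `` {s}) ` S - {{a, b}}"
  then obtain s where "s \<in> S" "L = conn P Q `` {s}" "L \<noteq> {a, b}" by blast
  moreover then have "s \<notin> {a, b}" using cls by blast
  ultimately show "L \<in> (\<lambda>s. conn P Q `` {s}) ` (S - {a, b})" by blast
 qed (use ne' in blast)
 finally show "polygons (P - {{a, b}}) (remove_pair {a, b} Q) = polygons P Q - {{a, b}}" .
qed

text \<open>No polygon is lost or merged: the points \<open>a\<close> and \<open>b\<close> lie in
  one polygon, \<open>mate Q a\<close> lies in it as well and survives the contraction. So every
  polygon keeps a point outside \<open>{a, b}\<close> and is determined by it.\<close>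

lemma polygons_contract_notin:
 assumes "{a, b} \<notin> Q"
 shows "inj_on (\<lambda>L. L - {a, b}) (polygons P Q)"
  "polygons (P - {{a, b}}) (remove_pair {a, b} Q) = (\<lambda>L. L - {a, b}) ` polygons P Q"
proof -
 note off = mate_off[OF Q contract_in(1,2) assms contract_in(3)]
 have ex: "\<exists>t\<in>S - {a, b}. conn P Q `` {s} = conn P Q `` {t}" if "s \<in> S" for s
 proof (cases "s \<in> {a, b}")
  case True
  then have "mate Q s \<in> S - {a, b}" using off by auto
  moreover have "conn P Q `` {s} = conn P Q `` {mate Q s}" using polygons_class_eq[OF conn_mate(2)[OF P Q that]] .
  ultimately show ?thesis by blast
 qed (use that in auto)
 show "inj_on (\<lambda>L. L - {a, b}) (polygons P Q)"
 proof (rule inj_onI)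
  fix L M assume LM: "L \<in> polygons P Q" "M \<in> polygons P Q" "L - {a, b} = M - {a, b}"
  obtain t where t: "t \<in> S - {a, b}" "L = conn P Q `` {t}" using ex LM(1) by (auto simp: polygons_eq[OF P Q])
  then have "t \<in> L" by auto
  then have "t \<in> M" using LM(3) t by blast
  with \<open>t \<in> L\<close> LM show "L = M" using polygonD(1)[OF P Q] by metis
 qed
 show "polygons (P - {{a, b}}) (remove_pair {a, b} Q) = (\<lambda>L. L - {a, b}) ` polygons P Q"
 proof
  show "polygons (P - {{a, b}}) (remove_pair {a, b} Q) \<subseteq> (\<lambda>L. L - {a, b}) ` polygons P Q"
   unfolding polygons_eq[OF P Q] polygons_eq[OF contract_pairings] using conn_contract_class by auto
  show "(\<lambda>L. L - {a, b}) ` polygons P Q \<subseteq> polygons (P - {{a, b}}) (remove_pair {a, b} Q)"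
  proof
   fix L assume "L \<in> (\<lambda>L. L - {a, b}) ` polygons P Q"
   then obtain s where "s \<in> S" "L = conn P Q `` {s} - {a, b}" by (auto simp: polygons_eq[OF P Q])
   with ex obtain t where "t \<in> S - {a, b}" "L = conn P Q `` {t} - {a, b}" by metis
   then show "L \<in> polygons (P - {{a, b}}) (remove_pair {a, b} Q)"
    unfolding polygons_eq[OF contract_pairings] using conn_contract_class by blast
  qed
 qed
qed

text \<open>The basic counting rule. Contraction shortens one polygon by two edges, and a polygon
  disappears only when it is the digon formed by a common pair.\<close>

lemma npoly_contract:
 assumes "finite S"
 shows "npoly P Q = npoly (P - {{a, b}}) (remove_pair {a, b} Q) + (if {a, b} \<in> Q then 1 else 0)"
proof (cases "{a, b} \<in> Q")
 case True
 show ?thesis using True polygons_contract_in[OF True] card.remove[OF finite_polygons[OF assms P Q]] by simp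
next
 case False
 then show ?thesis using polygons_contract_notin[OF False] by (simp add: card_image)
qed

end

text \<open>Every nonempty pair of pairings arises from a smaller one by undoing a contraction; the
  two step cases are those of \<open>npoly_contract\<close>.\<close>

lemma pairing_pair_induct [consumes 3, case_names empty same contract]:
 assumes "finite S" "P \<in> pairings S" "Q \<in> pairings S"
  and "\<Phi> {} {} {}"
  and "\<And>S P Q a b. finite S \<Longrightarrow> P \<in> pairings S \<Longrightarrow> Q \<in> pairings S \<Longrightarrow> {a, b} \<in> P \<Longrightarrow> {a, b} \<in> Q \<Longrightarrow>
   \<Phi> (S - {a, b}) (P - {{a, b}}) (remove_pair {a, b} Q) \<Longrightarrow> \<Phi> S P Q"
  and "\<And>S P Q a b. finite S \<Longrightarrow> P \<in> pairings S \<Longrightarrow> Q \<in> pairings S \<Longrightarrow> {a, b} \<in> P \<Longrightarrow> {a, b} \<notin> Q \<Longrightarrow>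
   \<Phi> (S - {a, b}) (P - {{a, b}}) (remove_pair {a, b} Q) \<Longrightarrow> \<Phi> S P Q"
 shows "\<Phi> S P Q" using assms(1-3)
proof (induction "card S" arbitrary: S P Q rule: less_induct)
 case less
 show ?case
 proof (cases "S = {}")
  case True
  with less.prems assms(4) show ?thesis by simp
 next
  case False
  then obtain a where "a \<in> S" by auto
  let ?b = "mate P a"
  have ab: "{a, ?b} \<in> P" using mate_pair[OF less.prems(2) \<open>a \<in> S\<close>] .
  have "card (S - {a, ?b}) < card S" using \<open>a \<in> S\<close> less.prems(1) by (intro psubset_card_mono) auto
  from less.hyps[OF this _ contract_pairings[OF less.prems(2,3) ab]]
  have "\<Phi> (S - {a, ?b}) (P - {{a, ?b}}) (remove_pair {a, ?b} Q)" using less.prems(1) by simp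
  then show ?thesis using assms(5,6) less.prems ab by blast
 qed
qed

text \<open>Proper 2-colourings of the polygon edges, made extensional on \<open>S\<close> so that
  they can be counted.\<close>

definition alternations :: "'a set \<Rightarrow> 'a set set \<Rightarrow> 'a set set \<Rightarrow> ('a \<Rightarrow> bool) set" where
 "alternations S P Q = {f \<in> S \<rightarrow>\<^sub>E UNIV. alternating_on P f \<and> alternating_on Q f}"

lemma alternating_on_expand:
 assumes P: "P \<in> pairings S" and Q: "Q \<in> pairings S" and ab: "{a, b} \<in> P" and nQ: "{a, b} \<notin> Q"
  and f: "alternating_on (P - {{a, b}}) f" "alternating_on (remove_pair {a, b} Q) f"
 shows "alternating_on P (f(a := \<not> f (mate Q a), b := f (mate Q a)))" (is "alternating_on P ?g")
  "alternating_on Q (f(a := \<not> f (mate Q a), b := f (mate Q a)))"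
proof -
 note c = pair_facts[OF P ab] and cp = contract_pairings[OF P Q ab]
 note off = mate_off[OF Q c(1,2) nQ c(3)]
 show "alternating_on P ?g" unfolding alternating_on_mate[OF P]
 proof
  fix s assume "s \<in> S"
  show "?g (mate P s) = (\<not> ?g s)"
  proof (cases "s = a \<or> s = b")
   case True then show ?thesis using c by auto
  next
   case False
   then have "mate P s \<noteq> a" "mate P s \<noteq> b" using c mate_mate[OF P \<open>s \<in> S\<close>] by auto
   moreover have "f (mate P s) = (\<not> f s)"
    using f(1) False \<open>s \<in> S\<close> mate_diff[OF P ab \<open>s \<in> S\<close>]
    by (metis alternating_on_mate[OF cp(1)] DiffI empty_iff insert_iff)
   ultimately show ?thesis using False by auto
  qed
 qed
 have f1: "f (mate Q a) \<noteq> f (mate Q b)"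
  and f2: "\<And>s. s \<in> S - {a, b, mate Q a, mate Q b} \<Longrightarrow> f (mate Q s) \<noteq> f s"
  using f(2) by (auto simp: alternating_on_remove[OF Q c(1,2) nQ c(3)])
 show "alternating_on Q ?g" unfolding alternating_on_mate[OF Q]
 proof
  fix s assume "s \<in> S"
  consider "s = a" | "s = b" | "s = mate Q a" | "s = mate Q b" | "s \<in> S - {a, b, mate Q a, mate Q b}"
   using \<open>s \<in> S\<close> by blast
  then show "?g (mate Q s) = (\<not> ?g s)"
  proof cases
   case 5
   then have "mate Q s \<noteq> a" "mate Q s \<noteq> b" using mate_mate[OF Q \<open>s \<in> S\<close>] by auto
   with 5 f2[OF 5] show ?thesis by auto
  qed (use off f1 mate_mate[OF Q] c in auto)
 qed
qed

text \<open>Every polygon has even length and hence exactly two proper 2-colourings, chosen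
  independently. In the induction a common pair contributes the free colour \<open>e\<close> of
  \<open>a\<close>, while otherwise the colours of \<open>a\<close> and \<open>b\<close> are forced
  by that of \<open>mate Q a\<close>.\<close>

lemma card_alternations:
 fixes S :: "'a set"
 assumes "finite S" "P \<in> pairings S" "Q \<in> pairings S"
 shows "card (alternations S P Q) = 2 ^ npoly P Q" using assms
proof (induction rule: pairing_pair_induct)
 case empty
 have "alternations ({} :: 'a set) {} {} = {\<lambda>_. undefined}"
  by (auto simp: alternations_def alternating_on_def)
 then show ?case by (simp add: polygons_def)
next
 case (same S P Q a b)
 note c = pair_facts[OF same(2,4)] and cp = contract_pairings[OF same(2-4)]
 let ?A' = "alternations (S - {a, b}) (P - {{a, b}}) (remove_pair {a, b} Q)"
 have ins: "alternating_on R (g(a := e, b := \<not> e))"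
  if R: "R \<in> pairings S" "{a, b} \<in> R" "alternating_on (R - {{a, b}}) g" for R e g unfolding alternating_on_def
 proof (intro allI impI)
  fix u v assume uv: "{u, v} \<in> R"
  show "(g(a := e, b := \<not> e)) u \<noteq> (g(a := e, b := \<not> e)) v"
  proof (cases "{u, v} = {a, b}")
   case True then show ?thesis using c(3) by (auto simp: doubleton_eq_iff)
  next
   case False
   then have "{u, v} \<inter> {a, b} = {}" using pairings_uniq[OF R(1) uv R(2)] by blast
   then show ?thesis using R(3) uv False by (auto simp: alternating_on_def)
  qed
 qed
 have "bij_betw (\<lambda>(e, g). g(a := e, b := \<not> e)) ((UNIV :: bool set) \<times> ?A') (alternations S P Q)"
 proof (rule bij_betw_byWitness[where f' = "\<lambda>f. (f a, restrict f (S - {a, b}))"])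
  show "\<forall>x\<in>UNIV \<times> ?A'. (\<lambda>f. (f a, restrict f (S - {a, b}))) ((\<lambda>(e, g). g(a := e, b := \<not> e)) x) = x"
   using c(3) by (auto simp: alternations_def fun_eq_iff PiE_def extensional_def restrict_def)
  have "f b = (\<not> f a)" if "f \<in> alternations S P Q" for f
   using that same(4) by (auto simp: alternations_def alternating_on_def)
  then have "(restrict f (S - {a, b}))(a := f a, b := \<not> f a) = f" if "f \<in> alternations S P Q" for f
   using that by (intro ext) (simp add: alternations_def PiE_def extensional_def restrict_def)
  then show "\<forall>f\<in>alternations S P Q. (\<lambda>(e, g). g(a := e, b := \<not> e)) (f a, restrict f (S - {a, b})) = f"
   by simp
  show "(\<lambda>(e, g). g(a := e, b := \<not> e)) ` (UNIV \<times> ?A') \<subseteq> alternations S P Q"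
  proof (clarsimp simp del: fun_upd_apply)
   fix g e assume g: "g \<in> ?A'"
   then have "alternating_on P (g(a := e, b := \<not> e))" "alternating_on Q (g(a := e, b := \<not> e))"
    using ins[OF same(2,4)] ins[OF same(3,5)] by (auto simp: alternations_def remove_pair_in[OF same(5)])
   moreover have "g(a := e, b := \<not> e) \<in> S \<rightarrow>\<^sub>E UNIV"
    using g c by (auto simp: alternations_def PiE_def extensional_def)
   ultimately show "g(a := e, b := \<not> e) \<in> alternations S P Q" by (simp only: alternations_def mem_Collect_eq)
  qed
  show "(\<lambda>f. (f a, restrict f (S - {a, b}))) ` alternations S P Q \<subseteq> UNIV \<times> ?A'"
   using alternating_on_contract[OF same(2-4)]
    alternating_on_cong[OF cp(1), of "restrict _ (S - {a, b})"] alternating_on_cong[OF cp(2), of "restrict _ (S - {a, b})"]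
   by (auto simp: alternations_def)
 qed
 from bij_betw_same_card[OF this] show ?case
  using same.IH npoly_contract[OF same(2-4,1)] same(5) by (simp add: card_cartesian_product)
next
 case (contract S P Q a b)
 note c = pair_facts[OF contract(2,4)] and cp = contract_pairings[OF contract(2-4)]
 note off = mate_off[OF contract(3) c(1,2) contract(5) c(3)]
 let ?A' = "alternations (S - {a, b}) (P - {{a, b}}) (remove_pair {a, b} Q)"
 have "bij_betw (\<lambda>g. g(a := \<not> g (mate Q a), b := g (mate Q a))) ?A' (alternations S P Q)"
 proof (rule bij_betw_byWitness[where f' = "\<lambda>f. restrict f (S - {a, b})"])
  show "\<forall>g\<in>?A'. restrict (g(a := \<not> g (mate Q a), b := g (mate Q a))) (S - {a, b}) = g"
   by (auto simp: alternations_def fun_eq_iff PiE_def extensional_def restrict_def)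
  have "f b = (\<not> f a) \<and> f (mate Q a) = (\<not> f a)" if "f \<in> alternations S P Q" for f
   using that contract(4) c(1) by (auto simp: alternations_def alternating_on_def[of P] alternating_on_mate[OF contract(3)])
  then show "\<forall>f\<in>alternations S P Q. (restrict f (S - {a, b}))(a := \<not> restrict f (S - {a, b}) (mate Q a), b := restrict f (S - {a, b}) (mate Q a)) = f"
   using off by (auto simp: alternations_def fun_eq_iff PiE_def extensional_def restrict_def)
  show "(\<lambda>g. g(a := \<not> g (mate Q a), b := g (mate Q a))) ` ?A' \<subseteq> alternations S P Q"
  proof (clarsimp simp del: fun_upd_apply)
   fix g assume g: "g \<in> ?A'"
   let ?g = "g(a := \<not> g (mate Q a), b := g (mate Q a))"
   have "alternating_on P ?g" "alternating_on Q ?g"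
    using alternating_on_expand[OF contract(2-5)] g by (auto simp: alternations_def simp del: fun_upd_apply)
   moreover have "?g \<in> S \<rightarrow>\<^sub>E UNIV"
    using g c by (auto simp: alternations_def PiE_def extensional_def)
   ultimately show "?g \<in> alternations S P Q" by (simp only: alternations_def mem_Collect_eq)
  qed
  show "(\<lambda>f. restrict f (S - {a, b})) ` alternations S P Q \<subseteq> ?A'"
   using alternating_on_contract[OF contract(2-4)]
    alternating_on_cong[OF cp(1), of "restrict _ (S - {a, b})"] alternating_on_cong[OF cp(2), of "restrict _ (S - {a, b})"]
   by (auto simp: alternations_def)
 qed
 from bij_betw_same_card[OF this] show ?case using contract.IH npoly_contract[OF contract(2-4,1)] contract(5) by simp
qed

lemma alternating_exists:
 assumes "finite S" "P \<in> pairings S" "Q \<in> pairings S"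
 obtains f where "alternating_on P f" "alternating_on Q f"
proof -
 have "alternations S P Q \<noteq> {}" using card_alternations[OF assms] by (metis card.empty power_not_zero zero_neq_numeral)
 with that show thesis by (auto simp: alternations_def)
qed

text \<open>The inner sum over the edge pairing when a labelling \<kappa> of the ground set is
  fixed; only pairings respecting the labels count. The base -2 is the vertex weight that remains
  after powers of \<gamma> have been divided out.\<close>

definition pairing_sum :: "'a set \<Rightarrow> 'a set set \<Rightarrow> ('a \<Rightarrow> 'k) \<Rightarrow> real" where
 "pairing_sum S W \<kappa> = (\<Sum>B\<in>pairings S. if const_on B \<kappa> then (-2) ^ npoly B W else 0)"

lemma const_on_insert: "const_on (insert {a, b} B) \<kappa> \<longleftrightarrow> \<kappa> a = \<kappa> b \<and> const_on B \<kappa>"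
 by (auto simp: const_on_def doubleton_eq_iff)

lemma pairing_sum_rec:
 assumes "finite S" "W \<in> pairings S" "a \<in> S"
 shows "pairing_sum S W \<kappa> = (\<Sum>b\<in>S - {a}. if \<kappa> b = \<kappa> a then
  (if {a, b} \<in> W then -2 else 1) * pairing_sum (S - {a, b}) (remove_pair {a, b} W) \<kappa> else 0)"
 unfolding pairing_sum_def sum_pairings[OF assms(1,3)]
proof (rule sum.cong[OF refl])
 fix b assume b: "b \<in> S - {a}"
 have "(-2::real) ^ npoly (insert {a, b} B) W = (if {a, b} \<in> W then -2 else 1) * (-2) ^ npoly B (remove_pair {a, b} W)"
  if B: "B \<in> pairings (S - {a, b})" for B
 proof -
  have I: "insert {a, b} B \<in> pairings S" using pairings_insert'[OF B assms(3)] b by auto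
  have "{a, b} \<notin> B" using pair_in[OF B] by blast
  then show ?thesis using npoly_contract[OF I assms(2) _ assms(1), of a b] by simp
 qed
 then show "(\<Sum>B\<in>pairings (S - {a, b}). if const_on (insert {a, b} B) \<kappa> then (- 2) ^ npoly (insert {a, b} B) W else 0) =
     (if \<kappa> b = \<kappa> a then (if {a, b} \<in> W then - 2 else 1) *
      (\<Sum>B\<in>pairings (S - {a, b}). if const_on B \<kappa> then (- 2::real) ^ npoly B (remove_pair {a, b} W) else 0) else 0)"
  by (auto simp: const_on_insert sum_distrib_left intro!: sum.cong)
qed

text \<open>With \<open>x\<close> in place of \<open>-2\<close> the value would be \<open>x (x + 2) (x + 4) \<cdots>\<close>, which vanishes at \<open>x = -2\<close> from the second factor on.\<close>

lemma pairing_sum_const: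
 assumes "finite S" "W \<in> pairings S" "\<And>s. s \<in> S \<Longrightarrow> \<kappa> s = k"
 shows "pairing_sum S W \<kappa> = (if card S = 0 then 1 else if card S = 2 then -2 else 0)" using assms
proof (induction "card S" arbitrary: S W rule: less_induct)
 case less
 show ?case
 proof (cases "S = {}")
  case True
  with less.prems show ?thesis by (simp add: pairing_sum_def const_on_def polygons_def)
 next
  case False
  then obtain a where a: "a \<in> S" by auto
  let ?b0 = "mate W a"
  have b0: "?b0 \<in> S - {a}" "{a, ?b0} \<in> W"
   using mate_in[OF less.prems(2) a] mate_neq[OF less.prems(2) a] mate_pair[OF less.prems(2) a] by auto
  let ?v = "if card S = 2 then 1 else if card S = 4 then -2 else 0 :: real"
  have ev: "even (card S)" using card_pairing[OF less.prems(1,2)] by simp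
  have ev: "even (card S)" "card S > 0" using ev False less.prems(1) by (auto simp: card_gt_0_iff)
  have sub: "pairing_sum (S - {a, b}) (remove_pair {a, b} W) \<kappa> = ?v" if "b \<in> S - {a}" for b
  proof -
   have cd: "card (S - {a, b}) = card S - 2" using that a less.prems(1) by (subst card_Diff_subset) auto
   have "card S \<ge> 2" using ev by (meson dvd_imp_le)
   moreover have "pairing_sum (S - {a, b}) (remove_pair {a, b} W) \<kappa> =
     (if card (S - {a, b}) = 0 then 1 else if card (S - {a, b}) = 2 then -2 else 0)"
    using that less.prems ev cd a by (intro less.hyps remove_pair_pairings) auto
   ultimately show ?thesis unfolding cd by auto
  qed
  \<comment> \<open>The mate of \<open>a\<close> in \<open>W\<close> contributes the factor -2 and
    each of the \<open>card S - 2\<close> other partners the factor 1. The total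
    \<open>card S - 4\<close> vanishes for four points, and from there on the value stays 0.\<close>
  have "pairing_sum S W \<kappa> = (\<Sum>b\<in>S - {a}. (if {a, b} \<in> W then -2 else 1) * ?v)"
   unfolding pairing_sum_rec[OF less.prems(1,2) a] by (rule sum.cong) (use a sub less.prems(3) in auto)
  also have "\<dots> = -2 * ?v + (\<Sum>b\<in>S - {a} - {?b0}. (if {a, b} \<in> W then -2 else 1) * ?v)"
   using b0 less.prems(1) by (subst sum.remove[of _ ?b0]) auto
  also have "(\<Sum>b\<in>S - {a} - {?b0}. (if {a, b} \<in> W then -2 else 1) * ?v) = (\<Sum>b\<in>S - {a} - {?b0}. ?v)"
   by (rule sum.cong) (auto dest: mate_eqI[OF less.prems(2)])
  also have "(\<Sum>b\<in>S - {a} - {?b0}. ?v) = real (card S - 2) * ?v"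
   using b0 a less.prems(1) by (simp add: card_Diff_subset numeral_2_eq_2)
  finally show ?thesis using ev by auto
 qed
qed

text \<open>Contracting pairs with labels other than \<open>k\<close> leaves the fibre of
  \<open>k\<close> untouched. Once only this fibre remains, the constant case applies, and three or
  more points force the value 0.\<close>

lemma pairing_sum_eq_0:
 assumes "finite S" "W \<in> pairings S" "card {s \<in> S. \<kappa> s = k} \<ge> 3"
 shows "pairing_sum S W \<kappa> = 0" using assms
proof (induction "card S" arbitrary: S W rule: less_induct)
 case less
 show ?case
 proof (cases "\<forall>s\<in>S. \<kappa> s = k")
  case True
  then have "{s \<in> S. \<kappa> s = k} = S" by auto
  with less.prems(3) have "card S \<ge> 3" by simp
  with pairing_sum_const[OF less.prems(1,2), of \<kappa> k] True show ?thesis by auto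
 next
  case False
  then obtain a where a: "a \<in> S" "\<kappa> a \<noteq> k" by auto
  have "pairing_sum (S - {a, b}) (remove_pair {a, b} W) \<kappa> = 0" if "b \<in> S - {a}" "\<kappa> b = \<kappa> a" for b
  proof (rule less.hyps)
   show "card (S - {a, b}) < card S" using less.prems(1) a(1) by (intro psubset_card_mono) auto
   have "{s \<in> S - {a, b}. \<kappa> s = k} = {s \<in> S. \<kappa> s = k}" using a that by auto
   then show "3 \<le> card {s \<in> S - {a, b}. \<kappa> s = k}" using less.prems(3) by simp
  qed (use a less.prems that in \<open>auto intro: remove_pair_pairings\<close>)
  then show ?thesis unfolding pairing_sum_rec[OF less.prems(1,2) a(1)] by (intro sum.neutral) auto
 qed
qed

text \<open>A permutation is stored as the pairing matching copy \<open>False\<close> of each point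
  with copy \<open>True\<close> of its image. Permutations and pairings thus become objects of the
  same kind, and a type can be read off their union.\<close>

definition perm_pairs :: "'d set \<Rightarrow> ('d \<Rightarrow> 'd) \<Rightarrow> ('d \<times> bool) set set" where
 "perm_pairs D \<sigma> = (\<lambda>d. {(d, False), (\<sigma> d, True)}) ` D"

lemma perm_pairs_pairings:
 assumes "\<sigma> permutes D" shows "perm_pairs D \<sigma> \<in> pairings (D \<times> UNIV)"
proof -
 have "\<exists>d\<in>D. (x, e) = (d, False) \<or> (x, e) = (\<sigma> d, True)" if "x \<in> D" for x e
  using that permutes_image[OF assms] by (cases e; force)
 then have "\<Union>(perm_pairs D \<sigma>) = D \<times> UNIV"
  using permutes_in_image[OF assms] by (auto simp: perm_pairs_def)
 then show ?thesis
  using permutes_inj[OF assms] by (auto simp: pairings_def partition_on_def disjoint_def perm_pairs_def inj_eq)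
qed

lemma mate_perm_pairs:
 assumes "\<sigma> permutes D" "d \<in> D"
 shows "mate (perm_pairs D \<sigma>) (d, False) = (\<sigma> d, True)" "mate (perm_pairs D \<sigma>) (\<sigma> d, True) = (d, False)"
 using assms by (auto intro!: mate_eqI[OF perm_pairs_pairings[OF assms(1)]])
   (auto simp: perm_pairs_def insert_commute)

text \<open>The polygons formed with the identity pairing correspond to the cycles of \<sigma>, so
  this is the formula sign = (-1)^(points - cycles). The proof contracts the pair of the two copies
  of one point instead of speaking about cycles.\<close>

lemma sign_npoly:
 assumes "finite D" "\<sigma> permutes D"
 shows "(-1) ^ npoly (perm_pairs D id) (perm_pairs D \<sigma>) = (-1) ^ card D * sign \<sigma>" using assms
proof (induction D arbitrary: \<sigma> rule: finite_induct)
 case empty then show ?case by (simp add: perm_pairs_def polygons_def)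
next
 case (insert s D)
 let ?D = "insert s D" and ?a = "(s, False)" and ?b = "(s, True)"
 let ?P = "perm_pairs ?D id" and ?Q = "perm_pairs ?D \<sigma>"
 have P: "?P \<in> pairings (?D \<times> UNIV)" and Q: "?Q \<in> pairings (?D \<times> UNIV)"
  using perm_pairs_pairings[OF permutes_id] perm_pairs_pairings[OF insert.prems] by auto
 have ab: "{?a, ?b} \<in> ?P" by (simp add: perm_pairs_def)
 have fin: "finite (?D \<times> (UNIV :: bool set))" using insert.hyps by simp
 have P': "?P - {{?a, ?b}} = perm_pairs D id" using insert.hyps(2) by (auto simp: perm_pairs_def)
 note ct = npoly_contract[OF P Q ab fin, unfolded P']
 show ?case
 proof (cases "\<sigma> s = s")
  case True
  then have p: "\<sigma> permutes D" using insert.prems insert.hyps(2)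
   by (intro permutes_superset[OF insert.prems]) auto
  have "{?a, ?b} \<in> ?Q" using True by (auto simp: perm_pairs_def)
  moreover have "{?a, ?b} \<notin> perm_pairs D \<sigma>" "?Q = insert {?a, ?b} (perm_pairs D \<sigma>)"
   using insert.hyps(2) True by (auto simp: perm_pairs_def doubleton_eq_iff)
  then have "remove_pair {?a, ?b} ?Q = perm_pairs D \<sigma>" using remove_pair_in[of ?a ?b ?Q] by simp
  ultimately show ?thesis using insert.IH[OF p] insert.hyps ct by (simp add: id_def)
 next
  case False
  \<comment> \<open>This transposition makes \<open>s\<close> a fixed point and bypasses it in its
    cycle, which is what the contraction does to the pairing; the sign changes once.\<close>
  define \<sigma>' where "\<sigma>' = transpose s (\<sigma> s) \<circ> \<sigma>"
  have sin: "\<sigma> s \<in> ?D" using permutes_in_image[OF insert.prems, of s] by auto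
  have p0: "\<sigma>' permutes ?D" unfolding \<sigma>'_def
   by (intro permutes_compose[OF insert.prems] permutes_swap_id) (use sin in auto)
  have "\<sigma>' s = s" by (simp add: \<sigma>'_def)
  then have p: "\<sigma>' permutes D" by (intro permutes_superset[OF p0]) auto
  have sg: "sign \<sigma>' = - sign \<sigma>" unfolding \<sigma>'_def using False insert.prems insert.hyps
   by (subst sign_compose) (auto simp: permutation_swap_id sign_swap_id intro: permutes_imp_permutation)
  define r where "r = inv \<sigma> s"
  have r: "\<sigma> r = s" unfolding r_def by (rule permutes_inverses(1)[OF insert.prems])
  then have "r \<in> ?D" using permutes_in_image[OF insert.prems, of r] by simp
  then have r: "\<sigma> r = s" "r \<in> ?D" "r \<noteq> s" using r False by auto
  have m: "mate ?Q ?a = (\<sigma> s, True)" "mate ?Q ?b = (r, False)"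
   using mate_perm_pairs[OF insert.prems, of s] mate_perm_pairs[OF insert.prems r(2)] r by auto
  have nQ: "{?a, ?b} \<notin> ?Q" using False m(1) mate_eqI[OF Q, of ?a ?b] by force
  have inj: "inj \<sigma>" using permutes_inj[OF insert.prems] .
  have s': "\<sigma>' r = \<sigma> s" "\<And>d. d \<noteq> r \<Longrightarrow> d \<noteq> s \<Longrightarrow> \<sigma>' d = \<sigma> d"
   using r inj by (auto simp: \<sigma>'_def transpose_def inj_eq)
  have "remove_pair {?a, ?b} ?Q = {p \<in> ?Q. ?a \<notin> p \<and> ?b \<notin> p} \<union> {{(\<sigma> s, True), (r, False)}}"
   using remove_pair_notin[OF Q _ _ nQ] m by simp
  also have "{p \<in> ?Q. ?a \<notin> p \<and> ?b \<notin> p} = (\<lambda>d. {(d, False), (\<sigma> d, True)}) ` (D - {r})"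
   using r insert.hyps(2) by (auto simp: perm_pairs_def inj_eq[OF inj])
  also have "\<dots> = (\<lambda>d. {(d, False), (\<sigma>' d, True)}) ` (D - {r})"
  proof (rule image_cong[OF refl])
   fix d assume "d \<in> D - {r}"
   then have "\<sigma>' d = \<sigma> d" using insert.hyps(2) by (intro s'(2)) auto
   then show "{(d, False), (\<sigma> d, True)} = {(d, False), (\<sigma>' d, True)}" by simp
  qed
  also have "\<dots> \<union> {{(\<sigma> s, True), (r, False)}} = (\<lambda>d. {(d, False), (\<sigma>' d, True)}) ` (insert r (D - {r}))"
   unfolding image_insert s'(1) insert_commute[of "(\<sigma> s, True)"] by simp
  also have "insert r (D - {r}) = D" using r by auto
  finally have "remove_pair {?a, ?b} ?Q = perm_pairs D \<sigma>'" by (simp add: perm_pairs_def)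
  then show ?thesis using ct nQ insert.IH[OF p] sg insert.hyps by (simp add: id_def)
 qed
qed

section \<open>The weight of a map\<close>

text \<open>Removing an edge \<open>{u, v}\<close> from a pairing that does not contain it amounts
  to a switch creating the pair \<open>{u, v}\<close>, followed by the contraction of this pair.
  Contraction is already understood, so only the effect of a switch on the number of polygons has to
  be found.\<close>

definition switch_pairs :: "'a \<Rightarrow> 'a \<Rightarrow> 'a \<Rightarrow> 'a \<Rightarrow> 'a set set \<Rightarrow> 'a set set" where
 "switch_pairs s t s' t' Q = Q - {{s, t}, {s', t'}} \<union> {{s, s'}, {t, t'}}"

lemma switch_pairs_pairings:
 assumes "Q \<in> pairings S" "{s, t} \<in> Q" "{s', t'} \<in> Q" "s \<noteq> s'" "s \<noteq> t'"
 shows "switch_pairs s t s' t' Q \<in> pairings S" "distinct [s, t, s', t']" "{s, t, s', t'} \<subseteq> S"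
proof -
 show d: "distinct [s, t, s', t']" "{s, t, s', t'} \<subseteq> S"
  using assms pair_facts[OF assms(1,2)] pair_facts[OF assms(1,3)] by auto
 have 1: "Q - {{s, t}} - {{s', t'}} \<in> pairings (S - {s, t} - {s', t'})"
  using assms d by (intro pairings_diff) (auto simp: doubleton_eq_iff)
 have 2: "insert {t, t'} (Q - {{s, t}} - {{s', t'}}) \<in> pairings (insert t (insert t' (S - {s, t} - {s', t'})))"
  using d by (intro pairings_insert[OF 1]) auto
 have "insert {s, s'} (insert {t, t'} (Q - {{s, t}} - {{s', t'}}))
   \<in> pairings (insert s (insert s' (insert t (insert t' (S - {s, t} - {s', t'})))))"
  using d by (intro pairings_insert[OF 2]) auto
 moreover have "insert s (insert s' (insert t (insert t' (S - {s, t} - {s', t'})))) = S" using d by auto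
 moreover have "insert {s, s'} (insert {t, t'} (Q - {{s, t}} - {{s', t'}})) = switch_pairs s t s' t' Q"
  by (auto simp: switch_pairs_def)
 ultimately show "switch_pairs s t s' t' Q \<in> pairings S" by simp
qed

lemma npoly_single: "s \<noteq> t \<Longrightarrow> npoly {{s, t}} {{s, t}} = 1"
 using npoly_contract[of "{{s, t}}" "{s, t}" "{{s, t}}" s t] pairings_insert[of "{}" "{}" s t]
 by (simp add: remove_pair_in polygons_def)

lemma pairings_4:
 assumes "distinct [s, t, s', t']" "P \<in> pairings {s, t, s', t'}"
 shows "P = {{s, t}, {s', t'}} \<or> P = {{s, s'}, {t, t'}} \<or> P = {{s, t'}, {s', t}}"
proof -
 let ?S = "{s, t, s', t'}"
 have two: "R \<in> pairings {x, y} \<Longrightarrow> x \<noteq> y \<Longrightarrow> R = {{x, y}}" for x y R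
 proof -
  assume R: "R \<in> pairings {x, y}" "x \<noteq> y"
  then have "mate R x = y" using mate_in[OF R(1), of x] mate_neq[OF R(1), of x] by auto
  then have xy: "{x, y} \<in> R" using mate_pair[OF R(1), of x] by auto
  then have "R - {{x, y}} \<in> pairings {}" using pairings_diff[OF R(1) xy] by simp
  then show "R = {{x, y}}" using xy by auto
 qed
 have m: "mate P s \<in> ?S" "mate P s \<noteq> s" "{s, mate P s} \<in> P"
  using mate_in[OF assms(2), of s] mate_neq[OF assms(2), of s] mate_pair[OF assms(2), of s] by auto
 have d: "P - {{s, mate P s}} \<in> pairings (?S - {s, mate P s})" using pairings_diff[OF assms(2) m(3)] .
 consider "mate P s = t" | "mate P s = s'" | "mate P s = t'" using m by auto
 then show ?thesis
 proof cases
  case 1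
  then have e: "?S - {s, mate P s} = {s', t'}" using assms(1) by auto
  have "P - {{s, mate P s}} = {{s', t'}}" using d assms(1) unfolding e by (intro two) auto
  then have "P = {{s, mate P s}, {s', t'}}" using m(3) by blast
  then show ?thesis using 1 by simp
 next
  case 2
  then have e: "?S - {s, mate P s} = {t, t'}" using assms(1) by auto
  have "P - {{s, mate P s}} = {{t, t'}}" using d assms(1) unfolding e by (intro two) auto
  then have "P = {{s, mate P s}, {t, t'}}" using m(3) by blast
  then show ?thesis using 2 by simp
 next
  case 3
  then have e: "?S - {s, mate P s} = {s', t}" using assms(1) by auto
  have "P - {{s, mate P s}} = {{s', t}}" using d assms(1) unfolding e by (intro two) auto
  then have "P = {{s, mate P s}, {s', t}}" using m(3) by blast
  then show ?thesis using 3 by simp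
 qed
qed

lemma remove_pair_4:
 assumes "distinct [s, t, s', t']"
 shows "remove_pair {s, t} {{s, s'}, {t, t'}} = {{s', t'}}"
proof -
 have "{p \<in> {{s, s'}, {t, t'}}. p \<inter> {s, t} = {}} = {}" by auto
 moreover have "{p \<in> {{s, s'}, {t, t'}}. p \<inter> {s, t} \<noteq> {}} = {{s, s'}, {t, t'}}" by auto
 moreover have "{s, t} \<notin> {{s, s'}, {t, t'}}" using assms by (auto simp: doubleton_eq_iff)
 ultimately show ?thesis using assms unfolding remove_pair_def by auto
qed

lemma npoly_4:
 assumes "distinct [s, t, s', t']"
 shows "npoly {{s, t}, {s', t'}} {{s, t}, {s', t'}} = 2"
  "npoly {{s, t}, {s', t'}} {{s, s'}, {t, t'}} = 1"
proof -
 have P: "{{u, v}, {u', v'}} \<in> pairings {u, v, u', v'}" if "distinct [u, v, u', v']" for u v u' v' :: 'a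
  using pairings_insert[OF pairings_insert[of "{}" "{}" u' v'], of u v] that by auto
 have S: "{s, s', t, t'} = {s, t, s', t'}" by auto
 have d: "{{s, t}, {s', t'}} - {{s, t}} = {{s', t'}}" using assms by (auto simp: doubleton_eq_iff)
 show "npoly {{s, t}, {s', t'}} {{s, t}, {s', t'}} = 2"
  using npoly_contract[OF P[OF assms] P[OF assms], of s t] npoly_single[of s' t'] assms
  by (simp add: remove_pair_in d)
 have Q: "{{s, s'}, {t, t'}} \<in> pairings {s, t, s', t'}" using P[of s s' t t'] assms S by auto
 have "{s, t} \<notin> {{s, s'}, {t, t'}}" using assms by (auto simp: doubleton_eq_iff)
 then show "npoly {{s, t}, {s', t'}} {{s, s'}, {t, t'}} = 1"
  using npoly_contract[OF P[OF assms] Q, of s t] npoly_single[of s' t'] assms by (simp add: remove_pair_4[OF assms] d)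
qed

text \<open>Contracting the pairs untouched by the switch reduces the statement to four points.\<close>

lemma npoly_switch:
 assumes "finite S" "P \<in> pairings S" "Q \<in> pairings S" "{s, t} \<in> Q" "{s', t'} \<in> Q" "s \<noteq> s'" "s \<noteq> t'"
  and "alternating_on P f" "alternating_on Q f"
 shows "int (npoly (switch_pairs s t s' t' Q) P) = int (npoly Q P) +
  (if (s, s') \<notin> conn Q P then -1 else if f s = f s' then 0 else 1)" using assms
proof (induction "card S" arbitrary: S P Q rule: less_induct)
 case less
 note P = less.prems(2) and Q = less.prems(3)
 note sw = switch_pairs_pairings[OF Q less.prems(4-7)]
 let ?Q = "switch_pairs s t s' t' Q"
 show ?case
 proof (cases "S \<subseteq> {s, t, s', t'}")
  case True
  with sw have S: "S = {s, t, s', t'}" by auto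
  note d = sw(2)
  have "Q \<noteq> {{s, s'}, {t, t'}}" "Q \<noteq> {{s, t'}, {s', t}}"
   using mate_eqI[OF Q less.prems(4)] mate_eqI[OF Q, of s s'] mate_eqI[OF Q, of s t'] d by auto
  then have Q4: "Q = {{s, t}, {s', t'}}" using pairings_4[OF d Q[unfolded S]] by simp
  have Q4': "?Q = {{s, s'}, {t, t'}}" unfolding Q4 switch_pairs_def by blast
  have fQ: "f s \<noteq> f t" "f s' \<noteq> f t'" using less.prems(9) by (auto simp: alternating_on_def Q4)
  have d1: "distinct [s, s', t, t']" "distinct [s, t, t', s']" "distinct [s, s', t', t]" using d by auto
  have fl: "{{s, t}, {s', t'}} = {{s, t}, {t', s'}}" "{{s, t'}, {s', t}} = {{s, t'}, {t, s'}}"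
   "{{s, s'}, {t, t'}} = {{s, s'}, {t', t}}"  by (auto simp: insert_commute)
  \<comment> \<open>Three pairings of four points, three cases: the switch merges two polygons,
    splits one, or reconnects one to a single polygon again.\<close>
  from pairings_4[OF d P[unfolded S]]
  consider "P = {{s, t}, {s', t'}}" | "P = {{s, s'}, {t, t'}}" | "P = {{s, t'}, {s', t}}" by (elim disjE)
  then show ?thesis
  proof cases
   case 1
   have "const_on P (\<lambda>u. u \<in> {s, t})" "const_on Q (\<lambda>u. u \<in> {s, t})"
    using d by (auto simp: const_on_def 1 Q4 doubleton_eq_iff)
   from conn_const[OF Q P _ this(2,1), of s s'] have "(s, s') \<notin> conn Q P" using d by auto
   then show ?thesis unfolding Q4 1 Q4'[unfolded Q4] using npoly_4[OF d] npoly_4[OF d1(1)] by simp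
  next
   case 2
   have "(s, s') \<in> conn Q P" using conn_mate(2)[OF Q P, of s] mate_eqI[OF P, of s s'] sw by (auto simp: 2)
   moreover have "f s \<noteq> f s'" using less.prems(8) by (auto simp: alternating_on_def 2)
   ultimately show ?thesis unfolding Q4 2 Q4'[unfolded Q4] using npoly_4[OF d] npoly_4[OF d1(1)] by simp
  next
   case 3
   have c1: "(s, t') \<in> conn Q P" using conn_mate(2)[OF Q P, of s] mate_eqI[OF P, of s t'] sw by (auto simp: 3)
   have c2: "(t', s') \<in> conn Q P"
    using conn_mate(1)[OF Q P, of t'] mate_eqI[OF Q, of t' s'] less.prems(5) sw by (auto simp: insert_commute)
   have "f s = f s'" using less.prems(8) fQ by (auto simp: alternating_on_def 3)
   moreover have "npoly {{s, t}, {t', s'}} {{s, t'}, {t, s'}} = 1" using npoly_4(2)[OF d1(2)] .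
   moreover have "npoly {{s, s'}, {t', t}} {{s, t'}, {s', t}} = 1" using npoly_4(2)[OF d1(3)] .
   ultimately show ?thesis unfolding Q4 3 Q4'[unfolded Q4] using conn_trans[OF c1 c2] fl by (simp add: Q4 3)
  qed
 next
  case False
  then obtain a where a: "a \<in> S" "a \<notin> {s, t, s', t'}" by auto
  define b where "b = mate Q a"
  have ab: "{a, b} \<in> Q" using mate_pair[OF Q a(1)] by (simp add: b_def)
  have b: "b \<notin> {s, t, s', t'}" "b \<in> S"
   using a pair_facts[OF Q less.prems(4)] pair_facts[OF Q less.prems(5)] mate_mate[OF Q a(1)] mate_in[OF Q a(1)]
   unfolding b_def by auto
  have nab: "{a, b} \<notin> {{s, t}, {s', t'}, {s, s'}, {t, t'}}" using a b by blast
  have ab': "{a, b} \<in> ?Q" using ab nab by (auto simp: switch_pairs_def)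
  have sweq: "?Q - {{a, b}} = switch_pairs s t s' t' (Q - {{a, b}})"
  proof -
   have "A - X \<union> Y - {z} = A - {z} - X \<union> Y" if "z \<notin> Y" for A X Y and z :: "'a set"
    using that by blast
   from this[of "{a, b}" "{{s, s'}, {t, t'}}"] show ?thesis using nab by (simp add: switch_pairs_def)
  qed
  note cp = contract_pairings[OF Q P ab]
  have "int (npoly (switch_pairs s t s' t' (Q - {{a, b}})) (remove_pair {a, b} P)) =
    int (npoly (Q - {{a, b}}) (remove_pair {a, b} P)) +
    (if (s, s') \<notin> conn (Q - {{a, b}}) (remove_pair {a, b} P) then -1 else if f s = f s' then 0 else 1)"
  proof -
   have lt: "card (S - {a, b}) < card S" using a less.prems(1) by (intro psubset_card_mono) auto
   have "{s, t} \<in> Q - {{a, b}}" "{s', t'} \<in> Q - {{a, b}}"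
    using less.prems(4,5) nab by (simp_all add: eq_commute[of "{a, b}"])
   from less.hyps[OF lt _ cp(2,1) this less.prems(6,7)] less.prems(1) alternating_on_contract[OF Q P ab less.prems(9,8)]
   show ?thesis by simp
  qed
  moreover have "(s, s') \<in> conn (Q - {{a, b}}) (remove_pair {a, b} P) \<longleftrightarrow> (s, s') \<in> conn Q P"
   using a b sw by (intro conn_contract[OF Q P ab]) auto
  ultimately show ?thesis using npoly_contract[OF sw(1) P ab' less.prems(1)] npoly_contract[OF Q P ab less.prems(1)]
   unfolding sweq by simp
 qed
qed

lemma conn_relpow:
 assumes "P \<in> pairings S" "Q \<in> pairings S" "alternating_on P f" "alternating_on Q f" "(s, t) \<in> next_to P Q ^^ k"
 shows "f s = f t \<longleftrightarrow> even k" using assms(5)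
proof (induction k arbitrary: t)
 case (Suc k)
 then obtain u where u: "(s, u) \<in> next_to P Q ^^ k" "(u, t) \<in> next_to P Q" by auto
 have "f t = (\<not> f u)" using u(2) assms(1-4) by (auto simp: next_to_iff alternating_on_mate)
 with Suc.IH[OF u(1)] show ?case by auto
qed auto

text \<open>Distance \<open>k\<close> means \<open>k\<close> edges strictly in between, hence
  \<open>Suc k\<close> steps of \<open>next_to\<close>, each of which changes the colour. So even
  distance corresponds to different colours.\<close>

lemma face_distance_parity:
 assumes "blacks M \<in> pairings S" "whites M \<in> pairings S" "alternating_on (blacks M) f" "alternating_on (whites M) f"
  and "(s, t) \<in> conn (blacks M) (whites M)" "s \<noteq> t"
 shows "even (face_distance M s t) \<longleftrightarrow> f s \<noteq> f t"
proof -
 have "(s, t) \<in> (next_to (blacks M) (whites M))\<^sup>+" using assms(5,6) by (auto simp: conn_def rtrancl_eq_or_trancl)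
 then obtain k where "(s, t) \<in> next_to (blacks M) (whites M) ^^ Suc k" by (metis Suc_pred trancl_power)
 then have "(s, t) \<in> next_to (blacks M) (whites M) ^^ Suc (face_distance M s t)"
  unfolding face_distance_def by (rule LeastI)
 from conn_relpow[OF assms(1-4) this] show ?thesis by auto
qed

text \<open>Distances are replaced by a proper 2-colouring \<open>f\<close> of the faces, the notion
  that \<open>npoly_switch\<close> speaks about: equal colours mean twisted, different colours
  straight.\<close>

lemma edge_weight_eq:
 assumes M: "blacks M \<in> pairings S" "whites M \<in> pairings S"
  and f: "alternating_on (blacks M) f" "alternating_on (whites M) f"
  and st: "s \<in> S" "t \<in> S" "s \<noteq> t"
 shows "edge_weight \<alpha> M {s, t} = (if (s, t) \<notin> conn (blacks M) (whites M) then 1 / 2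
  else if f s = f t then jack_gamma \<alpha> else 1)"
proof -
 have face: "(\<exists>F\<in>faces M. u \<in> F \<and> v \<in> F) \<longleftrightarrow> u \<in> S \<and> (u, v) \<in> conn (blacks M) (whites M)" for u v
  unfolding faces_def polygons_eq[OF M] by (auto intro: conn_trans conn_sym dest: conn_in[OF M])
 have iff: "(\<exists>F\<in>faces M. \<exists>u\<in>F. \<exists>v\<in>F. u \<noteq> v \<and> {s, t} = {u, v} \<and> R (face_distance M u v)) \<longleftrightarrow>
   (s, t) \<in> conn (blacks M) (whites M) \<and> (R (face_distance M s t) \<or> R (face_distance M t s))" for R
 proof
  assume "\<exists>F\<in>faces M. \<exists>u\<in>F. \<exists>v\<in>F. u \<noteq> v \<and> {s, t} = {u, v} \<and> R (face_distance M u v)"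
  then obtain F u v where "F \<in> faces M" "u \<in> F" "v \<in> F" "{s, t} = {u, v}" "R (face_distance M u v)" by blast
  then show "(s, t) \<in> conn (blacks M) (whites M) \<and> (R (face_distance M s t) \<or> R (face_distance M t s))"
   using face[of s t] by (metis doubleton_eq_iff)
 next
  assume *: "(s, t) \<in> conn (blacks M) (whites M) \<and> (R (face_distance M s t) \<or> R (face_distance M t s))"
  then obtain F where "F \<in> faces M" "s \<in> F" "t \<in> F" using face[of s t] st(1) by blast
  with * st(3) show "\<exists>F\<in>faces M. \<exists>u\<in>F. \<exists>v\<in>F. u \<noteq> v \<and> {s, t} = {u, v} \<and> R (face_distance M u v)"
   by (metis insert_commute)
 qed
 show ?thesis
 proof (cases "(s, t) \<in> conn (blacks M) (whites M)")
  case True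
  from face_distance_parity[OF M f True st(3)] face_distance_parity[OF M f conn_sym[OF True] st(3)[symmetric]] True
  show ?thesis unfolding edge_weight_def straight_edge_def twisted_edge_def iff[of even] iff[of odd] by auto
 next
  case False
  then show ?thesis unfolding edge_weight_def straight_edge_def twisted_edge_def iff[of even] iff[of odd] by auto
 qed
qed

definition genus_map :: "'a set \<Rightarrow> 'a gmap \<Rightarrow> bool" where
 "genus_map S M \<longleftrightarrow> blacks M \<in> pairings S \<and> whites M \<in> pairings S \<and> edges M \<in> pairings S"

text \<open>The interface weight \<open>1 / 2\<close> is the square of \<gamma>, so straight,
  twisted and interface edges have weight \<gamma> to the power 0, 1 and 2. This exponent is exactly
  the drop of edges + faces - vertices under removal of the edge. The identity is multiplied out to
  avoid negative exponents.\<close>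

lemma remove_edge_step:
 assumes S: "finite S" and M: "genus_map S M" and E: "E \<in> edges M"
  and \<gamma>: "jack_gamma \<alpha> ^ 2 = 1 / 2"
 shows "edge_weight \<alpha> M E * jack_gamma \<alpha> ^ (card (faces (remove_edge E M)) + card (black_vertices M) + card (white_vertices M))
   = jack_gamma \<alpha> ^ (1 + card (faces M) + card (black_vertices (remove_edge E M)) + card (white_vertices (remove_edge E M)))"
  and "genus_map (S - E) (remove_edge E M)" and "edges (remove_edge E M) = edges M - {E}"
proof -
 let ?B = "blacks M" and ?W = "whites M" and ?E = "edges M"
 have B: "?B \<in> pairings S" and W: "?W \<in> pairings S" and EE: "?E \<in> pairings S" using M by (auto simp: genus_map_def)
 obtain s t where st: "s \<noteq> t" "E = {s, t}" "s \<in> S" "t \<in> S" using pairings_pairE[OF EE E] by blast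
 have st': "{s, t} \<in> ?E" using E st by simp
 show ed: "edges (remove_edge E M) = ?E - {E}" using st' st(2) by (simp add: remove_edge_def remove_pair_in)
 show "genus_map (S - E) (remove_edge E M)"
  using remove_pair_pairings[OF B st(3,4,1)] remove_pair_pairings[OF W st(3,4,1)] remove_pair_pairings[OF EE st(3,4,1)]
  by (simp add: genus_map_def remove_edge_def st(2))
 obtain f where f: "alternating_on ?B f" "alternating_on ?W f" using alternating_exists[OF S B W] by blast
 have V: "card (black_vertices M) = card (black_vertices (remove_edge E M)) + (if E \<in> ?B then 1 else 0)"
  "card (white_vertices M) = card (white_vertices (remove_edge E M)) + (if E \<in> ?W then 1 else 0)"
  using npoly_contract[OF EE B st' S] npoly_contract[OF EE W st' S]
  unfolding black_vertices_def white_vertices_def polygons_commute[of ?B] polygons_commute[of ?W]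
   polygons_commute[of "blacks (remove_edge E M)"] polygons_commute[of "whites (remove_edge E M)"] ed
  by (auto simp: remove_edge_def st(2))
 have F: "int (card (faces (remove_edge E M))) = int (card (faces M)) - (if E \<in> ?B then 1 else 0) - (if E \<in> ?W then 1 else 0)
   + (if (s, t) \<notin> conn ?B ?W then -1 else if f s = f t then 0 else 1)"
 proof (cases "E \<in> ?B")
  case True
  then have tB: "{s, t} \<in> ?B" using st by simp
  have "(s, t) \<in> conn ?B ?W" using conn_mate(1)[OF B W st(3)] mate_eqI[OF B tB] by simp
  moreover have "f s \<noteq> f t" using f(1) tB by (auto simp: alternating_on_def)
  ultimately show ?thesis using npoly_contract[OF B W tB S] True st(2) tB
   by (simp add: faces_def remove_edge_def remove_pair_in)
 next
  case False
  then have nB: "{s, t} \<notin> ?B" using st by simp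
  let ?s = "mate ?B s" and ?t = "mate ?B t"
  have pr: "{s, ?s} \<in> ?B" "{t, ?t} \<in> ?B" using mate_pair[OF B] st by auto
  have ne: "s \<noteq> ?t" using mate_off(2)[OF B st(3,4) nB st(1)] by auto
  \<comment> \<open>After the switch \<open>{s, t}\<close> is a black pair, and contracting it gives
    \<open>remove_pair {s, t}\<close> of the original black pairing.\<close>
  let ?B' = "switch_pairs s ?s t ?t ?B"
  note sw = switch_pairs_pairings[OF B pr st(1) ne]
  have tB: "{s, t} \<in> ?B'" by (simp add: switch_pairs_def)
  have d: "{p \<in> ?B. s \<notin> p \<and> t \<notin> p} = ?B - {{s, ?s}, {t, ?t}}"
   using pairings_uniq[OF B _ pr(1), of _ s] pairings_uniq[OF B _ pr(2), of _ t] by blast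
  have "{s, t} \<noteq> {?s, ?t}" using sw(2) by (auto simp: doubleton_eq_iff)
  then have "?B' - {{s, t}} = remove_pair {s, t} ?B"
   unfolding remove_pair_notin[OF B st(3,4) nB st(1)] d using nB by (auto simp: switch_pairs_def)
  with npoly_contract[OF sw(1) W tB S]
  have "npoly ?B' ?W = card (faces (remove_edge E M)) + (if E \<in> ?W then 1 else 0)"
   by (simp add: faces_def remove_edge_def st(2))
  moreover have "int (npoly ?B' ?W) = int (npoly ?B ?W) + (if (s, t) \<notin> conn ?B ?W then -1 else if f s = f t then 0 else 1)"
   by (rule npoly_switch[OF S W B pr st(1) ne f(2,1)])
  ultimately show ?thesis using False unfolding faces_def by (auto split: if_splits)
 qed
 let ?g = "jack_gamma \<alpha>"
 define F V F' V' where "F = card (faces M)" and "V = card (black_vertices M) + card (white_vertices M)"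
  and "F' = card (faces (remove_edge E M))" and "V' = card (black_vertices (remove_edge E M)) + card (white_vertices (remove_edge E M))"
 have ew: "edge_weight \<alpha> M E = (if (s, t) \<notin> conn ?B ?W then 1 / 2 else if f s = f t then ?g else 1)"
  using edge_weight_eq[OF B W f st(3,4,1)] st(2) by simp
 have "edge_weight \<alpha> M E * ?g ^ (F' + V) = ?g ^ (1 + F + V')"
 proof -
  \<comment> \<open>Interface, twisted and straight edge, in this order. The corrections for
    \<open>E\<close> being a black or a white pair cancel between faces and vertices.\<close>
  consider "edge_weight \<alpha> M E = ?g ^ 2" "F' + V + 2 = 1 + F + V'" | "edge_weight \<alpha> M E = ?g" "F' + V + 1 = 1 + F + V'"
   | "edge_weight \<alpha> M E = 1" "F' + V = 1 + F + V'"
   using F V unfolding ew \<gamma> F_def V_def F'_def V'_def by (auto split: if_splits)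
  then show ?thesis by cases (metis power_add mult.commute power_one_right mult_1)+
 qed
 then show "edge_weight \<alpha> M E * ?g ^ (card (faces (remove_edge E M)) + card (black_vertices M) + card (white_vertices M))
   = ?g ^ (1 + card (faces M) + card (black_vertices (remove_edge E M)) + card (white_vertices (remove_edge E M)))"
  by (simp add: F_def V_def F'_def V'_def add.assoc)
qed

text \<open>The local identities telescope along any order of removal, down to the empty map where
  both sides are 1. The outcome does not depend on \<open>h\<close>, so averaging over histories is
  trivial.\<close>

lemma history_weight_eq:
 assumes "finite S" "genus_map S M" "set h = edges M" "distinct h" "jack_gamma \<alpha> ^ 2 = 1 / 2"
 shows "history_weight \<alpha> M h * jack_gamma \<alpha> ^ (card (black_vertices M) + card (white_vertices M))
  = jack_gamma \<alpha> ^ (length h + card (faces M))" using assms(1-4)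
proof (induction h arbitrary: S M)
 case Nil
 then have "edges M = {}" by simp
 with Nil have "S = {}" using pairings_cover by (fastforce simp: genus_map_def)
 then have "blacks M = {}" "whites M = {}" "edges M = {}" using Nil by (auto simp: genus_map_def)
 then show ?case by (simp add: faces_def black_vertices_def white_vertices_def polygons_def)
next
 case (Cons E h)
 let ?g = "jack_gamma \<alpha>" and ?M = "remove_edge E M"
 have E: "E \<in> edges M" using Cons by auto
 note st = remove_edge_step[OF Cons.prems(1,2) E assms(5)]
 have "set h = edges ?M" unfolding st(3) using Cons.prems(3,4) by auto
 then have IH: "history_weight \<alpha> ?M h * ?g ^ (card (black_vertices ?M) + card (white_vertices ?M)) = ?g ^ (length h + card (faces ?M))"
  using Cons.prems by (intro Cons.IH[OF _ st(2)]) auto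
 have g: "?g \<noteq> 0" using assms(5) by auto
 have "(history_weight \<alpha> M (E # h) * ?g ^ (card (black_vertices M) + card (white_vertices M))) *
   ?g ^ (card (faces ?M) + (card (black_vertices ?M) + card (white_vertices ?M)))
  = (edge_weight \<alpha> M E * ?g ^ (card (faces ?M) + card (black_vertices M) + card (white_vertices M))) *
   (history_weight \<alpha> ?M h * ?g ^ (card (black_vertices ?M) + card (white_vertices ?M)))"
  by (simp add: power_add)
 also have "\<dots> = ?g ^ (length (E # h) + card (faces M)) * ?g ^ (card (faces ?M) + (card (black_vertices ?M) + card (white_vertices ?M)))"
  unfolding st(1) IH by (simp add: power_add)
 finally show ?case using g by simp
qed

lemma map_weight_eq:
 assumes "finite S" "genus_map S M" "jack_gamma \<alpha> ^ 2 = 1 / 2"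
 shows "map_weight \<alpha> M * jack_gamma \<alpha> ^ (card (black_vertices M) + card (white_vertices M))
  = jack_gamma \<alpha> ^ (card (edges M) + card (faces M))"
proof -
 have fin: "finite (edges M)" using assms finite_pairing by (auto simp: genus_map_def)
 have "(\<Sum>h\<in>permutations_of_set (edges M). history_weight \<alpha> M h) * jack_gamma \<alpha> ^ (card (black_vertices M) + card (white_vertices M))
   = (\<Sum>h\<in>permutations_of_set (edges M). jack_gamma \<alpha> ^ (card (edges M) + card (faces M)))"
  unfolding sum_distrib_right
 proof (rule sum.cong[OF refl])
  fix h assume "h \<in> permutations_of_set (edges M)"
  then have "set h = edges M" "distinct h" "length h = card (edges M)"
   by (auto dest: permutations_of_setD simp: length_finite_permutations_of_set)
  then show "history_weight \<alpha> M h * jack_gamma \<alpha> ^ (card (black_vertices M) + card (white_vertices M)) =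
    jack_gamma \<alpha> ^ (card (edges M) + card (faces M))"
   using history_weight_eq[OF assms(1,2) _ _ assms(3)] by metis
 qed
 also have "\<dots> = fact (card (edges M)) * jack_gamma \<alpha> ^ (card (edges M) + card (faces M))"
  using fin by simp
 finally show ?thesis by (simp add: map_weight_def field_simps)
qed

section \<open>Isomorphisms of pairs of pairings\<close>

lemma mate_remove:
 assumes "Q \<in> pairings S" "a \<in> S" "b \<in> S" "{a, b} \<notin> Q" "a \<noteq> b" "s \<in> S - {a, b}"
 shows "mate (remove_pair {a, b} Q) s =
  (if s = mate Q a then mate Q b else if s = mate Q b then mate Q a else mate Q s)"
proof -
 note off = mate_off[OF assms(1-5)]
 have ins: "{mate Q a, mate Q b} \<in> remove_pair {a, b} Q" unfolding remove_pair_notin[OF assms(1-5)] by simp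
 have "{s, mate Q s} \<in> remove_pair {a, b} Q" if "s \<noteq> mate Q a" "s \<noteq> mate Q b"
 proof -
  have "a \<notin> {s, mate Q s}" "b \<notin> {s, mate Q s}" using that assms(6) mate_mate[OF assms(1), of s] by auto
  then show ?thesis unfolding remove_pair_notin[OF assms(1-5)] using mate_pair[OF assms(1), of s] assms(6) by blast
 qed
 then show ?thesis using ins mate_eqI[OF remove_pair_pairings[OF assms(1,2,3,5)]] off by (auto simp: insert_commute)
qed

definition isos :: "'a set \<Rightarrow> 'a set set \<Rightarrow> 'a set set \<Rightarrow> 'b set \<Rightarrow> 'b set set \<Rightarrow> 'b set set \<Rightarrow> ('a \<Rightarrow> 'b) set" where
 "isos S B W S' B' W' = {g \<in> S \<rightarrow>\<^sub>E S'. bij_betw g S S' \<and>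
   (\<forall>s\<in>S. g (mate B s) = mate B' (g s) \<and> g (mate W s) = mate W' (g s))}"

context
 fixes S :: "'a set" and B W and S' :: "'b set" and B' W' and a b a' b'
 assumes B: "B \<in> pairings S" and W: "W \<in> pairings S" and ab: "{a, b} \<in> B"
  and B': "B' \<in> pairings S'" and W': "W' \<in> pairings S'" and ab': "{a', b'} \<in> B'"
begin

text \<open>An isomorphism sending \<open>a\<close> to \<open>a'\<close> must send \<open>b\<close>
  to \<open>b'\<close>, so its restriction to the contracted pairs determines it. If the pair is not
  common, the restriction has to match the ends of the spliced pairs; one condition suffices, since
  the other end follows by applying mates.\<close>

lemma isos_contract:
 assumes "{a, b} \<in> W \<longleftrightarrow> {a', b'} \<in> W'"
 shows "card {g \<in> isos S B W S' B' W'. g a = a'} =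
  card {g \<in> isos (S - {a, b}) (B - {{a, b}}) (remove_pair {a, b} W)
    (S' - {a', b'}) (B' - {{a', b'}}) (remove_pair {a', b'} W').
   {a, b} \<notin> W \<longrightarrow> g (mate W a) = mate W' a'}" (is "card ?X = card ?Y")
proof (rule bij_betw_same_card[where f = "\<lambda>g. restrict g (S - {a, b})"],
  rule bij_betw_byWitness[where f' = "\<lambda>g. g(a := a', b := b')"])
 note c = pair_facts[OF B ab] and c' = pair_facts[OF B' ab']
 have Xb: "g b = b'" if "g \<in> ?X" for g using that c c' by (auto simp: isos_def)
 have mb: "mate B s \<in> S - {a, b}" if "s \<in> S - {a, b}" for s
  using that c mate_in[OF B, of s] mate_mate[OF B, of s] by auto
 have mb': "mate B' s \<in> S' - {a', b'}" if "s \<in> S' - {a', b'}" for s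
  using that c' mate_in[OF B', of s] mate_mate[OF B', of s] by auto
 note off = mate_off[OF W c(1,2) _ c(3)] and off' = mate_off[OF W' c'(1,2) _ c'(3)]
 have win: "mate W a = b" "mate W b = a" "mate W' a' = b'" "mate W' b' = a'" if "{a, b} \<in> W"
  using pair_facts[OF W that] pair_facts[OF W', of a' b'] that assms by auto
 have cm: "mate (remove_pair {a, b} W) s = (if {a, b} \<in> W then mate W s else
   if s = mate W a then mate W b else if s = mate W b then mate W a else mate W s)" if "s \<in> S - {a, b}" for s
  using that mate_remove[OF W c(1,2) _ c(3) that] mate_diff[OF W, of a b s] by (auto simp: remove_pair_in)
 have cm': "mate (remove_pair {a', b'} W') s = (if {a, b} \<in> W then mate W' s else
   if s = mate W' a' then mate W' b' else if s = mate W' b' then mate W' a' else mate W' s)" if "s \<in> S' - {a', b'}" for s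
  using that mate_remove[OF W' c'(1,2) _ c'(3) that] mate_diff[OF W', of a' b' s] assms by (auto simp: remove_pair_in)
 show "\<forall>g\<in>?X. (restrict g (S - {a, b}))(a := a', b := b') = g"
 proof
  fix g assume g: "g \<in> ?X"
  show "(restrict g (S - {a, b}))(a := a', b := b') = g"
   using g Xb[OF g] c by (intro ext) (auto simp: isos_def PiE_def extensional_def restrict_def)
 qed
 show "\<forall>g\<in>?Y. restrict (g(a := a', b := b')) (S - {a, b}) = g"
  by (auto simp: isos_def PiE_def extensional_def restrict_def fun_eq_iff)
 show "(\<lambda>g. restrict g (S - {a, b})) ` ?X \<subseteq> ?Y"
 proof (rule image_subsetI)
  fix g assume g: "g \<in> ?X"
  then have bij: "bij_betw g S S'" and ga: "g a = a'" and gB: "\<And>s. s \<in> S \<Longrightarrow> g (mate B s) = mate B' (g s)"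
   and gW: "\<And>s. s \<in> S \<Longrightarrow> g (mate W s) = mate W' (g s)" by (auto simp: isos_def)
  have gb: "g b = b'" using Xb[OF g] .
  have bij': "bij_betw g (S - {a, b}) (S' - {a', b'})"
   using bij_betw_DiffI[OF bij, of "{a, b}" "{a', b'}"] c c' ga gb by (auto simp: bij_betw_def)
  then have gin: "g s \<in> S' - {a', b'}" if "s \<in> S - {a, b}" for s using that by (auto simp: bij_betw_def)
  have inj: "g s = g t \<longleftrightarrow> s = t" if "s \<in> S" "t \<in> S" for s t
   using bij that by (auto simp: bij_betw_def inj_on_def)
  have 1: "g (mate (B - {{a, b}}) s) = mate (B' - {{a', b'}}) (g s)" if "s \<in> S - {a, b}" for s
   using mate_diff[OF B ab, of s] mate_diff[OF B' ab', of "g s"] gin[OF that] that gB by auto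
  have 2: "g (mate (remove_pair {a, b} W) s) = mate (remove_pair {a', b'} W') (g s)" if "s \<in> S - {a, b}" for s
   unfolding cm[OF that] cm'[OF gin[OF that]]
   using that gW[of a] gW[of b] gW[of s] ga gb c mate_in[OF W] inj[of s "mate W a"] inj[of s "mate W b"] by auto
  have mr: "mate (B - {{a, b}}) s \<in> S - {a, b}" "mate (remove_pair {a, b} W) s \<in> S - {a, b}" if "s \<in> S - {a, b}" for s
   using mate_in[OF contract_pairings(1)[OF B W ab] that] mate_in[OF contract_pairings(2)[OF B W ab] that] by auto
  have "restrict g (S - {a, b}) \<in> isos (S - {a, b}) (B - {{a, b}}) (remove_pair {a, b} W)
    (S' - {a', b'}) (B' - {{a', b'}}) (remove_pair {a', b'} W')"
  proof -
   have "bij_betw (restrict g (S - {a, b})) (S - {a, b}) (S' - {a', b'})"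
    using bij' by (rule bij_betw_cong[THEN iffD1, rotated]) simp
   moreover have "restrict g (S - {a, b}) (mate (B - {{a, b}}) s) = mate (B' - {{a', b'}}) (restrict g (S - {a, b}) s)"
    "restrict g (S - {a, b}) (mate (remove_pair {a, b} W) s) = mate (remove_pair {a', b'} W') (restrict g (S - {a, b}) s)"
    if "s \<in> S - {a, b}" for s using 1[OF that] 2[OF that] mr[OF that] that by simp_all
   moreover have "restrict g (S - {a, b}) \<in> (S - {a, b}) \<rightarrow>\<^sub>E (S' - {a', b'})" using gin by auto
   ultimately show ?thesis unfolding isos_def by blast
  qed
  moreover have "restrict g (S - {a, b}) (mate W a) = mate W' a'" if "{a, b} \<notin> W"
   using off[OF that] gW[OF c(1)] ga by auto
  ultimately show "restrict g (S - {a, b}) \<in> ?Y" by blast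
 qed
 show "(\<lambda>g. g(a := a', b := b')) ` ?Y \<subseteq> ?X"
 proof (rule image_subsetI)
  fix g assume g: "g \<in> ?Y"
  let ?g = "g(a := a', b := b')"
  have bij: "bij_betw g (S - {a, b}) (S' - {a', b'})"
   and gB: "\<And>s. s \<in> S - {a, b} \<Longrightarrow> g (mate (B - {{a, b}}) s) = mate (B' - {{a', b'}}) (g s)"
   and gW: "\<And>s. s \<in> S - {a, b} \<Longrightarrow> g (mate (remove_pair {a, b} W) s) = mate (remove_pair {a', b'} W') (g s)"
   and gc: "{a, b} \<notin> W \<Longrightarrow> g (mate W a) = mate W' a'" and ext: "g \<in> extensional (S - {a, b})"
   using g by (auto simp: isos_def PiE_def)
  have gin: "g s \<in> S' - {a', b'}" if "s \<in> S - {a, b}" for s using that bij by (auto simp: bij_betw_def)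
  have inj: "g s = g t \<longleftrightarrow> s = t" if "s \<in> S - {a, b}" "t \<in> S - {a, b}" for s t
   using bij inj_on_eq_iff[OF _ that] unfolding bij_betw_def by metis
  have bijg: "bij_betw ?g S S'"
  proof -
   have "bij_betw ?g (S - {a, b}) (S' - {a', b'})" using bij by (rule bij_betw_cong[THEN iffD1, rotated]) auto
   moreover have "bij_betw ?g {a, b} {a', b'}" using c(3) c'(3) by (intro bij_betw_imageI) (auto simp: inj_on_def)
   ultimately have "bij_betw ?g ((S - {a, b}) \<union> {a, b}) ((S' - {a', b'}) \<union> {a', b'})"
    by (rule bij_betw_combine) auto
   moreover have "(S - {a, b}) \<union> {a, b} = S" "(S' - {a', b'}) \<union> {a', b'} = S'" using c c' by auto
   ultimately show ?thesis by simp
  qed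
  have 1: "?g (mate B s) = mate B' (?g s)" if "s \<in> S" for s
  proof (cases "s \<in> {a, b}")
   case True then show ?thesis using c c' by auto
  next
   case False
   then have s: "s \<in> S - {a, b}" using that by auto
   then have "g (mate B s) = mate B' (g s)"
    using gB[OF s] mate_diff[OF B ab that] mate_diff[OF B' ab', of "g s"] gin[OF s] by auto
   then show ?thesis using mb[OF s] s by auto
  qed
  have gd: "g (mate W b) = mate W' b'" if "{a, b} \<notin> W"
  proof -
   have "g (mate (remove_pair {a, b} W) (mate W a)) = mate (remove_pair {a', b'} W') (g (mate W a))"
    using gW off[OF that] by auto
   then show ?thesis using cm[of "mate W a"] cm'[of "mate W' a'"] off[OF that] off' that assms gc by auto
  qed
  have 2: "?g (mate W s) = mate W' (?g s)" if sS: "s \<in> S" for s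
  proof (cases "{a, b} \<in> W")
   case True
   note win = win[OF True]
   show ?thesis
   proof (cases "s \<in> {a, b}")
    case True then show ?thesis using win c(3) by auto
   next
    case False
    then have s: "s \<in> S - {a, b}" using that by auto
    have "mate W s \<noteq> a" "mate W s \<noteq> b" using win False mate_mate[OF W that] by auto
    then show ?thesis using gW[OF s] s cm[OF s] cm'[OF gin[OF s]] True by auto
   qed
  next
   case nW: False
   note off = off[OF nW]
   have off': "mate W' a' \<in> S' - {a', b'}" "mate W' b' \<in> S' - {a', b'}" "mate W' a' \<noteq> mate W' b'"
    using off' nW assms by auto
   consider "s = a" | "s = b" | "s = mate W a" | "s = mate W b" | "s \<in> S - {a, b, mate W a, mate W b}"
    using sS by blast
   then show ?thesis
   proof cases
    case 1 then show ?thesis using off gc[OF nW] c by auto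
   next
    case 2 then show ?thesis using off gd[OF nW] c by auto
   next
    case 3 then show ?thesis using off gc[OF nW] c c' mate_mate[OF W] mate_mate[OF W'] by auto
   next
    case 4 then show ?thesis using off gd[OF nW] c c' mate_mate[OF W] mate_mate[OF W'] by auto
   next
    case 5
    then have s: "s \<in> S - {a, b}" by auto
    have "mate W s \<noteq> a" "mate W s \<noteq> b" using 5 mate_mate[OF W sS] by auto
    moreover have "g s \<noteq> mate W' a'" "g s \<noteq> mate W' b'"
     using inj[OF s off(1)] inj[OF s off(2)] 5 gc[OF nW] gd[OF nW] by auto
    ultimately show ?thesis using gW[OF s] s cm[OF s] cm'[OF gin[OF s]] 5 nW by auto
   qed
  qed
  have "?g \<in> S \<rightarrow>\<^sub>E S'" using bijg ext c by (auto simp: bij_betw_def PiE_def extensional_def)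
  then show "?g \<in> ?X" using bijg 1 2 c(3) unfolding isos_def by (auto simp del: fun_upd_apply) (auto simp: fun_upd_apply)
 qed
qed

lemma isos_mixed:
 assumes "{a, b} \<in> W \<longleftrightarrow> {a', b'} \<notin> W'" "g \<in> isos S B W S' B' W'"
 shows "g a \<noteq> a'"
proof
 assume ga: "g a = a'"
 note c = pair_facts[OF B ab] and c' = pair_facts[OF B' ab']
 have gb: "g b = b'" using assms(2) ga c c' by (auto simp: isos_def)
 have inj: "g s = g t \<longleftrightarrow> s = t" if "s \<in> S" "t \<in> S" for s t
  using assms(2) that by (auto simp: isos_def bij_betw_def inj_on_def)
 have "g (mate W a) = mate W' a'" using assms(2) ga c by (auto simp: isos_def)
 then have "mate W a = b \<longleftrightarrow> mate W' a' = b'" using inj[of "mate W a" b] mate_in[OF W c(1)] c(2) gb by auto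
 then show False using assms(1) c(1) c'(1) by (auto simp: pair_iff[OF W] pair_iff[OF W'])
qed

end

definition ptype :: "'a set set \<Rightarrow> 'a set set \<Rightarrow> nat multiset" where
 "ptype P Q = image_mset (\<lambda>L. card L div 2) (mset_set (polygons P Q))"

text \<open>The number z of the partition times 2 to its length. It is the order of the automorphism
  group of a pair of pairings of this type: a polygon with \<open>2 * k\<close> elements has
  \<open>2 * k\<close> automorphisms, and polygons of equal length can be permuted.\<close>

definition zmset :: "nat multiset \<Rightarrow> nat" where
 "zmset M = prod_mset M * (\<Prod>i\<in>set_mset M. fact (count M i)) * 2 ^ size M"

lemma zmset_add: "zmset (add_mset k M) = 2 * k * Suc (count M k) * zmset M"
proof -
 have "(\<Prod>i\<in>set_mset (add_mset k M). fact (count (add_mset k M) i)) =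
   fact (Suc (count M k)) * (\<Prod>i\<in>set_mset M - {k}. fact (count M i) :: nat)"
  by (simp add: prod.insert_remove)
 also have "(\<Prod>i\<in>set_mset M. fact (count M i)) = fact (count M k) * (\<Prod>i\<in>set_mset M - {k}. fact (count M i) :: nat)"
  by (cases "k \<in># M") (auto simp: prod.remove not_in_iff)
 ultimately show ?thesis unfolding zmset_def by (simp del: set_mset_add_mset_insert count_add_mset add: algebra_simps)
qed

lemma ptype_contract_in:
 assumes "finite S" "P \<in> pairings S" "Q \<in> pairings S" "{a, b} \<in> P" "{a, b} \<in> Q"
 shows "ptype P Q = add_mset 1 (ptype (P - {{a, b}}) (remove_pair {a, b} Q))"
  "conn P Q `` {a} = {a, b}"
proof -
 note ct = polygons_contract_in[OF assms(2-5)]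
 have "a \<noteq> b" using pair_facts[OF assms(2,4)] by simp
 then have "card {a, b} div 2 = 1" by simp
 then show "ptype P Q = add_mset 1 (ptype (P - {{a, b}}) (remove_pair {a, b} Q))"
  unfolding ptype_def ct(2) using mset_set.remove[OF finite_polygons[OF assms(1-3)] ct(1)] by simp
 show "conn P Q `` {a} = {a, b}" using polygonD(1)[OF assms(2,3) ct(1), of a] by simp
qed

lemma ptype_contract_notin:
 assumes "finite S" "P \<in> pairings S" "Q \<in> pairings S" "{a, b} \<in> P" "{a, b} \<notin> Q"
 defines "L \<equiv> conn P Q `` {a}" and "R \<equiv> image_mset (\<lambda>L. card L div 2) (mset_set (polygons P Q - {conn P Q `` {a}}))"
 shows "ptype P Q = add_mset (card L div 2) R"
  "ptype (P - {{a, b}}) (remove_pair {a, b} Q) = add_mset (card L div 2 - 1) R"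
  "conn (P - {{a, b}}) (remove_pair {a, b} Q) `` {mate Q a} = L - {a, b}" "{a, b} \<subset> L"
proof -
 note ct = polygons_contract_notin[OF assms(2-5)]
 note c = pair_facts[OF assms(2,4)] and fin = finite_polygons[OF assms(1-3)]
 note off = mate_off[OF assms(3) c(1,2) assms(5) c(3)]
 have Lp: "L \<in> polygons P Q" using c(1) by (auto simp: L_def polygons_eq[OF assms(2,3)])
 have finS: "finite L" using Lp polygonD(2)[OF assms(2,3)] assms(1) by (meson finite_subset subsetI)
 have abL: "a \<in> L" "b \<in> L" "mate Q a \<in> L" using conn_mate[OF assms(2,3) c(1)] c(4) by (auto simp: L_def)
 then show "{a, b} \<subset> L" using off by auto
 show "ptype P Q = add_mset (card L div 2) R"
  unfolding ptype_def R_def using mset_set.remove[OF fin Lp] by (simp add: L_def)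
 have "card (L - {a, b}) = card L - 2" using abL c(3) finS by (simp add: card_Diff_subset)
 then have cL: "card (L - {a, b}) div 2 = card L div 2 - 1" by simp
 have "mset_set ((\<lambda>L. L - {a, b}) ` polygons P Q) = image_mset (\<lambda>L. L - {a, b}) (mset_set (polygons P Q))"
  using image_mset_mset_set[OF ct(1)] by simp
 then have "ptype (P - {{a, b}}) (remove_pair {a, b} Q) =
   image_mset (\<lambda>L. card (L - {a, b}) div 2) (add_mset L (mset_set (polygons P Q - {L})))"
  unfolding ptype_def ct(2) using mset_set.remove[OF fin Lp] by (simp add: image_mset.compositionality comp_def)
 also have "\<dots> = add_mset (card L div 2 - 1) (image_mset (\<lambda>L. card (L - {a, b}) div 2) (mset_set (polygons P Q - {L})))"
  by (simp add: cL)
 also have "image_mset (\<lambda>L. card (L - {a, b}) div 2) (mset_set (polygons P Q - {L})) = R"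
  unfolding R_def L_def[symmetric]
 proof (rule image_mset_cong)
  fix M assume "M \<in># mset_set (polygons P Q - {L})"
  then have M: "M \<in> polygons P Q" "M \<noteq> L" using fin by auto
  then have "a \<notin> M" "b \<notin> M" using polygonD(1)[OF assms(2,3) M(1)] polygonD(1)[OF assms(2,3) Lp] abL by metis+
  then have "M - {a, b} = M" by auto
  then show "card (M - {a, b}) div 2 = card M div 2" by simp
 qed
 finally show "ptype (P - {{a, b}}) (remove_pair {a, b} Q) = add_mset (card L div 2 - 1) R" .
 show "conn (P - {{a, b}}) (remove_pair {a, b} Q) `` {mate Q a} = L - {a, b}"
  using conn_contract_class[OF assms(2-4) off(1)] polygonD(1)[OF assms(2,3) Lp abL(3)] by simp
qed

lemma sum_ptype:
 assumes "finite S" "P \<in> pairings S" "Q \<in> pairings S"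
 shows "2 * sum_mset (ptype P Q) = card S" using assms
proof (induction rule: pairing_pair_induct)
 case empty then show ?case by (simp add: ptype_def polygons_def)
next
 case (same S P Q a b)
 note c = pair_facts[OF same(2,4)]
 have "{a, b} \<subseteq> S" using c by auto
 then have "card (S - {a, b}) = card S - 2" "card S \<ge> 2"
  using c same(1) card_mono[of S "{a, b}"] by (auto simp: card_Diff_subset)
 then show ?case using same.IH ptype_contract_in(1)[OF same(1-5)] by simp
next
 case (contract S P Q a b)
 note c = pair_facts[OF contract(2,4)] and pt = ptype_contract_notin[OF contract(1-5)]
 have "{a, b} \<subseteq> S" using c by auto
 then have cd: "card (S - {a, b}) = card S - 2" "card S \<ge> 2"
  using c contract(1) card_mono[of S "{a, b}"] by (auto simp: card_Diff_subset)
 have "finite (conn P Q `` {a})" using conn_in[OF contract(2,3)] c(1) contract(1) by (meson Image_singleton_iff finite_subset subsetI)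
 then have "card (conn P Q `` {a}) \<ge> 2" using pt(4) psubset_card_mono[of "conn P Q `` {a}" "{a, b}"] c(3) by auto
 then have "card (conn P Q `` {a}) div 2 \<ge> 1" by auto
 then show ?case using contract.IH cd pt(1,2) by simp
qed

lemma even_polygon:
 assumes "finite S" "P \<in> pairings S" "Q \<in> pairings S" "a \<in> S"
 shows "even (card (conn P Q `` {a}))"
proof -
 let ?L = "conn P Q `` {a}"
 have L: "?L \<subseteq> S" using conn_in[OF assms(2,3)] assms(4) by blast
 have "{p \<in> P. p \<subseteq> ?L} \<in> pairings ?L"
 proof -
  have "\<Union>{p \<in> P. p \<subseteq> ?L} = ?L"
  proof (intro equalityI subsetI)
   fix x assume x: "x \<in> ?L"
   then have "x \<in> S" using L by auto
   then have "{x, mate P x} \<in> P" "{x, mate P x} \<subseteq> ?L"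
    using mate_pair[OF assms(2)] conn_mate(1)[OF assms(2,3)] x by (auto intro: conn_trans)
   then show "x \<in> \<Union>{p \<in> P. p \<subseteq> ?L}" by blast
  qed auto
  then show ?thesis using assms(2) by (auto simp: pairings_def partition_on_def disjoint_def)
 qed
 then show ?thesis using card_pairing[OF finite_subset[OF L assms(1)]] by simp
qed

text \<open>The two counts need each other. The pointed count reduces by contraction to a smaller
  pointed count or, for a digon, to a smaller total count; the total count sums the pointed ones
  over the possible images of a fixed \<open>a\<close>.\<close>

lemma card_isos_aux:
 fixes S :: "'a set" and S' :: "'b set"
 assumes "finite S" "B \<in> pairings S" "W \<in> pairings S" "finite S'" "B' \<in> pairings S'" "W' \<in> pairings S'"
 shows "card (isos S B W S' B' W') = (if ptype B W = ptype B' W' then zmset (ptype B W) else 0)"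
  and "\<And>a a'. a \<in> S \<Longrightarrow> a' \<in> S' \<Longrightarrow> card {g \<in> isos S B W S' B' W'. g a = a'} =
   (if ptype B W = ptype B' W' \<and> card (conn B W `` {a}) = card (conn B' W' `` {a'})
    then zmset (ptype B W - {#card (conn B W `` {a}) div 2#}) else 0)"
proof -
 have fin: "finite (isos S B W S' B' W')" if "finite S" "finite S'" for S :: "'a set" and S' :: "'b set" and B W B' W'
  by (rule finite_subset[of _ "S \<rightarrow>\<^sub>E S'"]) (use that in \<open>auto simp: isos_def intro: finite_PiE\<close>)
 have "card (isos S B W S' B' W') = (if ptype B W = ptype B' W' then zmset (ptype B W) else 0) \<and>
  (\<forall>a\<in>S. \<forall>a'\<in>S'. card {g \<in> isos S B W S' B' W'. g a = a'} =
   (if ptype B W = ptype B' W' \<and> card (conn B W `` {a}) = card (conn B' W' `` {a'})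
    then zmset (ptype B W - {#card (conn B W `` {a}) div 2#}) else 0))" using assms
 proof (induction "card S" arbitrary: S B W S' B' W' rule: less_induct)
  case less
  note B = less.prems(2) and W = less.prems(3) and B' = less.prems(5) and W' = less.prems(6)
  have pointed: "card {g \<in> isos S B W S' B' W'. g a = a'} =
   (if ptype B W = ptype B' W' \<and> card (conn B W `` {a}) = card (conn B' W' `` {a'})
    then zmset (ptype B W - {#card (conn B W `` {a}) div 2#}) else 0)" if a: "a \<in> S" and a': "a' \<in> S'" for a a'
  proof -
   let ?b = "mate B a" and ?b' = "mate B' a'"
   have ab: "{a, ?b} \<in> B" and ab': "{a', ?b'} \<in> B'" using mate_pair[OF B a] mate_pair[OF B' a'] by auto
   have lt: "card (S - {a, ?b}) < card S" using a less.prems(1) by (intro psubset_card_mono) auto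
   note cp = contract_pairings[OF B W ab] and cp' = contract_pairings[OF B' W' ab']
   note IH = less.hyps[OF lt _ cp _ cp']
   have ev: "even (card (conn B W `` {a}))" "even (card (conn B' W' `` {a'}))"
    using even_polygon[OF less.prems(1) B W a] even_polygon[OF less.prems(4) B' W' a'] by auto
   have two: "card {a, ?b} = 2" "card {a', ?b'} = 2" using pair_neq[OF B ab] pair_neq[OF B' ab'] by auto
   have finL: "finite (conn B W `` {a})" "finite (conn B' W' `` {a'})"
    using conn_in[OF B W _ a] conn_in[OF B' W' _ a'] less.prems(1,4) by (meson Image_singleton_iff finite_subset subsetI)+
   consider (both) "{a, ?b} \<in> W" "{a', ?b'} \<in> W'" | (none) "{a, ?b} \<notin> W" "{a', ?b'} \<notin> W'"
    | (mixed) "{a, ?b} \<in> W \<longleftrightarrow> {a', ?b'} \<notin> W'" by blast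
   then show ?thesis
   proof cases
    case both
    note pt = ptype_contract_in[OF less.prems(1) B W ab both(1)] ptype_contract_in[OF less.prems(4) B' W' ab' both(2)]
    show ?thesis using isos_contract[OF B W ab B' W' ab'] both IH less.prems(1,4) two unfolding pt by simp
   next
    case none
    note pt = ptype_contract_notin[OF less.prems(1) B W ab none(1)] ptype_contract_notin[OF less.prems(4) B' W' ab' none(2)]
    define k k' where "k = card (conn B W `` {a}) div 2" and "k' = card (conn B' W' `` {a'}) div 2"
    have kk: "card (conn B W `` {a}) = 2 * k" "card (conn B' W' `` {a'}) = 2 * k'" using ev by (auto simp: k_def k'_def)
    have ge: "card (conn B W `` {a}) > 2" "card (conn B' W' `` {a'}) > 2"
     using psubset_card_mono[OF finL(1) pt(4)] psubset_card_mono[OF finL(2) pt(8)] two by auto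
    then have k: "k > 1" "k' > 1" using kk by auto
    have cd: "card (conn B W `` {a} - {a, ?b}) = 2 * (k - 1)" "card (conn B' W' `` {a'} - {a', ?b'}) = 2 * (k' - 1)"
     using pt(4,8) two kk finL by (subst card_Diff_subset; force)+
    have m: "mate W a \<in> S - {a, ?b}" "mate W' a' \<in> S' - {a', ?b'}"
     using mate_off(1)[OF W a _ none(1)] mate_off(1)[OF W' a' _ none(2)] mate_in[OF B a] mate_in[OF B' a'] mate_neq[OF B a] mate_neq[OF B' a'] by auto
    have "card {g \<in> isos S B W S' B' W'. g a = a'} =
      card {g \<in> isos (S - {a, ?b}) (B - {{a, ?b}}) (remove_pair {a, ?b} W)
        (S' - {a', ?b'}) (B' - {{a', ?b'}}) (remove_pair {a', ?b'} W'). g (mate W a) = mate W' a'}"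
     using isos_contract[OF B W ab B' W' ab'] none by simp
    also have "\<dots> = (if ptype (B - {{a, ?b}}) (remove_pair {a, ?b} W) = ptype (B' - {{a', ?b'}}) (remove_pair {a', ?b'} W')
      \<and> 2 * (k - 1) = 2 * (k' - 1) then zmset (ptype (B - {{a, ?b}}) (remove_pair {a, ?b} W) - {#k - 1#}) else 0)"
     using IH[THEN conjunct2, rule_format, OF _ _ m] less.prems(1,4) unfolding pt(3,7) cd by simp
    finally show ?thesis unfolding pt(1,2,5,6) kk using k by auto
   next
    case mixed
    have "{g \<in> isos S B W S' B' W'. g a = a'} = {}" using isos_mixed[OF B W ab B' W' ab' mixed] by auto
    \<comment> \<open>A digon on one side faces a longer polygon on the other.\<close>
    moreover have "card (conn B W `` {a}) \<noteq> card (conn B' W' `` {a'})"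
    proof (cases "{a, ?b} \<in> W")
     case True
     then have "{a', ?b'} \<notin> W'" using mixed by simp
     from ptype_contract_notin(4)[OF less.prems(4) B' W' ab' this] ptype_contract_in(2)[OF less.prems(1) B W ab True]
     show ?thesis using psubset_card_mono[OF finL(2), of "{a', ?b'}"] two by simp
    next
     case False
     then have "{a', ?b'} \<in> W'" using mixed by simp
     from ptype_contract_notin(4)[OF less.prems(1) B W ab False] ptype_contract_in(2)[OF less.prems(4) B' W' ab' this]
     show ?thesis using psubset_card_mono[OF finL(1), of "{a, ?b}"] two by simp
    qed
    ultimately show ?thesis by (simp only: card.empty if_False simp_thms)
   qed
  qed
  have total: "card (isos S B W S' B' W') = (if ptype B W = ptype B' W' then zmset (ptype B W) else 0)"
  proof (cases "S = {}")
   case True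
   then have e: "B = {}" "W = {}" using B W by auto
   show ?thesis
   proof (cases "S' = {}")
    case True
    then have "B' = {}" "W' = {}" using B' W' by auto
    moreover have "isos {} {} {} ({} :: 'b set) {} {} = {\<lambda>_ :: 'a. undefined}" by (auto simp: isos_def bij_betw_def)
    ultimately show ?thesis using \<open>S = {}\<close> True e by (simp add: ptype_def zmset_def polygons_def)
   next
    case False
    have "isos S B W S' B' W' = {}" using \<open>S = {}\<close> False by (auto simp: isos_def bij_betw_def)
    moreover have "ptype B W \<noteq> ptype B' W'"
     using sum_ptype[OF less.prems(1-3)] sum_ptype[OF less.prems(4-6)] False \<open>S = {}\<close> less.prems(4)
     by (metis card.empty card_0_eq)
    ultimately show ?thesis by simp
   qed
  next
   case False
   then obtain a where a: "a \<in> S" by auto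
   define k where "k = card (conn B W `` {a}) div 2"
   have k: "card (conn B W `` {a}) = 2 * k" using even_polygon[OF less.prems(1) B W a] by (simp add: k_def)
   have La: "conn B W `` {a} \<in> polygons B W" using a by (auto simp: polygons_eq[OF B W])
   have kin: "k \<in># ptype B W" using La finite_polygons[OF less.prems(1) B W] by (auto simp: ptype_def k_def)
   have "isos S B W S' B' W' = (\<Union>a'\<in>S'. {g \<in> isos S B W S' B' W'. g a = a'})"
    using a by (auto simp: isos_def)
   then have "card (isos S B W S' B' W') = (\<Sum>a'\<in>S'. card {g \<in> isos S B W S' B' W'. g a = a'})"
    using less.prems(1,4) fin[of S S' B W B' W'] by (subst card_UN_disjoint[symmetric]) auto
   also have "\<dots> = (\<Sum>a'\<in>S'. if ptype B W = ptype B' W' \<and> card (conn B' W' `` {a'}) = 2 * k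
     then zmset (ptype B W - {#k#}) else 0)" using pointed[OF a] k by (auto intro!: sum.cong)
   also have "\<dots> = (if ptype B W = ptype B' W' then card {a' \<in> S'. card (conn B' W' `` {a'}) = 2 * k} * zmset (ptype B W - {#k#}) else 0)"
    using less.prems(4) by (simp add: sum.If_cases Int_def)
   also have "\<dots> = (if ptype B W = ptype B' W' then zmset (ptype B W) else 0)"
   proof (cases "ptype B W = ptype B' W'")
    case True
    have fp: "finite (polygons B' W')" using finite_polygons[OF less.prems(4) B' W'] .
    have evL: "even (card L)" if "L \<in> polygons B' W'" for L
     using that even_polygon[OF less.prems(4) B' W'] by (auto simp: polygons_eq[OF B' W'])
    \<comment> \<open>The possible images of \<open>a\<close> fill the polygons of length
      \<open>2 * k\<close>; their number is the factor by which \<open>zmset_add\<close> changes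
      \<open>zmset\<close>.\<close>
    have "{a' \<in> S'. card (conn B' W' `` {a'}) = 2 * k} = \<Union>{L \<in> polygons B' W'. card L = 2 * k}"
    proof (intro equalityI subsetI)
     fix s assume "s \<in> \<Union>{L \<in> polygons B' W'. card L = 2 * k}"
     then obtain L where L: "L \<in> polygons B' W'" "card L = 2 * k" "s \<in> L" by auto
     then show "s \<in> {a' \<in> S'. card (conn B' W' `` {a'}) = 2 * k}" using polygonD[OF B' W' L(1,3)] by auto
    next
     fix s assume "s \<in> {a' \<in> S'. card (conn B' W' `` {a'}) = 2 * k}"
     then have "conn B' W' `` {s} \<in> {L \<in> polygons B' W'. card L = 2 * k}" "s \<in> conn B' W' `` {s}"
      by (auto simp: polygons_eq[OF B' W'])
     then show "s \<in> \<Union>{L \<in> polygons B' W'. card L = 2 * k}" by blast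
    qed
    also have "card \<dots> = card {L \<in> polygons B' W'. card L = 2 * k} * (2 * k)"
     using fp partition_on_polygons[OF B' W'] less.prems(4) by (subst card_Union_disjoint)
       (auto simp: partition_on_def disjoint_def pairwise_def disjnt_def intro: finite_subset)
    also have "card {L \<in> polygons B' W'. card L = 2 * k} = count (ptype B' W') k"
    proof -
     have "{L \<in> polygons B' W'. card L = 2 * k} = {L \<in> polygons B' W'. k = card L div 2}" using evL by force
     then show ?thesis using fp by (simp add: ptype_def count_image_mset' sum.If_cases Int_def)
    qed
    finally have "card {a' \<in> S'. card (conn B' W' `` {a'}) = 2 * k} = 2 * k * count (ptype B W) k" using True by simp
    moreover obtain M where "ptype B W = add_mset k M" using kin by (metis mset_add)
    ultimately show ?thesis using True by (simp add: zmset_add)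
   qed simp
   finally show ?thesis .
  qed
  from total pointed show ?case by blast
 qed
 then show "card (isos S B W S' B' W') = (if ptype B W = ptype B' W' then zmset (ptype B W) else 0)"
  and "\<And>a a'. a \<in> S \<Longrightarrow> a' \<in> S' \<Longrightarrow> card {g \<in> isos S B W S' B' W'. g a = a'} =
   (if ptype B W = ptype B' W' \<and> card (conn B W `` {a}) = card (conn B' W' `` {a'})
    then zmset (ptype B W - {#card (conn B W `` {a}) div 2#}) else 0)" by blast+
qed

lemmas card_isos = card_isos_aux(1)

lemma mset_pairs_type [simp]: "mset (pairs_type P Q) = ptype P Q" by (simp add: pairs_type_def ptype_def)

lemma zmset_part_z: "zmset (mset r) = part_z r * 2 ^ length r"
 by (simp add: zmset_def part_z_def prod_mset_prod_list count_mset)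

section \<open>Power sums and the uniqueness of Jack functions\<close>

abbreviation "lookup \<equiv> Poly_Mapping.lookup"
abbreviation "keys \<equiv> Poly_Mapping.keys"
abbreviation "single \<equiv> Poly_Mapping.single"

lemma finite_bounded_poly_mapping:
 fixes b :: "nat \<Rightarrow>\<^sub>0 nat"
 shows "finite {c. \<forall>i. lookup c i \<le> lookup b i}" (is "finite ?C")
proof (rule finite_imageD)
 show "inj_on lookup ?C" by (auto simp: inj_on_def intro: poly_mapping_eqI)
 have "lookup ` ?C \<subseteq>
   (\<lambda>f i. if i \<in> keys b then f i else 0) ` (PiE (keys b) (\<lambda>i. {..lookup b i}))"
 proof
  fix f assume "f \<in> lookup ` ?C"
  then have f: "f i \<le> lookup b i" for i by auto
  have "f = (\<lambda>i. if i \<in> keys b then restrict f (keys b) i else 0)"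
   using f by (auto simp: fun_eq_iff in_keys_iff) (metis le_zero_eq)
  moreover have "restrict f (keys b) \<in> PiE (keys b) (\<lambda>i. {..lookup b i})" using f by auto
  ultimately show "f \<in> (\<lambda>f i. if i \<in> keys b then f i else 0) ` (PiE (keys b) (\<lambda>i. {..lookup b i}))"
   by blast
 qed
 then show "finite (lookup ` ?C)" by (rule finite_subset) (auto intro!: finite_PiE)
qed

lemma finite_poly_mapping_splits: "finite {(c, d). c + d = (b :: nat \<Rightarrow>\<^sub>0 nat)}"
proof (rule finite_subset)
 let ?C = "{c. \<forall>i. lookup c i \<le> lookup b i}"
 show "{(c, d). c + d = b} \<subseteq> ?C \<times> ?C" by (auto simp: lookup_add)
 show "finite (?C \<times> ?C)" using finite_bounded_poly_mapping by blast
qed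

lemma single_add_minus:
 fixes b :: "nat \<Rightarrow>\<^sub>0 nat"
 assumes "k \<le> lookup b i"
 shows "single i k + (b - single i k) = b"
 using assms by (intro poly_mapping_eqI) (auto simp: lookup_add lookup_minus lookup_single when_def)

lemma series_times_power_sum:
 assumes "k > 0"
 shows "series_times (power_sum k) g b =
  (\<Sum>i | k \<le> lookup b i. g (b - single i k))"
proof -
 let ?I = "{i. k \<le> lookup b i}"
 let ?h = "\<lambda>i. (single i k, b - single i k)"
 have sub: "?h ` ?I \<subseteq> {(c, d). c + d = b}" using single_add_minus by auto
 have "i = j" if "single i k = single j k" for i j
  using arg_cong[OF that, of "\<lambda>c. lookup c i"] assms by (auto simp: lookup_single when_def split: if_splits)
 then have inj: "inj_on ?h ?I" by (auto simp: inj_on_def)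
 have "series_times (power_sum k) g b = (\<Sum>(c, d)\<in>?h ` ?I. power_sum k c * g d)" unfolding series_times_def
 proof (rule sum.mono_neutral_right[OF finite_poly_mapping_splits sub], intro ballI)
  fix cd assume *: "cd \<in> {(c, d). c + d = b} - ?h ` ?I"
  obtain c d where cd: "cd = (c, d)" by force
  have "c \<noteq> single i k" for i
  proof
   assume c: "c = single i k"
   have b: "b = single i k + d" using * cd c by auto
   then have "k \<le> lookup b i" "d = b - single i k" by (auto simp: lookup_add)
   with * cd c show False by auto
  qed
  then show "(case cd of (c, d) \<Rightarrow> power_sum k c * g d) = 0" by (simp add: cd power_sum_def)
 qed
 also have "\<dots> = (\<Sum>i\<in>?I. power_sum k (single i k) * g (b - single i k))"
  using inj by (simp add: sum.reindex)
 also have "\<dots> = (\<Sum>i\<in>?I. g (b - single i k))"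
 proof (rule sum.cong[OF refl])
  fix i
  have "power_sum k (single i k) = 1" unfolding power_sum_def by (rule if_P) blast
  then show "power_sum k (single i k) * g (b - single i k) = g (b - single i k)" by simp
 qed
 finally show ?thesis .
qed

text \<open>Choices of a variable for every part: expanding a product of power sums yields one such
  choice for each contribution to the monomial \<open>b\<close>. The parts are indexed by an
  arbitrary set so that polygons can serve as indices.\<close>

definition weighted_colorings :: "'l set \<Rightarrow> ('l \<Rightarrow> nat) \<Rightarrow> (nat \<Rightarrow>\<^sub>0 nat) \<Rightarrow> ('l \<Rightarrow> nat) set" where
 "weighted_colorings I k b = {c \<in> I \<rightarrow>\<^sub>E UNIV. \<forall>i. (\<Sum>L | L \<in> I \<and> c L = i. k L) = lookup b i}"

lemma weighted_coloring_le:
 assumes "finite I" "c \<in> weighted_colorings I k b" "L \<in> I"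
 shows "k L \<le> lookup b (c L)"
proof -
 have "k L \<le> (\<Sum>M | M \<in> I \<and> c M = c L. k M)" using assms by (intro member_le_sum) auto
 then show ?thesis using assms(2) by (simp add: weighted_colorings_def)
qed

lemma finite_weighted_colorings:
 assumes "finite I" "\<And>L. L \<in> I \<Longrightarrow> k L > 0"
 shows "finite (weighted_colorings I k b)"
proof (rule finite_subset[of _ "I \<rightarrow>\<^sub>E keys b"])
 show "weighted_colorings I k b \<subseteq> I \<rightarrow>\<^sub>E keys b"
 proof
  fix c assume c: "c \<in> weighted_colorings I k b"
  have "c L \<in> keys b" if "L \<in> I" for L
   using weighted_coloring_le[OF assms(1) c that] assms(2)[OF that] by (auto simp: in_keys_iff)
  then show "c \<in> I \<rightarrow>\<^sub>E keys b" using c by (auto simp: weighted_colorings_def)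
 qed
qed (use assms(1) in \<open>auto intro: finite_PiE\<close>)

lemma card_weighted_colorings_insert:
 assumes "finite I" "\<And>M. M \<in> I \<Longrightarrow> k M > 0" "L \<notin> I" "k L > 0"
 shows "card (weighted_colorings (insert L I) k b) =
  (\<Sum>i | k L \<le> lookup b i. card (weighted_colorings I k (b - single i (k L))))"
proof -
 let ?X = "{i. k L \<le> lookup b i}"
 have finX: "finite ?X" by (rule finite_subset[of _ "keys b"]) (use assms(4) in \<open>auto simp: in_keys_iff\<close>)
 have split: "(\<Sum>M | M \<in> insert L I \<and> c M = i. k M) = (if c L = i then k L else 0) + (\<Sum>M | M \<in> I \<and> c M = i. k M)" for c i
 proof -
  have "{M. M \<in> insert L I \<and> c M = i} = (if c L = i then insert L {M. M \<in> I \<and> c M = i} else {M. M \<in> I \<and> c M = i})"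
   by auto
  then show ?thesis using assms(1,3) by auto
 qed
 have "(\<Sum>i\<in>?X. card (weighted_colorings I k (b - single i (k L)))) =
   card (SIGMA i:?X. weighted_colorings I k (b - single i (k L)))"
  using finX finite_weighted_colorings[OF assms(1,2)] by (subst card_SigmaI) auto
 also have "\<dots> = card (weighted_colorings (insert L I) k b)"
 proof (rule bij_betw_same_card[where f = "\<lambda>(i, c). c(L := i)"], rule bij_betw_byWitness[where f' = "\<lambda>c. (c L, restrict c I)"])
  show "\<forall>x\<in>SIGMA i:?X. weighted_colorings I k (b - single i (k L)).
    (((case x of (i, c) \<Rightarrow> c(L := i)) L), restrict (case x of (i, c) \<Rightarrow> c(L := i)) I) = x"
   using assms(3) by (auto simp: weighted_colorings_def PiE_def extensional_def fun_eq_iff restrict_def)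
  show "\<forall>c\<in>weighted_colorings (insert L I) k b. (case (c L, restrict c I) of (i, c) \<Rightarrow> c(L := i)) = c"
   by (auto simp: weighted_colorings_def PiE_def extensional_def fun_eq_iff restrict_def)
  show "(\<lambda>(i, c). c(L := i)) ` (SIGMA i:?X. weighted_colorings I k (b - single i (k L)))
    \<subseteq> weighted_colorings (insert L I) k b"
  proof (safe)
   fix i c assume i: "k L \<le> lookup b i" and c: "c \<in> weighted_colorings I k (b - single i (k L))"
   have "(\<Sum>M | M \<in> insert L I \<and> (c(L := i)) M = j. k M) = lookup b j" for j
   proof -
    have "(\<Sum>M | M \<in> I \<and> (c(L := i)) M = j. k M) = (\<Sum>M | M \<in> I \<and> c M = j. k M)"
     using assms(3) by (intro sum.cong) auto
    moreover have "(\<Sum>M | M \<in> I \<and> c M = j. k M) = lookup (b - single i (k L)) j"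
     using c by (simp add: weighted_colorings_def)
    ultimately show ?thesis unfolding split using i by (auto simp: lookup_minus lookup_single when_def)
   qed
   moreover have "c(L := i) \<in> insert L I \<rightarrow>\<^sub>E UNIV"
    using c by (auto simp: weighted_colorings_def PiE_def extensional_def)
   ultimately show "c(L := i) \<in> weighted_colorings (insert L I) k b" by (simp only: weighted_colorings_def mem_Collect_eq simp_thms)
  qed
  show "(\<lambda>c. (c L, restrict c I)) ` weighted_colorings (insert L I) k b
    \<subseteq> (SIGMA i:?X. weighted_colorings I k (b - single i (k L)))"
  proof (rule image_subsetI)
   fix c assume c: "c \<in> weighted_colorings (insert L I) k b"
   have le: "k L \<le> lookup b (c L)" using weighted_coloring_le[OF _ c] assms(1) by auto
   have "(\<Sum>M | M \<in> I \<and> restrict c I M = j. k M) = lookup (b - single (c L) (k L)) j" for j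
   proof -
    have "(\<Sum>M | M \<in> I \<and> restrict c I M = j. k M) = (\<Sum>M | M \<in> I \<and> c M = j. k M)"
     by (intro sum.cong) auto
    moreover have "(if c L = j then k L else 0) + (\<Sum>M | M \<in> I \<and> c M = j. k M) = lookup b j"
     using c unfolding split[symmetric] by (simp add: weighted_colorings_def)
    ultimately show ?thesis by (auto simp: lookup_minus lookup_single when_def split: if_splits)
   qed
   then show "(c L, restrict c I) \<in> (SIGMA i:?X. weighted_colorings I k (b - single i (k L)))"
    using le by (auto simp: weighted_colorings_def)
  qed
 qed
 finally show ?thesis by simp
qed

lemma power_sums_eq_card:
 assumes "finite I" "\<And>L. L \<in> I \<Longrightarrow> k L > 0" "mset r = image_mset k (mset_set I)"
 shows "power_sums r b = real (card (weighted_colorings I k b))" using assms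
proof (induction r arbitrary: I b)
 case Nil
 then have "I = {}" by (simp add: mset_set_empty_iff)
 then have "weighted_colorings I k b = (if b = 0 then {\<lambda>_. undefined} else {})"
  by (auto simp: weighted_colorings_def poly_mapping_eq_iff fun_eq_iff)
 then show ?case by (simp add: power_sums_def series_one_def)
next
 case (Cons a r)
 have "a \<in># image_mset k (mset_set I)" using Cons.prems(3) by (metis list.set_intros(1) set_mset_mset)
 then obtain L where L: "L \<in> I" "k L = a" using Cons.prems(1) by auto
 have "mset_set I = add_mset L (mset_set (I - {L}))" using mset_set.remove[OF Cons.prems(1) L(1)] .
 then have m: "mset r = image_mset k (mset_set (I - {L}))" using Cons.prems(3) L by simp
 have I: "insert L (I - {L}) = I" using L by auto
 have a: "a > 0" using L Cons.prems(2) by auto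
 have "power_sums (a # r) b = (\<Sum>i | a \<le> lookup b i. power_sums r (b - single i a))"
  using series_times_power_sum[OF a] by (simp add: power_sums_def)
 also have "\<dots> = (\<Sum>i | a \<le> lookup b i. real (card (weighted_colorings (I - {L}) k (b - single i a))))"
  using Cons.prems m by (intro sum.cong refl Cons.IH) auto
 also have "\<dots> = real (card (weighted_colorings I k b))"
  using card_weighted_colorings_insert[of "I - {L}" k L b] Cons.prems a L unfolding I by simp
 finally show ?case .
qed

definition pair_colorings :: "'a set \<Rightarrow> 'a set set \<Rightarrow> 'a set set \<Rightarrow> (nat \<Rightarrow>\<^sub>0 nat) \<Rightarrow> ('a \<Rightarrow> nat) set" where
 "pair_colorings S B W b = {h \<in> S \<rightarrow>\<^sub>E UNIV. const_on B h \<and> const_on W h \<and>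
   (\<forall>i. card {s \<in> S. h s = i} = 2 * lookup b i)}"

lemma polygon_pos:
 assumes "finite S" "B \<in> pairings S" "W \<in> pairings S" "L \<in> polygons B W"
 shows "card L = 2 * (card L div 2)" "card L div 2 > 0"
proof -
 obtain s where s: "s \<in> S" "L = conn B W `` {s}" using assms(4) by (auto simp: polygons_eq[OF assms(2,3)])
 show e: "card L = 2 * (card L div 2)" using even_polygon[OF assms(1-3) s(1)] s by simp
 have "finite L" using s conn_in[OF assms(2,3)] assms(1) by (meson Image_singleton_iff finite_subset subsetI)
 moreover have "s \<in> L" using s by auto
 ultimately have "card L > 0" by (auto simp: card_gt_0_iff)
 then show "card L div 2 > 0" using e by presburger
qed

text \<open>A colouring of the ground set that is constant on both pairings is a colouring of the
  polygons. A part \<open>k\<close> is a polygon with \<open>2 * k\<close> elements, hence the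
  factor 2 in \<open>pair_colorings\<close>. In this form power sums can be summed over pairings,
  since the colouring makes separate conditions on \<open>B\<close> and on \<open>W\<close>.\<close>

lemma power_sums_pairs_type:
 assumes "finite S" "B \<in> pairings S" "W \<in> pairings S"
 shows "power_sums (pairs_type B W) b = real (card (pair_colorings S B W b))"
proof -
 let ?k = "\<lambda>L :: 'a set. card L div 2"
 have fp: "finite (polygons B W)" using finite_polygons[OF assms] .
 have "power_sums (pairs_type B W) b = real (card (weighted_colorings (polygons B W) ?k b))"
  using fp polygon_pos[OF assms] by (intro power_sums_eq_card) (auto simp: ptype_def)
 also have "card (weighted_colorings (polygons B W) ?k b) = card (pair_colorings S B W b)"
 proof (rule bij_betw_same_card[where f = "\<lambda>c. \<lambda>s\<in>S. c (conn B W `` {s})"],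
   rule bij_betw_byWitness[where f' = "\<lambda>h. \<lambda>L\<in>polygons B W. h (SOME s. s \<in> L)"])
  have pin: "conn B W `` {s} \<in> polygons B W" if "s \<in> S" for s using that by (auto simp: polygons_eq[OF assms(2,3)])
  have some: "(SOME s. s \<in> L) \<in> L" "(SOME s. s \<in> L) \<in> S" "conn B W `` {SOME s. s \<in> L} = L" if "L \<in> polygons B W" for L
  proof -
   have "L \<noteq> {}" using partition_on_polygons[OF assms(2,3)] that by (auto simp: partition_on_def)
   then show "(SOME s. s \<in> L) \<in> L" by (simp add: some_in_eq)
   then show "(SOME s. s \<in> L) \<in> S" "conn B W `` {SOME s. s \<in> L} = L"
    using polygonD[OF assms(2,3) that] by auto
  qed
  have fiber: "card {s \<in> S. c (conn B W `` {s}) = i} = 2 * (\<Sum>L | L \<in> polygons B W \<and> c L = i. ?k L)" for c :: "'a set \<Rightarrow> nat" and i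
  proof -
   have "{s \<in> S. c (conn B W `` {s}) = i} = \<Union>{L. L \<in> polygons B W \<and> c L = i}"
   proof (intro equalityI subsetI)
    fix s assume "s \<in> \<Union>{L. L \<in> polygons B W \<and> c L = i}"
    then obtain L where L: "L \<in> polygons B W" "c L = i" "s \<in> L" by auto
    then show "s \<in> {s \<in> S. c (conn B W `` {s}) = i}" using polygonD[OF assms(2,3) L(1,3)] by auto
   next
    fix s assume "s \<in> {s \<in> S. c (conn B W `` {s}) = i}"
    then show "s \<in> \<Union>{L. L \<in> polygons B W \<and> c L = i}"
     using pin[of s] by (auto intro!: exI[of _ "conn B W `` {s}"])
   qed
   also have "card \<dots> = (\<Sum>L | L \<in> polygons B W \<and> c L = i. card L)"
    using partition_on_polygons[OF assms(2,3)] assms(1)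
    by (intro card_Union_disjoint) (auto simp: partition_on_def disjoint_def pairwise_def disjnt_def intro: finite_subset)
   also have "\<dots> = 2 * (\<Sum>L | L \<in> polygons B W \<and> c L = i. ?k L)"
    unfolding sum_distrib_left using polygon_pos(1)[OF assms] by (intro sum.cong) auto
   finally show ?thesis .
  qed
  show "\<forall>c\<in>weighted_colorings (polygons B W) ?k b.
    (\<lambda>L\<in>polygons B W. (\<lambda>s\<in>S. c (conn B W `` {s})) (SOME s. s \<in> L)) = c"
  proof
   fix c assume c: "c \<in> weighted_colorings (polygons B W) ?k b"
   show "(\<lambda>L\<in>polygons B W. (\<lambda>s\<in>S. c (conn B W `` {s})) (SOME s. s \<in> L)) = c"
    using c some by (intro ext) (auto simp: weighted_colorings_def PiE_def extensional_def restrict_def)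
  qed
  have hc: "h (SOME t. t \<in> conn B W `` {s}) = h s" if "h \<in> pair_colorings S B W b" "s \<in> S" for h s
  proof -
   have "(s, SOME t. t \<in> conn B W `` {s}) \<in> conn B W" using some(1)[OF pin[OF that(2)]] by simp
   from conn_const[OF assms(2,3) this, of h] that(1) show ?thesis by (simp add: pair_colorings_def)
  qed
  then show "\<forall>h\<in>pair_colorings S B W b. (\<lambda>s\<in>S. (\<lambda>L\<in>polygons B W. h (SOME s. s \<in> L)) (conn B W `` {s})) = h"
   using pin by (auto simp: fun_eq_iff restrict_def pair_colorings_def PiE_def extensional_def)
  show "(\<lambda>c. \<lambda>s\<in>S. c (conn B W `` {s})) ` weighted_colorings (polygons B W) ?k b \<subseteq> pair_colorings S B W b"
  proof (rule image_subsetI)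
   fix c assume c: "c \<in> weighted_colorings (polygons B W) ?k b"
   let ?h = "\<lambda>s\<in>S. c (conn B W `` {s})"
   have "const_on B ?h" "const_on W ?h"
    using mate_in[OF assms(2)] mate_in[OF assms(3)] polygons_class_eq[OF conn_mate(1)[OF assms(2,3)]]
     polygons_class_eq[OF conn_mate(2)[OF assms(2,3)]]
    by (auto simp: const_on_mate[OF assms(2)] const_on_mate[OF assms(3)])
   moreover have "card {s \<in> S. ?h s = i} = 2 * lookup b i" for i
   proof -
    have "{s \<in> S. ?h s = i} = {s \<in> S. c (conn B W `` {s}) = i}" by auto
    then show ?thesis using fiber[of c i] c by (simp add: weighted_colorings_def)
   qed
   ultimately show "?h \<in> pair_colorings S B W b" by (auto simp: pair_colorings_def)
  qed
  show "(\<lambda>h. \<lambda>L\<in>polygons B W. h (SOME s. s \<in> L)) ` pair_colorings S B W b \<subseteq> weighted_colorings (polygons B W) ?k b"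
  proof (rule image_subsetI)
   fix h assume h: "h \<in> pair_colorings S B W b"
   let ?c = "\<lambda>L\<in>polygons B W. h (SOME s. s \<in> L)"
   have "(\<Sum>L | L \<in> polygons B W \<and> ?c L = i. ?k L) = lookup b i" for i
   proof -
    have "{s \<in> S. ?c (conn B W `` {s}) = i} = {s \<in> S. h s = i}" using hc[OF h] pin by auto
    then show ?thesis using fiber[of ?c i] h by (simp add: pair_colorings_def)
   qed
   then show "?c \<in> weighted_colorings (polygons B W) ?k b" by (auto simp: weighted_colorings_def)
  qed
 qed
 finally show ?thesis .
qed

lemma finite_maximizer:
 fixes f :: "'x \<Rightarrow> nat"
 assumes "finite X" "X \<noteq> {}"
 obtains s where "s \<in> X" "\<And>t. t \<in> X \<Longrightarrow> f t \<le> f s"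
proof -
 have "Max (f ` X) \<in> f ` X" using assms by (intro Max_in) auto
 then obtain s where "s \<in> X" "f s = Max (f ` X)" by auto
 with assms that show thesis by auto
qed

lemma nth_pos: "0 \<notin> set r \<Longrightarrow> L \<in> {..<length r} \<Longrightarrow> 0 < (r ! L :: nat)"
 using nth_mem[of L r] by (cases "r ! L = 0") auto

section \<open>Partitions, monomials and the independence of power sums\<close>

definition shape :: "(nat \<Rightarrow>\<^sub>0 nat) \<Rightarrow> nat multiset" where
 "shape b = image_mset (lookup b) (mset_set (keys b))"

definition partitions_of :: "nat \<Rightarrow> nat list set" where
 "partitions_of n = {r. is_partition r \<and> sum_list r = n}"

definition expo :: "nat list \<Rightarrow> (nat \<Rightarrow>\<^sub>0 nat)" where
 "expo r = (\<Sum>i<length r. single i (r ! i))"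

lemma lookup_expo: "lookup (expo r) i = (if i < length r then r ! i else 0)"
proof -
 have "lookup (expo r) i = (\<Sum>j<length r. if j = i then r ! j else 0)"
  unfolding expo_def lookup_sum by (intro sum.cong) (auto simp: lookup_single when_def)
 then show ?thesis by simp
qed

lemma keys_expo: "0 \<notin> set r \<Longrightarrow> keys (expo r) = {..<length r}"
 using nth_pos[of r] by (auto simp: in_keys_iff lookup_expo split: if_splits)

lemma shape_expo: "0 \<notin> set r \<Longrightarrow> shape (expo r) = mset r"
proof -
 assume r: "0 \<notin> set r"
 have "shape (expo r) = image_mset ((!) r) (mset_set {..<length r})"
  unfolding shape_def keys_expo[OF r] by (intro image_mset_cong) (auto simp: lookup_expo)
 also have "\<dots> = mset (map ((!) r) [0..<length r])" by (simp add: atLeast0LessThan[symmetric] flip: mset_upt)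
 finally show ?thesis by (simp add: map_nth)
qed

lemma partition_eqI:
 assumes "is_partition r" "is_partition s" "mset r = mset s" shows "r = s"
proof -
 have "sorted (rev r)" "sorted (rev s)" using assms(1,2) by (auto simp: is_partition_def sorted_wrt_rev)
 then have "rev r = rev s" using assms(3) by (metis mset_rev properties_for_sort)
 then show ?thesis by simp
qed

lemma length_partition_le: "0 \<notin> set r \<Longrightarrow> length r \<le> sum_list r"
 by (induction r) (auto simp: Suc_le_eq)

lemma finite_partitions_of: "finite (partitions_of n)"
proof (rule finite_subset)
 show "partitions_of n \<subseteq> {r. set r \<subseteq> {..n} \<and> length r \<le> n}"
  using length_partition_le member_le_sum_list by (fastforce simp: partitions_of_def is_partition_def)
 show "finite {r. set r \<subseteq> {..n} \<and> length r \<le> n}" by (rule finite_lists_length_le) simp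
qed

lemma power_sums_eq_card_list:
 assumes "0 \<notin> set r"
 shows "power_sums r b = real (card (weighted_colorings {..<length r} ((!) r) b))"
proof (rule power_sums_eq_card)
 have "mset r = mset (map ((!) r) [0..<length r])" by (simp add: map_nth)
 also have "\<dots> = image_mset ((!) r) (mset_set {..<length r})"
  by (simp add: atLeast0LessThan[symmetric] flip: mset_upt)
 finally show "mset r = image_mset ((!) r) (mset_set {..<length r})" .
qed (use nth_pos[OF assms] in auto)

text \<open>Padding with zeros to the union of both supports turns equality of multisets into a
  permutation of the variables.\<close>

lemma shape_eq_permute:
 assumes "shape b = shape b'"
 obtains p where "bij p" "\<And>i. lookup b i = lookup b' (p i)"
proof -
 let ?A = "keys b \<union> keys b'"
 have ext: "image_mset (lookup c) (mset_set ?A) =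
   shape c + replicate_mset (card ?A - card (keys c)) 0" if "keys c \<subseteq> ?A" for c
 proof -
  have A: "?A = keys c \<union> (?A - keys c)" using that by auto
  have "mset_set ?A = mset_set (keys c) + mset_set (?A - keys c)" by (subst A, subst mset_set_Union) auto
  moreover have "image_mset (lookup c) (mset_set (?A - keys c)) =
    image_mset (\<lambda>_. 0) (mset_set (?A - keys c))" by (intro image_mset_cong) (auto simp: in_keys_iff)
  moreover have "card (?A - keys c) = card ?A - card (keys c)" using that by (intro card_Diff_subset) auto
  ultimately show ?thesis by (simp add: shape_def image_mset_const_eq)
 qed
 have "card (keys b) = card (keys b')" using arg_cong[OF assms, of size] by (simp add: shape_def)
 then have "image_mset (lookup b) (mset_set ?A) = image_mset (lookup b') (mset_set ?A)"
  using ext[of b] ext[of b'] assms by simp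
 then obtain p where p: "p permutes ?A" "\<forall>x\<in>?A. lookup b x = lookup b' (p x)"
  using image_mset_eq_implies_permutes[of ?A "lookup b" "lookup b'"] by auto
 have "lookup b i = lookup b' (p i)" for i
 proof (cases "i \<in> ?A")
  case False
  then have "p i = i" using p(1) by (simp add: permutes_not_in)
  then show ?thesis using False by (simp add: in_keys_iff)
 qed (use p in auto)
 then show thesis using that permutes_bij[OF p(1)] by blast
qed

lemma power_sums_cong_shape:
 assumes "0 \<notin> set r" "shape b = shape b'"
 shows "power_sums r b = power_sums r b'"
proof -
 obtain p where p: "bij p" "\<And>i. lookup b i = lookup b' (p i)" using shape_eq_permute[OF assms(2)] by blast
 let ?I = "{..<length r}"
 have inv: "p (inv p i) = i" "inv p (p i) = i" for i using p(1) by (auto simp: bij_def surj_f_inv_f inv_f_f)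
 have "card (weighted_colorings ?I ((!) r) b) = card (weighted_colorings ?I ((!) r) b')"
 proof (rule bij_betw_same_card[where f = "\<lambda>c. \<lambda>L\<in>?I. p (c L)"],
   rule bij_betw_byWitness[where f' = "\<lambda>c. \<lambda>L\<in>?I. inv p (c L)"])
  show "\<forall>c\<in>weighted_colorings ?I ((!) r) b. (\<lambda>L\<in>?I. inv p ((\<lambda>L\<in>?I. p (c L)) L)) = c"
   using inv by (auto simp: weighted_colorings_def fun_eq_iff restrict_def PiE_def extensional_def)
  show "\<forall>c\<in>weighted_colorings ?I ((!) r) b'. (\<lambda>L\<in>?I. p ((\<lambda>L\<in>?I. inv p (c L)) L)) = c"
   using inv by (auto simp: weighted_colorings_def fun_eq_iff restrict_def PiE_def extensional_def)
  have 1: "{L. L \<in> ?I \<and> (\<lambda>L\<in>?I. p (c L)) L = i} = {L. L \<in> ?I \<and> c L = inv p i}" for c i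
   using inv by auto
  have 2: "{L. L \<in> ?I \<and> (\<lambda>L\<in>?I. inv p (c L)) L = i} = {L. L \<in> ?I \<and> c L = p i}" for c i
   using inv by auto
  show "(\<lambda>c. \<lambda>L\<in>?I. p (c L)) ` weighted_colorings ?I ((!) r) b \<subseteq> weighted_colorings ?I ((!) r) b'"
   unfolding weighted_colorings_def image_subset_iff mem_Collect_eq 1 by (auto simp: p(2) inv)
  show "(\<lambda>c. \<lambda>L\<in>?I. inv p (c L)) ` weighted_colorings ?I ((!) r) b' \<subseteq> weighted_colorings ?I ((!) r) b"
   unfolding weighted_colorings_def image_subset_iff mem_Collect_eq 2 by (auto simp: p(2) inv)
 qed
 then show ?thesis using power_sums_eq_card_list[OF assms(1)] by simp
qed

lemma power_sums_degree:
 assumes "0 \<notin> set r" "power_sums r b \<noteq> 0"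
 shows "sum_mset (shape b) = sum_list r"
proof -
 let ?I = "{..<length r}"
 have "weighted_colorings ?I ((!) r) b \<noteq> {}" using assms power_sums_eq_card_list[OF assms(1), of b] by auto
 then obtain c where c: "c \<in> weighted_colorings ?I ((!) r) b" by auto
 have "c ` ?I \<subseteq> keys b"
 proof
  fix i assume "i \<in> c ` ?I"
  then obtain L where L: "L \<in> ?I" "i = c L" by auto
  then have "r ! L \<noteq> 0" using assms(1) by (metis lessThan_iff nth_mem)
  then show "i \<in> keys b" using weighted_coloring_le[OF _ c L(1)] L by (auto simp: in_keys_iff)
 qed
 then have "(\<Sum>L\<in>?I. r ! L) = (\<Sum>i\<in>keys b. \<Sum>L | L \<in> ?I \<and> c L = i. r ! L)"
  by (intro sum.group[symmetric]) auto
 also have "\<dots> = (\<Sum>i\<in>keys b. lookup b i)" using c by (simp add: weighted_colorings_def)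
 finally show ?thesis by (simp add: shape_def sum_unfold_sum_mset sum_list_sum_nth atLeast0LessThan)
qed

text \<open>Every part goes to one variable, so a monomial of the power sum product has at most
  \<open>length s\<close> variables. With \<open>length s \<le> length r\<close> each variable of
  \<open>expo r\<close> receives exactly one part, and the parts agree.\<close>

lemma power_sums_expo_neq_0:
 assumes "is_partition r" "is_partition s" "power_sums s (expo r) \<noteq> 0" "length s \<le> length r"
 shows "s = r"
proof -
 let ?I = "{..<length s}"
 have r: "0 \<notin> set r" and s: "0 \<notin> set s" using assms by (auto simp: is_partition_def)
 have "weighted_colorings ?I ((!) s) (expo r) \<noteq> {}" using assms(3) power_sums_eq_card_list[OF s, of "expo r"] by auto
 then obtain c where c: "c \<in> weighted_colorings ?I ((!) s) (expo r)" by auto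
 have fib: "(\<Sum>L | L \<in> ?I \<and> c L = i. s ! L) = (if i < length r then r ! i else 0)" for i
  using c by (simp add: weighted_colorings_def lookup_expo)
 have "{..<length r} \<subseteq> c ` ?I"
 proof
  fix i assume i: "i \<in> {..<length r}"
  then have "r ! i \<noteq> 0" using r by (metis lessThan_iff nth_mem)
  then have "{L. L \<in> ?I \<and> c L = i} \<noteq> {}" using fib[of i] i by (metis lessThan_iff sum.empty)
  then show "i \<in> c ` ?I" by auto
 qed
 moreover have "card (c ` ?I) \<le> length s" using card_image_le[of ?I c] by simp
 ultimately have eq: "{..<length r} = c ` ?I" using assms(4) by (intro card_seteq) auto
 have "length r = card (c ` ?I)" using arg_cong[OF eq, of card] by simp
 then have "length s = length r" using card_image_le[of ?I c] assms(4) by simp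
 with eq have eq: "c ` ?I = {..<length r}" "length s = length r" by auto
 then have inj: "inj_on c ?I" by (intro eq_card_imp_inj_on) auto
 have "s ! L = r ! (c L)" if "L \<in> ?I" for L
 proof -
  have "{M. M \<in> ?I \<and> c M = c L} = {L}" using inj that by (auto simp: inj_on_def)
  moreover have "c L < length r" using eq that by auto
  ultimately show ?thesis using fib[of "c L"] by simp
 qed
 then have "image_mset ((!) s) (mset_set ?I) = image_mset ((!) r) (image_mset c (mset_set ?I))"
  by (auto simp: image_mset.compositionality comp_def intro!: image_mset_cong)
 also have "image_mset c (mset_set ?I) = mset_set {..<length r}" using image_mset_mset_set[OF inj] eq(1) by simp
 finally have "mset (map ((!) s) [0..<length s]) = mset (map ((!) r) [0..<length r])"
  by (simp add: atLeast0LessThan[symmetric] flip: mset_upt)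
 then show ?thesis using partition_eqI[OF assms(2,1)] by (simp add: map_nth)
qed

lemma power_sums_expo_self:
 assumes "is_partition r" shows "power_sums r (expo r) \<noteq> 0"
proof -
 let ?I = "{..<length r}"
 have r: "0 \<notin> set r" using assms by (auto simp: is_partition_def)
 have "restrict id ?I \<in> weighted_colorings ?I ((!) r) (expo r)"
 proof -
  have "{L. L \<in> ?I \<and> restrict id ?I L = i} = (if i < length r then {i} else {})" for i by auto
  then show ?thesis by (auto simp: weighted_colorings_def lookup_expo)
 qed
 moreover have "finite (weighted_colorings ?I ((!) r) (expo r))"
  using nth_pos[OF r] by (intro finite_weighted_colorings) auto
 ultimately have "card (weighted_colorings ?I ((!) r) (expo r)) \<noteq> 0" by auto
 then show ?thesis using power_sums_eq_card_list[OF r] by simp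
qed

text \<open>A power sum contains only monomials obtained by merging its parts, so a longest \<open>r\<close> with
 nonzero coefficient is the only one contributing to its own monomial.\<close>

lemma power_sums_independent:
 assumes "finite A" "\<And>r. r \<in> A \<Longrightarrow> is_partition r" "\<And>b. (\<Sum>r\<in>A. a r * power_sums r b) = 0" "r \<in> A"
 shows "a r = 0"
proof (rule ccontr)
 assume "a r \<noteq> 0"
 let ?N = "{r \<in> A. a r \<noteq> 0}"
 have "finite ?N" "?N \<noteq> {}" using assms(1,4) \<open>a r \<noteq> 0\<close> by auto
 then obtain s where s: "s \<in> ?N" "\<And>t. t \<in> ?N \<Longrightarrow> length t \<le> length s"
  using finite_maximizer[of ?N length] by blast
 have "(\<Sum>r\<in>A. a r * power_sums r (expo s)) = (\<Sum>r\<in>{s}. a r * power_sums r (expo s))"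
 proof (rule sum.mono_neutral_right)
  show "\<forall>t\<in>A - {s}. a t * power_sums t (expo s) = 0" using power_sums_expo_neq_0[of s] s assms(2) by force
 qed (use assms(1) s in auto)
 then show False using assms(2,3) s power_sums_expo_self[of s] by auto
qed

definition pexp :: "nat \<Rightarrow> (nat list \<Rightarrow> real) \<Rightarrow> series" where
 "pexp n a = (\<lambda>b. \<Sum>r\<in>partitions_of n. a r * power_sums r b)"

text \<open>Independence discharges the description operator of \<open>power_coeff\<close>: two
  expansions are compared on the union of their supports.\<close>

lemma power_coeff_pexp: "power_coeff (pexp n a) = (\<lambda>r. if r \<in> partitions_of n then a r else 0)"
 unfolding power_coeff_def
proof (rule the_equality)
 let ?a = "\<lambda>r. if r \<in> partitions_of n then a r else 0"
 have "{r. ?a r \<noteq> 0} \<subseteq> partitions_of n" by auto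
 moreover have "(\<Sum>r | ?a r \<noteq> 0. ?a r * power_sums r b) = pexp n a b" for b
  unfolding pexp_def by (intro sum.mono_neutral_cong_left finite_partitions_of) auto
 ultimately show "finite {r. ?a r \<noteq> 0} \<and> (\<forall>r. ?a r \<noteq> 0 \<longrightarrow> is_partition r) \<and>
   pexp n a = (\<lambda>b. \<Sum>r | ?a r \<noteq> 0. ?a r * power_sums r b)"
  using finite_partitions_of[of n] by (auto intro: finite_subset simp: partitions_of_def)
next
 let ?a = "\<lambda>r. if r \<in> partitions_of n then a r else 0"
 fix c assume c: "finite {r. c r \<noteq> 0} \<and> (\<forall>r. c r \<noteq> 0 \<longrightarrow> is_partition r) \<and>
   pexp n a = (\<lambda>b. \<Sum>r | c r \<noteq> 0. c r * power_sums r b)"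
 let ?A = "partitions_of n \<union> {r. c r \<noteq> 0}"
 have fin: "finite ?A" using c finite_partitions_of by auto
 have "(\<Sum>r\<in>?A. (?a r - c r) * power_sums r b) = 0" for b
 proof -
  have "(\<Sum>r\<in>?A. ?a r * power_sums r b) = pexp n a b"
   unfolding pexp_def using fin by (intro sum.mono_neutral_cong_right) auto
  moreover have "(\<Sum>r\<in>?A. c r * power_sums r b) = (\<Sum>r | c r \<noteq> 0. c r * power_sums r b)"
   using fin by (intro sum.mono_neutral_cong_right) auto
  ultimately show ?thesis using c by (simp add: left_diff_distrib sum_subtractf)
 qed
 then have "?a r - c r = 0" if "r \<in> ?A" for r
  using c that by (intro power_sums_independent[OF fin, of "\<lambda>r. ?a r - c r"]) (auto simp: partitions_of_def)
 then have "c r = ?a r" for r by (cases "r \<in> ?A") (auto split: if_splits)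
 then show "c = ?a" by blast
qed

lemma jack_form_pexp:
 "jack_form \<alpha> (pexp n a) (pexp n a') = (\<Sum>r\<in>partitions_of n. a r * a' r * (real (part_z r) * \<alpha> ^ length r))"
 unfolding jack_form_def power_coeff_pexp
 by (intro sum.mono_neutral_cong_left finite_partitions_of) (auto simp: mult.assoc)

lemma jack_form_pexp_neq: "n \<noteq> m \<Longrightarrow> jack_form \<alpha> (pexp n a) (pexp m a') = 0"
 unfolding jack_form_def power_coeff_pexp by (intro sum.neutral) (auto simp: partitions_of_def)

lemma exists_partition_shape: "\<exists>r. is_partition r \<and> mset r = shape b"
proof -
 let ?r = "rev (sorted_list_of_multiset (shape b))"
 have "mset ?r = shape b" by simp
 moreover have "0 \<notin> set ?r" unfolding set_mset_mset[symmetric] calculation by (auto simp: shape_def in_keys_iff)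
 moreover have "sorted_wrt (\<ge>) ?r" by (simp add: sorted_wrt_rev)
 ultimately show ?thesis unfolding is_partition_def by blast
qed

lemma monomial_expansion:
 assumes "\<And>b b'. shape b = shape b' \<Longrightarrow> f b = f b'" "\<And>b. f b \<noteq> 0 \<Longrightarrow> sum_mset (shape b) = n"
 shows "f b = (\<Sum>m\<in>partitions_of n. f (expo m) * monomial_sym m b)"
proof -
 obtain r where r: "is_partition r" "mset r = shape b" using exists_partition_shape by blast
 have sum: "sum_list r = sum_mset (shape b)" using r(2) by (metis sum_mset_sum_list)
 have ms: "monomial_sym m b = (if m = r then 1 else 0)" if "m \<in> partitions_of n" for m
  unfolding monomial_sym_def shape_def[symmetric] r(2)[symmetric]
  using that r(1) partition_eqI[of m r] by (auto simp: partitions_of_def)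
 have "shape (expo r) = shape b" using shape_expo[of r] r by (simp add: is_partition_def)
 then have fb: "f (expo r) = f b" by (rule assms(1))
 have "(\<Sum>m\<in>partitions_of n. f (expo m) * monomial_sym m b) = (\<Sum>m\<in>partitions_of n. if m = r then f b else 0)"
  using ms fb by (intro sum.cong) auto
 also have "\<dots> = (if r \<in> partitions_of n then f b else 0)" using finite_partitions_of by simp
 also have "\<dots> = f b" using assms(2)[of b] r(1) sum by (auto simp: partitions_of_def)
 finally show ?thesis by simp
qed

lemma pexp_monomial:
 "pexp n a b = (\<Sum>m\<in>partitions_of n. pexp n a (expo m) * monomial_sym m b)"
proof (rule monomial_expansion)
 have r0: "r \<in> partitions_of n \<Longrightarrow> 0 \<notin> set r" for r by (simp add: partitions_of_def is_partition_def)
 show "pexp n a b = pexp n a b'" if "shape b = shape b'" for b b'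
  unfolding pexp_def using power_sums_cong_shape[OF _ that] r0 by (auto intro!: sum.cong)
 show "sum_mset (shape b) = n" if nz: "pexp n a b \<noteq> 0" for b
 proof -
  obtain r where "r \<in> partitions_of n" "power_sums r b \<noteq> 0"
   using nz sum.neutral[of "partitions_of n" "\<lambda>r. a r * power_sums r b"] unfolding pexp_def by auto
  then show ?thesis using power_sums_degree[OF r0, of r b] by (simp add: partitions_of_def)
 qed
qed

lemma take_sums_eqI:
 assumes "\<And>k. sum_list (take k l) = sum_list (take k m)" "0 \<notin> set l" "0 \<notin> set (m :: nat list)"
 shows "l = m" using assms
proof (induction l arbitrary: m)
 case Nil
 then show ?case using Nil(1)[of 1] by (cases m) auto
next
 case (Cons x l)
 then obtain y m' where m: "m = y # m'" using Cons.prems(1)[of 1] by (cases m) auto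
 have "x = y" using Cons.prems(1)[of 1] m by simp
 moreover have "sum_list (take k l) = sum_list (take k m')" for k
  using Cons.prems(1)[of "Suc k"] m calculation by simp
 ultimately show ?case using Cons m by auto
qed

lemma dominates_antisym: "is_partition l \<Longrightarrow> is_partition m \<Longrightarrow> dominates l m \<Longrightarrow> dominates m l \<Longrightarrow> l = m"
 by (rule take_sums_eqI) (auto simp: dominates_def is_partition_def le_antisym)

lemma dominates_refl [simp]: "dominates l l" by (simp add: dominates_def)

lemma dominates_trans: "dominates l m \<Longrightarrow> dominates m k \<Longrightarrow> dominates l k"
 unfolding dominates_def by (metis le_trans)

section \<open>Triangularity and orthogonality determine the Jack functions\<close>

context
 fixes \<alpha> :: real and \<theta> :: "nat list \<Rightarrow> nat list \<Rightarrow> real" and c :: "nat list \<Rightarrow> real"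
 assumes alpha: "\<alpha> > 0"
  and tri: "\<And>l m. is_partition l \<Longrightarrow> m \<in> partitions_of (sum_list l) \<Longrightarrow>
   pexp (sum_list l) (\<theta> l) (expo m) \<noteq> 0 \<Longrightarrow> dominates l m"
  and lead: "\<And>l. is_partition l \<Longrightarrow> pexp (sum_list l) (\<theta> l) (expo l) = c l"
  and lead_neq: "\<And>l. is_partition l \<Longrightarrow> c l \<noteq> 0"
  and orth: "\<And>l m. is_partition l \<Longrightarrow> is_partition m \<Longrightarrow> sum_list l = sum_list m \<Longrightarrow> l \<noteq> m \<Longrightarrow>
   (\<Sum>r\<in>partitions_of (sum_list l). \<theta> l r * \<theta> m r * (real (part_z r) * \<alpha> ^ length r)) = 0"
begin

text \<open>Since \<theta> is to give the integral form \<open>J\<close>, division by the leading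
  coefficient \<open>c l\<close> gives the candidate for the monic function.\<close>

definition P0 :: "nat list \<Rightarrow> series" where
 "P0 l = pexp (sum_list l) (\<lambda>r. \<theta> l r / c l)"

lemma P0_eq: "P0 l b = pexp (sum_list l) (\<theta> l) b / c l" by (simp add: P0_def pexp_def sum_divide_distrib)

definition below :: "nat list \<Rightarrow> nat list set" where
 "below l = {m. is_partition m \<and> dominates l m \<and> m \<noteq> l}"

lemma below_sub: "below l \<subseteq> partitions_of (sum_list l)"
 by (auto simp: below_def partitions_of_def dominates_def)

lemma finite_below: "finite (below l)" using below_sub finite_partitions_of finite_subset by blast

lemma P0_triangular:
 assumes "is_partition l"
 shows "P0 l b = monomial_sym l b + (\<Sum>m\<in>below l. P0 l (expo m) * monomial_sym m b)"
proof -
 have "P0 l b = (\<Sum>m\<in>partitions_of (sum_list l). P0 l (expo m) * monomial_sym m b)"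
  unfolding P0_def by (rule pexp_monomial)
 also have "\<dots> = (\<Sum>m\<in>insert l (below l). P0 l (expo m) * monomial_sym m b)"
 proof (rule sum.mono_neutral_right[OF finite_partitions_of])
  show "insert l (below l) \<subseteq> partitions_of (sum_list l)" using below_sub assms by (auto simp: partitions_of_def)
  show "\<forall>m\<in>partitions_of (sum_list l) - insert l (below l). P0 l (expo m) * monomial_sym m b = 0"
   using tri[OF assms] by (auto simp: P0_eq below_def partitions_of_def)
 qed
 also have "\<dots> = P0 l (expo l) * monomial_sym l b + (\<Sum>m\<in>below l. P0 l (expo m) * monomial_sym m b)"
  using finite_below by (subst sum.insert) (auto simp: below_def)
 also have "P0 l (expo l) = 1" using lead[OF assms] lead_neq[OF assms] by (simp add: P0_eq)
 finally show ?thesis by simp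
qed

lemma P0_orthogonal:
 assumes "is_partition l" "is_partition m" "l \<noteq> m"
 shows "jack_form \<alpha> (P0 l) (P0 m) = 0"
proof (cases "sum_list l = sum_list m")
 case True
 have "jack_form \<alpha> (P0 l) (P0 m) =
   (\<Sum>r\<in>partitions_of (sum_list l). \<theta> l r * \<theta> m r * (real (part_z r) * \<alpha> ^ length r)) / (c l * c m)"
  unfolding P0_def True jack_form_pexp sum_divide_distrib by (intro sum.cong) auto
 then show ?thesis using orth[OF assms(1,2) True assms(3)] by simp
qed (simp add: P0_def jack_form_pexp_neq)

lemma P0_family: "jack_P_family \<alpha> P0" unfolding jack_P_family_def
proof (intro conjI allI impI)
 fix l assume l: "is_partition l"
 show "\<exists>u. P0 l = (\<lambda>b. monomial_sym l b + (\<Sum>m | is_partition m \<and> dominates l m \<and> m \<noteq> l. u m * monomial_sym m b))"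
  by (intro exI[of _ "\<lambda>m. P0 l (expo m)"] ext) (rule P0_triangular[OF l, unfolded below_def])
qed (use P0_orthogonal in blast)

text \<open>A unitriangular system, solved by eliminating a maximal index first; closure of
  \<open>X\<close> under \<open>below\<close> keeps the remainder inside \<open>X\<close>.\<close>

lemma monomials_in_span:
 assumes "finite X" "\<And>m. m \<in> X \<Longrightarrow> is_partition m" "\<And>m k. m \<in> X \<Longrightarrow> k \<in> below m \<Longrightarrow> k \<in> X"
 shows "\<exists>x. \<forall>b. (\<Sum>m\<in>X. u m * monomial_sym m b) = (\<Sum>m\<in>X. x m * P0 m b)" using assms
proof (induction "card X" arbitrary: X u)
 case 0 then show ?case by auto
next
 case (Suc n)
 then have "X \<noteq> {}" by auto
 obtain k where k: "k \<in> X" "\<And>m. m \<in> X \<Longrightarrow> k \<notin> below m"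
 proof -
  \<comment> \<open>A maximal index is found through the size of its lower set, which grows strictly
    along the dominance order.\<close>
  obtain k where k: "k \<in> X" "\<And>m. m \<in> X \<Longrightarrow> card (below m) \<le> card (below k)"
   using finite_maximizer[OF Suc.prems(1) \<open>X \<noteq> {}\<close>, of "\<lambda>m. card (below m)"] by blast
  have "k \<notin> below m" if "m \<in> X" for m
  proof
   assume km: "k \<in> below m"
   then have "below k \<subset> below m"
    using dominates_trans[of m k] dominates_antisym[of m k] Suc.prems(2)[OF that] by (auto simp: below_def)
   then have "card (below k) < card (below m)" using finite_below psubset_card_mono by blast
   then show False using k(2)[OF that] by simp
  qed
  with k(1) show thesis using that by blast
 qed
 let ?u = "\<lambda>m. u m - u k * (if m \<in> below k then P0 k (expo m) else 0)"
 have sub: "below k \<subseteq> X - {k}" using Suc.prems(3)[OF k(1)] by (auto simp: below_def)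
 have "\<exists>x. \<forall>b. (\<Sum>m\<in>X - {k}. ?u m * monomial_sym m b) = (\<Sum>m\<in>X - {k}. x m * P0 m b)"
 proof (rule Suc.hyps(1))
  show "n = card (X - {k})" using Suc.hyps(2) Suc.prems(1) k(1) by simp
 qed (use Suc.prems k in auto)
 then obtain x where x: "\<And>b. (\<Sum>m\<in>X - {k}. ?u m * monomial_sym m b) = (\<Sum>m\<in>X - {k}. x m * P0 m b)" by blast
 have "(\<Sum>m\<in>X. u m * monomial_sym m b) = (\<Sum>m\<in>X. (x(k := u k)) m * P0 m b)" for b
 proof -
  have "(\<Sum>m\<in>X - {k}. (if m \<in> below k then P0 k (expo m) else 0) * monomial_sym m b) =
    (\<Sum>m\<in>below k. P0 k (expo m) * monomial_sym m b)"
   using sub Suc.prems(1) by (intro sum.mono_neutral_cong_right) auto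
  then have s: "(\<Sum>m\<in>X - {k}. ?u m * monomial_sym m b) =
    (\<Sum>m\<in>X - {k}. u m * monomial_sym m b) - u k * (\<Sum>m\<in>below k. P0 k (expo m) * monomial_sym m b)"
   by (simp only: left_diff_distrib sum_subtractf sum_distrib_left[symmetric] mult.assoc)
  have "(\<Sum>m\<in>X. u m * monomial_sym m b) = u k * monomial_sym k b + (\<Sum>m\<in>X - {k}. u m * monomial_sym m b)"
   using Suc.prems(1) k(1) by (rule sum.remove)
  also have "\<dots> = u k * P0 k b + (\<Sum>m\<in>X - {k}. x m * P0 m b)"
   using s x[of b] P0_triangular[of k b] Suc.prems(2)[OF k(1)] by (simp add: algebra_simps)
  also have "\<dots> = (\<Sum>m\<in>X. (x(k := u k)) m * P0 m b)"
   using Suc.prems(1) k(1) by (subst (2) sum.remove) (auto intro!: sum.cong)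
  finally show ?thesis .
 qed
 then show ?case by blast
qed

text \<open>For \<alpha> > 0 the form is a sum of squares with positive weights, and the function is
  nonzero because its leading coefficient is.\<close>

lemma jack_form_P0_pos:
 assumes "is_partition m" shows "jack_form \<alpha> (P0 m) (P0 m) \<noteq> 0"
proof
 assume "jack_form \<alpha> (P0 m) (P0 m) = 0"
 then have *: "(\<Sum>r\<in>partitions_of (sum_list m). \<theta> m r / c m * (\<theta> m r / c m) * (real (part_z r) * \<alpha> ^ length r)) = 0"
  by (simp add: P0_def jack_form_pexp)
 have z: "part_z r > 0" if "r \<in> partitions_of (sum_list m)" for r
  using that by (auto simp: part_z_def partitions_of_def is_partition_def prod_list_zero_iff intro!: gr0I)
 have "\<theta> m r / c m = 0" if r: "r \<in> partitions_of (sum_list m)" for r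
 proof -
  have "\<forall>r\<in>partitions_of (sum_list m). \<theta> m r / c m * (\<theta> m r / c m) * (real (part_z r) * \<alpha> ^ length r) = 0"
   using * alpha by (subst sum_nonneg_eq_0_iff[symmetric]) (auto simp: finite_partitions_of)
  with r have "\<theta> m r / c m * (\<theta> m r / c m) * (real (part_z r) * \<alpha> ^ length r) = 0" by blast
  then show ?thesis using z[OF r] alpha by simp
 qed
 then have "P0 m (expo m) = 0" unfolding P0_def pexp_def by (intro sum.neutral ballI) (metis mult_zero_left)
 then show False using lead[OF assms] lead_neq[OF assms] by (simp add: P0_eq)
qed

text \<open>By triangularity the difference of \<open>P l\<close> and \<open>P0 l\<close> is a
  combination of functions \<open>P0 m\<close> with \<open>m\<close> strictly below
  \<open>l\<close>. There \<open>P m = P0 m\<close> by induction, and pairing with this function, to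
  which both \<open>P l\<close> and \<open>P0 l\<close> are orthogonal, isolates one coefficient
  after the other.\<close>

lemma jack_family_unique:
 assumes "jack_P_family \<alpha> P" "is_partition l"
 shows "P l = P0 l" using assms(2)
proof (induction "card (below l)" arbitrary: l rule: less_induct)
 case less
 have IH: "P m = P0 m" if m: "m \<in> below l" for m
 proof (rule less.hyps)
  have "below m \<subset> below l"
   using m dominates_trans[of l m] dominates_antisym[of l m] less.prems by (auto simp: below_def)
  then show "card (below m) < card (below l)" using finite_below psubset_card_mono by blast
 qed (use m in \<open>auto simp: below_def\<close>)
 obtain u where u: "P l = (\<lambda>b. monomial_sym l b + (\<Sum>m\<in>below l. u m * monomial_sym m b))"
  using assms(1) less.prems unfolding jack_P_family_def below_def by blast
 obtain x where x: "\<And>b. (\<Sum>m\<in>below l. (u m - P0 l (expo m)) * monomial_sym m b) = (\<Sum>m\<in>below l. x m * P0 m b)"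
 proof -
  have "\<exists>x. \<forall>b. (\<Sum>m\<in>below l. (u m - P0 l (expo m)) * monomial_sym m b) = (\<Sum>m\<in>below l. x m * P0 m b)"
  proof (rule monomials_in_span[OF finite_below])
   show "k \<in> below l" if "m \<in> below l" "k \<in> below m" for m k
    using that dominates_trans[of l m k] dominates_antisym[of l m] less.prems by (auto simp: below_def)
  qed (auto simp: below_def)
  then show thesis using that by blast
 qed
 \<comment> \<open>The power sum coefficients of \<open>P l\<close>; \<open>jack_form\<close> is
   only accessible through such an expansion.\<close>
 define a where "a r = \<theta> l r / c l + (\<Sum>m\<in>below l. x m * (\<theta> m r / c m))" for r
 let ?n = "sum_list l"
 have sm: "sum_list m = ?n" if "m \<in> below l" for m using that by (simp add: below_def dominates_def)
 have "P l = pexp ?n a"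
 proof
  fix b
  have "P l b = P0 l b + (\<Sum>m\<in>below l. x m * P0 m b)"
   using x[of b] P0_triangular[OF less.prems, of b] unfolding u by (simp add: left_diff_distrib sum_subtractf)
  also have "(\<Sum>m\<in>below l. x m * P0 m b) = (\<Sum>m\<in>below l. \<Sum>r\<in>partitions_of ?n. x m * (\<theta> m r / c m) * power_sums r b)"
   using sm by (intro sum.cong) (auto simp: P0_def pexp_def sum_distrib_left mult.assoc)
  also have "\<dots> = (\<Sum>r\<in>partitions_of ?n. (\<Sum>m\<in>below l. x m * (\<theta> m r / c m)) * power_sums r b)"
   by (subst sum.swap) (simp add: sum_distrib_right)
  finally show "P l b = pexp ?n a b" by (simp add: pexp_def P0_def a_def algebra_simps sum.distrib)
 qed
 have "x m = 0" if m: "m \<in> below l" for m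
 proof -
  have mp: "is_partition m" "m \<noteq> l" using m by (auto simp: below_def)
  let ?w = "\<lambda>r. real (part_z r) * \<alpha> ^ length r"
  have F: "jack_form \<alpha> (P0 k) (P0 m) = (\<Sum>r\<in>partitions_of ?n. \<theta> k r / c k * (\<theta> m r / c m) * ?w r)"
   if "sum_list k = ?n" for k unfolding P0_def that sm[OF m] jack_form_pexp ..
  have "0 = jack_form \<alpha> (P l) (P m)" using assms(1) less.prems mp unfolding jack_P_family_def by metis
  also have "\<dots> = (\<Sum>r\<in>partitions_of ?n. a r * (\<theta> m r / c m) * ?w r)"
   unfolding IH[OF m] \<open>P l = pexp ?n a\<close> P0_def sm[OF m] jack_form_pexp ..
  also have "\<dots> = (\<Sum>r\<in>partitions_of ?n. \<theta> l r / c l * (\<theta> m r / c m) * ?w r) +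
    (\<Sum>r\<in>partitions_of ?n. \<Sum>k\<in>below l. x k * (\<theta> k r / c k * (\<theta> m r / c m) * ?w r))"
   by (simp add: a_def algebra_simps sum.distrib sum_distrib_left sum_distrib_right)
  also have "\<dots> = jack_form \<alpha> (P0 l) (P0 m) + (\<Sum>k\<in>below l. x k * jack_form \<alpha> (P0 k) (P0 m))"
   using F[of l] F sm by (subst sum.swap) (auto simp: sum_distrib_left intro!: sum.cong)
  also have "(\<Sum>k\<in>below l. x k * jack_form \<alpha> (P0 k) (P0 m)) = (\<Sum>k\<in>below l. if k = m then x m * jack_form \<alpha> (P0 m) (P0 m) else 0)"
   using P0_orthogonal mp(1) by (intro sum.cong) (auto simp: below_def)
  also have "\<dots> = x m * jack_form \<alpha> (P0 m) (P0 m)" using m finite_below by simp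
  finally show ?thesis using P0_orthogonal[OF less.prems mp(1)] mp jack_form_P0_pos[OF mp(1)] by simp
 qed
 then have "a r = \<theta> l r / c l" for r by (simp add: a_def)
 then show ?case using \<open>P l = pexp ?n a\<close> by (simp add: P0_def pexp_def)
qed

lemma jack_P_eq: "is_partition l \<Longrightarrow> jack_P \<alpha> l = P0 l"
 unfolding jack_P_def by (rule jack_family_unique[OF someI[of "jack_P_family \<alpha>", OF P0_family]])

text \<open>When the leading coefficient is the hook product, the normalisation of
  \<open>jack_J\<close> undoes the division in \<open>P0\<close>, and the coefficients are \<theta>
  itself.\<close>

lemma jack_theta_eq:
 assumes "is_partition l" "c l = (\<Prod>s\<in>boxes l. \<alpha> * real (arm l s) + real (leg l s) + 1)"
  "r \<in> partitions_of (sum_list l)"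
 shows "jack_theta \<alpha> r l = \<theta> l r"
proof -
 have "jack_J \<alpha> l = pexp (sum_list l) (\<theta> l)"
  unfolding jack_J_def jack_P_eq[OF assms(1)] assms(2)[symmetric] P0_eq using lead_neq[OF assms(1)] by simp
 then show ?thesis using assms(3) by (simp add: jack_theta_def power_coeff_pexp)
qed

end

section \<open>The zonal character formula\<close>

definition level_pairings :: "('d \<Rightarrow> nat) \<Rightarrow> 'd set \<Rightarrow> ('d \<times> bool) set set set" where
 "level_pairings x D = {B \<in> pairings (D \<times> UNIV). const_on B (\<lambda>u. x (fst u))}"

definition level_perms :: "('d \<Rightarrow> nat) \<Rightarrow> 'd set \<Rightarrow> ('d \<Rightarrow> 'd) set" where
 "level_perms y D = {\<sigma>. \<sigma> permutes D \<and> (\<forall>d. y (\<sigma> d) = y d)}"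

text \<open>On the boxes of a diagram, with \<open>x\<close> the row and \<open>y\<close> the
  column, these are the power sum coefficients of the zonal polynomial; with the two exchanged they
  give the case \<open>\<alpha> = 1 / 2\<close> up to scaling. \<open>D\<close> is an arbitrary set
  because boxes will be deleted from diagrams.\<close>

definition tcoef :: "'d set \<Rightarrow> ('d \<Rightarrow> nat) \<Rightarrow> ('d \<Rightarrow> nat) \<Rightarrow> nat list \<Rightarrow> real" where
 "tcoef D x y r = (\<Sum>B\<in>level_pairings x D. \<Sum>\<sigma>\<in>level_perms y D.
   if pairs_type B (perm_pairs D \<sigma>) = r then of_int (sign \<sigma>) else 0)"

lemma finite_level_pairings: "finite D \<Longrightarrow> finite (level_pairings x D)"
 by (rule finite_subset[of _ "pairings (D \<times> UNIV)"]) (auto simp: level_pairings_def finite_pairings)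

lemma finite_level_perms: "finite D \<Longrightarrow> finite (level_perms y D)"
 by (rule finite_subset[of _ "{\<sigma>. \<sigma> permutes D}"]) (auto simp: level_perms_def finite_permutations)

lemma level_pairingsD: "B \<in> level_pairings x D \<Longrightarrow> B \<in> pairings (D \<times> UNIV)"
 by (simp add: level_pairings_def)

lemma level_permsD: "\<sigma> \<in> level_perms y D \<Longrightarrow> \<sigma> permutes D"
 by (simp add: level_perms_def)

lemma length_pairs_type: "length (pairs_type P Q) = npoly P Q"
 by (metis mset_pairs_type ptype_def size_image_mset size_mset size_mset_set)

lemma pairs_type_partition:
 assumes "finite S" "P \<in> pairings S" "Q \<in> pairings S" "card S = 2 * n"
 shows "pairs_type P Q \<in> partitions_of n"
proof -
 have "0 \<notin># ptype P Q"
 proof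
  assume "0 \<in># ptype P Q"
  then obtain L where "L \<in> polygons P Q" "card L div 2 = 0"
   using finite_polygons[OF assms(1-3)] by (auto simp: ptype_def)
  then show False using polygon_pos(2)[OF assms(1-3)] by fastforce
 qed
 then have "0 \<notin> set (pairs_type P Q)" by (metis mset_pairs_type set_mset_mset)
 moreover have "sorted_wrt (\<ge>) (pairs_type P Q)" by (simp add: pairs_type_def sorted_wrt_rev)
 moreover have "sum_list (pairs_type P Q) = n"
  using sum_ptype[OF assms(1-3)] assms(4) by (metis mset_pairs_type mult_cancel1 sum_mset_sum_list zero_neq_numeral)
 ultimately show ?thesis by (simp add: partitions_of_def is_partition_def)
qed

lemma pairs_type_eq_iff: "pairs_type P Q = pairs_type P' Q' \<longleftrightarrow> ptype P Q = ptype P' Q'"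
 by (metis mset_pairs_type pairs_type_def ptype_def)

definition content_maps :: "'d set \<Rightarrow> (nat \<Rightarrow>\<^sub>0 nat) \<Rightarrow> ('d \<times> bool \<Rightarrow> nat) set" where
 "content_maps D b = {h \<in> (D \<times> UNIV) \<rightarrow>\<^sub>E UNIV. \<forall>i. card {u \<in> D \<times> UNIV. h u = i} = 2 * lookup b i}"

lemma finite_content_maps:
 assumes "finite D" shows "finite (content_maps D b)"
proof (rule finite_subset[of _ "(D \<times> UNIV) \<rightarrow>\<^sub>E keys b"])
 show "content_maps D b \<subseteq> D \<times> UNIV \<rightarrow>\<^sub>E keys b"
 proof
  fix h assume h: "h \<in> content_maps D b"
  have "h u \<in> keys b" if u: "u \<in> D \<times> UNIV" for u
  proof -
   have "u \<in> {v \<in> D \<times> UNIV. h v = h u}" using u by simp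
   moreover have "finite {v \<in> D \<times> UNIV. h v = h u}" using assms by simp
   ultimately have "card {v \<in> D \<times> UNIV. h v = h u} > 0" by (metis card_gt_0_iff empty_iff)
   then show ?thesis using h by (auto simp: content_maps_def in_keys_iff)
  qed
  then show "h \<in> D \<times> UNIV \<rightarrow>\<^sub>E keys b" using h by (auto simp: content_maps_def)
 qed
 show "finite ((D \<times> (UNIV :: bool set)) \<rightarrow>\<^sub>E keys b)" using assms by (intro finite_PiE) auto
qed

text \<open>Each power sum is replaced by its colourings of the doubled set, and the colouring
  \<open>h\<close> is moved outermost. The weight \<phi> sees only the number of polygons: it is 1
  for \<open>\<alpha> = 2\<close> and a power of -2 for \<open>\<alpha> = 1 / 2\<close>.\<close>

lemma pexp_tcoef:
 assumes D: "finite D" "card D = n"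
 shows "pexp n (\<lambda>r. \<phi> (length r) * tcoef D x y r) b =
  (\<Sum>h\<in>content_maps D b. \<Sum>\<sigma>\<in>level_perms y D. if const_on (perm_pairs D \<sigma>) h then of_int (sign \<sigma>) *
   (\<Sum>B\<in>level_pairings x D. if const_on B h then \<phi> (npoly B (perm_pairs D \<sigma>)) else 0) else 0)"
proof -
 let ?S = "D \<times> (UNIV :: bool set)"
 have S: "finite ?S" "card ?S = 2 * n" using D by (auto simp: card_cartesian_product)
 note fin = finite_level_pairings[OF D(1), of x] finite_level_perms[OF D(1), of y] finite_content_maps[OF D(1), of b]
 have "pexp n (\<lambda>r. \<phi> (length r) * tcoef D x y r) b =
   (\<Sum>r\<in>partitions_of n. \<Sum>B\<in>level_pairings x D. \<Sum>\<sigma>\<in>level_perms y D.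
    if r = pairs_type B (perm_pairs D \<sigma>) then \<phi> (length r) * of_int (sign \<sigma>) * power_sums r b else 0)"
  unfolding pexp_def tcoef_def sum_distrib_left sum_distrib_right by (intro sum.cong refl) auto
 also have "\<dots> = (\<Sum>B\<in>level_pairings x D. \<Sum>\<sigma>\<in>level_perms y D. \<Sum>r\<in>partitions_of n.
    if r = pairs_type B (perm_pairs D \<sigma>) then \<phi> (length r) * of_int (sign \<sigma>) * power_sums r b else 0)"
  by (subst sum.swap, intro sum.cong refl, rule sum.swap)
 also have "\<dots> = (\<Sum>B\<in>level_pairings x D. \<Sum>\<sigma>\<in>level_perms y D. \<Sum>h\<in>content_maps D b.
   if const_on B h \<and> const_on (perm_pairs D \<sigma>) h then of_int (sign \<sigma>) * \<phi> (npoly B (perm_pairs D \<sigma>)) else 0)"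
 proof (intro sum.cong refl)
  fix B \<sigma> assume B: "B \<in> level_pairings x D" and s: "\<sigma> \<in> level_perms y D"
  let ?W = "perm_pairs D \<sigma>"
  note BW = level_pairingsD[OF B] perm_pairs_pairings[OF level_permsD[OF s]]
  have "(\<Sum>r\<in>partitions_of n. if r = pairs_type B ?W then \<phi> (length r) * of_int (sign \<sigma>) * power_sums r b else 0)
    = \<phi> (npoly B ?W) * of_int (sign \<sigma>) * real (card (pair_colorings ?S B ?W b))"
   using pairs_type_partition[OF S(1) BW S(2)]
   by (simp add: finite_partitions_of length_pairs_type power_sums_pairs_type[OF S(1) BW])
  also have "pair_colorings ?S B ?W b = {h \<in> content_maps D b. const_on B h \<and> const_on ?W h}"
   by (auto simp: pair_colorings_def content_maps_def)
  also have "\<phi> (npoly B ?W) * of_int (sign \<sigma>) * real (card \<dots>) = (\<Sum>h\<in>content_maps D b.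
   if const_on B h \<and> const_on ?W h then of_int (sign \<sigma>) * \<phi> (npoly B ?W) else 0)"
   using fin(3) by (simp add: sum.If_cases Int_def)
  finally show "(\<Sum>r\<in>partitions_of n. if r = pairs_type B ?W then \<phi> (length r) * of_int (sign \<sigma>) * power_sums r b else 0) =
   (\<Sum>h\<in>content_maps D b. if const_on B h \<and> const_on ?W h then of_int (sign \<sigma>) * \<phi> (npoly B ?W) else 0)" .
 qed
 also have "\<dots> = (\<Sum>h\<in>content_maps D b. \<Sum>\<sigma>\<in>level_perms y D. \<Sum>B\<in>level_pairings x D.
   if const_on B h \<and> const_on (perm_pairs D \<sigma>) h then of_int (sign \<sigma>) * \<phi> (npoly B (perm_pairs D \<sigma>)) else 0)"
  by (subst (2) sum.swap, subst sum.swap, subst (2) sum.swap, rule refl)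
 also have "\<dots> = (\<Sum>h\<in>content_maps D b. \<Sum>\<sigma>\<in>level_perms y D. if const_on (perm_pairs D \<sigma>) h then of_int (sign \<sigma>) *
   (\<Sum>B\<in>level_pairings x D. if const_on B h then \<phi> (npoly B (perm_pairs D \<sigma>)) else 0) else 0)"
 proof (intro sum.cong refl)
  fix h \<sigma>
  show "(\<Sum>B\<in>level_pairings x D. if const_on B h \<and> const_on (perm_pairs D \<sigma>) h
    then of_int (sign \<sigma>) * \<phi> (npoly B (perm_pairs D \<sigma>)) else 0) =
   (if const_on (perm_pairs D \<sigma>) h then of_int (sign \<sigma>) *
    (\<Sum>B\<in>level_pairings x D. if const_on B h then \<phi> (npoly B (perm_pairs D \<sigma>)) else 0) else 0)"
  proof (cases "const_on (perm_pairs D \<sigma>) h")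
   case True
   then show ?thesis unfolding sum_distrib_left by (simp add: if_distrib cong: if_cong)
  qed simp
 qed
 finally show ?thesis .
qed

lemma level_perms_transpose:
 assumes "\<sigma> \<in> level_perms y D" "s \<in> D" "t \<in> D" "y s = y t"
 shows "\<sigma> \<circ> transpose s t \<in> level_perms y D" "transpose s t \<circ> \<sigma> \<in> level_perms y D"
proof -
 have "y (transpose s t d) = y d" for d using assms(4) by (simp add: transpose_def)
 then show "\<sigma> \<circ> transpose s t \<in> level_perms y D" "transpose s t \<circ> \<sigma> \<in> level_perms y D"
  using assms(1) permutes_swap_id[OF assms(2,3)] by (auto simp: level_perms_def permutes_compose)
qed

lemma sign_transpose:
 assumes "finite D" "\<sigma> \<in> level_perms y D" "s \<noteq> t"
 shows "sign (\<sigma> \<circ> transpose s t) = - sign \<sigma>" "sign (transpose s t \<circ> \<sigma>) = - sign \<sigma>"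
 using assms permutes_imp_permutation[OF assms(1) level_permsD[OF assms(2)]]
 by (simp_all add: sign_compose sign_swap_id permutation_swap_id)

lemma sum_level_perms_cancel:
 fixes \<psi> :: "('d \<Rightarrow> 'd) \<Rightarrow> 'b :: ring_1"
 assumes D: "finite D" and st: "s \<in> D" "t \<in> D" "y s = y t" "s \<noteq> t"
  and "(\<forall>\<sigma>\<in>level_perms y D. \<psi> (\<sigma> \<circ> transpose s t) = \<psi>' \<sigma>) \<or>
     (\<forall>\<sigma>\<in>level_perms y D. \<psi> (transpose s t \<circ> \<sigma>) = \<psi>' \<sigma>)"
 shows "(\<Sum>\<sigma>\<in>level_perms y D. of_int (sign \<sigma>) * \<psi>' \<sigma>) = - (\<Sum>\<sigma>\<in>level_perms y D. of_int (sign \<sigma>) * \<psi> \<sigma>)"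
proof -
 have inv: "\<sigma> \<circ> transpose s t \<circ> transpose s t = \<sigma>" "transpose s t \<circ> (transpose s t \<circ> \<sigma>) = \<sigma>" for \<sigma> :: "'d \<Rightarrow> 'd"
  by (auto simp: fun_eq_iff)
 note tr = level_perms_transpose[OF _ st(1-3)] and sg = sign_transpose[OF D _ st(4)]
 show ?thesis using assms(6)
 proof
  assume *: "\<forall>\<sigma>\<in>level_perms y D. \<psi> (\<sigma> \<circ> transpose s t) = \<psi>' \<sigma>"
  have "(\<Sum>\<sigma>\<in>level_perms y D. of_int (sign \<sigma>) * \<psi>' \<sigma>) =
    (\<Sum>\<sigma>\<in>level_perms y D. - (of_int (sign (\<sigma> \<circ> transpose s t)) * \<psi> (\<sigma> \<circ> transpose s t)))"
   using * sg by (intro sum.cong) auto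
  also have "\<dots> = (\<Sum>\<sigma>\<in>level_perms y D. - (of_int (sign \<sigma>) * \<psi> \<sigma>))"
   by (rule sum.reindex_bij_witness[where i = "\<lambda>\<sigma>. \<sigma> \<circ> transpose s t" and j = "\<lambda>\<sigma>. \<sigma> \<circ> transpose s t"])
     (use inv tr in auto)
  finally show ?thesis by (simp add: sum_negf)
 next
  assume *: "\<forall>\<sigma>\<in>level_perms y D. \<psi> (transpose s t \<circ> \<sigma>) = \<psi>' \<sigma>"
  have "(\<Sum>\<sigma>\<in>level_perms y D. of_int (sign \<sigma>) * \<psi>' \<sigma>) =
    (\<Sum>\<sigma>\<in>level_perms y D. - (of_int (sign (transpose s t \<circ> \<sigma>)) * \<psi> (transpose s t \<circ> \<sigma>)))"
   using * sg by (intro sum.cong) auto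
  also have "\<dots> = (\<Sum>\<sigma>\<in>level_perms y D. - (of_int (sign \<sigma>) * \<psi> \<sigma>))"
   by (rule sum.reindex_bij_witness[where i = "\<lambda>\<sigma>. transpose s t \<circ> \<sigma>" and j = "\<lambda>\<sigma>. transpose s t \<circ> \<sigma>"])
     (use inv tr in auto)
  finally show ?thesis by (simp add: sum_negf)
 qed
qed

lemma const_on_perm_pairs: "\<sigma> permutes D \<Longrightarrow> const_on (perm_pairs D \<sigma>) h \<longleftrightarrow> (\<forall>d\<in>D. h (\<sigma> d, True) = h (d, False))"
proof -
 assume s: "\<sigma> permutes D"
 have "h (mate (perm_pairs D \<sigma>) u) = h u"
  if h: "\<forall>d\<in>D. h (\<sigma> d, True) = h (d, False)" "u \<in> D \<times> UNIV" for u
 proof -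
  obtain d e where u: "u = (d, e)" "d \<in> D" using h(2) by auto
  obtain d' where d': "d' \<in> D" "d = \<sigma> d'" using u(2) permutes_image[OF s] by (metis imageE)
  show ?thesis using u d' h(1) mate_perm_pairs(1)[OF s u(2)] mate_perm_pairs(2)[OF s d'(1)] by (cases e) auto
 qed
 moreover have "h (\<sigma> d, True) = h (d, False)"
  if "\<forall>u\<in>D \<times> UNIV. h (mate (perm_pairs D \<sigma>) u) = h u" "d \<in> D" for d
  using that mate_perm_pairs(1)[OF s that(2)] by (metis SigmaI UNIV_I)
 ultimately show ?thesis unfolding const_on_mate[OF perm_pairs_pairings[OF s]] by blast
qed

lemma transpose_ball:
 assumes "s \<in> D" "t \<in> D" shows "(\<forall>d\<in>D. Q (transpose s t d)) \<longleftrightarrow> (\<forall>d\<in>D. Q d)"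
proof -
 have "transpose s t ` D = D" by (rule permutes_image[OF permutes_swap_id[OF assms]])
 then have "(\<forall>d\<in>D. Q d) \<longleftrightarrow> (\<forall>d\<in>transpose s t ` D. Q d)" by simp
 then show ?thesis by simp
qed

text \<open>Points of one level with equal colour in the same copy can be swapped without affecting
  the condition on \<sigma>. Copy \<open>False\<close> carries the arguments of \<sigma> and calls
  for right multiplication, copy \<open>True\<close> carries the values and calls for left
  multiplication.\<close>

lemma level_sign_sum_eq_0:
 assumes D: "finite D" and st: "s \<in> D" "t \<in> D" "y s = y t" "s \<noteq> t" "h (s, e) = h (t, e)"
 shows "(\<Sum>\<sigma>\<in>level_perms y D. if const_on (perm_pairs D \<sigma>) h then of_int (sign \<sigma>) else 0 :: real) = 0"
proof -
 let ?\<psi> = "\<lambda>\<sigma>. if const_on (perm_pairs D \<sigma>) h then 1 else 0 :: real"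
 have ht: "h (transpose s t d, e) = h (d, e)" for d using st(5) by (auto simp: transpose_def)
 have "(\<Sum>\<sigma>\<in>level_perms y D. of_int (sign \<sigma>) * ?\<psi> \<sigma>) = - (\<Sum>\<sigma>\<in>level_perms y D. of_int (sign \<sigma>) * ?\<psi> \<sigma>)"
 proof (rule sum_level_perms_cancel[OF D st(1-4)])
  show "(\<forall>\<sigma>\<in>level_perms y D. ?\<psi> (\<sigma> \<circ> transpose s t) = ?\<psi> \<sigma>) \<or>
   (\<forall>\<sigma>\<in>level_perms y D. ?\<psi> (transpose s t \<circ> \<sigma>) = ?\<psi> \<sigma>)"
  proof (cases e)
   case True
   have "?\<psi> (transpose s t \<circ> \<sigma>) = ?\<psi> \<sigma>" if s: "\<sigma> \<in> level_perms y D" for \<sigma>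
    using level_permsD[OF s] level_permsD[OF level_perms_transpose(2)[OF s st(1-3)]] ht True
    by (simp add: const_on_perm_pairs)
   then show ?thesis by blast
  next
   case False
   have "?\<psi> (\<sigma> \<circ> transpose s t) = ?\<psi> \<sigma>" if s: "\<sigma> \<in> level_perms y D" for \<sigma>
    using level_permsD[OF s] level_permsD[OF level_perms_transpose(1)[OF s st(1-3)]] ht False
     transpose_ball[OF st(1,2), of "\<lambda>d. h (\<sigma> d, True) = h (d, False)"]
    by (simp add: const_on_perm_pairs)
   then show ?thesis by blast
  qed
 qed
 then have "(\<Sum>\<sigma>\<in>level_perms y D. of_int (sign \<sigma>) * ?\<psi> \<sigma>) = 0" by simp
 moreover have "(\<Sum>\<sigma>\<in>level_perms y D. of_int (sign \<sigma>) * ?\<psi> \<sigma>) =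
   (\<Sum>\<sigma>\<in>level_perms y D. if const_on (perm_pairs D \<sigma>) h then of_int (sign \<sigma>) else 0)"
  by (intro sum.cong) auto
 ultimately show ?thesis by simp
qed

text \<open>What survives the cancellation: within a level each copy uses a colour at most once.
  Hence a colour occurs at most twice per level, the bound from which dominance will follow.\<close>

definition layer_injective :: "'d set \<Rightarrow> ('d \<Rightarrow> nat) \<Rightarrow> ('d \<times> bool \<Rightarrow> nat) \<Rightarrow> bool" where
 "layer_injective D y h \<longleftrightarrow> (\<forall>s\<in>D. \<forall>t\<in>D. \<forall>e. y s = y t \<longrightarrow> h (s, e) = h (t, e) \<longrightarrow> s = t)"

lemma layer_injective_card_le:
 assumes "finite D" "layer_injective D y h"
 shows "card {u \<in> D \<times> UNIV. y (fst u) = j \<and> h u = i} \<le> 2"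
proof -
 have "inj_on snd {u \<in> D \<times> UNIV. y (fst u) = j \<and> h u = i}"
  using assms(2) by (auto simp: inj_on_def layer_injective_def)
 then have "card {u \<in> D \<times> UNIV. y (fst u) = j \<and> h u = i} \<le> card (UNIV :: bool set)"
  by (rule card_inj_on_le) auto
 then show ?thesis by simp
qed

lemma image_pairing:
 assumes "B \<in> pairings S" "bij_betw g S S'"
 shows "image g ` B \<in> pairings S'" "\<And>s. s \<in> S \<Longrightarrow> mate (image g ` B) (g s) = g (mate B s)"
proof -
 have inj: "inj_on g S" and im: "g ` S = S'" using assms(2) by (auto simp: bij_betw_def)
 have sub: "p \<subseteq> S" "card p = 2" if "p \<in> B" for p using assms(1) that by (auto simp: pairings_def partition_on_def)
 show 1: "image g ` B \<in> pairings S'" unfolding pairings_def partition_on_def disjoint_def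
 proof (intro CollectI conjI ballI impI)
  show "\<Union> (image g ` B) = S'" using im pairings_cover[OF assms(1)] by blast
  show "{} \<notin> image g ` B" using assms(1) by (auto simp: pairings_def partition_on_def)
  show "card q = 2" if q: "q \<in> image g ` B" for q
  proof -
   obtain p where p: "p \<in> B" "q = g ` p" using q by auto
   then show ?thesis using sub[OF p(1)] card_image[of g p] inj_on_subset[OF inj] by auto
  qed
  show "q \<inter> q' = {}" if q: "q \<in> image g ` B" "q' \<in> image g ` B" "q \<noteq> q'" for q q'
  proof -
   obtain p p' where p: "p \<in> B" "q = g ` p" "p' \<in> B" "q' = g ` p'" using q by auto
   then have "p \<inter> p' = {}" using pairings_uniq[OF assms(1) p(1,3)] q(3) by blast
   then show ?thesis using inj_on_image_Int[OF inj sub(1)[OF p(1)] sub(1)[OF p(3)]] p by simp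
  qed
 qed
 show "mate (image g ` B) (g s) = g (mate B s)" if "s \<in> S" for s
 proof (rule mate_eqI[OF 1])
  have "{g s, g (mate B s)} = g ` {s, mate B s}" by auto
  then show "{g s, g (mate B s)} \<in> image g ` B" using mate_pair[OF assms(1) that] by blast
 qed
qed

lemma sum_level_pairings_image:
 assumes D': "finite D'" and Bp: "B \<in> pairings S" and bij: "bij_betw g S (D' \<times> (UNIV :: bool set))"
 shows "(\<Sum>B'\<in>level_pairings x' D'. if \<forall>u\<in>S. g (mate B u) = mate B' (g u) then 1 else 0 :: real) =
  (if const_on B (\<lambda>u. x' (fst (g u))) then 1 else 0)"
proof -
 let ?S' = "D' \<times> (UNIV :: bool set)"
 note im = image_pairing[OF Bp bij]
 have uniq: "(\<forall>u\<in>S. g (mate B u) = mate B' (g u)) \<longleftrightarrow> B' = image g ` B" if B': "B' \<in> pairings ?S'" for B'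
 proof
  assume c: "\<forall>u\<in>S. g (mate B u) = mate B' (g u)"
  have "mate B' v = mate (image g ` B) v" if v: "v \<in> ?S'" for v
  proof -
   have "v \<in> g ` S" using v bij by (simp add: bij_betw_def)
   then obtain u where u: "u \<in> S" "v = g u" by blast
   then show ?thesis using c im(2)[OF u(1)] by metis
  qed
  then show "B' = image g ` B" by (intro pairings_eqI[OF B' im(1)]) auto
 qed (use im in auto)
 have mem: "image g ` B \<in> level_pairings x' D' \<longleftrightarrow> const_on B (\<lambda>u. x' (fst (g u)))"
 proof -
  have "const_on (image g ` B) (\<lambda>u. x' (fst u)) \<longleftrightarrow> (\<forall>v\<in>g ` S. x' (fst (mate (image g ` B) v)) = x' (fst v))"
   unfolding const_on_mate[OF im(1)] using bij by (simp add: bij_betw_def)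
  also have "\<dots> \<longleftrightarrow> const_on B (\<lambda>u. x' (fst (g u)))" unfolding const_on_mate[OF Bp] using im(2) by simp
  finally show ?thesis using im(1) by (simp add: level_pairings_def)
 qed
 have "(\<Sum>B'\<in>level_pairings x' D'. if \<forall>u\<in>S. g (mate B u) = mate B' (g u) then 1 else 0 :: real) =
   (\<Sum>B'\<in>level_pairings x' D'. if B' = image g ` B then 1 else 0)"
  by (rule sum.cong[OF refl]) (simp only: uniq[OF level_pairingsD])
 then show ?thesis using mem finite_level_pairings[OF D'] by simp
qed

text \<open>Bijections \<open>g\<close> are sorted by the labels \<open>x'\<close> they induce on
  the doubled set. The pairing factor \<open>K\<close> depends only on these labels, while the
  permutation factor \<open>L\<close> changes sign when \<open>g\<close> is composed with a
  transposition inside one level and one copy. If the labels of the two points agreed, the whole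
  class would contribute 0.\<close>

lemma isos_orthogonality:
 assumes D: "finite D" and D': "finite D'"
  and nz: "(\<Sum>B\<in>level_pairings x D. \<Sum>\<sigma>\<in>level_perms y D. \<Sum>B'\<in>level_pairings x' D'. \<Sum>\<sigma>'\<in>level_perms y' D'.
   of_int (sign \<sigma>) * of_int (sign \<sigma>') *
   real (card (isos (D \<times> UNIV) B (perm_pairs D \<sigma>) (D' \<times> UNIV) B' (perm_pairs D' \<sigma>')))) \<noteq> 0"
 obtains g where "bij_betw g (D \<times> (UNIV :: bool set)) (D' \<times> (UNIV :: bool set))" "layer_injective D y (\<lambda>u. x' (fst (g u)))"
proof -
 let ?S = "D \<times> (UNIV :: bool set)" and ?S' = "D' \<times> (UNIV :: bool set)"
 let ?G = "{g \<in> ?S \<rightarrow>\<^sub>E ?S'. bij_betw g ?S ?S'}"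
 have finG: "finite ?G" by (rule finite_subset[of _ "?S \<rightarrow>\<^sub>E ?S'"]) (use D D' in \<open>auto intro: finite_PiE\<close>)
 define C where "C g W W' \<longleftrightarrow> (\<forall>u\<in>?S. g (mate W u) = mate W' (g u))" for g and W :: "('a \<times> bool) set set" and W' :: "('b \<times> bool) set set"
 define K where "K g = (\<Sum>B\<in>level_pairings x D. \<Sum>B'\<in>level_pairings x' D'. if C g B B' then 1 else 0 :: real)" for g
 define L where "L g = (\<Sum>\<sigma>\<in>level_perms y D. of_int (sign \<sigma>) * (\<Sum>\<sigma>'\<in>level_perms y' D'.
   if C g (perm_pairs D \<sigma>) (perm_pairs D' \<sigma>') then of_int (sign \<sigma>') else 0 :: real))" for g
 have iso: "real (card (isos ?S B W ?S' B' W')) = (\<Sum>g\<in>?G. (if C g B B' then 1 else 0) * (if C g W W' then 1 else 0))" for B W B' W'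
 proof -
  have "isos ?S B W ?S' B' W' = {g \<in> ?G. C g B B' \<and> C g W W'}" by (auto simp: isos_def C_def)
  also have "real (card \<dots>) = (\<Sum>g\<in>?G. if C g B B' \<and> C g W W' then 1 else 0)"
   using finG by (simp add: sum.If_cases Int_def)
  also have "\<dots> = (\<Sum>g\<in>?G. (if C g B B' then 1 else 0) * (if C g W W' then 1 else 0))" by (intro sum.cong) auto
  finally show ?thesis .
 qed
 have "(\<Sum>B\<in>level_pairings x D. \<Sum>\<sigma>\<in>level_perms y D. \<Sum>B'\<in>level_pairings x' D'. \<Sum>\<sigma>'\<in>level_perms y' D'.
   of_int (sign \<sigma>) * of_int (sign \<sigma>') * real (card (isos ?S B (perm_pairs D \<sigma>) ?S' B' (perm_pairs D' \<sigma>'))))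
  = (\<Sum>B\<in>level_pairings x D. \<Sum>\<sigma>\<in>level_perms y D. \<Sum>B'\<in>level_pairings x' D'. \<Sum>\<sigma>'\<in>level_perms y' D'. \<Sum>g\<in>?G.
   (if C g B B' then 1 else 0) * (of_int (sign \<sigma>) * (if C g (perm_pairs D \<sigma>) (perm_pairs D' \<sigma>') then of_int (sign \<sigma>') else 0)))"
  unfolding iso sum_distrib_left by (intro sum.cong refl) auto
 also have "\<dots> = (\<Sum>g\<in>?G. \<Sum>B\<in>level_pairings x D. \<Sum>B'\<in>level_pairings x' D'. \<Sum>\<sigma>\<in>level_perms y D. \<Sum>\<sigma>'\<in>level_perms y' D'.
   (if C g B B' then 1 else 0) * (of_int (sign \<sigma>) * (if C g (perm_pairs D \<sigma>) (perm_pairs D' \<sigma>') then of_int (sign \<sigma>') else 0)))"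
  unfolding sum.swap[of _ ?G] sum.swap[of _ "level_perms y D" "level_pairings x' D'"] ..
 also have "\<dots> = (\<Sum>g\<in>?G. K g * L g)"
  unfolding K_def sum_distrib_right unfolding L_def sum_distrib_left ..
 finally have nz': "(\<Sum>g\<in>?G. K g * L g) \<noteq> 0" using nz by simp
 have K: "K g = real (card {B \<in> level_pairings x D. const_on B (\<lambda>u. x' (fst (g u)))})" if g: "g \<in> ?G" for g
 proof -
  have bij: "bij_betw g ?S ?S'" using g by simp
  note sum_level_pairings_image[OF D' level_pairingsD bij, of _ x x']
  then have "K g = (\<Sum>B\<in>level_pairings x D. if const_on B (\<lambda>u. x' (fst (g u))) then 1 else 0)"
   unfolding K_def C_def by (intro sum.cong) auto
  then show ?thesis using finite_level_pairings[OF D] by (simp add: sum.If_cases Int_def)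
 qed
 define \<H> where "\<H> g = restrict (\<lambda>u. x' (fst (g u))) ?S" for g :: "'a \<times> bool \<Rightarrow> 'b \<times> bool"
 have KH: "K g = K g'" if "g \<in> ?G" "g' \<in> ?G" "\<H> g = \<H> g'" for g g'
 proof -
  have "x' (fst (g u)) = x' (fst (g' u))" if "u \<in> ?S" for u
   using fun_cong[OF \<open>\<H> g = \<H> g'\<close>, of u] that by (simp add: \<H>_def)
  then have "const_on B (\<lambda>u. x' (fst (g u))) = const_on B (\<lambda>u. x' (fst (g' u)))" if "B \<in> level_pairings x D" for B
   by (intro const_on_cong[OF level_pairingsD[OF that]])
  then have "{B \<in> level_pairings x D. const_on B (\<lambda>u. x' (fst (g u)))} = {B \<in> level_pairings x D. const_on B (\<lambda>u. x' (fst (g' u)))}"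
   by blast
  then show ?thesis unfolding K[OF that(1)] K[OF that(2)] by simp
 qed
 have "(\<Sum>g\<in>?G. K g * L g) = (\<Sum>H\<in>\<H> ` ?G. \<Sum>g | g \<in> ?G \<and> \<H> g = H. K g * L g)"
  using finG by (intro sum.group[symmetric]) auto
 with nz' obtain H where H: "H \<in> \<H> ` ?G" "(\<Sum>g | g \<in> ?G \<and> \<H> g = H. K g * L g) \<noteq> 0"
  using sum.neutral[of "\<H> ` ?G" "\<lambda>H. \<Sum>g | g \<in> ?G \<and> \<H> g = H. K g * L g"] by fastforce
 obtain g0 where g0: "g0 \<in> ?G" "\<H> g0 = H" using H(1) by auto
 have "(\<Sum>g | g \<in> ?G \<and> \<H> g = H. K g * L g) = (\<Sum>g | g \<in> ?G \<and> \<H> g = H. K g0 * L g)"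
 proof (intro sum.cong refl)
  fix g assume "g \<in> {g. g \<in> ?G \<and> \<H> g = H}"
  then have "K g = K g0" using g0 by (intro KH) simp_all
  then show "K g * L g = K g0 * L g" by simp
 qed
 with H(2) have nzL: "(\<Sum>g | g \<in> ?G \<and> \<H> g = H. L g) \<noteq> 0" by (auto simp: sum_distrib_left[symmetric])
 have "layer_injective D y (\<lambda>u. x' (fst (g0 u)))" unfolding layer_injective_def
 proof (intro ballI allI impI, rule ccontr)
  fix s t e assume st: "s \<in> D" "t \<in> D" "y s = y t" "x' (fst (g0 (s, e))) = x' (fst (g0 (t, e)))" "s \<noteq> t"
  let ?\<tau> = "transpose (s, e) (t, e)"
  have \<tau>S: "?\<tau> permutes ?S" using st by (intro permutes_swap_id) auto
  have Gt: "g \<circ> ?\<tau> \<in> ?G" if g: "g \<in> ?G" for g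
  proof -
   have "bij_betw (g \<circ> ?\<tau>) ?S ?S'" using g permutes_imp_bij[OF \<tau>S] bij_betw_trans by blast
   moreover have "g \<circ> ?\<tau> \<in> ?S \<rightarrow>\<^sub>E ?S'"
   proof (rule PiE_I)
    fix u assume "u \<in> ?S"
    then have "?\<tau> u \<in> ?S" by (simp only: permutes_in_image[OF \<tau>S])
    then show "(g \<circ> ?\<tau>) u \<in> ?S'" unfolding comp_def by (rule PiE_mem[OF conjunct1[OF g[simplified]]])
   next
    fix u assume u: "u \<notin> ?S"
    then have "?\<tau> u = u" by (rule permutes_not_in[OF \<tau>S])
    moreover have "g u = undefined" by (rule PiE_arb[OF conjunct1[OF g[simplified]] u])
    ultimately show "(g \<circ> ?\<tau>) u = undefined" unfolding comp_def by (simp only:)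
   qed
   ultimately show ?thesis by simp
  qed
  have Ht: "\<H> (g \<circ> ?\<tau>) = H" if g: "g \<in> ?G" "\<H> g = H" for g
  proof -
   have eq: "x' (fst (g (s, e))) = x' (fst (g (t, e)))"
    using st g(2) g0(2) unfolding \<H>_def by (metis SigmaI UNIV_I restrict_apply')
   have "\<H> (g \<circ> ?\<tau>) = \<H> g" unfolding \<H>_def by (intro restrict_ext) (auto simp: transpose_def eq)
   then show ?thesis using g by simp
  qed
  have Ceq: "C g (perm_pairs D \<sigma>) W' \<longleftrightarrow> (\<forall>d\<in>D. g (\<sigma> d, True) = mate W' (g (d, False)))"
   if g: "g \<in> ?G" and s: "\<sigma> permutes D" and W': "W' \<in> pairings ?S'" for g \<sigma> W'
  proof
   assume c: "C g (perm_pairs D \<sigma>) W'"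
   show "\<forall>d\<in>D. g (\<sigma> d, True) = mate W' (g (d, False))"
   proof
    fix d assume d: "d \<in> D"
    then have "g (mate (perm_pairs D \<sigma>) (d, False)) = mate W' (g (d, False))" using c by (simp add: C_def)
    then show "g (\<sigma> d, True) = mate W' (g (d, False))" using mate_perm_pairs(1)[OF s d] by simp
   qed
  next
   assume *: "\<forall>d\<in>D. g (\<sigma> d, True) = mate W' (g (d, False))"
   show "C g (perm_pairs D \<sigma>) W'" unfolding C_def
   proof
    fix u assume "u \<in> ?S"
    obtain d e' where u: "u = (d, e')" "d \<in> D" using \<open>u \<in> ?S\<close> by auto
    show "g (mate (perm_pairs D \<sigma>) u) = mate W' (g u)"
    proof (cases e')
     case False
     then show ?thesis using * u mate_perm_pairs(1)[OF s u(2)] by simp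
    next
     case True
     obtain d' where d': "d' \<in> D" "d = \<sigma> d'" using u(2) permutes_image[OF s] by (metis imageE)
     have "g (d', False) \<in> ?S'" using d' by (intro PiE_mem[OF conjunct1[OF g[simplified]]]) simp
     then show ?thesis using True * u d' mate_perm_pairs(2)[OF s d'(1)] mate_mate[OF W', of "g (d', False)"] by simp
    qed
   qed
  qed
  have Lneg: "L (g \<circ> ?\<tau>) = - L g" if g: "g \<in> ?G" for g unfolding L_def
  proof (rule sum_level_perms_cancel[OF D st(1-3,5)])
   let ?\<psi> = "\<lambda>g \<sigma>. \<Sum>\<sigma>'\<in>level_perms y' D'. if C g (perm_pairs D \<sigma>) (perm_pairs D' \<sigma>') then of_int (sign \<sigma>') else 0 :: real"
   have tt: "transpose s t permutes D" using st by (intro permutes_swap_id)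
   show "(\<forall>\<sigma>\<in>level_perms y D. ?\<psi> g (\<sigma> \<circ> transpose s t) = ?\<psi> (g \<circ> ?\<tau>) \<sigma>) \<or>
    (\<forall>\<sigma>\<in>level_perms y D. ?\<psi> g (transpose s t \<circ> \<sigma>) = ?\<psi> (g \<circ> ?\<tau>) \<sigma>)"
   proof (cases e)
    case True
    have "?\<psi> g (transpose s t \<circ> \<sigma>) = ?\<psi> (g \<circ> ?\<tau>) \<sigma>" if s: "\<sigma> \<in> level_perms y D" for \<sigma>
    proof (intro sum.cong refl if_cong)
     fix \<sigma>' assume "\<sigma>' \<in> level_perms y' D'"
     then have W': "perm_pairs D' \<sigma>' \<in> pairings ?S'" using perm_pairs_pairings[OF level_permsD] by blast
     have "(g \<circ> ?\<tau>) (d, False) = g (d, False)" "(g \<circ> ?\<tau>) (d, True) = g (transpose s t d, True)" for d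
      using True by (auto simp: transpose_def)
     then show "C g (perm_pairs D (transpose s t \<circ> \<sigma>)) (perm_pairs D' \<sigma>') = C (g \<circ> ?\<tau>) (perm_pairs D \<sigma>) (perm_pairs D' \<sigma>')"
      unfolding Ceq[OF g permutes_compose[OF level_permsD[OF s] tt] W'] Ceq[OF Gt[OF g] level_permsD[OF s] W'] by simp
    qed
    then show ?thesis by blast
   next
    case False
    have "?\<psi> g (\<sigma> \<circ> transpose s t) = ?\<psi> (g \<circ> ?\<tau>) \<sigma>" if s: "\<sigma> \<in> level_perms y D" for \<sigma>
    proof (intro sum.cong refl if_cong)
     fix \<sigma>' assume "\<sigma>' \<in> level_perms y' D'"
     then have W': "perm_pairs D' \<sigma>' \<in> pairings ?S'" using perm_pairs_pairings[OF level_permsD] by blast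
     have "(g \<circ> ?\<tau>) (d, True) = g (d, True)" "(g \<circ> ?\<tau>) (d, False) = g (transpose s t d, False)" for d
      using False by (auto simp: transpose_def)
     then show "C g (perm_pairs D (\<sigma> \<circ> transpose s t)) (perm_pairs D' \<sigma>') = C (g \<circ> ?\<tau>) (perm_pairs D \<sigma>) (perm_pairs D' \<sigma>')"
      unfolding Ceq[OF g permutes_compose[OF tt level_permsD[OF s]] W'] Ceq[OF Gt[OF g] level_permsD[OF s] W']
      using transpose_ball[OF st(1,2), of "\<lambda>d. g (\<sigma> d, True) = mate (perm_pairs D' \<sigma>') (g (transpose s t d, False))"] by simp
    qed
    then show ?thesis by blast
   qed
  qed
  have "(\<Sum>g | g \<in> ?G \<and> \<H> g = H. L g) = (\<Sum>g | g \<in> ?G \<and> \<H> g = H. L (g \<circ> ?\<tau>))"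
   by (rule sum.reindex_bij_witness[where i = "\<lambda>g. g \<circ> ?\<tau>" and j = "\<lambda>g. g \<circ> ?\<tau>"])
     (use Gt Ht in \<open>auto simp: comp_assoc\<close>)
  also have "\<dots> = - (\<Sum>g | g \<in> ?G \<and> \<H> g = H. L g)" using Lneg by (simp add: sum_negf)
  finally show False using nzL by simp
 qed
 with g0 that show thesis by blast
qed

text \<open>\<open>part_z r * 2 ^ length r\<close> is the number of isomorphisms between two pairs
  of type \<open>r\<close>, and there are none between pairs of different types, so the scalar
  product counts isomorphisms.\<close>

lemma tcoef_inner:
 assumes "finite D" "finite D'" "card D = n" "card D' = n"
 shows "(\<Sum>r\<in>partitions_of n. tcoef D x y r * tcoef D' x' y' r * (real (part_z r) * 2 ^ length r)) =
  (\<Sum>B\<in>level_pairings x D. \<Sum>\<sigma>\<in>level_perms y D. \<Sum>B'\<in>level_pairings x' D'. \<Sum>\<sigma>'\<in>level_perms y' D'.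
   of_int (sign \<sigma>) * of_int (sign \<sigma>') *
   real (card (isos (D \<times> UNIV) B (perm_pairs D \<sigma>) (D' \<times> UNIV) B' (perm_pairs D' \<sigma>'))))"
proof -
 let ?S = "D \<times> (UNIV :: bool set)" and ?S' = "D' \<times> (UNIV :: bool set)"
 have S: "finite ?S" "card ?S = 2 * n" "finite ?S'" "card ?S' = 2 * n" using assms by (auto simp: card_cartesian_product)
 have "(\<Sum>r\<in>partitions_of n. tcoef D x y r * tcoef D' x' y' r * (real (part_z r) * 2 ^ length r)) =
  (\<Sum>r\<in>partitions_of n. \<Sum>B\<in>level_pairings x D. \<Sum>\<sigma>\<in>level_perms y D. \<Sum>B'\<in>level_pairings x' D'. \<Sum>\<sigma>'\<in>level_perms y' D'.
   if r = pairs_type B (perm_pairs D \<sigma>) then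
    (if r = pairs_type B' (perm_pairs D' \<sigma>') then of_int (sign \<sigma>) * of_int (sign \<sigma>') * (real (part_z r) * 2 ^ length r) else 0) else 0)"
  unfolding mult.assoc[of "tcoef D x y _"] unfolding tcoef_def[of D x] sum_distrib_right
  unfolding tcoef_def sum_distrib_right sum_distrib_left by (intro sum.cong refl) auto
 also have "\<dots> = (\<Sum>B\<in>level_pairings x D. \<Sum>\<sigma>\<in>level_perms y D. \<Sum>B'\<in>level_pairings x' D'. \<Sum>\<sigma>'\<in>level_perms y' D'. \<Sum>r\<in>partitions_of n.
   if r = pairs_type B (perm_pairs D \<sigma>) then
    (if r = pairs_type B' (perm_pairs D' \<sigma>') then of_int (sign \<sigma>) * of_int (sign \<sigma>') * (real (part_z r) * 2 ^ length r) else 0) else 0)"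
  unfolding sum.swap[of _ _ "partitions_of n"] ..
 also have "\<dots> = (\<Sum>B\<in>level_pairings x D. \<Sum>\<sigma>\<in>level_perms y D. \<Sum>B'\<in>level_pairings x' D'. \<Sum>\<sigma>'\<in>level_perms y' D'.
   of_int (sign \<sigma>) * of_int (sign \<sigma>') *
   real (card (isos (D \<times> UNIV) B (perm_pairs D \<sigma>) (D' \<times> UNIV) B' (perm_pairs D' \<sigma>'))))"
 proof (intro sum.cong refl)
  fix B \<sigma> B' \<sigma>' assume *: "B \<in> level_pairings x D" "\<sigma> \<in> level_perms y D" "B' \<in> level_pairings x' D'" "\<sigma>' \<in> level_perms y' D'"
  let ?W = "perm_pairs D \<sigma>" and ?W' = "perm_pairs D' \<sigma>'"
  note p = level_pairingsD[OF *(1)] perm_pairs_pairings[OF level_permsD[OF *(2)]]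
   level_pairingsD[OF *(3)] perm_pairs_pairings[OF level_permsD[OF *(4)]]
  have "pairs_type B ?W \<in> partitions_of n" by (rule pairs_type_partition[OF S(1) p(1,2) S(2)])
  then have "(\<Sum>r\<in>partitions_of n. if r = pairs_type B ?W then
    (if r = pairs_type B' ?W' then of_int (sign \<sigma>) * of_int (sign \<sigma>') * (real (part_z r) * 2 ^ length r) else 0) else 0)
   = (if pairs_type B ?W = pairs_type B' ?W' then of_int (sign \<sigma>) * of_int (sign \<sigma>') * real (zmset (ptype B ?W)) else 0)"
   using zmset_part_z[of "pairs_type B ?W"] by (simp add: finite_partitions_of)
  then show "(\<Sum>r\<in>partitions_of n. if r = pairs_type B ?W then
    (if r = pairs_type B' ?W' then of_int (sign \<sigma>) * of_int (sign \<sigma>') * (real (part_z r) * 2 ^ length r) else 0) else 0)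
   = of_int (sign \<sigma>) * of_int (sign \<sigma>') * real (card (isos ?S B ?W ?S' B' ?W'))"
   unfolding card_isos[OF S(1) p(1,2) S(3) p(3,4)] pairs_type_eq_iff by simp
 qed
 finally show ?thesis .
qed

section \<open>Gaussian functionals on polynomials\<close>

type_synonym 'v mp = "('v \<Rightarrow>\<^sub>0 nat) \<Rightarrow>\<^sub>0 real"

definition Var :: "'v \<Rightarrow> 'v mp" where
 "Var v = single (single v 1) 1"

lemma mp_induct [case_names single add]:
 fixes p :: "'v mp"
 assumes "\<And>m a. Q (single m a)" "\<And>p q. Q p \<Longrightarrow> Q q \<Longrightarrow> Q (p + q)"
 shows "Q p"
proof -
 have "p = (\<Sum>m\<in>keys p. single m (lookup p m))"
 proof (rule poly_mapping_eqI)
  fix k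
  have "lookup (\<Sum>m\<in>keys p. single m (lookup p m)) k
    = (\<Sum>m\<in>keys p. if m = k then lookup p m else 0)"
   unfolding lookup_sum by (intro sum.cong) (auto simp: lookup_single when_def)
  then show "lookup p k =
    lookup (\<Sum>m\<in>keys p. single m (lookup p m)) k" by (simp add: in_keys_iff)
 qed
 moreover have "Q (\<Sum>m\<in>X. single m (lookup p m))" if "finite X" for X using that
 proof induction
  case empty
  then show ?case using assms(1)[of 0 0] by simp
 qed (use assms in auto)
 ultimately show ?thesis by (metis finite_keys)
qed

text \<open>Extends a map on terms, additive in the coefficient, to polynomials; derivative and
  expectation are both of this form.\<close>

definition mp_sum :: "(('v \<Rightarrow>\<^sub>0 nat) \<Rightarrow> real \<Rightarrow> 'b) \<Rightarrow> 'v mp \<Rightarrow> 'b :: comm_monoid_add" where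
 "mp_sum \<phi> p = (\<Sum>m\<in>keys p. \<phi> m (lookup p m))"

context
 fixes \<phi> :: "('v \<Rightarrow>\<^sub>0 nat) \<Rightarrow> real \<Rightarrow> 'b :: comm_monoid_add"
 assumes \<phi>0: "\<And>m. \<phi> m 0 = 0" and \<phi>add: "\<And>m a b. \<phi> m (a + b) = \<phi> m a + \<phi> m b"
begin

lemma mp_sum_superset: "finite X \<Longrightarrow> keys p \<subseteq> X \<Longrightarrow> mp_sum \<phi> p = (\<Sum>m\<in>X. \<phi> m (lookup p m))"
 unfolding mp_sum_def by (rule sum.mono_neutral_left) (auto simp: \<phi>0 in_keys_iff)

lemma mp_sum_add: "mp_sum \<phi> (p + q) = mp_sum \<phi> p + mp_sum \<phi> q"
proof -
 let ?X = "keys p \<union> keys q"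
 have "mp_sum \<phi> (p + q) = (\<Sum>m\<in>?X. \<phi> m (lookup (p + q) m))"
  by (rule mp_sum_superset) (auto simp: keys_add)
 also have "\<dots> = mp_sum \<phi> p + mp_sum \<phi> q"
  using mp_sum_superset[of ?X p] mp_sum_superset[of ?X q] by (simp add: lookup_add \<phi>add sum.distrib)
 finally show ?thesis .
qed

lemma mp_sum_single: "mp_sum \<phi> (single m a) = \<phi> m a"
 using mp_sum_superset[of "{m}" "single m a"] by (auto split: if_splits)

end

definition pd :: "'v \<Rightarrow> 'v mp \<Rightarrow> 'v mp" where
 "pd u = mp_sum (\<lambda>m a. single (m - single u 1) (a * real (lookup m u)))"

lemma pd_add: "pd u (p + q) = pd u p + pd u q"
 unfolding pd_def by (rule mp_sum_add) (auto simp: distrib_right single_add)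

lemma pd_single: "pd u (single m a) =
  single (m - single u 1) (a * real (lookup m u))"
 unfolding pd_def by (rule mp_sum_single) (auto simp: distrib_right single_add)

lemma pd_mult: "pd u (p * q) = pd u p * q + p * pd u q"
proof (induction p rule: mp_induct)
 case (single m a)
 show ?case
 proof (induction q rule: mp_induct)
  case (single n b)
  have 1: "(m - single u 1) + n = m + n - single u 1" if "lookup m u \<noteq> 0"
   using that by (intro poly_mapping_eqI) (auto simp: lookup_add lookup_minus lookup_single when_def)
  have 2: "m + (n - single u 1) = m + n - single u 1" if "lookup n u \<noteq> 0"
   using that by (intro poly_mapping_eqI) (auto simp: lookup_add lookup_minus lookup_single when_def)
  have "pd u (single m a) * single n b =
    single (m + n - single u 1) (a * b * real (lookup m u))"
   using 1 unfolding pd_single mult_single by (cases "lookup m u = 0") (simp_all add: mult.assoc mult.commute mult.left_commute)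
  moreover have "single m a * pd u (single n b) =
    single (m + n - single u 1) (a * b * real (lookup n u))"
   using 2 unfolding pd_single mult_single by (cases "lookup n u = 0") (simp_all add: mult.assoc)
  ultimately show ?case by (simp add: mult_single pd_single lookup_add distrib_left single_add)
 qed (simp add: distrib_left pd_add add_ac)
qed (simp add: distrib_right pd_add add_ac)

lemma pd_Var: "pd u (Var v) = (if u = v then 1 else 0)"
 by (simp add: Var_def pd_single lookup_single when_def single_one)

text \<open>The moments of centred Gaussian variables with covariance \<open>cov\<close> are defined by Wick's formula.\<close>

locale gaussian =
 fixes bar :: "'v \<Rightarrow> 'v" and s :: "'v \<Rightarrow> real"
 assumes bar_bar: "bar (bar v) = v" and s_bar: "s (bar v) = s v"
begin

definition cov :: "'v \<Rightarrow> 'v \<Rightarrow> real" where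
 "cov v w = (if w = bar v then s v else 0)"

lemma cov_sym: "cov v w = cov w v" unfolding cov_def by (metis bar_bar s_bar)

text \<open>Summed over both orders and halved, so that it makes sense for an unordered
  pair.\<close>

definition pair_cov :: "('k \<Rightarrow> 'v) \<Rightarrow> 'k set \<Rightarrow> real" where
 "pair_cov f p = (\<Sum>a\<in>p. \<Sum>b\<in>p - {a}. cov (f a) (f b)) / 2"

lemma pair_cov_pair: "a \<noteq> b \<Longrightarrow> pair_cov f {a, b} = cov (f a) (f b)"
proof -
 assume "a \<noteq> b"
 then have "{a, b} - {a} = {b}" "{a, b} - {b} = {a}" by auto
 then show ?thesis using \<open>a \<noteq> b\<close> cov_sym[of "f a" "f b"] by (simp add: pair_cov_def)
qed

definition wick :: "'k set \<Rightarrow> ('k \<Rightarrow> 'v) \<Rightarrow> real" where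
 "wick S f = (\<Sum>B\<in>pairings S. \<Prod>p\<in>B. pair_cov f p)"

lemma wick_rec:
 assumes "finite S" "a \<in> S"
 shows "wick S f = (\<Sum>b\<in>S - {a}. cov (f a) (f b) * wick (S - {a, b}) f)"
 unfolding wick_def sum_pairings[OF assms] sum_distrib_left
proof (intro sum.cong refl)
 fix b B assume b: "b \<in> S - {a}" and B: "B \<in> pairings (S - {a, b})"
 have "{a, b} \<notin> B" using pair_in[OF B] by blast
 moreover have "finite B" using finite_pairing[OF _ B] assms by simp
 ultimately show "(\<Prod>p\<in>insert {a, b} B. pair_cov f p) = cov (f a) (f b) * (\<Prod>p\<in>B. pair_cov f p)"
  using b pair_cov_pair[of a b f] by auto
qed

lemma wick_empty [simp]: "wick {} f = 1" by (simp add: wick_def)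

lemma wick_bij:
 assumes "finite S" "bij_betw g S S'" "\<And>x. x \<in> S \<Longrightarrow> f x = f' (g x)"
 shows "wick S f = wick S' f'" using assms
proof (induction "card S" arbitrary: S S' rule: less_induct)
 case less
 show ?case
 proof (cases "S = {}")
  case True
  then show ?thesis using less.prems by (simp add: bij_betw_def)
 next
  case False
  then obtain a where a: "a \<in> S" by auto
  have inj: "inj_on g S" and im: "g ` S = S'" using less.prems(2) by (auto simp: bij_betw_def)
  have S': "finite S'" "g a \<in> S'" using less.prems(1) im a by auto
  have "wick S f = (\<Sum>b\<in>S - {a}. cov (f a) (f b) * wick (S - {a, b}) f)" by (rule wick_rec[OF less.prems(1) a])
  also have "\<dots> = (\<Sum>b\<in>S - {a}. cov (f' (g a)) (f' (g b)) * wick (S' - {g a, g b}) f')"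
  proof (intro sum.cong refl)
   fix b assume b: "b \<in> S - {a}"
   have "bij_betw g (S - {a, b}) (S' - {g a, g b})" using inj im a b by (auto simp: bij_betw_def inj_on_def)
   then have "wick (S - {a, b}) f = wick (S' - {g a, g b}) f'"
    using less.prems a by (intro less.hyps psubset_card_mono) auto
   then show "cov (f a) (f b) * wick (S - {a, b}) f = cov (f' (g a)) (f' (g b)) * wick (S' - {g a, g b}) f'"
    using less.prems(3) a b by simp
  qed
  also have "\<dots> = (\<Sum>c\<in>S' - {g a}. cov (f' (g a)) (f' c) * wick (S' - {g a, c}) f')"
  proof (rule sum.reindex_cong[symmetric, of g])
   show "inj_on g (S - {a})" using inj by (rule inj_on_subset) auto
   show "S' - {g a} = g ` (S - {a})" using inj im a by (auto simp: inj_on_def)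
  qed auto
  also have "\<dots> = wick S' f'" by (rule wick_rec[OF S', symmetric])
  finally show ?thesis .
 qed
qed

text \<open>One labelled slot for every occurrence of a variable in a monomial, since Wick's formula
  pairs factors and not variables.\<close>

definition slots :: "('v \<Rightarrow>\<^sub>0 nat) \<Rightarrow> ('v \<times> nat) set" where
 "slots m = {(v, i). i < lookup m v}"

lemma finite_slots: "finite (slots m)"
proof -
 have "slots m = (SIGMA v:keys m. {..<lookup m v})" by (auto simp: slots_def in_keys_iff)
 then show ?thesis by simp
qed

definition moment :: "('v \<Rightarrow>\<^sub>0 nat) \<Rightarrow> real" where
 "moment m = wick (slots m) fst"

lemma lookup_sum_single: "finite S \<Longrightarrow> lookup (\<Sum>x\<in>S. single (f x) 1) v = card {x \<in> S. f x = v}"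
proof -
 assume S: "finite S"
 have "lookup (\<Sum>x\<in>S. single (f x) (1 :: nat)) v = (\<Sum>x\<in>S. if f x = v then 1 else 0)"
  unfolding lookup_sum by (intro sum.cong) (auto simp: lookup_single when_def)
 then show ?thesis using S by (simp add: sum.If_cases Int_def del: One_nat_def)
qed

lemma wick_moment:
 assumes "finite S"
 shows "wick S f = moment (\<Sum>x\<in>S. single (f x) 1)"
proof -
 let ?m = "\<Sum>x\<in>S. single (f x) 1 :: 'v \<Rightarrow>\<^sub>0 nat"
 have "\<exists>h. bij_betw h {x \<in> S. f x = v} {0..<lookup ?m v}" for v
  unfolding lookup_sum_single[OF assms] using assms by (intro ex_bij_betw_finite_nat) auto
 then obtain h where h: "bij_betw (h v) {x \<in> S. f x = v} {0..<lookup ?m v}" for v by metis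
 have "bij_betw (\<lambda>x. (f x, h (f x) x)) S (slots ?m)" unfolding bij_betw_def
 proof
  show "inj_on (\<lambda>x. (f x, h (f x) x)) S"
  proof (rule inj_onI)
   fix x y assume "x \<in> S" "y \<in> S" "(f x, h (f x) x) = (f y, h (f y) y)"
   then show "x = y" using h[of "f x"] unfolding bij_betw_def inj_on_def by auto
  qed
  show "(\<lambda>x. (f x, h (f x) x)) ` S = slots ?m"
  proof (intro equalityI subsetI)
   fix z assume "z \<in> (\<lambda>x. (f x, h (f x) x)) ` S"
   then obtain x where x: "x \<in> S" "z = (f x, h (f x) x)" by auto
   then have "h (f x) x \<in> {0..<lookup ?m (f x)}" using h[of "f x"] unfolding bij_betw_def by blast
   then show "z \<in> slots ?m" using x by (simp add: slots_def)
  next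
   fix z assume "z \<in> slots ?m"
   then obtain v i where z: "z = (v, i)" "i \<in> {0..<lookup ?m v}" by (auto simp: slots_def)
   then have "i \<in> h v ` {x \<in> S. f x = v}" using h[of v] by (simp only: bij_betw_def)
   then obtain x where "x \<in> S" "f x = v" "h v x = i" by blast
   then show "z \<in> (\<lambda>x. (f x, h (f x) x)) ` S" using z by auto
  qed
 qed
 then show ?thesis unfolding moment_def by (intro wick_bij[OF assms]) auto
qed

lemma sum_slots: "(\<Sum>t\<in>slots m. single (fst t) 1) = m"
proof (rule poly_mapping_eqI)
 fix v
 have "{x \<in> slots m. fst x = v} = Pair v ` {..<lookup m v}" by (auto simp: slots_def)
 then show "lookup (\<Sum>t\<in>slots m. single (fst t) 1) v = lookup m v"
  unfolding lookup_sum_single[OF finite_slots] by (simp add: card_image inj_on_def)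
qed

definition Ex :: "'v mp \<Rightarrow> real" where
 "Ex = mp_sum (\<lambda>m a. a * moment m)"

lemma Ex_add: "Ex (p + q) = Ex p + Ex q" unfolding Ex_def by (rule mp_sum_add) (auto simp: distrib_right)

lemma Ex_single: "Ex (single m a) = a * moment m" unfolding Ex_def by (rule mp_sum_single) (auto simp: distrib_right)

lemma prod_Var: "finite S \<Longrightarrow> (\<Prod>x\<in>S. Var (f x)) = single (\<Sum>x\<in>S. single (f x) 1) 1"
 by (induction S rule: finite_induct) (auto simp: Var_def mult_single single_one)

lemma Ex_prod_Var: "finite S \<Longrightarrow> Ex (\<Prod>x\<in>S. Var (f x)) = wick S f"
 by (simp add: prod_Var Ex_single wick_moment)

text \<open>The recursion of Wick's formula at the new factor \<open>v\<close>, placed at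
  \<open>None\<close>: it can only be paired with an occurrence of \<open>bar v\<close>, and the
  number of these occurrences is the exponent that the derivative produces.\<close>

lemma Ex_by_parts: "Ex (Var v * p) = s v * Ex (pd (bar v) p)"
proof (induction p rule: mp_induct)
 case (single m a)
 let ?S = "insert None (Some ` slots m)" and ?f = "case_option v fst"
 have fin: "finite (slots m)" by (rule finite_slots)
 have sumSome: "(\<Sum>t\<in>Some ` X. single (?f t) 1) = (\<Sum>t\<in>X. single (fst t) 1)" for X
  by (simp add: sum.reindex)
 have "moment (single v 1 + m) = wick ?S ?f"
  using fin by (subst wick_moment) (auto simp: sumSome sum_slots simp del: One_nat_def)
 also have "\<dots> = (\<Sum>b\<in>?S - {None}. cov v (?f b) * wick (?S - {None, b}) ?f)"
  using fin by (subst wick_rec[of _ None]) auto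
 also have "?S - {None} = Some ` slots m" by auto
 also have "(\<Sum>b\<in>Some ` slots m. cov v (?f b) * wick (?S - {None, b}) ?f) =
   (\<Sum>t\<in>slots m. cov v (fst t) * wick (?S - {None, Some t}) ?f)" by (simp add: sum.reindex)
 also have "\<dots> = (\<Sum>t\<in>slots m. if fst t = bar v then s v * moment (m - single (bar v) 1) else 0)"
 proof (intro sum.cong refl)
  fix t assume t: "t \<in> slots m"
  have "?S - {None, Some t} = Some ` (slots m - {t})" by auto
  then have "wick (?S - {None, Some t}) ?f = moment (\<Sum>t\<in>slots m - {t}. single (fst t) 1)"
   using fin by (simp add: wick_moment sumSome del: One_nat_def)
  also have "(\<Sum>t\<in>slots m - {t}. single (fst t) 1) = m - single (fst t) 1"
   using sum.remove[OF fin t, of "\<lambda>t. single (fst t) (1::nat)"] sum_slots[of m] by (metis add_diff_cancel_left')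
  finally show "cov v (fst t) * wick (?S - {None, Some t}) ?f =
    (if fst t = bar v then s v * moment (m - single (bar v) 1) else 0)" by (simp add: cov_def)
 qed
 also have "\<dots> = real (card {t \<in> slots m. fst t = bar v}) * (s v * moment (m - single (bar v) 1))"
  using fin by (simp add: sum.If_cases Int_def)
 also have "card {t \<in> slots m. fst t = bar v} = lookup m (bar v)"
  using lookup_sum_single[OF fin, of fst "bar v"] sum_slots[of m] by (simp del: One_nat_def)
 finally show ?case unfolding Var_def mult_single Ex_single pd_single by simp
qed (simp add: distrib_left pd_add Ex_add)

end

section \<open>Polarization operators and products of minors\<close>

lemma additive_of_int_mult:
 fixes F :: "'x :: ring_1 \<Rightarrow> 'y :: ring_1"
 assumes "\<And>p q. F (p + q) = F p + F q"
 shows "F (of_int k * p) = of_int k * F p"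
proof -
 have F0: "F 0 = 0" using assms[of 0 0] by simp
 have neg: "F (- p) = - F p" for p using assms[of p "- p"] F0 by (simp add: eq_neg_iff_add_eq_0 add.commute)
 have "F (of_nat n * p) = of_nat n * F p" for n by (induction n) (auto simp: F0 assms distrib_right)
 then show ?thesis by (cases k rule: int_cases2) (auto simp: neg)
qed

lemma additive_sum:
 assumes "\<And>p q. F (p + q) = F p + F q" "F (0 :: 'x :: comm_monoid_add) = (0 :: 'y :: comm_monoid_add)"
 shows "F (\<Sum>i\<in>I. f i) = (\<Sum>i\<in>I. F (f i))"
 by (induction I rule: infinite_finite_induct) (auto simp: assms)

lemma derivation_prod:
 fixes F :: "'x :: comm_ring_1 \<Rightarrow> 'x"
 assumes mult: "\<And>p q. F (p * q) = F p * q + p * F q" and "finite I"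
 shows "F (\<Prod>i\<in>I. a i) = (\<Sum>i\<in>I. F (a i) * (\<Prod>j\<in>I - {i}. a j))" using assms(2)
proof (induction I rule: finite_induct)
 case empty
 show ?case using mult[of 1 1] by simp
next
 case (insert x I)
 have "F (\<Prod>i\<in>insert x I. a i) = F (a x) * (\<Prod>i\<in>I. a i) + a x * (\<Sum>i\<in>I. F (a i) * (\<Prod>j\<in>I - {i}. a j))"
  using insert by (simp add: mult)
 also have "a x * (\<Sum>i\<in>I. F (a i) * (\<Prod>j\<in>I - {i}. a j)) = (\<Sum>i\<in>I. F (a i) * (\<Prod>j\<in>insert x I - {i}. a j))"
  unfolding sum_distrib_left
 proof (intro sum.cong refl)
  fix i assume i: "i \<in> I"
  then have "insert x I - {i} = insert x (I - {i})" using insert by auto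
  then show "a x * (F (a i) * (\<Prod>j\<in>I - {i}. a j)) = F (a i) * (\<Prod>j\<in>insert x I - {i}. a j)"
   using insert by (simp add: mult_ac)
 qed
 also have "F (a x) * (\<Prod>i\<in>I. a i) = F (a x) * (\<Prod>j\<in>insert x I - {x}. a j)" using insert by simp
 finally show ?case using insert by simp
qed

text \<open>The polarization operator, a derivation replacing row \<open>p\<close> by row
  \<open>l\<close> in one occurrence at a time. These operators give the action of the general
  linear Lie algebra on rows, for which products of leading minors are highest weight
  vectors.\<close>

definition polar :: "'c set \<Rightarrow> 'r \<Rightarrow> 'r \<Rightarrow> ('r \<times> 'c) mp \<Rightarrow> ('r \<times> 'c) mp" where
 "polar Cs l p q = (\<Sum>c\<in>Cs. Var (l, c) * pd (p, c) q)"

lemma polar_add: "polar Cs l p (q + q') = polar Cs l p q + polar Cs l p q'"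
 by (simp add: polar_def pd_add distrib_left sum.distrib)

lemma polar_mult: "polar Cs l p (q * q') = polar Cs l p q * q' + q * polar Cs l p q'"
 by (simp add: polar_def pd_mult algebra_simps sum.distrib sum_distrib_left sum_distrib_right)

lemma polar_0 [simp]: "polar Cs l p 0 = 0" using polar_add[of Cs l p 0 0] by simp

lemma polar_sum: "polar Cs l p (\<Sum>i\<in>I. f i) = (\<Sum>i\<in>I. polar Cs l p (f i))"
 by (rule additive_sum) (auto simp: polar_add)

lemma polar_of_int: "polar Cs l p (of_int k * q) = of_int k * polar Cs l p q"
 by (rule additive_of_int_mult) (rule polar_add)

lemma polar_prod: "finite I \<Longrightarrow> polar Cs l p (\<Prod>i\<in>I. a i) = (\<Sum>i\<in>I. polar Cs l p (a i) * (\<Prod>j\<in>I - {i}. a j))"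
 by (rule derivation_prod) (rule polar_mult)

lemma polar_Var:
 assumes "finite Cs" "c \<in> Cs"
 shows "polar Cs l p (Var (a, c)) = (if a = p then Var (l, c) else 0)"
proof -
 have "polar Cs l p (Var (a, c)) = (\<Sum>c'\<in>Cs. if c' = c then (if a = p then Var (l, c) else 0) else 0)"
  unfolding polar_def by (intro sum.cong) (auto simp: pd_Var)
 then show ?thesis using assms by simp
qed

lemma mp_eq_uminus: "(p :: 'v mp) = - p \<Longrightarrow> p = 0"
proof (rule poly_mapping_eqI)
 fix k assume "p = - p"
 then have "lookup p k = - lookup p k" by (metis lookup_uminus)
 then show "lookup p k = lookup 0 k" by simp
qed

text \<open>For the boxes of a diagram with \<open>r\<close> the row and \<open>y\<close> the column
  this is the product, over the columns of the diagram, of leading principal minors of a generic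
  matrix.\<close>

definition level_det :: "'k set \<Rightarrow> ('k \<Rightarrow> 'r) \<Rightarrow> ('k \<Rightarrow> nat) \<Rightarrow> ('r \<times> 'r) mp" where
 "level_det C r y = (\<Sum>u\<in>level_perms y C. of_int (sign u) * (\<Prod>s\<in>C. Var (r s, r (u s))))"

lemma polar_level_det:
 assumes C: "finite C" "finite Cs" "r ` C \<subseteq> Cs"
 shows "polar Cs l p (level_det C r y) = (\<Sum>s | s \<in> C \<and> r s = p. \<Sum>u\<in>level_perms y C.
  of_int (sign u) * (Var (l, r (u s)) * (\<Prod>t\<in>C - {s}. Var (r t, r (u t)))))"
proof -
 have "polar Cs l p (level_det C r y) = (\<Sum>u\<in>level_perms y C. \<Sum>s\<in>C.
   if r s = p then of_int (sign u) * (Var (l, r (u s)) * (\<Prod>t\<in>C - {s}. Var (r t, r (u t)))) else 0)"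
  unfolding level_det_def polar_sum polar_of_int polar_prod[OF C(1)] sum_distrib_left
 proof (intro sum.cong refl)
  fix u s assume u: "u \<in> level_perms y C" and s: "s \<in> C"
  have "r (u s) \<in> Cs" using s permutes_in_image[OF level_permsD[OF u]] C(3) by blast
  from polar_Var[OF C(2) this, of l p "r s"] show "of_int (sign u) * (polar Cs l p (Var (r s, r (u s))) * (\<Prod>t\<in>C - {s}. Var (r t, r (u t)))) =
    (if r s = p then of_int (sign u) * (Var (l, r (u s)) * (\<Prod>t\<in>C - {s}. Var (r t, r (u t)))) else 0)" by simp
 qed
 also have "\<dots> = (\<Sum>s\<in>C. \<Sum>u\<in>level_perms y C.
   if r s = p then of_int (sign u) * (Var (l, r (u s)) * (\<Prod>t\<in>C - {s}. Var (r t, r (u t)))) else 0)"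
  by (rule sum.swap)
 also have "\<dots> = (\<Sum>s\<in>C. if r s = p then \<Sum>u\<in>level_perms y C.
   of_int (sign u) * (Var (l, r (u s)) * (\<Prod>t\<in>C - {s}. Var (r t, r (u t)))) else 0)"
  by (intro sum.cong refl) auto
 finally show ?thesis using C(1) by (simp add: sum.If_cases Int_def)
qed

text \<open>Replacing row \<open>p\<close> by row \<open>l\<close> in a minor that already contains
  row \<open>l\<close> produces two equal rows. The hypothesis \<open>ex\<close> guarantees this for
  every minor containing row \<open>p\<close>; in a Young diagram it holds whenever \<open>l\<close>
  lies above \<open>p\<close>.\<close>

lemma polar_level_det_eq_0:
 assumes C: "finite C" "finite Cs" "r ` C \<subseteq> Cs" and lp: "l \<noteq> p"
  and ex: "\<And>s. s \<in> C \<Longrightarrow> r s = p \<Longrightarrow> \<exists>t\<in>C. r t = l \<and> y t = y s"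
 shows "polar Cs l p (level_det C r y) = 0" unfolding polar_level_det[OF C]
proof (rule sum.neutral, rule ballI)
 fix s assume "s \<in> {s. s \<in> C \<and> r s = p}"
 then have s: "s \<in> C" "r s = p" by auto
 then obtain t where t: "t \<in> C" "r t = l" "y t = y s" using ex by blast
 have st: "s \<noteq> t" using s t lp by auto
 let ?\<psi> = "\<lambda>u. Var (l, r (u s)) * (\<Prod>t\<in>C - {s}. Var (r t, r (u t)))"
 have split: "?\<psi> u = Var (l, r (u s)) * (Var (l, r (u t)) * (\<Prod>t\<in>C - {s} - {t}. Var (r t, r (u t))))" for u
  using C(1) t st by (subst prod.remove[of "C - {s}" t]) auto
 have sym: "?\<psi> (u \<circ> transpose s t) = ?\<psi> u" for u
 proof -
  have "(\<Prod>v\<in>C - {s} - {t}. Var (r v, r ((u \<circ> transpose s t) v))) = (\<Prod>v\<in>C - {s} - {t}. Var (r v, r (u v)))"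
   by (intro prod.cong) auto
  then show ?thesis unfolding split by (simp add: mult_ac)
 qed
 have "(\<Sum>u\<in>level_perms y C. of_int (sign u) * ?\<psi> u) = - (\<Sum>u\<in>level_perms y C. of_int (sign u) * ?\<psi> u)"
  using sym by (intro sum_level_perms_cancel[OF C(1) s(1) t(1) t(3)[symmetric] st]) blast
 then show "(\<Sum>u\<in>level_perms y C. of_int (sign u) * ?\<psi> u) = 0" by (rule mp_eq_uminus)
qed

text \<open>For equal rows the operator is Euler's and multiplies by the degree in row
  \<open>p\<close>.\<close>

lemma polar_level_det_diag:
 assumes C: "finite C" "finite Cs" "r ` C \<subseteq> Cs"
 shows "polar Cs p p (level_det C r y) = of_nat (card {s \<in> C. r s = p}) * level_det C r y"
proof -
 have "polar Cs p p (level_det C r y) = (\<Sum>s | s \<in> C \<and> r s = p. level_det C r y)"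
  unfolding polar_level_det[OF C] unfolding level_det_def
 proof (intro sum.cong refl)
  fix s u assume "s \<in> {s. s \<in> C \<and> r s = p}"
  then have s: "s \<in> C" "r s = p" by auto
  then show "of_int (sign u) * (Var (p, r (u s)) * (\<Prod>t\<in>C - {s}. Var (r t, r (u t)))) =
    of_int (sign u) * (\<Prod>s\<in>C. Var (r s, r (u s)))"
   using prod.remove[OF C(1) s(1), of "\<lambda>s. Var (r s, r (u s))"] by simp
 qed
 then show ?thesis by simp
qed

lemma level_det_union:
 assumes fin: "finite C0" "finite C1" and disj: "\<And>s t. s \<in> C0 \<Longrightarrow> t \<in> C1 \<Longrightarrow> y s \<noteq> y t"
 shows "level_det (C0 \<union> C1) r y = level_det C0 r y * level_det C1 r y"
proof -
 have d: "C0 \<inter> C1 = {}" using disj by auto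
 have "level_det C0 r y * level_det C1 r y = (\<Sum>(u0, u1)\<in>level_perms y C0 \<times> level_perms y C1.
   of_int (sign u0 * sign u1) * ((\<Prod>s\<in>C0. Var (r s, r (u0 s))) * (\<Prod>s\<in>C1. Var (r s, r (u1 s)))))"
  unfolding level_det_def sum_product sum.cartesian_product by (intro sum.cong) (auto simp: mult_ac)
 also have "\<dots> = (\<Sum>u\<in>level_perms y (C0 \<union> C1). of_int (sign u) * (\<Prod>s\<in>C0 \<union> C1. Var (r s, r (u s))))"
 proof (rule sum.reindex_bij_witness[where j = "\<lambda>(u0, u1). u0 \<circ> u1" and i = "\<lambda>u. (restrict_id u C0, restrict_id u C1)"])
  fix a assume "a \<in> level_perms y C0 \<times> level_perms y C1"
  then obtain u0 u1 where a: "a = (u0, u1)" and u: "u0 \<in> level_perms y C0" "u1 \<in> level_perms y C1" by auto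
  note p = level_permsD[OF u(1)] level_permsD[OF u(2)]
  have v0: "(u0 \<circ> u1) s = u0 s" if "s \<in> C0" for s
  proof -
   have "s \<notin> C1" using that d by auto
   then show ?thesis using permutes_not_in[OF p(2), of s] by simp
  qed
  have v1: "(u0 \<circ> u1) s = u1 s" if "s \<in> C1" for s
  proof -
   have "u1 s \<notin> C0" using that d permutes_in_image[OF p(2), of s] by auto
   then show ?thesis using permutes_not_in[OF p(1), of "u1 s"] by simp
  qed
  have r0: "restrict_id (u0 \<circ> u1) C0 = u0" "restrict_id (u0 \<circ> u1) C1 = u1"
   using v0 v1 permutes_not_in[OF p(1)] permutes_not_in[OF p(2)] by (auto simp: fun_eq_iff restrict_id_def)
  then show "(restrict_id (case a of (u0, u1) \<Rightarrow> u0 \<circ> u1) C0, restrict_id (case a of (u0, u1) \<Rightarrow> u0 \<circ> u1) C1) = a"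
   using a by simp
  have "u0 \<circ> u1 permutes C0 \<union> C1"
   using permutes_compose[OF permutes_subset[OF p(2)] permutes_subset[OF p(1)], of "C0 \<union> C1"] by auto
  then show "(case a of (u0, u1) \<Rightarrow> u0 \<circ> u1) \<in> level_perms y (C0 \<union> C1)" using u a by (auto simp: level_perms_def)
  have sg: "sign (u0 \<circ> u1) = sign u0 * sign u1"
   using p fin by (intro sign_compose) (auto intro: permutes_imp_permutation)
  have "(\<Prod>s\<in>C0 \<union> C1. Var (r s, r ((u0 \<circ> u1) s))) = (\<Prod>s\<in>C0. Var (r s, r ((u0 \<circ> u1) s))) * (\<Prod>s\<in>C1. Var (r s, r ((u0 \<circ> u1) s)))"
   using fin d by (rule prod.union_disjoint)
  also have "(\<Prod>s\<in>C0. Var (r s, r ((u0 \<circ> u1) s))) = (\<Prod>s\<in>C0. Var (r s, r (u0 s)))"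
   using v0 by (intro prod.cong) auto
  also have "(\<Prod>s\<in>C1. Var (r s, r ((u0 \<circ> u1) s))) = (\<Prod>s\<in>C1. Var (r s, r (u1 s)))"
   using v1 by (intro prod.cong) auto
  finally show "of_int (sign (case a of (u0, u1) \<Rightarrow> u0 \<circ> u1)) * (\<Prod>s\<in>C0 \<union> C1. Var (r s, r ((case a of (u0, u1) \<Rightarrow> u0 \<circ> u1) s))) =
    (case a of (u0, u1) \<Rightarrow> of_int (sign u0 * sign u1) * ((\<Prod>s\<in>C0. Var (r s, r (u0 s))) * (\<Prod>s\<in>C1. Var (r s, r (u1 s)))))"
   using a sg by simp
 next
  fix u assume u: "u \<in> level_perms y (C0 \<union> C1)"
  note p = level_permsD[OF u]
  have yu: "y (u s) = y s" for s using u by (simp add: level_perms_def)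
  have 0: "u s \<in> C0" if "s \<in> C0" for s
   using permutes_in_image[OF p, of s] that disj[of s "u s"] yu[of s] by auto
  have 1: "u s \<in> C1" if "s \<in> C1" for s
   using permutes_in_image[OF p, of s] that disj[of "u s" s] yu[of s] by auto
  have inj: "inj_on u X" for X using permutes_inj[OF p] by (rule inj_on_subset) auto
  have b0: "bij_betw u C0 C0" "bij_betw u C1 C1"
   using 0 1 fin inj endo_inj_surj[of C0 u] endo_inj_surj[of C1 u] by (auto simp: bij_betw_def image_subset_iff)
  have "restrict_id u C0 \<in> level_perms y C0" "restrict_id u C1 \<in> level_perms y C1"
   using permutes_restrict_id[OF b0(1)] permutes_restrict_id[OF b0(2)] yu by (auto simp: level_perms_def restrict_id_def)
  then show "(restrict_id u C0, restrict_id u C1) \<in> level_perms y C0 \<times> level_perms y C1" by simp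
  have "restrict_id u C0 \<circ> restrict_id u C1 = u"
  proof
   fix s
   show "(restrict_id u C0 \<circ> restrict_id u C1) s = u s"
    using 0[of s] 1[of s] d permutes_not_in[OF p, of s] by (auto simp: restrict_id_def)
  qed
  then show "(case (restrict_id u C0, restrict_id u C1) of (u0, u1) \<Rightarrow> u0 \<circ> u1) = u" by simp
 qed
 finally show ?thesis by (simp add: level_det_def)
qed

definition rowdet :: "'r set \<Rightarrow> ('r \<times> 'r) mp" where
 "rowdet R = (\<Sum>u | u permutes R. of_int (sign u) * (\<Prod>p\<in>R. Var (p, u p)))"

lemma level_det_single:
 assumes fin: "finite C" and bij: "bij_betw r C R" and y: "\<And>s. s \<in> C \<Longrightarrow> y s = j"
 shows "level_det C r y = rowdet R"
proof -
 have inj: "inj_on r C" and im: "r ` C = R" using bij by (auto simp: bij_betw_def)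
 have lp: "level_perms y C = {u. u permutes C}"
 proof -
  have "y (u d) = y d" if u: "u permutes C" for u d
   using y permutes_in_image[OF u, of d] permutes_not_in[OF u, of d] by (cases "d \<in> C") auto
  then show ?thesis by (auto simp: level_perms_def)
 qed
 have app: "map_permutation C r u (r s) = r (u s)" if "s \<in> C" for u s
  using that inj by (simp add: map_permutation_def)
 show ?thesis unfolding level_det_def rowdet_def lp
 proof (rule sum.reindex_bij_witness[where j = "map_permutation C r" and i = "map_permutation R (inv_into C r)"])
  have bij': "bij_betw (inv_into C r) R C" using bij_betw_inv_into[OF bij] .
  fix u assume "u \<in> {u. u permutes C}"
  then have u: "u permutes C" by simp
  have "map_permutation R (inv_into C r) (map_permutation C r u) = map_permutation C (inv_into C r \<circ> r) u"
   using bij bij' by (intro map_permutation_compose) (auto simp: bij_betw_def)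
  also have "\<dots> = map_permutation C id u" using u inj by (intro map_permutation_cong) (auto simp: inj_on_def)
  finally show "map_permutation R (inv_into C r) (map_permutation C r u) = u" using u by simp
  show "map_permutation C r u \<in> {u. u permutes R}" using map_permutation_permutes[OF bij u] by simp
  have "(\<Prod>p\<in>R. Var (p, map_permutation C r u p)) = (\<Prod>s\<in>C. Var (r s, r (u s)))"
   unfolding im[symmetric] using inj app by (subst prod.reindex) (auto intro!: prod.cong)
  then show "of_int (sign (map_permutation C r u)) * (\<Prod>p\<in>R. Var (p, map_permutation C r u p)) =
    of_int (sign u) * (\<Prod>s\<in>C. Var (r s, r (u s)))" using sign_map_permutation[OF inj u fin] by simp
 next
  have bij': "bij_betw (inv_into C r) R C" using bij_betw_inv_into[OF bij] .
  fix v assume "v \<in> {u. u permutes R}"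
  then have v: "v permutes R" by simp
  have "map_permutation C r (map_permutation R (inv_into C r) v) = map_permutation R (r \<circ> inv_into C r) v"
   using bij bij' by (intro map_permutation_compose) (auto simp: bij_betw_def)
  also have "\<dots> = map_permutation R id v"
   using v im by (intro map_permutation_cong) (auto simp: inj_on_def f_inv_into_f)
  finally show "map_permutation C r (map_permutation R (inv_into C r) v) = v" using v by simp
  show "map_permutation R (inv_into C r) v \<in> {u. u permutes C}" using map_permutation_permutes[OF bij' v] by simp
 qed
qed

text \<open>With the next lemma this is the determinant part of a Cauchy-Binet expansion: a choice
  \<open>f\<close> of columns gives 0 unless it is a permutation, and then a determinant up to
  sign.\<close>

lemma rowdet_columns_inj:
 assumes R: "finite R" and f: "f permutes R"
 shows "(\<Sum>\<pi> | \<pi> permutes R. of_int (sign \<pi>) * (\<Prod>i\<in>R. Var (\<pi> i, f i))) = of_int (sign f) * rowdet R"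
proof -
 have "of_int (sign f) * rowdet R = (\<Sum>u | u permutes R. of_int (sign f * sign u) * (\<Prod>p\<in>R. Var (p, u p)))"
  unfolding rowdet_def sum_distrib_left by (intro sum.cong) (auto simp: mult.assoc)
 also have "\<dots> = (\<Sum>\<pi> | \<pi> permutes R. of_int (sign \<pi>) * (\<Prod>i\<in>R. Var (\<pi> i, f i)))"
 proof (rule sum.reindex_bij_witness[where j = "\<lambda>u. inv u \<circ> f" and i = "\<lambda>\<pi>. f \<circ> inv \<pi>"])
  fix u assume "u \<in> {u. u permutes R}"
  then have u: "u permutes R" by simp
  have iu: "inv u permutes R" using permutes_inv[OF u] .
  show p: "inv u \<circ> f \<in> {\<pi>. \<pi> permutes R}" using permutes_compose[OF f iu] by simp
  show "f \<circ> inv (inv u \<circ> f) = u" using permutes_bij[OF f] permutes_bij[OF u] permutes_bij[OF iu]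
   by (simp add: o_inv_distrib bij_imp_bij_inv inv_inv_eq o_assoc[symmetric] flip: o_assoc)
     (auto simp: fun_eq_iff bij_def surj_f_inv_f)
  have "sign (inv u \<circ> f) = sign f * sign u"
   using R f u iu by (simp add: sign_compose sign_inverse permutes_imp_permutation mult.commute)
  moreover have "(\<Prod>i\<in>R. Var ((inv u \<circ> f) i, f i)) = (\<Prod>p\<in>R. Var (p, u p))"
   using permutes_inverses[OF u] permutes_imp_bij[OF permutes_compose[OF f iu]]
   by (intro prod.reindex_bij_betw[where g = "\<lambda>p. Var (p, u p)" and h = "inv u \<circ> f", THEN trans[rotated]] prod.cong) auto
  ultimately show "of_int (sign (inv u \<circ> f)) * (\<Prod>i\<in>R. Var ((inv u \<circ> f) i, f i)) = of_int (sign f * sign u) * (\<Prod>p\<in>R. Var (p, u p))"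
   by simp
 next
  fix \<pi> assume "\<pi> \<in> {\<pi>. \<pi> permutes R}"
  then have \<pi>: "\<pi> permutes R" by simp
  show "f \<circ> inv \<pi> \<in> {u. u permutes R}" using permutes_compose[OF permutes_inv[OF \<pi>] f] by simp
  have "inv (f \<circ> inv \<pi>) = \<pi> \<circ> inv f"
   using permutes_bij[OF f] permutes_bij[OF \<pi>] by (simp add: o_inv_distrib bij_imp_bij_inv inv_inv_eq)
  then show "inv (f \<circ> inv \<pi>) \<circ> f = \<pi>" using permutes_inv_o[OF f] by (simp add: comp_assoc)
 qed
 finally show ?thesis by simp
qed

lemma rowdet_columns_not_inj:
 assumes R: "finite R" and ij: "i \<in> R" "j \<in> R" "i \<noteq> j" "f i = f j"
 shows "(\<Sum>\<pi> | \<pi> permutes R. of_int (sign \<pi>) * (\<Prod>i\<in>R. Var (\<pi> i, f i))) = (0 :: ('r \<times> 'c) mp)"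
proof -
 have lp: "level_perms (\<lambda>_. 0) R = {\<pi>. \<pi> permutes R}" by (simp add: level_perms_def)
 let ?\<psi> = "\<lambda>\<pi>. \<Prod>i\<in>R. Var (\<pi> i, f i) :: ('r \<times> 'c) mp"
 have "?\<psi> (\<pi> \<circ> transpose i j) = ?\<psi> \<pi>" for \<pi>
 proof -
  have "(\<Prod>k\<in>R. Var (\<pi> k, f k)) = (\<Prod>k\<in>R. Var (\<pi> (transpose i j k), f (transpose i j k)))"
   using prod.reindex_bij_betw[OF permutes_imp_bij[OF permutes_swap_id[OF ij(1,2)]], of "\<lambda>k. Var (\<pi> k, f k)"] by simp
  moreover have "f (transpose i j k) = f k" for k using ij(4) by (simp add: transpose_def)
  ultimately show ?thesis by simp
 qed
 then have "(\<Sum>\<pi>\<in>level_perms (\<lambda>_. 0) R. of_int (sign \<pi>) * ?\<psi> \<pi>) = - (\<Sum>\<pi>\<in>level_perms (\<lambda>_. 0) R. of_int (sign \<pi>) * ?\<psi> \<pi>)"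
  by (intro sum_level_perms_cancel[OF R ij(1,2) refl ij(3)]) blast
 then show ?thesis unfolding lp by (rule mp_eq_uminus)
qed

context gaussian
begin

lemma Ex_0 [simp]: "Ex 0 = 0" using Ex_add[of 0 0] by simp

lemma Ex_sum: "Ex (\<Sum>i\<in>I. f i) = (\<Sum>i\<in>I. Ex (f i))" by (rule additive_sum) (auto simp: Ex_add)

lemma Ex_of_int: "Ex (of_int k * q) = of_int k * Ex q" by (rule additive_of_int_mult) (rule Ex_add)

lemma Ex_of_nat: "Ex (of_nat k * q) = of_nat k * Ex q" using Ex_of_int[of "int k" q] by simp

end

text \<open>One step of the expansion of a Gram determinant along a new row \<open>p\<close>: integrating that row by
 parts either closes up a colour loop, merges two rows, or differentiates \<open>F\<close>, which is a highest
 weight vector for the polarization operators.\<close>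

locale matrix_gaussian = gaussian bar s for bar :: "'r \<times> 'c \<Rightarrow> 'r \<times> 'c" and s
begin

lemma cayley_step:
 assumes fin: "finite Cs" "finite K" "p \<notin> K"
  and A: "\<And>c H. c \<in> Cs \<Longrightarrow> Ex (A c * H) = Ex (pd (p, c) H)"
  and Q1: "\<And>b q. b \<in> K \<Longrightarrow> q permutes K \<Longrightarrow> polar Cs b p (Q (transpose p b \<circ> q)) = Q q"
  and Q2: "\<And>q. q permutes K \<Longrightarrow> polar Cs p p (Q q) = 0"
  and F1: "\<And>b. b \<in> K \<Longrightarrow> polar Cs b p F = 0"
  and F2: "polar Cs p p F = of_nat d * F"
 shows "Ex ((\<Sum>\<pi> | \<pi> permutes insert p K. of_int (sign \<pi>) * ((\<Sum>c\<in>Cs. A c * Var (\<pi> p, c)) * Q \<pi>)) * F) =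
  (real (card Cs) - real (card K) + real d) * Ex ((\<Sum>q | q permutes K. of_int (sign q) * Q q) * F)"
proof -
 have one: "Ex ((\<Sum>c\<in>Cs. A c * Var (b, c)) * G) = (if b = p then real (card Cs) * Ex G else 0) + Ex (polar Cs b p G)" for b G
 proof -
  have "Ex ((\<Sum>c\<in>Cs. A c * Var (b, c)) * G) = (\<Sum>c\<in>Cs. Ex (pd (p, c) (Var (b, c) * G)))"
   unfolding sum_distrib_right Ex_sum using A by (intro sum.cong) (auto simp: mult.assoc)
  also have "\<dots> = (\<Sum>c\<in>Cs. (if b = p then Ex G else 0) + Ex (Var (b, c) * pd (p, c) G))"
   by (intro sum.cong) (auto simp: pd_mult pd_Var Ex_add)
  finally show ?thesis by (auto simp: sum.distrib polar_def Ex_sum)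
 qed
 have sg: "sign (transpose p b \<circ> q) = - sign q" if "b \<in> K" "q permutes K" for b q
  using that fin permutes_imp_permutation[OF fin(2) that(2)] by (auto simp: sign_compose sign_swap_id permutation_swap_id)
 let ?T = "\<lambda>\<pi>. of_int (sign \<pi>) * ((\<Sum>c\<in>Cs. A c * Var (\<pi> p, c)) * Q \<pi>)"
 have T1: "Ex (?T q * F) = (real (card Cs) + real d) * (of_int (sign q) * Ex (Q q * F))" if q: "q permutes K" for q
 proof -
  have "q p = p" using permutes_not_in[OF q fin(3)] .
  then have "Ex (?T q * F) = of_int (sign q) * Ex ((\<Sum>c\<in>Cs. A c * Var (p, c)) * (Q q * F))"
   by (simp add: mult.assoc Ex_of_int)
  also have "\<dots> = of_int (sign q) * (real (card Cs) * Ex (Q q * F) + Ex (of_nat d * (Q q * F)))"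
   unfolding one polar_mult Q2[OF q] F2 by (simp add: mult_ac)
  finally show ?thesis unfolding Ex_of_nat by (simp add: algebra_simps)
 qed
 have T2: "Ex (?T (transpose p b \<circ> q) * F) = - (of_int (sign q) * Ex (Q q * F))" if q: "q permutes K" and b: "b \<in> K" for b q
 proof -
  have "(transpose p b \<circ> q) p = b" using permutes_not_in[OF q fin(3)] by simp
  then have "Ex (?T (transpose p b \<circ> q) * F) =
    of_int (sign (transpose p b \<circ> q)) * Ex ((\<Sum>c\<in>Cs. A c * Var (b, c)) * (Q (transpose p b \<circ> q) * F))"
   by (simp add: mult.assoc Ex_of_int)
  also have "\<dots> = - of_int (sign q) * Ex (Q q * F)"
   unfolding one polar_mult Q1[OF b q] F1[OF b] sg[OF b q] using b fin(3) by auto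
  finally show ?thesis by simp
 qed
 \<comment> \<open>Permutations of \<open>insert p K\<close> are permutations \<open>q\<close> of
   \<open>K\<close>, multiplied by the identity or by a transposition of \<open>p\<close> with some
   \<open>b\<close> in \<open>K\<close>. The former give the factor \<open>card Cs + d\<close> by
   \<open>T1\<close>, each of the \<open>card K\<close> transpositions gives -1 by
   \<open>T2\<close>.\<close>
 have "Ex ((\<Sum>\<pi> | \<pi> permutes insert p K. ?T \<pi>) * F) = (\<Sum>b\<in>insert p K. \<Sum>q | q permutes K. Ex (?T (transpose p b \<circ> q) * F))"
  unfolding sum_over_permutations_insert[OF fin(2,3)] sum_distrib_right Ex_sum ..
 also have "\<dots> = (\<Sum>q | q permutes K. Ex (?T q * F)) + (\<Sum>b\<in>K. \<Sum>q | q permutes K. Ex (?T (transpose p b \<circ> q) * F))"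
  using fin by simp
 also have "\<dots> = (real (card Cs) + real d) * (\<Sum>q | q permutes K. of_int (sign q) * Ex (Q q * F)) +
   (\<Sum>b\<in>K. - (\<Sum>q | q permutes K. of_int (sign q) * Ex (Q q * F)))"
  using T1 T2 by (simp add: sum_distrib_left sum_negf)
 also have "(\<Sum>q | q permutes K. of_int (sign q) * Ex (Q q * F)) = Ex ((\<Sum>q | q permutes K. of_int (sign q) * Q q) * F)"
  unfolding sum_distrib_right Ex_sum by (intro sum.cong) (auto simp: mult.assoc Ex_of_int)
 finally show ?thesis by (simp add: algebra_simps)
qed

end

section \<open>Real Gaussian matrices and Gram determinants\<close>

interpretation rg: matrix_gaussian "\<lambda>v :: nat \<times> nat. v" "\<lambda>_. 1" by unfold_locales auto

definition gram :: "nat \<Rightarrow> nat \<Rightarrow> nat \<Rightarrow> (nat \<times> nat) mp" where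
 "gram N a b = (\<Sum>c<N. Var (a, c) * Var (b, c))"

definition gram_det :: "nat \<Rightarrow> nat \<Rightarrow> (nat \<times> nat) mp" where
 "gram_det N k = (\<Sum>\<pi> | \<pi> permutes {..<k}. of_int (sign \<pi>) * (\<Prod>i<k. gram N i (\<pi> i)))"

lemma polar_gram: "polar {..<N} l p (gram N a b) = (if a = p then gram N l b else 0) + (if b = p then gram N a l else 0)"
proof -
 have "polar {..<N} l p (gram N a b) = (\<Sum>c<N. (if a = p then Var (l, c) * Var (b, c) else 0) + (if b = p then Var (a, c) * Var (l, c) else 0))"
  unfolding gram_def polar_sum polar_mult by (intro sum.cong) (auto simp: polar_Var)
 then show ?thesis by (simp add: gram_def sum.distrib)
qed

text \<open>Row \<open>k\<close> occurs as a first and as a second index. The occurrence as first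
  index is integrated by parts, so \<open>Var (k, c)\<close> plays the role of \<open>A c\<close>,
  and the second index is moved by the permutation.\<close>

lemma gram_det_step:
 assumes "\<And>b. b < k \<Longrightarrow> polar {..<N} b k F = 0" "polar {..<N} k k F = of_nat d * F"
 shows "rg.Ex (gram_det N (Suc k) * F) = (real N - real k + real d) * rg.Ex (gram_det N k * F)"
proof -
 let ?Q = "\<lambda>\<pi> :: nat \<Rightarrow> nat. \<Prod>i<k. gram N i (\<pi> i)"
 have pq: "polar {..<N} l k (?Q \<pi>) = (\<Sum>i<k. (if \<pi> i = k then gram N i l else 0) * (\<Prod>j\<in>{..<k} - {i}. gram N j (\<pi> j)))" for l \<pi>
  by (subst polar_prod) (auto simp: polar_gram intro!: sum.cong)
 have "rg.Ex ((\<Sum>\<pi> | \<pi> permutes insert k {..<k}. of_int (sign \<pi>) * ((\<Sum>c<N. Var (k, c) * Var (\<pi> k, c)) * ?Q \<pi>)) * F) =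
  (real (card {..<N}) - real (card {..<k}) + real d) * rg.Ex ((\<Sum>q | q permutes {..<k}. of_int (sign q) * ?Q q) * F)"
 proof (rule rg.cayley_step)
  show "rg.Ex (Var (k, c) * H) = rg.Ex (pd (k, c) H)" for c H using rg.Ex_by_parts[of "(k, c)" H] by simp
  show "polar {..<N} k k (?Q q) = 0" if q: "q permutes {..<k}" for q unfolding pq
  proof (rule sum.neutral, rule ballI)
   fix i assume "i \<in> {..<k}"
   then have "q i \<noteq> k" using permutes_in_image[OF q, of i] by auto
   then show "(if q i = k then gram N i k else 0) * (\<Prod>j\<in>{..<k} - {i}. gram N j (q j)) = 0" by simp
  qed
  show "polar {..<N} b k (?Q (transpose k b \<circ> q)) = ?Q q" if b: "b \<in> {..<k}" and q: "q permutes {..<k}" for b q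
  proof -
   let ?\<pi> = "transpose k b \<circ> q"
   obtain i0 where i0: "i0 < k" "q i0 = b" using b permutes_image[OF q] by (metis imageE lessThan_iff)
   have qlt: "q i < k" if "i < k" for i using permutes_in_image[OF q, of i] that by simp
   have qi: "q i = b \<longleftrightarrow> i = i0" for i using i0(2) injD[OF permutes_inj[OF q], of i i0] by auto
   have pk: "?\<pi> i = k \<longleftrightarrow> i = i0" if "i < k" for i
    using qi[of i] qlt[OF that] b by (simp add: transpose_def)
   have pe: "?\<pi> i = q i" if "i < k" "i \<noteq> i0" for i
    using qi[of i] qlt[OF that(1)] that(2) by (simp add: transpose_def)
   have "polar {..<N} b k (?Q ?\<pi>) = (\<Sum>i<k. if i = i0 then gram N i0 b * (\<Prod>j\<in>{..<k} - {i0}. gram N j (?\<pi> j)) else 0)"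
    unfolding pq using pk by (intro sum.cong) auto
   also have "\<dots> = gram N i0 (q i0) * (\<Prod>j\<in>{..<k} - {i0}. gram N j (?\<pi> j))" using i0 by simp
   also have "(\<Prod>j\<in>{..<k} - {i0}. gram N j (?\<pi> j)) = (\<Prod>j\<in>{..<k} - {i0}. gram N j (q j))"
    using pe by (intro prod.cong) auto
   finally show ?thesis using i0 prod.remove[of "{..<k}" i0 "\<lambda>j. gram N j (q j)"] by simp
  qed
 qed (use assms in auto)
 moreover have "insert k {..<k} = {..<Suc k}" by auto
 ultimately show ?thesis by (simp add: gram_det_def gram_def mult_ac)
qed

text \<open>det(X X^T) = (det X)^2 for a square matrix: the entries are expanded over choices
  \<open>f\<close> of columns, and only permutations survive.\<close>

lemma gram_det_full: "gram_det N N = rowdet {..<N} * rowdet {..<N}"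
proof -
 let ?R = "{..<N}"
 have "gram_det N N = (\<Sum>\<pi> | \<pi> permutes ?R. \<Sum>f\<in>?R \<rightarrow>\<^sub>E ?R. (\<Prod>i\<in>?R. Var (i, f i)) * (of_int (sign \<pi>) * (\<Prod>i\<in>?R. Var (\<pi> i, f i))))"
  unfolding gram_det_def gram_def
  by (subst prod_sum_PiE) (auto simp: sum_distrib_left prod.distrib mult_ac intro!: sum.cong)
 also have "\<dots> = (\<Sum>f\<in>?R \<rightarrow>\<^sub>E ?R. (\<Prod>i\<in>?R. Var (i, f i)) * (\<Sum>\<pi> | \<pi> permutes ?R. of_int (sign \<pi>) * (\<Prod>i\<in>?R. Var (\<pi> i, f i))))"
  by (subst sum.swap) (simp add: sum_distrib_left)
 also have "\<dots> = (\<Sum>f | f \<in> ?R \<rightarrow>\<^sub>E ?R \<and> inj_on f ?R. (\<Prod>i\<in>?R. Var (i, f i)) * (\<Sum>\<pi> | \<pi> permutes ?R. of_int (sign \<pi>) * (\<Prod>i\<in>?R. Var (\<pi> i, f i))))"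
 proof (rule sum.mono_neutral_right)
  show "\<forall>f\<in>(?R \<rightarrow>\<^sub>E ?R) - {f. f \<in> ?R \<rightarrow>\<^sub>E ?R \<and> inj_on f ?R}.
    (\<Prod>i\<in>?R. Var (i, f i)) * (\<Sum>\<pi> | \<pi> permutes ?R. of_int (sign \<pi>) * (\<Prod>i\<in>?R. Var (\<pi> i, f i))) = 0"
  proof
   fix f assume "f \<in> (?R \<rightarrow>\<^sub>E ?R) - {f. f \<in> ?R \<rightarrow>\<^sub>E ?R \<and> inj_on f ?R}"
   then obtain i j where "i \<in> ?R" "j \<in> ?R" "i \<noteq> j" "f i = f j" by (auto simp: inj_on_def)
   from rowdet_columns_not_inj[OF _ this] show "(\<Prod>i\<in>?R. Var (i, f i)) * (\<Sum>\<pi> | \<pi> permutes ?R. of_int (sign \<pi>) * (\<Prod>i\<in>?R. Var (\<pi> i, f i))) = 0"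
    by simp
  qed
 qed (auto intro: finite_PiE)
 also have "\<dots> = (\<Sum>u | u permutes ?R. (\<Prod>i\<in>?R. Var (i, u i)) * (of_int (sign u) * rowdet ?R))"
 proof (rule sum.reindex_bij_witness[where j = "\<lambda>f. restrict_id f ?R" and i = "\<lambda>u. restrict u ?R"])
  fix f assume "f \<in> {f. f \<in> ?R \<rightarrow>\<^sub>E ?R \<and> inj_on f ?R}"
  then have f: "f \<in> ?R \<rightarrow>\<^sub>E ?R" "inj_on f ?R" by auto
  have "f ` ?R \<subseteq> ?R" using f(1) by auto
  then have "bij_betw f ?R ?R" using f(2) endo_inj_surj[of ?R f] by (simp add: bij_betw_def)
  then have p: "restrict_id f ?R permutes ?R" by (rule permutes_restrict_id)
  then show "restrict_id f ?R \<in> {u. u permutes ?R}" by simp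
  show "restrict (restrict_id f ?R) ?R = f" using f(1) by (intro ext) (auto simp: PiE_def extensional_def restrict_def)
  have "(\<Sum>\<pi> | \<pi> permutes ?R. of_int (sign \<pi>) * (\<Prod>i\<in>?R. Var (\<pi> i, f i))) =
    (\<Sum>\<pi> | \<pi> permutes ?R. of_int (sign \<pi>) * (\<Prod>i\<in>?R. Var (\<pi> i, restrict_id f ?R i)))"
   by (intro sum.cong refl) simp
  also have "\<dots> = of_int (sign (restrict_id f ?R)) * rowdet ?R" by (rule rowdet_columns_inj[OF _ p]) simp
  finally show "(\<Prod>i\<in>?R. Var (i, restrict_id f ?R i)) * (of_int (sign (restrict_id f ?R)) * rowdet ?R) =
    (\<Prod>i\<in>?R. Var (i, f i)) * (\<Sum>\<pi> | \<pi> permutes ?R. of_int (sign \<pi>) * (\<Prod>i\<in>?R. Var (\<pi> i, f i)))" by simp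
 next
  fix u assume "u \<in> {u. u permutes ?R}"
  then have u: "u permutes ?R" by simp
  show "restrict_id (restrict u ?R) ?R = u" using permutes_not_in[OF u] by (auto simp: fun_eq_iff restrict_id_def)
  show "restrict u ?R \<in> {f. f \<in> ?R \<rightarrow>\<^sub>E ?R \<and> inj_on f ?R}"
   using permutes_in_image[OF u] permutes_inj_on[OF u, of ?R] by (auto simp: inj_on_def)
 qed
 also have "\<dots> = rowdet ?R * rowdet ?R"
  unfolding rowdet_def[of ?R] sum_distrib_right by (intro sum.cong) (auto simp: mult_ac)
 finally show ?thesis .
qed

text \<open>The squared determinant is the full Gram determinant, from which the rows are integrated
  out starting with the last; each leaves its own scalar factor.\<close>

lemma real_first_column:
 assumes "\<And>b k. b < k \<Longrightarrow> k < N \<Longrightarrow> polar {..<N} b k F = 0"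
  and "\<And>k. k < N \<Longrightarrow> polar {..<N} k k F = of_nat (d k) * F"
 shows "rg.Ex (rowdet {..<N} * rowdet {..<N} * F) = (\<Prod>k<N. real N - real k + real (d k)) * rg.Ex F"
proof -
 have "rg.Ex (gram_det N k * F) = (\<Prod>k<k. real N - real k + real (d k)) * rg.Ex F" if "k \<le> N" for k
  using that
 proof (induction k)
  case 0
  show ?case by (simp add: gram_det_def)
 next
  case (Suc k)
  then show ?case using gram_det_step[of k N F "d k"] assms by simp
 qed
 from this[of N] show ?thesis by (simp add: gram_det_full)
qed

section \<open>Quaternionic Gaussian matrices and Pfaffians\<close>

definition layer_perm :: "('d \<Rightarrow> 'd) \<Rightarrow> ('d \<Rightarrow> 'd) \<Rightarrow> 'd \<times> bool \<Rightarrow> 'd \<times> bool" where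
 "layer_perm f g = (\<lambda>(d, e). (if e then g d else f d, e))"

definition flip_perm :: "'d set \<Rightarrow> 'd \<times> bool \<Rightarrow> 'd \<times> bool" where
 "flip_perm G = (\<lambda>(d, e). (d, if d \<in> G then \<not> e else e))"

lemma layer_perm:
 assumes D: "finite D" and f: "f permutes D" and g: "g permutes D"
 shows "layer_perm f g permutes D \<times> UNIV" "sign (layer_perm f g) = sign f * sign g"
proof -
 let ?F = "map_permutation D (\<lambda>d. (d, False)) f" and ?G = "map_permutation D (\<lambda>d. (d, True)) g"
 have inj: "inj_on (\<lambda>d. (d, e)) D" for e :: bool by (auto simp: inj_on_def)
 have bij: "bij_betw (\<lambda>d. (d, e)) D (D \<times> {e})" for e :: bool by (auto simp: bij_betw_def inj_on_def)
 have pF: "?F permutes D \<times> UNIV" "?G permutes D \<times> UNIV"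
  by (rule permutes_subset[OF map_permutation_permutes[OF bij f]], auto)
    (rule permutes_subset[OF map_permutation_permutes[OF bij g]], auto)
 have aF: "?F (d, False) = (f d, False)" "?G (d, True) = (g d, True)" for d
  using permutes_not_in[OF f, of d] permutes_not_in[OF g, of d] inv_into_f_f[OF inj, of d]
  by (cases "d \<in> D"; auto simp: map_permutation_def restrict_id_def)+
 have aG: "?F (d, True) = (d, True)" "?G (d, False) = (d, False)" for d
  by (auto simp: map_permutation_def restrict_id_def)
 have eq: "layer_perm f g = ?F \<circ> ?G"
 proof
  fix u show "layer_perm f g u = (?F \<circ> ?G) u" by (cases u; cases "snd u") (auto simp: layer_perm_def aF aG)
 qed
 show "layer_perm f g permutes D \<times> UNIV" unfolding eq using permutes_compose[OF pF(2,1)] .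
 have "sign (?F \<circ> ?G) = sign ?F * sign ?G"
  using permutes_imp_permutation[OF _ pF(1)] permutes_imp_permutation[OF _ pF(2)] D by (intro sign_compose) simp_all
 then show "sign (layer_perm f g) = sign f * sign g"
  unfolding eq using sign_map_permutation[OF inj f D] sign_map_permutation[OF inj g D] by simp
qed

lemma flip_perm:
 assumes "finite G" "G \<subseteq> D" "finite D"
 shows "flip_perm G permutes D \<times> UNIV" "sign (flip_perm G) = (-1) ^ card G"
proof -
 have "flip_perm G permutes D \<times> UNIV \<and> sign (flip_perm G) = (-1) ^ card G" using assms(1,2)
 proof (induction G rule: finite_induct)
  case empty
  have "flip_perm ({} :: 'a set) = id" by (auto simp: flip_perm_def)
  then show ?case using permutes_id[of "D \<times> (UNIV :: bool set)"] by (simp add: id_def)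
 next
  case (insert x G)
  have eq: "flip_perm (insert x G) = transpose (x, False) (x, True) \<circ> flip_perm G"
  proof
   fix u show "flip_perm (insert x G) u = (transpose (x, False) (x, True) \<circ> flip_perm G) u"
    using insert.hyps(2) by (cases u; cases "snd u") (auto simp: flip_perm_def transpose_def)
  qed
  have p: "flip_perm G permutes D \<times> UNIV" and s: "sign (flip_perm G) = (-1) ^ card G" using insert by auto
  have t: "transpose (x, False) (x, True) permutes D \<times> UNIV" using insert.prems by (intro permutes_swap_id) auto
  have "sign (flip_perm (insert x G)) = sign (transpose (x, False) (x, True)) * sign (flip_perm G)"
   unfolding eq using permutes_imp_permutation[OF _ p] assms(3) by (intro sign_compose permutation_swap_id) simp
  then have "sign (flip_perm (insert x G)) = (-1) ^ card (insert x G)" using s insert.hyps by (simp add: sign_swap_id)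
  moreover have "flip_perm (insert x G) permutes D \<times> UNIV" unfolding eq using permutes_compose[OF p t] .
  ultimately show ?case by blast
 qed
 then show "flip_perm G permutes D \<times> UNIV" "sign (flip_perm G) = (-1) ^ card G" by auto
qed

definition sgb :: "bool \<Rightarrow> int" where
 "sgb e = (if e then -1 else 1)"

text \<open>The conjugate index under the symplectic form; \<open>sgb\<close> is the sign of the
  form.\<close>

definition nb :: "nat \<times> bool \<Rightarrow> nat \<times> bool" where
 "nb q = (fst q, \<not> snd q)"

lemma nb_nb [simp]: "nb (nb q) = q" by (simp add: nb_def)

definition jbar :: "(nat \<times> bool) \<times> (nat \<times> bool) \<Rightarrow> (nat \<times> bool) \<times> (nat \<times> bool)" where
 "jbar v = (nb (fst v), nb (snd v))"

definition js :: "(nat \<times> bool) \<times> (nat \<times> bool) \<Rightarrow> real" where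
 "js v = of_int (sgb (snd (fst v)) * sgb (snd (snd v)))"

text \<open>The covariance is the tensor square of a symplectic form.\<close>

interpretation qg: matrix_gaussian jbar js by unfold_locales (auto simp: jbar_def js_def nb_def sgb_def)

definition spin :: "nat \<Rightarrow> (nat \<times> bool) set" where
 "spin n = {..<n} \<times> UNIV"

lemma finite_spin [simp]: "finite (spin n)" by (simp add: spin_def)

lemma nb_in_spin [simp]: "nb q \<in> spin n \<longleftrightarrow> q \<in> spin n" by (cases q) (simp add: nb_def spin_def)

type_synonym jmp = "((nat \<times> bool) \<times> (nat \<times> bool)) mp"

text \<open>The entries of X J X^T with J the symplectic form. The matrix is antisymmetric, so the
  Gram determinant of the real case is replaced by a Pfaffian.\<close>

definition jgram :: "nat \<Rightarrow> nat \<times> bool \<Rightarrow> nat \<times> bool \<Rightarrow> jmp" where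
 "jgram N a b = (\<Sum>q\<in>spin N. of_int (sgb (snd q)) * (Var (a, q) * Var (b, nb q)))"

lemma jgram_antisym: "jgram N b a = - jgram N a b"
proof -
 have "jgram N b a = (\<Sum>q\<in>spin N. of_int (sgb (snd (nb q))) * (Var (b, nb q) * Var (a, nb (nb q))))"
  unfolding jgram_def by (rule sum.reindex_bij_witness[where i = nb and j = nb]) auto
 also have "\<dots> = (\<Sum>q\<in>spin N. - (of_int (sgb (snd q)) * (Var (a, q) * Var (b, nb q))))"
  by (intro sum.cong) (auto simp: nb_def sgb_def mult_ac)
 finally show ?thesis by (simp add: jgram_def sum_negf)
qed

lemma polar_jgram: "polar (spin N) l p (jgram N a b) = (if a = p then jgram N l b else 0) + (if b = p then jgram N a l else 0)"
proof -
 have "polar (spin N) l p (jgram N a b) = (\<Sum>q\<in>spin N.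
   (if a = p then of_int (sgb (snd q)) * (Var (l, q) * Var (b, nb q)) else 0) +
   (if b = p then of_int (sgb (snd q)) * (Var (a, q) * Var (l, nb q)) else 0))"
  unfolding jgram_def polar_sum polar_of_int by (intro sum.cong) (auto simp: polar_mult polar_Var distrib_left)
 then show ?thesis by (simp add: jgram_def sum.distrib)
qed

definition jpf_term :: "nat \<Rightarrow> nat \<Rightarrow> (nat \<times> bool \<Rightarrow> nat \<times> bool) \<Rightarrow> jmp" where
 "jpf_term N k \<pi> = (\<Prod>i<k. jgram N (\<pi> (i, False)) (\<pi> (i, True)))"

text \<open>The Pfaffian of the block indexed by \<open>spin k\<close>, multiplied by
  \<open>2 ^ k * fact k\<close>, because the sum runs over permutations instead of pairings.\<close>

definition jpf :: "nat \<Rightarrow> nat \<Rightarrow> jmp" where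
 "jpf N k = (\<Sum>\<pi> | \<pi> permutes spin k. of_int (sign \<pi>) * jpf_term N k \<pi>)"

text \<open>The summand is invariant under permuting and flipping the pairs of positions, so the last
 row may be assumed to sit in the last position.\<close>

lemma jpf_position:
 assumes z: "z \<in> spin (Suc k)"
 shows "(\<Sum>\<pi> | \<pi> permutes spin (Suc k) \<and> \<pi> z = (k, True). of_int (sign \<pi>) * jpf_term N (Suc k) \<pi>) =
  (\<Sum>\<pi> | \<pi> permutes spin (Suc k) \<and> \<pi> (k, True) = (k, True). of_int (sign \<pi>) * jpf_term N (Suc k) \<pi>)"
proof -
 obtain j e where je: "z = (j, e)" "j < Suc k" using z by (auto simp: spin_def)
 \<comment> \<open>\<rho> is an involution exchanging \<open>z\<close> with the last position
   \<open>(k, True)\<close>. If the spin of \<open>z\<close> is \<open>False\<close>, both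
   \<open>j\<close> and \<open>k\<close> are flipped; every flip costs a sign in
   \<open>jgram\<close> and one in \<open>sign \<rho>\<close>, and these cancel.\<close>
 let ?t = "transpose j k" and ?G = "if e then {} else {j, k}"
 define \<rho> where "\<rho> = layer_perm ?t ?t \<circ> flip_perm ?G"
 have tp: "?t permutes {..<Suc k}" using je by (intro permutes_swap_id) auto
 have lp: "layer_perm ?t ?t permutes spin (Suc k)" "sign (layer_perm ?t ?t) = 1"
  using layer_perm[OF _ tp tp] by (auto simp: spin_def)
 have fp: "flip_perm ?G permutes spin (Suc k)" "sign (flip_perm ?G) = (-1) ^ card ?G"
  using flip_perm[of ?G "{..<Suc k}"] je by (auto simp: spin_def)
 have \<rho>p: "\<rho> permutes spin (Suc k)" unfolding \<rho>_def using permutes_compose[OF fp(1) lp(1)] .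
 have perm: "permutation \<pi>" if "\<pi> permutes spin (Suc k)" for \<pi> :: "nat \<times> bool \<Rightarrow> nat \<times> bool"
  using permutes_imp_permutation[OF finite_spin that] .
 have \<rho>s: "sign \<rho> = (-1) ^ card ?G"
  unfolding \<rho>_def using sign_compose[OF perm[OF lp(1)] perm[OF fp(1)]] lp(2) fp(2) by simp
 have \<rho>a: "\<rho> (i, b) = (?t i, if i \<in> ?G then \<not> b else b)" for i b
  by (simp add: \<rho>_def layer_perm_def flip_perm_def)
 have \<rho>\<rho>: "\<rho> (\<rho> u) = u" for u
 proof (cases u)
  case (Pair i b)
  have "?t i \<in> ?G \<longleftrightarrow> i \<in> ?G" by (auto simp: transpose_def)
  then show ?thesis by (auto simp: Pair \<rho>a)
 qed
 have \<rho>k: "\<rho> (k, True) = z" using je(1) by (cases e) (simp_all add: \<rho>a)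
 then have \<rho>k: "\<rho> (k, True) = z" "\<rho> z = (k, True)" using \<rho>\<rho>[of "(k, True)"] by simp_all
 have trm: "jpf_term N (Suc k) (\<pi> \<circ> \<rho>) = of_int ((-1) ^ card ?G) * jpf_term N (Suc k) \<pi>" for \<pi>
 proof -
  have "jpf_term N (Suc k) (\<pi> \<circ> \<rho>) = (\<Prod>i<Suc k. (if i \<in> ?G then -1 else 1) * jgram N (\<pi> (?t i, False)) (\<pi> (?t i, True)))"
   unfolding jpf_term_def
  proof (rule prod.cong[OF refl])
   fix i
   show "jgram N ((\<pi> \<circ> \<rho>) (i, False)) ((\<pi> \<circ> \<rho>) (i, True)) =
     (if i \<in> ?G then -1 else 1) * jgram N (\<pi> (?t i, False)) (\<pi> (?t i, True))"
   proof (cases "i \<in> ?G")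
    case True
    then show ?thesis unfolding comp_apply \<rho>a if_P[OF True] by (subst jgram_antisym) simp
   next
    case False
    then show ?thesis unfolding comp_apply \<rho>a if_not_P[OF False] by simp
   qed
  qed
  also have "\<dots> = (\<Prod>i<Suc k. if i \<in> ?G then -1 else 1) * (\<Prod>i<Suc k. jgram N (\<pi> (?t i, False)) (\<pi> (?t i, True)))"
   by (rule prod.distrib)
  also have "(\<Prod>i<Suc k. jgram N (\<pi> (?t i, False)) (\<pi> (?t i, True))) = jpf_term N (Suc k) \<pi>"
   unfolding jpf_term_def
   using prod.reindex_bij_betw[OF permutes_imp_bij[OF tp], of "\<lambda>i. jgram N (\<pi> (i, False)) (\<pi> (i, True))"] .
  also have "(\<Prod>i<Suc k. if i \<in> ?G then -1 else 1) = (of_int ((-1) ^ card ?G) :: jmp)"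
  proof -
   have "{..<Suc k} \<inter> {i. i \<in> ?G} = ?G" using je by auto
   moreover have "(\<Prod>i<Suc k. if i \<in> ?G then -1 else 1 :: jmp) =
     (\<Prod>i\<in>{..<Suc k} \<inter> {i. i \<in> ?G}. -1) * (\<Prod>i\<in>{..<Suc k} \<inter> - {i. i \<in> ?G}. 1)"
    by (rule prod.If_cases) simp
   ultimately show ?thesis by (simp only: prod_constant power_one mult_1_right of_int_power of_int_minus of_int_1)
  qed
  finally show ?thesis .
 qed
 have inv: "of_int (sign (\<pi> \<circ> \<rho>)) * jpf_term N (Suc k) (\<pi> \<circ> \<rho>) = of_int (sign \<pi>) * jpf_term N (Suc k) \<pi>"
  if "\<pi> permutes spin (Suc k)" for \<pi>
 proof -
  have "sign (\<pi> \<circ> \<rho>) = sign \<pi> * (-1) ^ card ?G" using sign_compose[OF perm[OF that] perm[OF \<rho>p]] \<rho>s by simp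
  moreover have "of_int ((-1) ^ card ?G) * of_int ((-1) ^ card ?G) = (1 :: jmp)" by (simp flip: power_mult_distrib)
  ultimately have "of_int (sign (\<pi> \<circ> \<rho>)) * of_int ((-1) ^ card ?G) = (of_int (sign \<pi>) :: jmp)"
   by (simp only: of_int_mult mult.assoc mult_1_right)
  then show ?thesis unfolding trm mult.assoc[symmetric] by simp
 qed
 show ?thesis
  by (rule sum.reindex_bij_witness[where i = "\<lambda>\<pi>. \<pi> \<circ> \<rho>" and j = "\<lambda>\<pi>. \<pi> \<circ> \<rho>"])
    (use inv \<rho>\<rho> \<rho>k permutes_compose[OF \<rho>p] in \<open>auto simp: fun_eq_iff\<close>)
qed

text \<open>All \<open>2 * Suc k\<close> positions of the row \<open>(k, True)\<close> contribute
  equally by \<open>jpf_position\<close>. It is therefore kept in the last place, and only the other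
  rows are permuted.\<close>

lemma jpf_Suc:
 "jpf N (Suc k) = of_nat (2 * Suc k) *
  (\<Sum>\<pi> | \<pi> permutes insert (k, False) (spin k). of_int (sign \<pi>) * (jgram N (\<pi> (k, False)) (k, True) * jpf_term N k \<pi>))"
proof -
 let ?a = "(k, True)" and ?R = "spin (Suc k)" and ?S0 = "insert (k, False) (spin k)"
 let ?f = "\<lambda>\<pi>. of_int (sign \<pi>) * jpf_term N (Suc k) \<pi>"
 have R: "?R = insert ?a ?S0" by (auto simp: spin_def)
 have a: "?a \<notin> ?S0" by (auto simp: spin_def)
 have fin: "finite {\<pi>. \<pi> permutes ?R}" by (rule finite_permutations) simp
 have "jpf N (Suc k) = (\<Sum>z\<in>?R. \<Sum>\<pi> | \<pi> \<in> {\<pi>. \<pi> permutes ?R} \<and> inv \<pi> ?a = z. ?f \<pi>)"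
  unfolding jpf_def
 proof (rule sum.group[symmetric, OF fin])
  show "(\<lambda>\<pi>. inv \<pi> ?a) ` {\<pi>. \<pi> permutes ?R} \<subseteq> ?R"
  proof (rule image_subsetI)
   fix \<pi> assume "\<pi> \<in> {\<pi>. \<pi> permutes ?R}"
   then have "inv \<pi> permutes ?R" by (simp add: permutes_inv)
   then show "inv \<pi> ?a \<in> ?R" using permutes_in_image[of "inv \<pi>" ?R ?a] by (simp add: spin_def)
  qed
 qed simp
 also have "\<dots> = (\<Sum>z\<in>?R. \<Sum>\<pi> | \<pi> permutes ?R \<and> \<pi> z = ?a. ?f \<pi>)"
 proof (intro sum.cong refl)
  fix z
  show "{\<pi> \<in> {\<pi>. \<pi> permutes ?R}. inv \<pi> ?a = z} = {\<pi>. \<pi> permutes ?R \<and> \<pi> z = ?a}"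
   using permutes_inv_eq by fastforce
 qed
 also have "\<dots> = (\<Sum>z\<in>?R. \<Sum>\<pi> | \<pi> permutes ?R \<and> \<pi> ?a = ?a. ?f \<pi>)"
  by (rule sum.cong[OF refl], rule jpf_position)
 also have "\<dots> = of_nat (2 * Suc k) * (\<Sum>\<pi> | \<pi> permutes ?R \<and> \<pi> ?a = ?a. ?f \<pi>)"
  by (simp add: spin_def card_cartesian_product mult.commute)
 also have "{\<pi>. \<pi> permutes ?R \<and> \<pi> ?a = ?a} = {\<pi>. \<pi> permutes ?S0}"
 proof (intro equalityI subsetI)
  fix \<pi> assume "\<pi> \<in> {\<pi>. \<pi> permutes ?R \<and> \<pi> ?a = ?a}"
  then show "\<pi> \<in> {\<pi>. \<pi> permutes ?S0}" unfolding R by (auto intro: permutes_superset)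
 next
  fix \<pi> assume "\<pi> \<in> {\<pi>. \<pi> permutes ?S0}"
  then have "\<pi> permutes ?S0" by simp
  then show "\<pi> \<in> {\<pi>. \<pi> permutes ?R \<and> \<pi> ?a = ?a}"
   unfolding R using permutes_not_in[of \<pi> ?S0 ?a] a permutes_subset[of \<pi> ?S0 "insert ?a ?S0"] by auto
 qed
 also have "(\<Sum>\<pi> | \<pi> permutes ?S0. ?f \<pi>) =
   (\<Sum>\<pi> | \<pi> permutes ?S0. of_int (sign \<pi>) * (jgram N (\<pi> (k, False)) (k, True) * jpf_term N k \<pi>))"
 proof (intro sum.cong refl)
  fix \<pi> assume "\<pi> \<in> {\<pi>. \<pi> permutes ?S0}"
  then have "\<pi> ?a = ?a" using permutes_not_in[of \<pi> ?S0 ?a] a by simp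
  then show "?f \<pi> = of_int (sign \<pi>) * (jgram N (\<pi> (k, False)) (k, True) * jpf_term N k \<pi>)"
   by (simp add: jpf_term_def mult_ac)
 qed
 finally show ?thesis .
qed

text \<open>Row \<open>(k, True)\<close> is fixed and row \<open>(k, False)\<close> moves.
  Multiplication by a variable of the fixed row is, up to the symplectic sign, the derivative in row
  \<open>(k, False)\<close>, so \<open>cayley_step\<close> applies with \<open>spin N\<close> as set
  of columns; its doubled size explains the factors 2.\<close>

lemma jpf_step:
 assumes "\<And>b. b \<in> spin k \<Longrightarrow> polar (spin N) b (k, False) F = 0" "polar (spin N) (k, False) (k, False) F = of_nat d * F"
 shows "qg.Ex (jpf N (Suc k) * F) = real (2 * Suc k) * (2 * real N - 2 * real k + real d) * qg.Ex (jpf N k * F)"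
proof -
 let ?p = "(k, False)" and ?A = "\<lambda>q. of_int (sgb (snd q)) * Var ((k, True), nb q)"
 have pq: "polar (spin N) l p (jpf_term N k \<pi>) = (\<Sum>i<k. ((if \<pi> (i, False) = p then jgram N l (\<pi> (i, True)) else 0) +
   (if \<pi> (i, True) = p then jgram N (\<pi> (i, False)) l else 0)) * (\<Prod>j\<in>{..<k} - {i}. jgram N (\<pi> (j, False)) (\<pi> (j, True))))" for l p \<pi>
  unfolding jpf_term_def by (subst polar_prod) (auto simp: polar_jgram intro!: sum.cong)
 have "qg.Ex ((\<Sum>\<pi> | \<pi> permutes insert ?p (spin k). of_int (sign \<pi>) * ((\<Sum>c\<in>spin N. ?A c * Var (\<pi> ?p, c)) * jpf_term N k \<pi>)) * F) =
  (real (card (spin N)) - real (card (spin k)) + real d) * qg.Ex ((\<Sum>q | q permutes spin k. of_int (sign q) * jpf_term N k q) * F)"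
 proof (rule qg.cayley_step)
  show "qg.Ex (?A c * H) = qg.Ex (pd (?p, c) H)" for c H
  proof -
   have "qg.Ex (?A c * H) = of_int (sgb (snd c)) * (js ((k, True), nb c) * qg.Ex (pd (jbar ((k, True), nb c)) H))"
    by (simp add: mult.assoc qg.Ex_of_int qg.Ex_by_parts)
   also have "jbar ((k, True), nb c) = (?p, c)" by (simp add: jbar_def nb_def)
   also have "js ((k, True), nb c) = of_int (sgb (snd c))" by (simp add: js_def nb_def sgb_def)
   finally show ?thesis by (simp add: sgb_def split: if_splits)
  qed
  show "?p \<notin> spin k" by (simp add: spin_def)
  show "polar (spin N) ?p ?p (jpf_term N k q) = 0" if q: "q permutes spin k" for q unfolding pq
  proof (rule sum.neutral, rule ballI)
   fix i assume "i \<in> {..<k}"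
   then have "q (i, e) \<noteq> ?p" for e using permutes_in_image[OF q, of "(i, e)"] by (auto simp: spin_def)
   then show "((if q (i, False) = ?p then jgram N ?p (q (i, True)) else 0) + (if q (i, True) = ?p then jgram N (q (i, False)) ?p else 0)) *
     (\<Prod>j\<in>{..<k} - {i}. jgram N (q (j, False)) (q (j, True))) = 0" by simp
  qed
  show "polar (spin N) b ?p (jpf_term N k (transpose ?p b \<circ> q)) = jpf_term N k q" if b: "b \<in> spin k" and q: "q permutes spin k" for b q
  proof -
   let ?\<pi> = "transpose ?p b \<circ> q"
   have "b \<in> q ` spin k" using b permutes_image[OF q] by simp
   then obtain u where "u \<in> spin k" "q u = b" by blast
   then obtain i0 e0 where z: "i0 < k" "q (i0, e0) = b" by (cases u) (auto simp: spin_def)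
   have qin: "q (i, e) \<in> spin k" if "i < k" for i e using permutes_in_image[OF q, of "(i, e)"] that by (simp add: spin_def)
   have pn: "?p \<notin> spin k" by (simp add: spin_def)
   have qi: "q u = b \<longleftrightarrow> u = (i0, e0)" for u using z(2) injD[OF permutes_inj[OF q], of u "(i0, e0)"] by auto
   have bp: "b \<noteq> ?p" using b pn by auto
   have pk: "?\<pi> (i, e) = ?p \<longleftrightarrow> (i, e) = (i0, e0)" if "i < k" for i e
   proof -
    have "q (i, e) \<noteq> ?p" using qin[OF that, of e] pn by auto
    then show ?thesis using qi[of "(i, e)"] bp by (simp add: transpose_def)
   qed
   have pe: "?\<pi> (i, e) = q (i, e)" if "i < k" "(i, e) \<noteq> (i0, e0)" for i e
   proof -
    have "q (i, e) \<noteq> ?p" using qin[OF that(1), of e] pn by auto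
    moreover have "q (i, e) \<noteq> b" using qi[of "(i, e)"] that(2) by simp
    ultimately show ?thesis by (simp add: transpose_def)
   qed
   have "polar (spin N) b ?p (jpf_term N k ?\<pi>) = (\<Sum>i<k. if i = i0 then
     jgram N (q (i0, False)) (q (i0, True)) * (\<Prod>j\<in>{..<k} - {i0}. jgram N (?\<pi> (j, False)) (?\<pi> (j, True))) else 0)"
    unfolding pq
   proof (intro sum.cong refl)
    fix i assume i: "i \<in> {..<k}"
    show "((if ?\<pi> (i, False) = ?p then jgram N b (?\<pi> (i, True)) else 0) + (if ?\<pi> (i, True) = ?p then jgram N (?\<pi> (i, False)) b else 0)) *
      (\<Prod>j\<in>{..<k} - {i}. jgram N (?\<pi> (j, False)) (?\<pi> (j, True))) =
     (if i = i0 then jgram N (q (i0, False)) (q (i0, True)) * (\<Prod>j\<in>{..<k} - {i0}. jgram N (?\<pi> (j, False)) (?\<pi> (j, True))) else 0)"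
    proof (cases "i = i0")
     case False
     then have "?\<pi> (i, False) \<noteq> ?p" "?\<pi> (i, True) \<noteq> ?p" using pk[of i] i by auto
     then show ?thesis using False by (simp only: if_False add_0 mult_zero_left)
    next
     case True
     show ?thesis
     proof (cases e0)
      case T: True
      have "?\<pi> (i0, False) \<noteq> ?p" "?\<pi> (i0, True) = ?p" "?\<pi> (i0, False) = q (i0, False)" "b = q (i0, True)"
       using pk[OF z(1), of False] pk[OF z(1), of True] pe[OF z(1), of False] z(2) T by simp_all
      then show ?thesis using True by (simp only: if_False if_True add_0 refl simp_thms)
     next
      case F: False
      have "?\<pi> (i0, False) = ?p" "?\<pi> (i0, True) \<noteq> ?p" "?\<pi> (i0, True) = q (i0, True)" "b = q (i0, False)"
       using pk[OF z(1), of False] pk[OF z(1), of True] pe[OF z(1), of True] z(2) F by simp_all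
      then show ?thesis using True by (simp only: if_False if_True add_0_right refl simp_thms)
     qed
    qed
   qed
   also have "\<dots> = jgram N (q (i0, False)) (q (i0, True)) * (\<Prod>j\<in>{..<k} - {i0}. jgram N (?\<pi> (j, False)) (?\<pi> (j, True)))"
    using z by simp
   also have "(\<Prod>j\<in>{..<k} - {i0}. jgram N (?\<pi> (j, False)) (?\<pi> (j, True))) = (\<Prod>j\<in>{..<k} - {i0}. jgram N (q (j, False)) (q (j, True)))"
   proof (intro prod.cong refl)
    fix j assume "j \<in> {..<k} - {i0}"
    then show "jgram N (?\<pi> (j, False)) (?\<pi> (j, True)) = jgram N (q (j, False)) (q (j, True))"
     using pe[of j False] pe[of j True] by simp
   qed
   finally show ?thesis unfolding jpf_term_def
    using z prod.remove[of "{..<k}" i0 "\<lambda>j. jgram N (q (j, False)) (q (j, True))"] by simp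
  qed
 qed (use assms in auto)
 moreover have "(\<Sum>c\<in>spin N. ?A c * Var (b, c)) = jgram N b (k, True)" for b
  unfolding jgram_def by (intro sum.cong) (auto simp: mult_ac)
 ultimately have "qg.Ex ((\<Sum>\<pi> | \<pi> permutes insert ?p (spin k). of_int (sign \<pi>) * (jgram N (\<pi> ?p) (k, True) * jpf_term N k \<pi>)) * F) =
   (real (card (spin N)) - real (card (spin k)) + real d) * qg.Ex (jpf N k * F)" by (simp only: jpf_def)
 moreover have "card (spin n) = 2 * n" for n by (simp add: spin_def card_cartesian_product)
 ultimately show ?thesis unfolding jpf_Suc mult.assoc qg.Ex_of_nat by simp
qed

text \<open>Pf(X J X^T) = det X in unnormalised form. A choice \<open>f\<close> of one column for
  each pair of positions contributes only if it meets every conjugate pair once. It is then a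
  permutation \<tau> with a set \<open>G\<close> of flips, the sign of the flips cancels against the
  coefficients \<open>sgb\<close>, and each of the \<open>2 ^ N * fact N\<close> choices leaves one
  copy of the determinant.\<close>

lemma jpf_full: "jpf N N = of_nat (2 ^ N * fact N) * rowdet (spin N)"
proof -
 let ?R = "spin N" and ?I = "{..<N}"
 define F where "F f = (\<lambda>(i, e). if e then nb (f i) else f i)" for f :: "nat \<Rightarrow> nat \<times> bool"
 let ?s = "\<lambda>f. \<Prod>i\<in>?I. of_int (sgb (snd (f i))) :: jmp"
 let ?D = "\<lambda>f. \<Sum>\<pi> | \<pi> permutes ?R. of_int (sign \<pi>) * (\<Prod>u\<in>?R. Var (\<pi> u, F f u))"
 have "jpf_term N N \<pi> = (\<Sum>f\<in>?I \<rightarrow>\<^sub>E ?R. ?s f * (\<Prod>u\<in>?R. Var (\<pi> u, F f u)))" for \<pi>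
 proof -
  have "jpf_term N N \<pi> = (\<Sum>f\<in>?I \<rightarrow>\<^sub>E ?R. \<Prod>i\<in>?I. of_int (sgb (snd (f i))) * (Var (\<pi> (i, False), f i) * Var (\<pi> (i, True), nb (f i))))"
   unfolding jpf_term_def jgram_def by (rule prod_sum_PiE) auto
  also have "\<dots> = (\<Sum>f\<in>?I \<rightarrow>\<^sub>E ?R. ?s f * (\<Prod>u\<in>?R. Var (\<pi> u, F f u)))"
  proof (intro sum.cong refl)
   fix f
   have "(\<Prod>u\<in>?R. Var (\<pi> u, F f u)) = (\<Prod>i\<in>?I. \<Prod>e\<in>UNIV. Var (\<pi> (i, e), F f (i, e)))"
    unfolding spin_def by (subst prod.cartesian_product) (auto intro!: prod.cong)
   also have "\<dots> = (\<Prod>i\<in>?I. Var (\<pi> (i, False), f i) * Var (\<pi> (i, True), nb (f i)))"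
    by (intro prod.cong) (auto simp: UNIV_bool F_def)
   finally show "(\<Prod>i\<in>?I. of_int (sgb (snd (f i))) * (Var (\<pi> (i, False), f i) * Var (\<pi> (i, True), nb (f i)))) =
     ?s f * (\<Prod>u\<in>?R. Var (\<pi> u, F f u))" by (simp add: prod.distrib)
  qed
  finally show ?thesis .
 qed
 then have "jpf N N = (\<Sum>\<pi> | \<pi> permutes ?R. \<Sum>f\<in>?I \<rightarrow>\<^sub>E ?R. ?s f * (of_int (sign \<pi>) * (\<Prod>u\<in>?R. Var (\<pi> u, F f u))))"
  unfolding jpf_def by (auto simp: sum_distrib_left mult_ac intro!: sum.cong)
 also have "\<dots> = (\<Sum>f\<in>?I \<rightarrow>\<^sub>E ?R. ?s f * ?D f)"
  by (subst sum.swap) (simp add: sum_distrib_left)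
 also have "\<dots> = (\<Sum>f | f \<in> ?I \<rightarrow>\<^sub>E ?R \<and> inj_on (\<lambda>i. fst (f i)) ?I. ?s f * ?D f)"
 proof (rule sum.mono_neutral_right)
  show "\<forall>f\<in>(?I \<rightarrow>\<^sub>E ?R) - {f. f \<in> ?I \<rightarrow>\<^sub>E ?R \<and> inj_on (\<lambda>i. fst (f i)) ?I}. ?s f * ?D f = 0"
  proof
   fix f assume "f \<in> (?I \<rightarrow>\<^sub>E ?R) - {f. f \<in> ?I \<rightarrow>\<^sub>E ?R \<and> inj_on (\<lambda>i. fst (f i)) ?I}"
   then obtain i j where ij: "i \<in> ?I" "j \<in> ?I" "i \<noteq> j" "fst (f i) = fst (f j)" by (auto simp: inj_on_def)
   \<comment> \<open>Two choices from the same conjugate pair agree directly or after conjugating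
     one of them, which gives two equal columns.\<close>
   have "F f (i, False) = F f (j, snd (f i) \<noteq> snd (f j))" using ij(4) by (auto simp: F_def nb_def prod_eq_iff)
   then have "?D f = 0"
    using ij by (intro rowdet_columns_not_inj[of ?R "(i, False)" "(j, snd (f i) \<noteq> snd (f j))"]) (auto simp: spin_def)
   then show "?s f * ?D f = 0" by simp
  qed
 qed (auto intro: finite_PiE)
 also have "\<dots> = (\<Sum>(\<tau>, G)\<in>{\<tau>. \<tau> permutes ?I} \<times> Pow ?I. rowdet ?R)"
 proof (rule sum.reindex_bij_witness[where j = "\<lambda>f. (restrict_id (\<lambda>i. fst (f i)) ?I, {i \<in> ?I. snd (f i)})"
    and i = "\<lambda>(\<tau>, G). \<lambda>i\<in>?I. (\<tau> i, i \<in> G)"])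
  fix f assume "f \<in> {f. f \<in> ?I \<rightarrow>\<^sub>E ?R \<and> inj_on (\<lambda>i. fst (f i)) ?I}"
  then have f: "f \<in> ?I \<rightarrow>\<^sub>E ?R" "inj_on (\<lambda>i. fst (f i)) ?I" by auto
  let ?\<tau> = "restrict_id (\<lambda>i. fst (f i)) ?I" and ?G = "{i \<in> ?I. snd (f i)}"
  have "(\<lambda>i. fst (f i)) ` ?I \<subseteq> ?I" using f(1) by (auto simp: spin_def PiE_def Pi_def mem_Times_iff)
  then have "bij_betw (\<lambda>i. fst (f i)) ?I ?I" using f(2) endo_inj_surj[of ?I "\<lambda>i. fst (f i)"] by (simp add: bij_betw_def)
  then have \<tau>: "?\<tau> permutes ?I" by (rule permutes_restrict_id)
  show "(case (?\<tau>, ?G) of (\<tau>, G) \<Rightarrow> \<lambda>i\<in>?I. (\<tau> i, i \<in> G)) = f"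
   using f(1) by (auto simp: fun_eq_iff PiE_def extensional_def)
  show "(?\<tau>, ?G) \<in> {\<tau>. \<tau> permutes ?I} \<times> Pow ?I" using \<tau> by auto
  let ?H = "layer_perm ?\<tau> ?\<tau> \<circ> flip_perm ?G"
  have lp: "layer_perm ?\<tau> ?\<tau> permutes ?R" "sign (layer_perm ?\<tau> ?\<tau>) = 1"
   using layer_perm[OF _ \<tau> \<tau>] by (auto simp: spin_def)
  have fp: "flip_perm ?G permutes ?R" "sign (flip_perm ?G) = (-1) ^ card ?G"
   using flip_perm[of ?G ?I] by (auto simp: spin_def)
  have Hp: "?H permutes ?R" using permutes_compose[OF fp(1) lp(1)] .
  have Hs: "sign ?H = (-1) ^ card ?G"
   using sign_compose[of "layer_perm ?\<tau> ?\<tau>" "flip_perm ?G"] lp fp permutes_imp_permutation[OF finite_spin] by simp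
  have HF: "F f u = ?H u" if uR: "u \<in> ?R" for u
  proof -
   obtain i e where u: "u = (i, e)" "i < N" using uR by (auto simp: spin_def)
   show ?thesis using u(2) unfolding u(1)
    by (cases e; cases "snd (f i)") (auto simp: F_def layer_perm_def flip_perm_def nb_def prod_eq_iff)
  qed
  have "?D f = (\<Sum>\<pi> | \<pi> permutes ?R. of_int (sign \<pi>) * (\<Prod>u\<in>?R. Var (\<pi> u, ?H u)))"
   using HF by (intro sum.cong refl arg_cong2[where f = "(*)"] prod.cong) auto
  also have "\<dots> = of_int (sign ?H) * rowdet ?R" by (rule rowdet_columns_inj[OF finite_spin Hp])
  finally have h1: "?D f = of_int ((-1) ^ card ?G) * rowdet ?R" unfolding Hs .
  have h2: "?s f = of_int ((-1) ^ card ?G)"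
  proof -
   have "?s f = (\<Prod>i\<in>?I. if snd (f i) then -1 else 1)" by (intro prod.cong) (auto simp: sgb_def)
   then show ?thesis by (simp add: prod.If_cases Int_def)
  qed
  have h3: "of_int ((-1) ^ card ?G) * of_int ((-1) ^ card ?G) = (1 :: jmp)" by (simp flip: power_mult_distrib)
  have "?s f * ?D f = rowdet ?R" unfolding h1 h2 mult.assoc[symmetric] h3 by simp
  then show "(case (?\<tau>, ?G) of (\<tau>, G) \<Rightarrow> rowdet ?R) = ?s f * ?D f" by simp
 next
  fix a assume "a \<in> {\<tau>. \<tau> permutes ?I} \<times> Pow ?I"
  then obtain \<tau> G where a: "a = (\<tau>, G)" "\<tau> permutes ?I" "G \<subseteq> ?I" by auto
  have "restrict_id (\<lambda>i. fst ((\<lambda>i\<in>?I. (\<tau> i, i \<in> G)) i)) ?I = \<tau>"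
   using permutes_not_in[OF a(2)] by (auto simp: fun_eq_iff restrict_id_def)
  moreover have "{i \<in> ?I. snd ((\<lambda>i\<in>?I. (\<tau> i, i \<in> G)) i)} = G" using a(3) by auto
  ultimately show "(restrict_id (\<lambda>i. fst ((case a of (\<tau>, G) \<Rightarrow> \<lambda>i\<in>?I. (\<tau> i, i \<in> G)) i)) ?I,
    {i \<in> ?I. snd ((case a of (\<tau>, G) \<Rightarrow> \<lambda>i\<in>?I. (\<tau> i, i \<in> G)) i)}) = a" using a by simp
  have "\<tau> i \<in> ?I" if "i \<in> ?I" for i using permutes_in_image[OF a(2), of i] that by simp
  moreover have "inj_on (\<lambda>i. fst ((\<lambda>i\<in>?I. (\<tau> i, i \<in> G)) i)) ?I"
   using permutes_inj_on[OF a(2), of ?I] by (auto simp: inj_on_def)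
  ultimately show "(case a of (\<tau>, G) \<Rightarrow> \<lambda>i\<in>?I. (\<tau> i, i \<in> G)) \<in> {f. f \<in> ?I \<rightarrow>\<^sub>E ?R \<and> inj_on (\<lambda>i. fst (f i)) ?I}"
   using a by (auto simp: spin_def)
 qed
 also have "\<dots> = of_nat (card ({\<tau>. \<tau> permutes ?I} \<times> Pow ?I)) * rowdet ?R" by (simp add: case_prod_unfold)
 also have "card ({\<tau>. \<tau> permutes ?I} \<times> Pow ?I) = 2 ^ N * fact N"
  using card_permutations[of ?I N] by (simp add: card_cartesian_product card_Pow)
 finally show ?thesis .
qed

text \<open>The factors \<open>2 * Suc k\<close> of the single steps multiply to
  \<open>2 ^ N * fact N\<close> and cancel against the normalisation of the Pfaffian.\<close>

lemma quaternionic_first_column: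
 assumes "\<And>b k. b \<in> spin k \<Longrightarrow> k < N \<Longrightarrow> polar (spin N) b (k, False) F = 0"
  and "\<And>k. k < N \<Longrightarrow> polar (spin N) (k, False) (k, False) F = of_nat (d k) * F"
 shows "qg.Ex (rowdet (spin N) * F) = (\<Prod>k<N. 2 * real N - 2 * real k + real (d k)) * qg.Ex F"
proof -
 have "qg.Ex (jpf N k * F) = real (2 ^ k * fact k) * (\<Prod>k<k. 2 * real N - 2 * real k + real (d k)) * qg.Ex F" if "k \<le> N" for k
  using that
 proof (induction k)
  case 0
  have "spin 0 = {}" by (simp add: spin_def)
  then show ?case by (simp add: jpf_def jpf_term_def)
 next
  case (Suc k)
  then show ?case using jpf_step[of k N F "d k"] assms by (simp add: algebra_simps)
 qed
 from this[of N] have "real (2 ^ N * fact N) * qg.Ex (rowdet (spin N) * F) =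
   real (2 ^ N * fact N) * ((\<Prod>k<N. 2 * real N - 2 * real k + real (d k)) * qg.Ex F)"
  unfolding jpf_full mult.assoc qg.Ex_of_nat by simp
 then show ?thesis by simp
qed

section \<open>Hook products\<close>

lemma partition_nth_mono: "is_partition l \<Longrightarrow> i \<le> i' \<Longrightarrow> i' < length l \<Longrightarrow> l ! i' \<le> l ! i"
 unfolding is_partition_def using sorted_wrt_nth_less[of "(\<ge>)" l i i'] by (cases "i = i'") auto

lemma finite_boxes: "finite (boxes l)"
proof -
 have "boxes l = (SIGMA i:{..<length l}. {..<l ! i})" by (auto simp: boxes_def)
 then show ?thesis by simp
qed

lemma card_boxes_rows: "card {s \<in> boxes l. fst s < k} = sum_list (take k l)"
proof -
 have "{s \<in> boxes l. fst s < k} = (SIGMA i:{..<min k (length l)}. {..<l ! i})" by (auto simp: boxes_def)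
 then have "card {s \<in> boxes l. fst s < k} = (\<Sum>i<min k (length l). l ! i)" by (simp add: card_SigmaI)
 also have "\<dots> = sum_list (take k l)" by (simp add: sum_list_sum_nth atLeast0LessThan min.commute)
 finally show ?thesis .
qed

lemma card_boxes: "card (boxes l) = sum_list l"
proof -
 have "{s \<in> boxes l. fst s < length l} = boxes l" by (auto simp: boxes_def)
 then show ?thesis using card_boxes_rows[of l "length l"] by simp
qed

lemma boxes_iff_col:
 assumes "is_partition l" shows "(i, j) \<in> boxes l \<longleftrightarrow> i < col_length l j"
proof -
 let ?X = "{i. i < length l \<and> j < l ! i}"
 have "?X = {..<card ?X}"
 proof (rule card_subset_eq[symmetric])
  show "finite ?X" by simp
  show "{..<card ?X} \<subseteq> ?X"
  proof (rule ccontr)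
   assume "\<not> {..<card ?X} \<subseteq> ?X"
   then obtain k where k: "k < card ?X" "k \<notin> ?X" by auto
   have "?X \<subseteq> {..<k}"
   proof
    fix i assume i: "i \<in> ?X"
    show "i \<in> {..<k}"
    proof (rule ccontr)
     assume "i \<notin> {..<k}"
     then have "k \<le> i" by simp
     then show False using i k(2) partition_nth_mono[OF assms, of k i] by auto
    qed
   qed
   then have "card ?X \<le> k" using card_mono[of "{..<k}" ?X] by simp
   with k(1) show False by simp
  qed
 qed simp
 then show ?thesis unfolding col_length_def boxes_def by (metis (no_types, lifting) case_prodD case_prodI lessThan_iff mem_Collect_eq)
qed

lemma boxes_bound: "(i, j) \<in> boxes l \<Longrightarrow> j < sum_list l"
proof -
 assume "(i, j) \<in> boxes l"
 then have "i < length l" "j < l ! i" by (auto simp: boxes_def)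
 moreover have "l ! i \<le> sum_list l" using \<open>i < length l\<close> by (intro member_le_sum_list) auto
 ultimately show ?thesis by simp
qed

lemma card_by_fibres:
 assumes "finite A" "finite I"
 shows "card {u \<in> A. h u \<in> I} = (\<Sum>i\<in>I. card {u \<in> A. h u = i})"
proof -
 have "{u \<in> A. h u \<in> I} = (\<Union>i\<in>I. {u \<in> A. h u = i})" by auto
 also have "card \<dots> = (\<Sum>i\<in>I. card {u \<in> A. h u = i})" by (rule card_UN_disjoint) (use assms in auto)
 finally show ?thesis .
qed

definition spin_row :: "(nat \<times> nat) \<times> bool \<Rightarrow> nat \<times> bool" where
 "spin_row u = (fst (fst u), snd u)"

lemma finite_cells: "finite (boxes l \<times> (UNIV :: bool set))" using finite_boxes by simp

text \<open>The columns from \<open>m\<close> on. The hook product is assembled from the right end,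
  one column at a time.\<close>

definition right_part :: "nat list \<Rightarrow> nat \<Rightarrow> (nat \<times> nat) set" where
 "right_part l m = {s \<in> boxes l. m \<le> snd s}"

context
 fixes l :: "nat list"
 assumes l: "is_partition l"
begin

lemma finite_right_part: "finite (right_part l m)" using finite_boxes by (simp add: right_part_def)

lemma right_part_split:
 "right_part l m = {..<col_length l m} \<times> {m} \<union> right_part l (Suc m)"
proof -
 have "s \<in> right_part l m \<longleftrightarrow> s \<in> {..<col_length l m} \<times> {m} \<union> right_part l (Suc m)" for s
 proof (cases s)
  case (Pair a b)
  show ?thesis
  proof (cases "b = m")
   case True
   then show ?thesis using boxes_iff_col[OF l, of a m] Pair by (simp add: right_part_def)
  next
   case False
   then show ?thesis using Pair by (auto simp: right_part_def)
  qed
 qed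
 then show ?thesis by blast
qed

lemma right_part_rows: "fst ` right_part l (Suc m) \<subseteq> {..<col_length l m}"
proof
 fix i assume "i \<in> fst ` right_part l (Suc m)"
 then obtain j where "(i, j) \<in> boxes l" "m < j" by (auto simp: right_part_def)
 then have "(i, m) \<in> boxes l" by (auto simp: boxes_def)
 then show "i \<in> {..<col_length l m}" using boxes_iff_col[OF l] by simp
qed

lemma right_part_up: "(k, j) \<in> right_part l m \<Longrightarrow> b < k \<Longrightarrow> (b, j) \<in> right_part l m"
 using boxes_iff_col[OF l] by (auto simp: right_part_def)

text \<open>The data of the integration over column \<open>m\<close>: the number of boxes to the
  right in row \<open>k\<close> is the arm, and the number of rows from \<open>k\<close> to the
  bottom of the column is the leg plus one.\<close>

lemma right_part_row_card:
 assumes "k < col_length l m"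
 shows "card {s \<in> right_part l (Suc m). fst s = k} = arm l (k, m)" "real (col_length l m) - real k = real (leg l (k, m)) + 1"
proof -
 have b: "(k, m) \<in> boxes l" using boxes_iff_col[OF l] assms by simp
 have "{s \<in> right_part l (Suc m). fst s = k} = Pair k ` {Suc m..<l ! k}"
  using b by (auto simp: right_part_def boxes_def)
 then show "card {s \<in> right_part l (Suc m). fst s = k} = arm l (k, m)"
  using b by (simp add: card_image inj_on_def arm_def boxes_def)
 show "real (col_length l m) - real k = real (leg l (k, m)) + 1" using assms by (simp add: leg_def)
qed

lemma prod_right_part:
 "(\<Prod>s\<in>right_part l m. g s) = (\<Prod>k<col_length l m. g (k, m)) * (\<Prod>s\<in>right_part l (Suc m). g s :: real)"
proof -
 have "(\<Prod>s\<in>right_part l m. g s) = (\<Prod>s\<in>{..<col_length l m} \<times> {m}. g s) * (\<Prod>s\<in>right_part l (Suc m). g s)"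
  unfolding right_part_split[of m]
  by (rule prod.union_disjoint) (use finite_right_part in \<open>auto simp: right_part_def\<close>)
 also have "(\<Prod>s\<in>{..<col_length l m} \<times> {m}. g s) = (\<Prod>k<col_length l m. g (k, m))"
 proof -
  have "{..<col_length l m} \<times> {m} = (\<lambda>k. (k, m)) ` {..<col_length l m}" by auto
  then show ?thesis by (simp add: prod.reindex inj_on_def)
 qed
 finally show ?thesis .
qed

lemma right_part_0: "right_part l 0 = boxes l" by (simp add: right_part_def)

lemma right_part_end: "right_part l (sum_list l) = {}" using boxes_bound[of _ _ l] by (force simp: right_part_def)

text \<open>Column \<open>m\<close> supplies the squared determinant, and the columns to its right
  form the highest weight vector \<open>?F\<close>. Row \<open>k\<close> has degree twice the arm in
  it, because the product of minors is squared, so its factor is leg + 1 + 2 arm.\<close>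

lemma real_hook_product:
 "rg.Ex (level_det (boxes l) fst snd * level_det (boxes l) fst snd) = (\<Prod>s\<in>boxes l. 2 * real (arm l s) + real (leg l s) + 1)"
proof -
 let ?L = "\<lambda>m. level_det (right_part l m) fst snd"
 have "rg.Ex (?L 0 * ?L 0) = (\<Prod>s\<in>right_part l 0. 2 * real (arm l s) + real (leg l s) + 1)"
 proof (rule inc_induct[of 0 "sum_list l"])
  show "rg.Ex (?L (sum_list l) * ?L (sum_list l)) = (\<Prod>s\<in>right_part l (sum_list l). 2 * real (arm l s) + real (leg l s) + 1)"
  proof -
   have "level_perms snd ({} :: (nat \<times> nat) set) = {id}" by (auto simp: level_perms_def)
   then have "?L (sum_list l) = 1" unfolding right_part_end level_det_def by simp
   moreover have "rg.Ex 1 = 1" using rg.Ex_prod_Var[of "{}" id] by simp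
   ultimately show ?thesis by (simp add: right_part_end)
  qed
 next
  fix m assume IH: "rg.Ex (?L (Suc m) * ?L (Suc m)) = (\<Prod>s\<in>right_part l (Suc m). 2 * real (arm l s) + real (leg l s) + 1)"
  let ?N = "col_length l m" and ?C = "right_part l (Suc m)"
  let ?F = "?L (Suc m) * ?L (Suc m)"
  have "?L m = level_det ({..<?N} \<times> {m}) fst snd * ?L (Suc m)" unfolding right_part_split[of m]
   by (rule level_det_union) (use finite_right_part in \<open>auto simp: right_part_def\<close>)
  also have "level_det ({..<?N} \<times> {m}) fst snd = rowdet {..<?N}"
   by (rule level_det_single[where j = m]) (auto simp: bij_betw_def inj_on_def)
  finally have "?L m * ?L m = rowdet {..<?N} * rowdet {..<?N} * ?F" by (simp add: mult_ac)
  also have "rg.Ex \<dots> = (\<Prod>k<?N. real ?N - real k + real (2 * card {s \<in> ?C. fst s = k})) * rg.Ex ?F"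
  proof (rule real_first_column)
   fix b k :: nat assume bk: "b < k"
   have "polar {..<?N} b k (?L (Suc m)) = 0"
   proof (rule polar_level_det_eq_0[OF finite_right_part _ right_part_rows])
    fix s assume "s \<in> ?C" "fst s = k"
    then show "\<exists>t\<in>?C. fst t = b \<and> snd t = snd s" using right_part_up[of k "snd s" "Suc m" b] bk by (cases s) force
   qed (use bk in auto)
   then show "polar {..<?N} b k ?F = 0" by (simp add: polar_mult)
  next
   fix k
   show "polar {..<?N} k k ?F = of_nat (2 * card {s \<in> ?C. fst s = k}) * ?F"
    unfolding polar_mult polar_level_det_diag[OF finite_right_part finite_lessThan right_part_rows]
    by (simp add: algebra_simps)
  qed
  also have "(\<Prod>k<?N. real ?N - real k + real (2 * card {s \<in> ?C. fst s = k})) =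
    (\<Prod>k<?N. 2 * real (arm l (k, m)) + real (leg l (k, m)) + 1)"
   using right_part_row_card by (intro prod.cong) auto
  finally show "rg.Ex (?L m * ?L m) = (\<Prod>s\<in>right_part l m. 2 * real (arm l s) + real (leg l s) + 1)"
   unfolding IH prod_right_part[of _ m] .
 qed simp
 then show ?thesis by (simp add: right_part_0)
qed

text \<open>A column of length N now gives a single minor of size 2 N, with rows
  \<open>(k, False)\<close> and \<open>(k, True)\<close>. Row \<open>(k, False)\<close> has degree
  arm in the columns to the right, and 2 N - 2 k is twice the leg plus one.\<close>

lemma quaternionic_hook_product:
 "qg.Ex (level_det (boxes l \<times> UNIV) spin_row (\<lambda>u. snd (fst u))) = (\<Prod>s\<in>boxes l. real (arm l s) + 2 * real (leg l s) + 2)"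
proof -
 let ?y = "\<lambda>u :: (nat \<times> nat) \<times> bool. snd (fst u)"
 let ?L = "\<lambda>m. level_det (right_part l m \<times> UNIV) spin_row ?y"
 have "qg.Ex (?L 0) = (\<Prod>s\<in>right_part l 0. real (arm l s) + 2 * real (leg l s) + 2)"
 proof (rule inc_induct[of 0 "sum_list l"])
  show "qg.Ex (?L (sum_list l)) = (\<Prod>s\<in>right_part l (sum_list l). real (arm l s) + 2 * real (leg l s) + 2)"
  proof -
   have "level_perms ?y {} = {id}" by (auto simp: level_perms_def)
   then have "?L (sum_list l) = 1" unfolding right_part_end level_det_def by simp
   moreover have "qg.Ex 1 = 1" using qg.Ex_prod_Var[of "{}" id] by simp
   ultimately show ?thesis by (simp add: right_part_end)
  qed
 next
  fix m assume IH: "qg.Ex (?L (Suc m)) = (\<Prod>s\<in>right_part l (Suc m). real (arm l s) + 2 * real (leg l s) + 2)"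
  let ?N = "col_length l m" and ?C = "right_part l (Suc m) \<times> (UNIV :: bool set)"
  have fin: "finite ?C" using finite_right_part by simp
  have rows: "spin_row ` ?C \<subseteq> spin ?N" using right_part_rows[of m] by (auto simp: spin_row_def spin_def)
  have "?L m = level_det (({..<?N} \<times> {m}) \<times> UNIV) spin_row ?y * ?L (Suc m)"
   unfolding right_part_split[of m] Sigma_Un_distrib1
   by (rule level_det_union) (use finite_right_part in \<open>auto simp: right_part_def\<close>)
  also have "level_det (({..<?N} \<times> {m}) \<times> UNIV) spin_row ?y = rowdet (spin ?N)"
   by (rule level_det_single[where j = m]) (auto simp: bij_betw_def inj_on_def spin_row_def spin_def image_iff)
  finally have "qg.Ex (?L m) = qg.Ex (rowdet (spin ?N) * ?L (Suc m))" by simp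
  also have "\<dots> = (\<Prod>k<?N. 2 * real ?N - 2 * real k + real (card {u \<in> ?C. spin_row u = (k, False)})) * qg.Ex (?L (Suc m))"
  proof (rule quaternionic_first_column)
   fix b k assume b: "b \<in> spin k"
   show "polar (spin ?N) b (k, False) (?L (Suc m)) = 0"
   proof (rule polar_level_det_eq_0[OF fin finite_spin rows])
    show "b \<noteq> (k, False)" using b by (auto simp: spin_def)
    fix s assume s: "s \<in> ?C" "spin_row s = (k, False)"
    then have "((fst b, ?y s), snd b) \<in> ?C"
     using right_part_up[of k "?y s" "Suc m" "fst b"] b by (auto simp: spin_def spin_row_def)
    then show "\<exists>t\<in>?C. spin_row t = b \<and> ?y t = ?y s" by (intro bexI[of _ "((fst b, ?y s), snd b)"]) (auto simp: spin_row_def)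
   qed
  next
   fix k
   show "polar (spin ?N) (k, False) (k, False) (?L (Suc m)) = of_nat (card {u \<in> ?C. spin_row u = (k, False)}) * ?L (Suc m)"
    by (rule polar_level_det_diag[OF fin finite_spin rows])
  qed
  also have "(\<Prod>k<?N. 2 * real ?N - 2 * real k + real (card {u \<in> ?C. spin_row u = (k, False)})) =
    (\<Prod>k<?N. real (arm l (k, m)) + 2 * real (leg l (k, m)) + 2)"
  proof (rule prod.cong[OF refl])
   fix k assume "k \<in> {..<?N}"
   then have k: "k < ?N" by simp
   have "{u \<in> ?C. spin_row u = (k, False)} = (\<lambda>s. (s, False)) ` {s \<in> right_part l (Suc m). fst s = k}"
    by (auto simp: spin_row_def)
   then have "card {u \<in> ?C. spin_row u = (k, False)} = arm l (k, m)"
    using right_part_row_card(1)[OF k] by (simp add: card_image inj_on_def)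
   then show "2 * real ?N - 2 * real k + real (card {u \<in> ?C. spin_row u = (k, False)}) = real (arm l (k, m)) + 2 * real (leg l (k, m)) + 2"
    using right_part_row_card(2)[OF k] by simp
  qed
  finally show "qg.Ex (?L m) = (\<Prod>s\<in>right_part l m. real (arm l s) + 2 * real (leg l s) + 2)"
   unfolding IH prod_right_part[of _ m] .
 qed simp
 then show ?thesis by (simp add: right_part_0)
qed

section \<open>Colourings of the doubled diagram and the dominance order\<close>

abbreviation cells :: "((nat \<times> nat) \<times> bool) set" where
 "cells \<equiv> boxes l \<times> UNIV"

lemma sum_min_col: "(\<Sum>j<sum_list l. min k (col_length l j)) = sum_list (take k l)"
proof -
 have "{s \<in> boxes l. fst s < k} = (\<lambda>(j, i). (i, j)) ` (SIGMA j:{..<sum_list l}. {..<min k (col_length l j)})"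
  using boxes_iff_col[OF l] boxes_bound[of _ _ l] by (force simp: image_iff)
 then have "card {s \<in> boxes l. fst s < k} = card (SIGMA j:{..<sum_list l}. {..<min k (col_length l j)})"
  by (simp add: card_image inj_on_def split_def)
 then show ?thesis unfolding card_boxes_rows by (simp add: card_SigmaI)
qed

context
 fixes h :: "(nat \<times> nat) \<times> bool \<Rightarrow> nat"
 assumes le2: "\<And>i j. card {u \<in> cells. snd (fst u) = j \<and> h u = i} \<le> 2"
begin

text \<open>One bound comes from two cells per colour and column, the other from the number of cells
  in the column. The minima of the two, summed over all columns, are partial sums of
  \<open>l\<close> by \<open>sum_min_col\<close>.\<close>

lemma column_colors_le:
 assumes "finite I"
 shows "card {u \<in> cells. snd (fst u) = j \<and> h u \<in> I} \<le> 2 * min (card I) (col_length l j)"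
proof -
 have fin: "finite {u \<in> cells. snd (fst u) = j \<and> h u = i}" for i using finite_cells by simp
 have "{u \<in> cells. snd (fst u) = j \<and> h u \<in> I} = (\<Union>i\<in>I. {u \<in> cells. snd (fst u) = j \<and> h u = i})" by auto
 then have "card {u \<in> cells. snd (fst u) = j \<and> h u \<in> I} \<le> (\<Sum>i\<in>I. card {u \<in> cells. snd (fst u) = j \<and> h u = i})"
  using card_UN_le[OF assms] by simp
 also have "\<dots> \<le> (\<Sum>i\<in>I. 2)" by (rule sum_mono) (rule le2)
 finally have 1: "card {u \<in> cells. snd (fst u) = j \<and> h u \<in> I} \<le> 2 * card I" by simp
 have "{u \<in> cells. snd (fst u) = j \<and> h u \<in> I} \<subseteq> ({..<col_length l j} \<times> {j}) \<times> UNIV"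
  using boxes_iff_col[OF l] by auto
 then have "card {u \<in> cells. snd (fst u) = j \<and> h u \<in> I} \<le> card (({..<col_length l j} \<times> {j}) \<times> (UNIV :: bool set))"
  by (rule card_mono[rotated]) auto
 then show ?thesis using 1 by (simp add: card_cartesian_product)
qed

lemma card_colors_columns:
 "card {u \<in> cells. h u \<in> I} = (\<Sum>j<sum_list l. card {u \<in> cells. snd (fst u) = j \<and> h u \<in> I})"
proof -
 have "{u \<in> cells. h u \<in> I} = {u \<in> {u \<in> cells. h u \<in> I}. snd (fst u) \<in> {..<sum_list l}}"
  using boxes_bound[of _ _ l] by fastforce
 then have "card {u \<in> cells. h u \<in> I} = card {u \<in> {u \<in> cells. h u \<in> I}. snd (fst u) \<in> {..<sum_list l}}"
  by (rule arg_cong)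
 also have "\<dots> = (\<Sum>j<sum_list l. card {u \<in> {u \<in> cells. h u \<in> I}. snd (fst u) = j})"
  by (rule card_by_fibres) (use finite_cells in auto)
 also have "\<dots> = (\<Sum>j<sum_list l. card {u \<in> cells. snd (fst u) = j \<and> h u \<in> I})"
  by (intro sum.cong refl arg_cong[where f = card]) auto
 finally show ?thesis .
qed

lemma colors_le: "finite I \<Longrightarrow> card {u \<in> cells. h u \<in> I} \<le> 2 * sum_list (take (card I) l)"
 unfolding card_colors_columns sum_min_col[symmetric] sum_distrib_left by (intro sum_mono column_colors_le)

text \<open>The first \<open>k\<close> colours occupy twice the sum of the first \<open>k\<close>
  parts of \<open>m\<close>, and by \<open>colors_le\<close> any \<open>k\<close> colours fit into
  no more cells than the first \<open>k\<close> rows of \<open>l\<close> provide.\<close>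

lemma dominates_of_coloring:
 assumes m: "is_partition m" "sum_list m = sum_list l"
  and cnt: "\<And>i. card {u \<in> cells. h u = i} = 2 * lookup (expo m) i"
 shows "dominates l m" unfolding dominates_def
proof (intro conjI allI)
 fix k
 let ?I = "{..<min k (length m)}"
 have "card {u \<in> cells. h u \<in> ?I} = (\<Sum>i\<in>?I. 2 * (m ! i))"
  unfolding card_by_fibres[OF finite_cells finite_lessThan] cnt by (simp add: lookup_expo)
 also have "\<dots> = 2 * sum_list (take k m)"
  by (simp add: sum_list_sum_nth atLeast0LessThan min.commute sum_distrib_left)
 finally have "2 * sum_list (take k m) \<le> 2 * sum_list (take (card ?I) l)" using colors_le[of ?I] by simp
 moreover have "sum_list (take (min k (length m)) l) \<le> sum_list (take k l)"
  unfolding card_boxes_rows[symmetric] by (rule card_mono) (auto simp: finite_boxes)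
 ultimately show "sum_list (take k m) \<le> sum_list (take k l)" by simp
qed (use m in auto)

text \<open>With content \<open>l\<close> all the estimates are equalities, so column \<open>j\<close> carries each of its first
 \<open>col_length l j\<close> colours exactly twice.\<close>

lemma extremal_coloring:
 assumes cnt: "\<And>i. card {u \<in> cells. h u = i} = 2 * lookup (expo l) i"
 shows "card {u \<in> cells. snd (fst u) = j \<and> h u = i} = (if i < col_length l j then 2 else 0)"
proof (cases "j < sum_list l")
 case False
 then have e: "{u \<in> cells. snd (fst u) = j \<and> h u = i} = {}" using boxes_bound[of _ j l] by auto
 have "\<not> i < col_length l j" using boxes_iff_col[OF l, of i j] boxes_bound[of i j l] False by auto
 then show ?thesis unfolding e by simp
next
 case True
 have eq: "card {u \<in> cells. snd (fst u) = j \<and> h u \<in> {..<k}} = 2 * min k (col_length l j)" for k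
 proof (rule sum_mono_inv[where I = "{..<sum_list l}" and i = j
   and f = "\<lambda>j. card {u \<in> cells. snd (fst u) = j \<and> h u \<in> {..<k}}" and g = "\<lambda>j. 2 * min k (col_length l j)"])
  have "card {u \<in> cells. h u \<in> {..<k}} = 2 * sum_list (take k l)"
  proof -
   have "card {u \<in> cells. h u \<in> {..<k}} = (\<Sum>i<k. 2 * (if i < length l then l ! i else 0))"
    unfolding card_by_fibres[OF finite_cells finite_lessThan] cnt by (simp add: lookup_expo)
   also have "\<dots> = (\<Sum>i<min k (length l). 2 * (l ! i))" by (rule sum.mono_neutral_cong_right) auto
   finally show ?thesis by (simp add: sum_list_sum_nth atLeast0LessThan min.commute sum_distrib_left)
  qed
  then show "(\<Sum>j<sum_list l. card {u \<in> cells. snd (fst u) = j \<and> h u \<in> {..<k}}) = (\<Sum>j<sum_list l. 2 * min k (col_length l j))"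
   by (simp only: card_colors_columns[symmetric] sum_distrib_left[symmetric] sum_min_col)
  show "card {u \<in> cells. snd (fst u) = j \<and> h u \<in> {..<k}} \<le> 2 * min k (col_length l j)" for j
   using column_colors_le[of "{..<k}" j] by simp
 qed (use True in auto)
 \<comment> \<open>Colour \<open>i\<close> is isolated as the difference of two initial segments of
   colours; the corresponding minima differ exactly when \<open>i\<close> is below the column
   length.\<close>
 have "{u \<in> cells. snd (fst u) = j \<and> h u \<in> {..<Suc i}} =
   {u \<in> cells. snd (fst u) = j \<and> h u \<in> {..<i}} \<union> {u \<in> cells. snd (fst u) = j \<and> h u = i}" by auto
 also have "card \<dots> = card {u \<in> cells. snd (fst u) = j \<and> h u \<in> {..<i}} + card {u \<in> cells. snd (fst u) = j \<and> h u = i}"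
  using finite_cells by (intro card_Un_disjoint) auto
 finally show ?thesis unfolding eq by (auto simp: min_def split: if_splits)
qed

text \<open>Colours may thus be read as rows: replacing the row of a cell by its colour stays inside
  the diagram, which turns colourings into column preserving maps.\<close>

lemma extremal_color_lt:
 assumes cnt: "\<And>i. card {u \<in> cells. h u = i} = 2 * lookup (expo l) i" and u: "u \<in> cells"
 shows "(h u, snd (fst u)) \<in> boxes l"
proof -
 have "u \<in> {v \<in> cells. snd (fst v) = snd (fst u) \<and> h v = h u}" using u by simp
 moreover have "finite {v \<in> cells. snd (fst v) = snd (fst u) \<and> h v = h u}" using finite_cells by simp
 ultimately have "card {v \<in> cells. snd (fst v) = snd (fst u) \<and> h v = h u} > 0" unfolding card_gt_0_iff by blast
 then have "h u < col_length l (snd (fst u))"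
  using extremal_coloring[OF cnt, of "snd (fst u)" "h u"] by (auto split: if_splits)
 then show ?thesis using boxes_iff_col[OF l] by simp
qed

end

end

text \<open>For independent standard variables a pair contributes 1 if its two variables coincide
  and 0 otherwise.\<close>

lemma rg_wick:
 assumes "finite S"
 shows "rg.wick S f = real (card {B \<in> pairings S. const_on B f})"
proof -
 have "(\<Prod>p\<in>B. rg.pair_cov f p) = (if const_on B f then 1 else 0)" if B: "B \<in> pairings S" for B
 proof -
  have pc: "rg.pair_cov f p = (if \<forall>a\<in>p. \<forall>b\<in>p. f a = f b then 1 else 0)" if p: "p \<in> B" for p
  proof -
   obtain a b where ab: "a \<noteq> b" "p = {a, b}" using pairings_pairE[OF B p] by metis
   have "rg.pair_cov f p = (if f b = f a then 1 else 0)" unfolding ab(2) rg.pair_cov_pair[OF ab(1)] rg.cov_def ..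
   moreover have "(\<forall>a\<in>p. \<forall>b\<in>p. f a = f b) \<longleftrightarrow> f b = f a" unfolding ab(2) by auto
   ultimately show ?thesis by simp
  qed
  have c: "const_on B f \<longleftrightarrow> (\<forall>p\<in>B. \<forall>a\<in>p. \<forall>b\<in>p. f a = f b)"
  proof
   assume *: "const_on B f"
   show "\<forall>p\<in>B. \<forall>a\<in>p. \<forall>b\<in>p. f a = f b"
   proof
    fix p assume p: "p \<in> B"
    obtain a b where ab: "a \<noteq> b" "p = {a, b}" using pairings_pairE[OF B p] by metis
    then show "\<forall>a\<in>p. \<forall>b\<in>p. f a = f b" using * p by (auto simp: const_on_def)
   qed
  qed (auto simp: const_on_def)
  show ?thesis
  proof (cases "const_on B f")
   case True
   have "rg.pair_cov f p = 1" if p: "p \<in> B" for p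
    unfolding pc[OF p] by (rule if_P[OF bspec[OF iffD1[OF c True] p]])
   then show ?thesis using True by simp
  next
   case False
   then obtain p where p: "p \<in> B" "\<not> (\<forall>a\<in>p. \<forall>b\<in>p. f a = f b)" unfolding c by blast
   have "rg.pair_cov f p = 0" unfolding pc[OF p(1)] by (rule if_not_P[OF p(2)])
   then have "(\<Prod>p\<in>B. rg.pair_cov f p) = 0" using finite_pairing[OF assms B] p(1) by (intro prod_zero) auto
   then show ?thesis using False by simp
  qed
 qed
 then have "rg.wick S f = (\<Sum>B\<in>pairings S. if const_on B f then 1 else 0)" by (simp add: rg.wick_def)
 then show ?thesis using finite_pairings[OF assms] by (simp add: sum.If_cases Int_def)
qed

section \<open>Jack functions for \<open>\<alpha> = 2\<close>\<close>

lemma card_row_boxes: "card {s \<in> boxes l. fst s = i} = lookup (expo l) i"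
proof -
 have "{s \<in> boxes l. fst s = i} = (if i < length l then Pair i ` {..<l ! i} else {})" by (auto simp: boxes_def)
 then show ?thesis by (simp add: lookup_expo card_image inj_on_def)
qed

lemma card_cells_layers:
 assumes "finite D"
 shows "card {u \<in> D \<times> UNIV. p u} = card {s \<in> D. p (s, False)} + card {s \<in> D. p (s, True)}"
proof -
 have "{u \<in> D \<times> UNIV. p u} = (\<lambda>s. (s, False)) ` {s \<in> D. p (s, False)} \<union> (\<lambda>s. (s, True)) ` {s \<in> D. p (s, True)}"
  by (auto simp: image_iff) (metis (full_types))+
 also have "card \<dots> = card ((\<lambda>s. (s, False)) ` {s \<in> D. p (s, False)}) + card ((\<lambda>s. (s, True)) ` {s \<in> D. p (s, True)})"
  by (rule card_Un_disjoint) (use assms in auto)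
 finally show ?thesis by (simp add: card_image inj_on_def)
qed

lemma card_row_cells: "card {u \<in> boxes l \<times> (UNIV :: bool set). fst (fst u) = i} = 2 * lookup (expo l) i"
 by (simp add: card_cells_layers[OF finite_boxes] card_row_boxes)

lemma card_bij_preimage:
 assumes "bij_betw g A A'"
 shows "card {u \<in> A. p (g u)} = card {v \<in> A'. p v}"
proof -
 have "bij_betw g {u \<in> A. p (g u)} {v \<in> A'. p v}" using assms by (auto simp: bij_betw_def inj_on_def)
 then show ?thesis by (rule bij_betw_same_card)
qed

lemma const_on_Pair: "const_on B (\<lambda>u. (f u, h u)) \<longleftrightarrow> const_on B f \<and> const_on B h"
 by (auto simp: const_on_def)

lemma content_mapsD: "h \<in> content_maps D b \<Longrightarrow> card {u \<in> D \<times> UNIV. h u = i} = 2 * lookup b i"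
 by (simp add: content_maps_def)

lemma sum_nonzeroE:
 assumes "(\<Sum>x\<in>A. f x) \<noteq> 0" obtains x where "x \<in> A" "f x \<noteq> 0"
 using assms sum.neutral by metis

definition sign_sum :: "(nat \<times> nat) set \<Rightarrow> ((nat \<times> nat) \<times> bool \<Rightarrow> nat) \<Rightarrow> real" where
 "sign_sum D h = (\<Sum>\<sigma>\<in>level_perms snd D. if const_on (perm_pairs D \<sigma>) h then of_int (sign \<sigma>) else 0)"

lemma sign_sum_layer_injective: "finite D \<Longrightarrow> sign_sum D h \<noteq> 0 \<Longrightarrow> layer_injective D snd h"
 unfolding layer_injective_def sign_sum_def using level_sign_sum_eq_0[of D _ _ snd h] by blast

text \<open>A row preserving pairing that respects \<open>h\<close> is a pairing respecting the
  labels (row, colour). The sum over such pairings is therefore a Gaussian moment of the matrix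
  entries with these indices.\<close>

lemma pexp_real:
 "pexp (sum_list l) (tcoef (boxes l) fst snd) b =
  (\<Sum>h\<in>content_maps (boxes l) b. rg.wick (boxes l \<times> UNIV) (\<lambda>u. (fst (fst u), h u)) * sign_sum (boxes l) h)"
proof -
 let ?D = "boxes l"
 have w: "(\<Sum>B\<in>level_pairings fst ?D. if const_on B h then 1 else 0) = rg.wick (?D \<times> UNIV) (\<lambda>u. (fst (fst u), h u))" for h
 proof -
  have "{B \<in> level_pairings fst ?D. const_on B h} = {B \<in> pairings (?D \<times> UNIV). const_on B (\<lambda>u. (fst (fst u), h u))}"
   by (auto simp: level_pairings_def const_on_Pair)
  then show ?thesis
   using rg_wick[of "?D \<times> UNIV" "\<lambda>u. (fst (fst u), h u)"] finite_level_pairings[OF finite_boxes, of fst l]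
   by (simp add: sum.If_cases Int_def finite_boxes)
 qed
 have "pexp (sum_list l) (\<lambda>r. (\<lambda>_. 1) (length r) * tcoef ?D fst snd r) b =
   (\<Sum>h\<in>content_maps ?D b. \<Sum>\<sigma>\<in>level_perms snd ?D. if const_on (perm_pairs ?D \<sigma>) h then of_int (sign \<sigma>) *
   (\<Sum>B\<in>level_pairings fst ?D. if const_on B h then 1 else 0) else 0)"
  by (rule pexp_tcoef[OF finite_boxes card_boxes])
 also have "\<dots> = (\<Sum>h\<in>content_maps ?D b. rg.wick (?D \<times> UNIV) (\<lambda>u. (fst (fst u), h u)) * sign_sum ?D h)"
  unfolding w sign_sum_def sum_distrib_left by (intro sum.cong refl) (auto simp: mult.commute)
 finally show ?thesis by simp
qed

lemma real_triangular:
 assumes "is_partition l" "m \<in> partitions_of (sum_list l)"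
  and "pexp (sum_list l) (tcoef (boxes l) fst snd) (expo m) \<noteq> 0"
 shows "dominates l m"
proof -
 from assms(3) obtain h where h: "h \<in> content_maps (boxes l) (expo m)" "sign_sum (boxes l) h \<noteq> 0"
  unfolding pexp_real by (elim sum_nonzeroE) auto
 show ?thesis
  by (rule dominates_of_coloring[OF assms(1) layer_injective_card_le[OF finite_boxes sign_sum_layer_injective[OF finite_boxes h(2)]]])
    (use assms(2) content_mapsD[OF h(1)] in \<open>auto simp: partitions_of_def\<close>)
qed

text \<open>Two column preserving permutations, one for each copy of the diagram; they will index
  the terms of the two factors in the squared product of minors.\<close>

definition pair_coloring :: "(nat \<times> nat) set \<Rightarrow> (nat \<times> nat \<Rightarrow> nat \<times> nat) \<times> (nat \<times> nat \<Rightarrow> nat \<times> nat) \<Rightarrow> (nat \<times> nat) \<times> bool \<Rightarrow> nat" where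
 "pair_coloring D = (\<lambda>(f, g). restrict (\<lambda>(s, e). fst (if e then g s else f s)) (D \<times> UNIV))"

lemma pair_coloring_simps:
 "s \<in> D \<Longrightarrow> pair_coloring D (f, g) (s, False) = fst (f s)" "s \<in> D \<Longrightarrow> pair_coloring D (f, g) (s, True) = fst (g s)"
 by (simp_all add: pair_coloring_def)

lemma level_perms_level: "f \<in> level_perms y D \<Longrightarrow> y (f s) = y s"
 by (simp only: level_perms_def mem_Collect_eq)

lemma level_permsI: "f permutes D \<Longrightarrow> (\<And>s. y (f s) = y s) \<Longrightarrow> f \<in> level_perms y D"
 by (simp only: level_perms_def mem_Collect_eq simp_thms)

lemma level_perms_eqI:
 assumes "f \<in> level_perms snd D" "g \<in> level_perms snd D" "\<And>s. s \<in> D \<Longrightarrow> fst (f s) = fst (g s)"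
 shows "f = g"
proof
 fix s
 show "f s = g s"
 proof (cases "s \<in> D")
  case True
  have "snd (f s) = snd (g s)" using assms(1,2)[THEN level_perms_level, of s] by simp
  then show ?thesis using assms(3)[OF True] by (simp add: prod_eq_iff)
 next
  case False
  then show ?thesis using assms(1,2)[THEN level_permsD] by (simp add: permutes_not_in)
 qed
qed

text \<open>Only \<open>inv g \<circ> f\<close> matches the colours of the two copies, since a
  column preserving permutation is determined by the rows of its values.\<close>

lemma sign_sum_pair_coloring:
 assumes D: "finite D" and f: "f \<in> level_perms snd D" and g: "g \<in> level_perms snd D"
 shows "sign_sum D (pair_coloring D (f, g)) = of_int (sign f * sign g)"
proof -
 note fp = level_permsD[OF f] and gp = level_permsD[OF g]
 let ?t = "inv g \<circ> f"
 have ginv: "inv g permutes D" by (rule permutes_inv[OF gp])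
 have gg: "g (inv g s) = s" for s by (rule permutes_inverses(1)[OF gp])
 have ig: "snd (inv g s) = snd s" for s using level_perms_level[OF g, of "inv g s"] unfolding gg by simp
 have t: "?t \<in> level_perms snd D"
  by (rule level_permsI[OF permutes_compose[OF fp ginv]]) (simp only: comp_apply ig level_perms_level[OF f])
 have "const_on (perm_pairs D \<sigma>) (pair_coloring D (f, g)) \<longleftrightarrow> \<sigma> = ?t" if s: "\<sigma> \<in> level_perms snd D" for \<sigma>
 proof -
  note sp = level_permsD[OF s]
  have gs: "g \<circ> \<sigma> \<in> level_perms snd D"
   by (rule level_permsI[OF permutes_compose[OF sp gp]]) (simp only: comp_apply level_perms_level[OF g] level_perms_level[OF s])
  have "const_on (perm_pairs D \<sigma>) (pair_coloring D (f, g)) \<longleftrightarrow> (\<forall>d\<in>D. fst ((g \<circ> \<sigma>) d) = fst (f d))"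
   unfolding const_on_perm_pairs[OF sp] using permutes_in_image[OF sp] by (simp add: pair_coloring_simps)
  also have "\<dots> \<longleftrightarrow> g \<circ> \<sigma> = f" using level_perms_eqI[OF gs f] by auto
  also have "\<dots> \<longleftrightarrow> \<sigma> = ?t"
   using permutes_inverses[OF gp] unfolding fun_eq_iff comp_apply by metis
  finally show ?thesis .
 qed
 then have "sign_sum D (pair_coloring D (f, g)) = (\<Sum>\<sigma>\<in>level_perms snd D. if \<sigma> = ?t then of_int (sign \<sigma>) else 0)"
  unfolding sign_sum_def by (intro sum.cong) auto
 also have "\<dots> = of_int (sign ?t)" using t finite_level_perms[OF D] by simp
 also have "sign ?t = sign f * sign g"
  using permutes_imp_permutation[OF D fp] permutes_imp_permutation[OF D gp] permutes_imp_permutation[OF D ginv]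
  by (simp add: sign_compose sign_inverse)
 finally show ?thesis .
qed

lemma prod_cells:
 fixes g :: "'d \<times> bool \<Rightarrow> 'b :: comm_monoid_mult"
 shows "(\<Prod>u\<in>D \<times> UNIV. g u) = (\<Prod>s\<in>D. g (s, False)) * (\<Prod>s\<in>D. g (s, True))"
proof -
 have "(\<Prod>u\<in>D \<times> UNIV. g u) = (\<Prod>s\<in>D. \<Prod>e\<in>UNIV. g (s, e))"
  unfolding prod.cartesian_product by (intro prod.cong) auto
 also have "\<dots> = (\<Prod>s\<in>D. g (s, False) * g (s, True))" by (simp add: UNIV_bool mult.commute)
 finally show ?thesis by (simp add: prod.distrib)
qed

text \<open>For content \<open>l\<close> the colourings with nonzero sign sum come from pairs of
  column permutations. Their signs and moments recombine to the expectation of the squared product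
  of column minors.\<close>

lemma real_leading:
 assumes l: "is_partition l"
 shows "pexp (sum_list l) (tcoef (boxes l) fst snd) (expo l) = (\<Prod>s\<in>boxes l. 2 * real (arm l s) + real (leg l s) + 1)"
proof -
 let ?D = "boxes l" and ?LP = "level_perms snd (boxes l)" and ?C = "content_maps (boxes l) (expo l)"
 let ?w = "\<lambda>h. rg.wick (?D \<times> UNIV) (\<lambda>u. (fst (fst u), h u))"
 have C: "pair_coloring ?D c \<in> ?C" if c: "c \<in> ?LP \<times> ?LP" for c
 proof -
  obtain f g where fg: "c = (f, g)" "f \<in> ?LP" "g \<in> ?LP" using c by auto
  have pre: "card {s \<in> ?D. fst (f s) = i} = lookup (expo l) i" if "f \<in> ?LP" for f i
   using card_bij_preimage[OF permutes_imp_bij[OF level_permsD[OF that]], of "\<lambda>s. fst s = i"] by (simp add: card_row_boxes)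
  have "card {u \<in> ?D \<times> UNIV. pair_coloring ?D c u = i} = 2 * lookup (expo l) i" for i
  proof -
   have "{s \<in> ?D. pair_coloring ?D c (s, False) = i} = {s \<in> ?D. fst (f s) = i}"
    "{s \<in> ?D. pair_coloring ?D c (s, True) = i} = {s \<in> ?D. fst (g s) = i}"
    unfolding fg(1) by (auto simp: pair_coloring_simps)
   then show ?thesis unfolding card_cells_layers[OF finite_boxes] using pre fg by simp
  qed
  moreover have "pair_coloring ?D c \<in> ?D \<times> UNIV \<rightarrow>\<^sub>E UNIV" by (simp add: fg(1) pair_coloring_def)
  ultimately show ?thesis by (simp add: content_maps_def)
 qed
 have inj: "inj_on (pair_coloring ?D) (?LP \<times> ?LP)"
 proof (rule inj_onI, clarify)
  fix f g f' g' assume *: "f \<in> ?LP" "g \<in> ?LP" "f' \<in> ?LP" "g' \<in> ?LP" "pair_coloring ?D (f, g) = pair_coloring ?D (f', g')"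
  have "fst (f s) = fst (f' s)" "fst (g s) = fst (g' s)" if "s \<in> ?D" for s
   using fun_cong[OF *(5), of "(s, False)"] fun_cong[OF *(5), of "(s, True)"] that by (simp_all add: pair_coloring_simps)
  then show "f = f' \<and> g = g'" using level_perms_eqI * by metis
 qed
 have surj: "h \<in> pair_coloring ?D ` (?LP \<times> ?LP)" if h: "h \<in> ?C" "sign_sum ?D h \<noteq> 0" for h
 proof -
  note inj = sign_sum_layer_injective[OF finite_boxes h(2)]
  have lt: "(h (s, e), snd s) \<in> ?D" if "s \<in> ?D" for s e
   using extremal_color_lt[OF l layer_injective_card_le[OF finite_boxes inj] content_mapsD[OF h(1)], of "(s, e)"] that by simp
  \<comment> \<open>With the colour read as a row, each copy gives an injective column preserving
    self-map of the diagram, hence a permutation.\<close>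
  define c where "c e s = (if s \<in> ?D then (h (s, e), snd s) else s)" for e s
  have c: "c e \<in> ?LP" for e
  proof -
   have "inj_on (c e) ?D" using inj by (auto simp: inj_on_def c_def layer_injective_def)
   then have "c e permutes ?D" by (rule inj_imp_permutes[OF _ finite_boxes]) (use lt in \<open>auto simp: c_def\<close>)
   then show ?thesis by (auto simp: level_perms_def c_def)
  qed
  have "h = pair_coloring ?D (c False, c True)"
  proof
   fix u :: "(nat \<times> nat) \<times> bool"
   obtain s e where u: "u = (s, e)" by (cases u)
   show "h u = pair_coloring ?D (c False, c True) u"
   proof (cases "s \<in> ?D")
    case True
    then show ?thesis unfolding u by (cases e) (simp_all add: pair_coloring_simps c_def)
   next
    case False
    then have "h u = undefined" "pair_coloring ?D (c False, c True) u = undefined"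
     using h(1) PiE_arb[of h "?D \<times> UNIV" "\<lambda>_. UNIV" u] unfolding u by (simp_all add: content_maps_def pair_coloring_def)
    then show ?thesis by simp
   qed
  qed
  then show ?thesis using c by blast
 qed
 have "pexp (sum_list l) (tcoef ?D fst snd) (expo l) = (\<Sum>h\<in>?C. ?w h * sign_sum ?D h)" by (rule pexp_real)
 also have "\<dots> = (\<Sum>h\<in>pair_coloring ?D ` (?LP \<times> ?LP). ?w h * sign_sum ?D h)"
 proof (rule sum.mono_neutral_right)
  show "pair_coloring ?D ` (?LP \<times> ?LP) \<subseteq> ?C" using C by blast
  show "\<forall>h\<in>?C - pair_coloring ?D ` (?LP \<times> ?LP). ?w h * sign_sum ?D h = 0" using surj by auto
 qed (rule finite_content_maps[OF finite_boxes])
 also have "\<dots> = (\<Sum>c\<in>?LP \<times> ?LP. ?w (pair_coloring ?D c) * sign_sum ?D (pair_coloring ?D c))"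
  unfolding sum.reindex[OF inj] comp_def ..
 also have "\<dots> = (\<Sum>f\<in>?LP. \<Sum>g\<in>?LP. ?w (pair_coloring ?D (f, g)) * sign_sum ?D (pair_coloring ?D (f, g)))"
  unfolding sum.cartesian_product by (intro sum.cong) auto
 also have "\<dots> = (\<Sum>f\<in>?LP. \<Sum>g\<in>?LP. rg.Ex (of_int (sign f * sign g) *
   ((\<Prod>s\<in>?D. Var (fst s, fst (f s))) * (\<Prod>s\<in>?D. Var (fst s, fst (g s))))))"
 proof (intro sum.cong refl)
  fix f g assume fg: "f \<in> ?LP" "g \<in> ?LP"
  have "(\<Prod>s\<in>?D. Var (fst s, fst (f s))) * (\<Prod>s\<in>?D. Var (fst s, fst (g s))) =
    (\<Prod>u\<in>?D \<times> UNIV. Var (fst (fst u), pair_coloring ?D (f, g) u))"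
   unfolding prod_cells by (simp add: pair_coloring_simps)
  also have "rg.Ex \<dots> = ?w (pair_coloring ?D (f, g))" by (rule rg.Ex_prod_Var) (simp add: finite_boxes)
  finally show "?w (pair_coloring ?D (f, g)) * sign_sum ?D (pair_coloring ?D (f, g)) = rg.Ex (of_int (sign f * sign g) *
   ((\<Prod>s\<in>?D. Var (fst s, fst (f s))) * (\<Prod>s\<in>?D. Var (fst s, fst (g s)))))"
   unfolding rg.Ex_of_int sign_sum_pair_coloring[OF finite_boxes fg] by simp
 qed
 also have "\<dots> = rg.Ex (level_det ?D fst snd * level_det ?D fst snd)"
  unfolding level_det_def sum_product rg.Ex_sum by (intro sum.cong refl arg_cong[where f = rg.Ex]) (simp add: algebra_simps)
 also have "\<dots> = (\<Prod>s\<in>?D. 2 * real (arm l s) + real (leg l s) + 1)" by (rule real_hook_product[OF l])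
 finally show ?thesis .
qed

text \<open>A nonzero scalar product provides a bijection whose row labels, taken from
  \<open>m\<close>, are distinct within each column of \<open>l\<close> and each copy. This is a
  colouring of \<open>l\<close> with content \<open>m\<close>; applied in both directions it gives
  orthogonality by antisymmetry.\<close>

lemma real_inner_dominates:
 assumes l: "is_partition l" and m: "is_partition m" "sum_list m = sum_list l"
  and nz: "(\<Sum>r\<in>partitions_of (sum_list l). tcoef (boxes l) fst snd r * tcoef (boxes m) fst snd r * (real (part_z r) * 2 ^ length r)) \<noteq> 0"
 shows "dominates l m"
proof -
 note fin = finite_boxes[of l] finite_boxes[of m]
 have c: "card (boxes l) = sum_list l" "card (boxes m) = sum_list l" using m by (simp_all add: card_boxes)
 obtain g :: "(nat \<times> nat) \<times> bool \<Rightarrow> (nat \<times> nat) \<times> bool" where g: "bij_betw g (boxes l \<times> UNIV) (boxes m \<times> UNIV)"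
   "layer_injective (boxes l) snd (\<lambda>u. fst (fst (g u)))"
  using isos_orthogonality[OF fin nz[unfolded tcoef_inner[OF fin c]]] by blast
 show ?thesis
 proof (rule dominates_of_coloring[OF l layer_injective_card_le[OF finite_boxes g(2)] m])
  show "card {u \<in> boxes l \<times> UNIV. fst (fst (g u)) = i} = 2 * lookup (expo m) i" for i
   using card_bij_preimage[OF g(1), of "\<lambda>v. fst (fst v) = i"] by (simp add: card_row_cells)
 qed
qed

lemma jack_theta_real:
 assumes "is_partition l" "r \<in> partitions_of (sum_list l)"
 shows "jack_theta 2 r l = tcoef (boxes l) fst snd r"
proof (rule jack_theta_eq[where \<theta> = "\<lambda>l. tcoef (boxes l) fst snd" and c = "\<lambda>l. \<Prod>s\<in>boxes l. 2 * real (arm l s) + real (leg l s) + 1"])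
 show "(\<Prod>s\<in>boxes l. 2 * real (arm l s) + real (leg l s) + 1) \<noteq> 0" for l
 proof -
  have "2 * real (arm l s) + real (leg l s) + 1 > 0" for s by (simp add: add_nonneg_pos)
  then show ?thesis by (simp add: finite_boxes less_imp_neq[symmetric])
 qed
 show "(\<Sum>r\<in>partitions_of (sum_list l). tcoef (boxes l) fst snd r * tcoef (boxes m) fst snd r * (real (part_z r) * 2 ^ length r)) = 0"
  if *: "is_partition l" "is_partition m" "sum_list l = sum_list m" "l \<noteq> m" for l m
 proof (rule ccontr)
  assume nz: "(\<Sum>r\<in>partitions_of (sum_list l). tcoef (boxes l) fst snd r * tcoef (boxes m) fst snd r * (real (part_z r) * 2 ^ length r)) \<noteq> 0"
  have "dominates l m" by (rule real_inner_dominates[OF *(1,2) *(3)[symmetric] nz])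
  moreover have "dominates m l"
   by (rule real_inner_dominates[OF *(2,1) *(3)]) (use nz *(3) in \<open>simp add: mult.commute mult.left_commute\<close>)
  ultimately show False using dominates_antisym * by blast
 qed
qed (use assms real_triangular real_leading in auto)

section \<open>Transport along bijections and the signs of spin permutations\<close>

lemma npoly_image:
 assumes "finite S" "P \<in> pairings S" "Q \<in> pairings S" "bij_betw g S S'"
 shows "npoly (image g ` P) (image g ` Q) = npoly P Q"
proof -
 have S': "finite S'" using assms(1,4) bij_betw_finite by blast
 note im = image_pairing[OF assms(2,4)] image_pairing[OF assms(3,4)]
 have "restrict g S \<in> isos S P Q S' (image g ` P) (image g ` Q)"
  using assms(4) im(2,4) mate_in[OF assms(2)] mate_in[OF assms(3)] by (auto simp: isos_def bij_betw_def)
 moreover have "finite (isos S P Q S' (image g ` P) (image g ` Q))"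
  by (rule finite_subset[of _ "S \<rightarrow>\<^sub>E S'"]) (use assms(1) S' in \<open>auto simp: isos_def intro: finite_PiE\<close>)
 ultimately have "card (isos S P Q S' (image g ` P) (image g ` Q)) \<noteq> 0" by auto
 then have "ptype P Q = ptype (image g ` P) (image g ` Q)"
  unfolding card_isos[OF assms(1-3) S' im(1,3)] by (metis (full_types))
 then show ?thesis by (metis length_pairs_type pairs_type_eq_iff)
qed

lemma image_fibre_pairing:
 assumes bij: "bij_betw g S (D \<times> (UNIV :: bool set))" and B: "B \<in> pairings S" "const_on B (\<lambda>v. fst (g v))"
 shows "image g ` B = perm_pairs D id"
proof -
 note im = image_pairing[OF B(1) bij]
 show ?thesis
 proof (rule pairings_eqI[OF im(1) perm_pairs_pairings[OF permutes_id]])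
  fix w assume w: "w \<in> D \<times> (UNIV :: bool set)"
  then have "w \<in> g ` S" using bij by (simp add: bij_betw_def)
  then obtain v where v: "v \<in> S" "w = g v" by blast
  obtain d e where de: "w = (d, e)" "d \<in> D" using w by auto
  have "mate (image g ` B) w = g (mate B v)" using im(2)[OF v(1)] v(2) by simp
  moreover have "fst (g (mate B v)) = fst w" using B(2) v unfolding const_on_mate[OF B(1)] by blast
  moreover have "g (mate B v) \<noteq> w"
   using mate_neq[OF B(1) v(1)] inj_onD[OF bij_betw_imp_inj_on[OF bij], of "mate B v" v] mate_in[OF B(1) v(1)] v by auto
  ultimately have "mate (image g ` B) w = (d, \<not> e)" using de by (cases "g (mate B v)") auto
  then show "mate (image g ` B) w = mate (perm_pairs D id) w"
   using mate_perm_pairs[OF permutes_id de(2)] de(1) by (cases e) simp_all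
 qed
qed

lemma inj_on_perm_pairs: "inj_on (perm_pairs D) (level_perms y D)"
proof (rule inj_onI)
 fix \<sigma> \<tau> assume st: "\<sigma> \<in> level_perms y D" "\<tau> \<in> level_perms y D" "perm_pairs D \<sigma> = perm_pairs D \<tau>"
 show "\<sigma> = \<tau>"
 proof
  fix d
  show "\<sigma> d = \<tau> d"
   using mate_perm_pairs(1)[OF level_permsD[OF st(1)], of d] mate_perm_pairs(1)[OF level_permsD[OF st(2)], of d] st(3)
    permutes_not_in[OF level_permsD[OF st(1)], of d] permutes_not_in[OF level_permsD[OF st(2)], of d]
   by (cases "d \<in> D") auto
 qed
qed

lemma perm_pairs_of_alternating:
 assumes D: "finite D" and PP: "P \<in> pairings (D \<times> UNIV)"
  and al: "\<And>v. v \<in> D \<times> UNIV \<Longrightarrow> snd (mate P v) = (\<not> snd v)"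
  and y: "\<And>v. v \<in> D \<times> UNIV \<Longrightarrow> y (fst (mate P v)) = y (fst v)"
 obtains \<sigma> where "\<sigma> \<in> level_perms y D" "P = perm_pairs D \<sigma>"
proof -
 let ?X = "D \<times> (UNIV :: bool set)"
 define \<sigma> where "\<sigma> d = (if d \<in> D then fst (mate P (d, False)) else d)" for d
 have m: "mate P (d, False) = (\<sigma> d, True)" "y (\<sigma> d) = y d" "\<sigma> d \<in> D" if d: "d \<in> D" for d
  using al[of "(d, False)"] y[of "(d, False)"] mate_in[OF PP, of "(d, False)"] d
  by (auto simp: \<sigma>_def prod_eq_iff mem_Times_iff)
 have "\<sigma> permutes D"
 proof (rule inj_imp_permutes[OF _ D])
  show "inj_on \<sigma> D"
  proof (rule inj_onI)
   fix d d' assume d: "d \<in> D" "d' \<in> D" "\<sigma> d = \<sigma> d'"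
   then have "mate P (d, False) = mate P (d', False)" using m(1) by simp
   then show "d = d'" using mate_inj[OF PP, of "(d, False)" "(d', False)"] d by simp
  qed
 qed (use m(3) in \<open>simp_all add: \<sigma>_def\<close>)
 moreover have "y (\<sigma> d) = y d" for d using m(2)[of d] by (cases "d \<in> D") (auto simp: \<sigma>_def)
 ultimately have s: "\<sigma> \<in> level_perms y D" by (rule level_permsI)
 note sp = level_permsD[OF s]
 have "P = perm_pairs D \<sigma>"
 proof (rule pairings_eqI[OF PP perm_pairs_pairings[OF sp]])
  fix v assume v: "v \<in> ?X"
  then obtain d e where de: "v = (d, e)" "d \<in> D" by auto
  show "mate P v = mate (perm_pairs D \<sigma>) v"
  proof (cases e)
   case False
   then show ?thesis using m(1)[OF de(2)] mate_perm_pairs(1)[OF sp de(2)] de(1) by simp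
  next
   case True
   obtain d' where d': "d' \<in> D" "d = \<sigma> d'" using de(2) permutes_image[OF sp] by (metis imageE)
   have "mate P v = (d', False)" using mate_mate[OF PP, of "(d', False)"] m(1)[OF d'(1)] d' de(1) True by simp
   then show ?thesis using mate_perm_pairs(2)[OF sp d'(1)] d'(2) de(1) True by simp
  qed
 qed
 with s that show thesis by blast
qed

text \<open>Permuting the second copy by \<sigma> and flipping the points of \<open>G\<close> turns
  \<open>u\<close> into a permutation \<open>q\<close> that keeps the two copies, i.e. a pair of
  permutations of \<open>D\<close>. Under \<open>u\<close> the pairing \<open>B\<close> becomes the
  identity pairing and the pairing of \<sigma> becomes that of the quotient \<open>?t\<close> of
  this pair, so the sign of \<open>?t\<close> is counted by polygons.\<close>

lemma spin_sign:
 assumes D: "finite D" and u: "u permutes D \<times> UNIV" and s: "\<sigma> permutes D"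
  and c: "\<And>d. d \<in> D \<Longrightarrow> snd (u (\<sigma> d, True)) = (\<not> snd (u (d, False)))"
  and B: "B \<in> pairings (D \<times> UNIV)" "const_on B (\<lambda>v. fst (u v))"
 shows "sign u * (\<Prod>d\<in>D. sgb (snd (u (d, False)))) = (-1) ^ card D * sign \<sigma> * (-1) ^ npoly B (perm_pairs D \<sigma>)"
proof -
 let ?X = "D \<times> (UNIV :: bool set)" and ?W = "perm_pairs D \<sigma>"
 have X: "finite ?X" using D by simp
 note bij = permutes_imp_bij[OF u] and W = perm_pairs_pairings[OF s] and E = perm_pairs_pairings[OF permutes_id[of D]]
 note 1 = image_fibre_pairing[OF bij B]
 define G where "G = {d \<in> D. snd (u (d, False))}"
 have G: "finite G" "G \<subseteq> D" using D by (auto simp: G_def)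
 note lp = layer_perm[OF D permutes_id s] and fp = flip_perm[OF G D]
 define q where "q = u \<circ> (layer_perm id \<sigma> \<circ> flip_perm G)"
 have q: "q permutes ?X" unfolding q_def by (intro permutes_compose lp(1) fp(1) u)
 have sq: "sign q = sign u * (sign \<sigma> * (-1) ^ card G)" unfolding q_def
  using permutes_imp_permutation[OF X lp(1)] permutes_imp_permutation[OF X fp(1)] permutes_imp_permutation[OF X u] lp(2) fp(2)
  by (simp add: sign_compose permutation_compose sign_id)
 define qe where "qe e d = fst (q (d, e))" for e d
 have qv: "q (d, False) = (if d \<in> G then u (\<sigma> d, True) else u (d, False))"
  "q (d, True) = (if d \<in> G then u (d, False) else u (\<sigma> d, True))" for d
  by (auto simp: q_def layer_perm_def flip_perm_def)
 have qs: "snd (q (d, e)) = e" for d e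
 proof (cases "d \<in> D")
  case True
  then show ?thesis using c[OF True] qv[of d] by (cases e) (auto simp: G_def)
 next
  case False
  then show ?thesis using permutes_not_in[OF q, of "(d, e)"] by simp
 qed
 have qq: "q (d, e) = (qe e d, e)" for d e using qs[of d e] by (simp add: qe_def prod_eq_iff)
 have qe: "qe e permutes D" for e
 proof (rule inj_imp_permutes[OF _ D])
  show "inj_on (qe e) D"
  proof (rule inj_onI)
   fix d d' assume "qe e d = qe e d'"
   then have "q (d, e) = q (d', e)" by (simp add: qq)
   then show "d = d'" using permutes_inj[OF q] by (simp add: inj_eq)
  qed
  show "qe e d \<in> D" if "d \<in> D" for d using permutes_in_image[OF q, of "(d, e)"] that by (simp add: qq)
  show "qe e d = d" if "d \<notin> D" for d using permutes_not_in[OF q, of "(d, e)"] that by (simp add: qe_def)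
 qed
 have "q = layer_perm (qe False) (qe True)" by (auto simp: fun_eq_iff layer_perm_def qq)
 then have sq': "sign q = sign (qe False) * sign (qe True)" using layer_perm(2)[OF D qe qe, of False True] by simp
 let ?t = "qe True \<circ> inv (qe False)"
 have t: "?t permutes D" by (intro permutes_compose permutes_inv qe)
 have 2: "image u ` ?W = perm_pairs D ?t"
 proof -
  have "image u ` ?W = (\<lambda>d. {u (d, False), u (\<sigma> d, True)}) ` D" by (simp add: perm_pairs_def image_image)
  also have "\<dots> = (\<lambda>d. {q (d, False), q (d, True)}) ` D" by (intro image_cong refl) (auto simp: qv)
  also have "\<dots> = (\<lambda>d. {(qe False d, False), (?t (qe False d), True)}) ` D"
   using permutes_inverses(2)[OF qe] by (simp add: qq)
  also have "\<dots> = (\<lambda>d. {(d, False), (?t d, True)}) ` (qe False ` D)" by (simp add: image_image)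
  finally show ?thesis unfolding permutes_image[OF qe] perm_pairs_def .
 qed
 have "(-1 :: int) ^ npoly B ?W = (-1) ^ card D * sign ?t"
  using npoly_image[OF X B(1) W bij] sign_npoly[OF D t] unfolding 1 2 by simp
 also have "sign ?t = sign (qe False) * sign (qe True)"
  using permutes_imp_permutation[OF D qe] permutes_imp_permutation[OF D permutes_inv[OF qe]]
  by (simp add: sign_compose sign_inverse mult.commute)
 also have "\<dots> = sign u * (sign \<sigma> * (-1) ^ card G)" using sq sq' by simp
 finally have 3: "(-1 :: int) ^ npoly B ?W = (-1) ^ card D * (sign u * (sign \<sigma> * (-1) ^ card G))" .
 have 4: "(\<Prod>d\<in>D. sgb (snd (u (d, False)))) = (-1) ^ card G"
  using D by (simp add: sgb_def prod.If_cases G_def Int_def)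
 have "sign \<sigma> * sign \<sigma> = 1" "(-1 :: int) ^ card D * (-1) ^ card D = 1"
  by (simp_all add: sign_def power_mult_distrib[symmetric])
 then have "(-1) ^ card D * sign \<sigma> * ((-1) ^ card D * (sign u * (sign \<sigma> * (-1) ^ card G))) = sign u * (-1) ^ card G"
  by (metis (no_types, opaque_lifting) mult.assoc mult.commute mult_1)
 then show ?thesis unfolding 3 4 by simp
qed

lemma prod_if_all:
 fixes g :: "'x \<Rightarrow> real"
 assumes "finite A"
 shows "(\<Prod>a\<in>A. if p a then g a else 0) = (if \<forall>a\<in>A. p a then \<Prod>a\<in>A. g a else 0)"
proof (cases "\<forall>a\<in>A. p a")
 case True
 then show ?thesis by simp
next
 case False
 then obtain a where "a \<in> A" "\<not> p a" by blast
 then have "(\<Prod>a\<in>A. if p a then g a else 0) = 0" using assms by (intro prod_zero) auto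
 then show ?thesis unfolding if_not_P[OF False] .
qed

text \<open>The condition on the second matrix index for a nonzero symplectic covariance along the
  pairs of \<sigma>.\<close>

definition spin_match :: "(nat \<times> nat) set \<Rightarrow> ((nat \<times> nat) \<times> bool \<Rightarrow> (nat \<times> nat) \<times> bool) \<Rightarrow> (nat \<times> nat \<Rightarrow> nat \<times> nat) \<Rightarrow> bool" where
 "spin_match D u \<sigma> \<longleftrightarrow> (\<forall>d\<in>D. spin_row (u (\<sigma> d, True)) = nb (spin_row (u (d, False))))"

text \<open>The covariance vanishes unless both indices are conjugate. For the first index this
  forces the pairing to come from a row preserving permutation \<sigma>, for the second it is
  \<open>spin_match\<close>; the product of signs reduces to the second index, since the first has
  spin \<open>False\<close>.\<close>

lemma qg_wick:
 assumes D: "finite D"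
 shows "qg.wick (D \<times> UNIV) (\<lambda>v. (spin_row v, spin_row (u v))) =
  (\<Sum>\<sigma>\<in>level_perms fst D. if spin_match D u \<sigma> then of_int (\<Prod>d\<in>D. sgb (snd (u (d, False)))) else 0)"
proof -
 let ?X = "D \<times> (UNIV :: bool set)" and ?f = "\<lambda>v. (spin_row v, spin_row (u v))" and ?LP = "level_perms fst D"
 have X: "finite ?X" using D by simp
 note inj = inj_on_perm_pairs[of D fst]
 have zero: "(\<Prod>p\<in>P. qg.pair_cov ?f p) = 0" if P: "P \<in> pairings ?X - perm_pairs D ` ?LP" for P
 proof (rule ccontr)
  assume nz: "(\<Prod>p\<in>P. qg.pair_cov ?f p) \<noteq> 0"
  have PP: "P \<in> pairings ?X" using P by simp
  have nb: "spin_row (mate P v) = nb (spin_row v)" if v: "v \<in> ?X" for v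
  proof -
   have "qg.pair_cov ?f {v, mate P v} \<noteq> 0"
    using nz mate_pair[OF PP v] finite_pairing[OF X PP] prod_zero[of P "qg.pair_cov ?f"] by blast
   then have "?f (mate P v) = jbar (?f v)"
    unfolding qg.pair_cov_pair[OF mate_neq[OF PP v, symmetric]] qg.cov_def by (simp split: if_splits)
   then show ?thesis by (simp add: jbar_def)
  qed
  obtain \<sigma> where "\<sigma> \<in> ?LP" "P = perm_pairs D \<sigma>"
   by (rule perm_pairs_of_alternating[OF D PP, of fst]) (use nb in \<open>auto simp: spin_row_def nb_def\<close>)
  then show False using P by blast
 qed
 have val: "(\<Prod>p\<in>perm_pairs D \<sigma>. qg.pair_cov ?f p) =
   (if spin_match D u \<sigma> then of_int (\<Prod>d\<in>D. sgb (snd (u (d, False)))) else 0)" if s: "\<sigma> \<in> ?LP" for \<sigma>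
 proof -
  have "inj_on (\<lambda>d. {(d, False), (\<sigma> d, True)}) D" by (auto simp: inj_on_def doubleton_eq_iff)
  then have "(\<Prod>p\<in>perm_pairs D \<sigma>. qg.pair_cov ?f p) = (\<Prod>d\<in>D. qg.pair_cov ?f {(d, False), (\<sigma> d, True)})"
   unfolding perm_pairs_def by (subst prod.reindex) auto
  also have "\<dots> = (\<Prod>d\<in>D. if spin_row (u (\<sigma> d, True)) = nb (spin_row (u (d, False))) then of_int (sgb (snd (u (d, False)))) else 0)"
  proof (rule prod.cong[OF refl])
   fix d
   have "spin_row (\<sigma> d, True) = nb (spin_row (d, False))" using level_perms_level[OF s, of d] by (simp add: spin_row_def nb_def)
   moreover have "js (?f (d, False)) = of_int (sgb (snd (u (d, False))))" by (simp add: js_def spin_row_def sgb_def)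
   moreover have "qg.pair_cov ?f {(d, False), (\<sigma> d, True)} = qg.cov (?f (d, False)) (?f (\<sigma> d, True))"
    by (rule qg.pair_cov_pair) simp
   ultimately show "qg.pair_cov ?f {(d, False), (\<sigma> d, True)} =
     (if spin_row (u (\<sigma> d, True)) = nb (spin_row (u (d, False))) then of_int (sgb (snd (u (d, False)))) else 0)"
    by (simp add: qg.cov_def jbar_def)
  qed
  finally show ?thesis unfolding prod_if_all[OF D] spin_match_def by simp
 qed
 have "qg.wick ?X ?f = (\<Sum>P\<in>perm_pairs D ` ?LP. \<Prod>p\<in>P. qg.pair_cov ?f p)" unfolding qg.wick_def
 proof (rule sum.mono_neutral_right)
  show "perm_pairs D ` ?LP \<subseteq> pairings ?X" using perm_pairs_pairings[OF level_permsD] by blast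
 qed (use zero finite_pairings[OF X] in auto)
 also have "\<dots> = (\<Sum>\<sigma>\<in>?LP. \<Prod>p\<in>perm_pairs D \<sigma>. qg.pair_cov ?f p)" unfolding sum.reindex[OF inj] comp_def ..
 finally show ?thesis using val by simp
qed

section \<open>Sums over embeddings\<close>

lemma fibre_pairing_unique:
 assumes S: "finite S" and P: "P \<in> pairings S" "const_on P \<kappa>" and Q: "Q \<in> pairings S" "const_on Q \<kappa>"
  and le: "\<And>k. card {s \<in> S. \<kappa> s = k} \<le> 2"
 shows "P = Q"
proof (rule pairings_eqI[OF P(1) Q(1)])
 fix s assume s: "s \<in> S"
 show "mate P s = mate Q s"
 proof (rule ccontr)
  assume ne: "mate P s \<noteq> mate Q s"
  have "{s, mate P s, mate Q s} \<subseteq> {t \<in> S. \<kappa> t = \<kappa> s}"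
   using s mate_in[OF P(1) s] mate_in[OF Q(1) s] P(2) Q(2) unfolding const_on_mate[OF P(1)] const_on_mate[OF Q(1)] by simp
  then have "card {s, mate P s, mate Q s} \<le> card {t \<in> S. \<kappa> t = \<kappa> s}" by (rule card_mono[rotated]) (use S in simp)
  then have "card {s, mate P s, mate Q s} \<le> 2" using le[of "\<kappa> s"] by simp
  moreover have "card {s, mate P s, mate Q s} = 3" using ne mate_neq[OF P(1) s] mate_neq[OF Q(1) s] by simp
  ultimately show False by simp
 qed
qed

lemma alternating_on_perm_pairs:
 assumes "\<And>d. d \<in> D \<Longrightarrow> f (\<sigma> d, True) = (\<not> f (d, False))"
 shows "alternating_on (perm_pairs D \<sigma>) f" unfolding alternating_on_def
proof (intro allI impI)
 fix s t assume "{s, t} \<in> perm_pairs D \<sigma>"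
 then obtain d where d: "d \<in> D" "{s, t} = {(d, False), (\<sigma> d, True)}" unfolding perm_pairs_def by blast
 then show "f s \<noteq> f t" using assms[OF d(1)] unfolding doubleton_eq_iff by auto
qed

text \<open>A nonzero sum admits a compatible pairing, so nonempty fibres have at least two
  elements; the vanishing beyond two makes every nonempty fibre a pair.\<close>

lemma card_image_pairing_sum:
 assumes S: "finite S" "W \<in> pairings S" and nz: "pairing_sum S W f \<noteq> 0"
 shows "card S = 2 * card (f ` S)" "card {s \<in> S. f s = k} \<le> 2"
proof -
 show le: "card {s \<in> S. f s = k} \<le> 2" for k using pairing_sum_eq_0[OF S, of f k] nz by linarith
 obtain E where E: "E \<in> pairings S" "const_on E f" using nz unfolding pairing_sum_def by (elim sum_nonzeroE) (auto split: if_splits)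
 have "card {s \<in> S. f s = k} = 2" if "k \<in> f ` S" for k
 proof -
  obtain s where s: "s \<in> S" "f s = k" using \<open>k \<in> f ` S\<close> by blast
  have "card {s, mate E s} \<le> card {s \<in> S. f s = k}"
   by (rule card_mono) (use S s E(2) mate_in[OF E(1) s(1)] in \<open>auto simp: const_on_mate[OF E(1)]\<close>)
  then show ?thesis using le[of k] mate_neq[OF E(1) s(1)] by simp
 qed
 then have "card {s \<in> S. f s \<in> f ` S} = 2 * card (f ` S)" using card_by_fibres[OF S(1), of "f ` S" f] S(1) by simp
 moreover have "{s \<in> S. f s \<in> f ` S} = S" by blast
 ultimately show "card S = 2 * card (f ` S)" by simp
qed

text \<open>The sum over maps with the labelling by boxes moved outermost. Abstract
  \<open>D\<close>, \<open>x\<close> and \<open>y\<close> make it possible to delete boxes and to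
  exchange rows and columns.\<close>

definition embedding_sum :: "'a set \<Rightarrow> 'a set set \<Rightarrow> 'a set set \<Rightarrow> 'd set \<Rightarrow> ('d \<Rightarrow> nat) \<Rightarrow> ('d \<Rightarrow> nat) \<Rightarrow> real" where
 "embedding_sum S B W D x y =
  (\<Sum>f\<in>S \<rightarrow>\<^sub>E D. if const_on B (\<lambda>s. x (f s)) \<and> const_on W (\<lambda>s. y (f s)) then pairing_sum S W f else 0)"

definition cell_maps :: "'a set \<Rightarrow> 'd set \<Rightarrow> ('a \<Rightarrow> 'd \<times> bool) set" where
 "cell_maps S D = {g \<in> S \<rightarrow>\<^sub>E D \<times> UNIV. bij_betw g S (D \<times> UNIV)}"

text \<open>The bijections onto the doubled diagram that lie over \<open>f\<close>. Counting those
  compatible with \<open>W\<close> is where the factors 2 of -2 are spent.\<close>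

definition map_fibre :: "'a set \<Rightarrow> 'd set \<Rightarrow> ('a \<Rightarrow> 'd) \<Rightarrow> ('a \<Rightarrow> 'd \<times> bool) set" where
 "map_fibre S D f = {g \<in> cell_maps S D. restrict (\<lambda>s. fst (g s)) S = f}"

context
 fixes S :: "'a set" and W :: "'a set set" and D :: "'d set"
 assumes S: "finite S" and W: "W \<in> pairings S" and D: "finite D"
begin

abbreviation dcells :: "('d \<times> bool) set" where "dcells \<equiv> D \<times> UNIV"

lemma finite_cell_maps: "finite (cell_maps S D)"
 by (rule finite_subset[of _ "S \<rightarrow>\<^sub>E dcells"]) (use S D in \<open>auto simp: cell_maps_def intro: finite_PiE\<close>)

lemma cell_mapsD: "g \<in> cell_maps S D \<Longrightarrow> bij_betw g S dcells" by (simp add: cell_maps_def)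

text \<open>At most one permutation has the image of \<open>W\<close> under \<open>g\<close> as its
  pairing; it exists iff \<open>W\<close> alternates between the copies and respects the levels.
  Since \<open>g\<close> sends the fibre pairing \<open>E\<close> to the identity pairing,
  \<open>sign_npoly\<close> gives its sign.\<close>

lemma sum_level_perms_image:
 assumes g: "g \<in> cell_maps S D" and E: "E \<in> pairings S" "const_on E (\<lambda>s. fst (g s))"
 shows "(\<Sum>\<sigma>\<in>level_perms y D. if \<forall>s\<in>S. g (mate W s) = mate (perm_pairs D \<sigma>) (g s) then of_int (sign \<sigma>) else 0 :: real) =
  (if alternating_on W (\<lambda>s. snd (g s)) \<and> const_on W (\<lambda>s. y (fst (g s))) then (-1) ^ card D * (-1) ^ npoly E W else 0)"
  (is "?L = ?R")
proof -
 note bij = cell_mapsD[OF g]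
 note im = image_pairing[OF W bij]
 have uniq: "(\<forall>s\<in>S. g (mate W s) = mate (perm_pairs D \<sigma>) (g s)) \<longleftrightarrow> image g ` W = perm_pairs D \<sigma>" if s: "\<sigma> \<in> level_perms y D" for \<sigma>
 proof
  assume c: "\<forall>s\<in>S. g (mate W s) = mate (perm_pairs D \<sigma>) (g s)"
  show "image g ` W = perm_pairs D \<sigma>"
  proof (rule pairings_eqI[OF im(1) perm_pairs_pairings[OF level_permsD[OF s]]])
   fix v assume "v \<in> dcells"
   then have "v \<in> g ` S" using bij by (simp add: bij_betw_def)
   then obtain u where u: "u \<in> S" "v = g u" by blast
   then show "mate (image g ` W) v = mate (perm_pairs D \<sigma>) v" using c im(2)[OF u(1)] by metis
  qed
 qed (use im(2) in metis)
 have via: "(\<forall>v\<in>dcells. p v (mate (image g ` W) v)) \<longleftrightarrow> (\<forall>s\<in>S. p (g s) (g (mate W s)))" for p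
 proof -
  have "(\<forall>v\<in>dcells. p v (mate (image g ` W) v)) \<longleftrightarrow> (\<forall>v\<in>g ` S. p v (mate (image g ` W) v))"
   using bij by (simp add: bij_betw_def)
  then show ?thesis using im(2) by simp
 qed
 have iff: "(\<exists>\<sigma>\<in>level_perms y D. image g ` W = perm_pairs D \<sigma>) \<longleftrightarrow>
   alternating_on W (\<lambda>s. snd (g s)) \<and> const_on W (\<lambda>s. y (fst (g s)))"
 proof
  assume "\<exists>\<sigma>\<in>level_perms y D. image g ` W = perm_pairs D \<sigma>"
  then obtain \<sigma> where s: "\<sigma> \<in> level_perms y D" "image g ` W = perm_pairs D \<sigma>" by blast
  note sp = level_permsD[OF s(1)]
  have "alternating_on (perm_pairs D \<sigma>) snd" by (rule alternating_on_perm_pairs) simp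
  then have a: "\<forall>v\<in>dcells. snd (mate (image g ` W) v) = (\<not> snd v)"
   unfolding alternating_on_mate[OF perm_pairs_pairings[OF sp]] s(2) .
  have "const_on (perm_pairs D \<sigma>) (\<lambda>v. y (fst v))"
   unfolding const_on_perm_pairs[OF sp] using level_perms_level[OF s(1)] by simp
  then have c: "\<forall>v\<in>dcells. y (fst (mate (image g ` W) v)) = y (fst v)"
   unfolding const_on_mate[OF perm_pairs_pairings[OF sp]] s(2) .
  show "alternating_on W (\<lambda>s. snd (g s)) \<and> const_on W (\<lambda>s. y (fst (g s)))"
   unfolding alternating_on_mate[OF W] const_on_mate[OF W]
   using a c via[of "\<lambda>v w. snd w = (\<not> snd v)"] via[of "\<lambda>v w. y (fst w) = y (fst v)"] by blast
 next
  assume "alternating_on W (\<lambda>s. snd (g s)) \<and> const_on W (\<lambda>s. y (fst (g s)))"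
  then have a: "\<forall>v\<in>dcells. snd (mate (image g ` W) v) = (\<not> snd v)" and c: "\<forall>v\<in>dcells. y (fst (mate (image g ` W) v)) = y (fst v)"
   unfolding alternating_on_mate[OF W] const_on_mate[OF W]
   using via[of "\<lambda>v w. snd w = (\<not> snd v)"] via[of "\<lambda>v w. y (fst w) = y (fst v)"] by blast+
  obtain \<sigma> where "\<sigma> \<in> level_perms y D" "image g ` W = perm_pairs D \<sigma>"
   by (rule perm_pairs_of_alternating[OF D im(1) bspec[OF a] bspec[OF c]])
  then show "\<exists>\<sigma>\<in>level_perms y D. image g ` W = perm_pairs D \<sigma>" by blast
 qed
 have L: "?L = (\<Sum>\<sigma>\<in>level_perms y D. if image g ` W = perm_pairs D \<sigma> then of_int (sign \<sigma>) else 0)"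
  by (rule sum.cong[OF refl]) (simp only: uniq)
 show ?thesis
 proof (cases "\<exists>\<sigma>\<in>level_perms y D. image g ` W = perm_pairs D \<sigma>")
  case True
  then obtain \<sigma> where s: "\<sigma> \<in> level_perms y D" "image g ` W = perm_pairs D \<sigma>" by blast
  have "?L = (\<Sum>\<tau>\<in>level_perms y D. if \<tau> = \<sigma> then of_int (sign \<tau>) else 0)"
   unfolding L s(2)
  proof (rule sum.cong[OF refl])
   fix \<tau> assume t: "\<tau> \<in> level_perms y D"
   show "(if perm_pairs D \<sigma> = perm_pairs D \<tau> then of_int (sign \<tau>) else 0 :: real) = (if \<tau> = \<sigma> then of_int (sign \<tau>) else 0)"
    unfolding inj_on_eq_iff[OF inj_on_perm_pairs s(1) t] by simp
  qed
  also have "\<dots> = of_int (sign \<sigma>)" using s(1) finite_level_perms[OF D] by simp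
  also have "sign \<sigma> = (-1) ^ card D * (-1) ^ npoly (perm_pairs D id) (perm_pairs D \<sigma>)"
   unfolding sign_npoly[OF D level_permsD[OF s(1)]] by (simp add: mult.assoc[symmetric] power_mult_distrib[symmetric])
  also have "npoly (perm_pairs D id) (perm_pairs D \<sigma>) = npoly E W"
   using npoly_image[OF S E(1) W bij] unfolding image_fibre_pairing[OF bij E] s(2) .
  finally show ?thesis using True unfolding iff by simp
 next
  case False
  then have "?L = 0" unfolding L by (intro sum.neutral) auto
  then show ?thesis using False unfolding iff by simp
 qed
qed

lemma map_fibreD:
 assumes "g \<in> map_fibre S D f" shows "g \<in> cell_maps S D" "s \<in> S \<Longrightarrow> fst (g s) = f s"
proof -
 have g: "g \<in> cell_maps S D" "restrict (\<lambda>s. fst (g s)) S = f" using assms by (simp_all add: map_fibre_def)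
 show "g \<in> cell_maps S D" by (rule g(1))
 show "s \<in> S \<Longrightarrow> fst (g s) = f s" using fun_cong[OF g(2), of s] by simp
qed

lemma map_fibre_pairing:
 assumes g: "g \<in> map_fibre S D f"
 shows "card {s \<in> S. f s = k} \<le> 2" "\<exists>E\<in>pairings S. const_on E f"
proof -
 note bij = cell_mapsD[OF map_fibreD(1)[OF g]]
 have "{s \<in> S. f s = k} = {s \<in> S. fst (g s) = k}" by (rule Collect_cong) (use map_fibreD(2)[OF g] in metis)
 also have "card \<dots> = card {w \<in> dcells. fst w = k}" by (rule card_bij_preimage[OF bij])
 also have "\<dots> \<le> card ({k} \<times> (UNIV :: bool set))" by (rule card_mono) auto
 finally show "card {s \<in> S. f s = k} \<le> 2" by simp
 note E = perm_pairs_pairings[OF permutes_id[of D]] and bij' = bij_betw_inv_into[OF bij]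
 note im = image_pairing[OF E bij']
 let ?B = "image (inv_into S g) ` perm_pairs D id"
 have "f (mate ?B v) = f v" if v: "v \<in> S" for v
 proof -
  have gv: "g v \<in> dcells" using bij_betwE[OF bij] v by blast
  have "mate ?B v = inv_into S g (mate (perm_pairs D id) (g v))"
   using im(2)[OF gv] unfolding bij_betw_inv_into_left[OF bij v] .
  then have "g (mate ?B v) = mate (perm_pairs D id) (g v)"
   using bij_betw_inv_into_right[OF bij mate_in[OF E gv]] by simp
  moreover have "fst (mate (perm_pairs D id) (g v)) = fst (g v)"
  proof -
   obtain d e where de: "g v = (d, e)" "d \<in> D" using gv by (metis SigmaE)
   show ?thesis unfolding de(1) using mate_perm_pairs[OF permutes_id de(2)] by (cases e) simp_all
  qed
  ultimately show ?thesis using map_fibreD(2)[OF g v] map_fibreD(2)[OF g mate_in[OF im(1) v]] by metis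
 qed
 then have "const_on ?B f" unfolding const_on_mate[OF im(1)] by blast
 with im(1) show "\<exists>E\<in>pairings S. const_on E f" by blast
qed

text \<open>Distributing the two points of each fibre over the two copies so that \<open>W\<close>
  alternates is the same as a proper 2-colouring of the polygons of \<open>E\<close> and
  \<open>W\<close>.\<close>

lemma card_alternating_map_fibre:
 assumes n: "card S = 2 * card D" and f: "f \<in> S \<rightarrow>\<^sub>E D"
  and le: "\<And>k. card {s \<in> S. f s = k} \<le> 2" and E: "E \<in> pairings S" "const_on E f"
 shows "card {g \<in> map_fibre S D f. alternating_on W (\<lambda>s. snd (g s))} = 2 ^ npoly E W"
proof -
 let ?G = "{g \<in> map_fibre S D f. alternating_on W (\<lambda>s. snd (g s))}"
 let ?l = "\<lambda>\<epsilon>. restrict (\<lambda>s. (f s, \<epsilon> s)) S"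
 have "bij_betw ?l (alternations S E W) ?G"
 proof (rule bij_betwI)
  show "?l \<in> alternations S E W \<rightarrow> ?G"
  proof
   fix \<epsilon> assume e: "\<epsilon> \<in> alternations S E W"
   have al: "alternating_on E \<epsilon>" "alternating_on W \<epsilon>" using e by (auto simp: alternations_def)
   have inj: "inj_on (?l \<epsilon>) S"
   proof (rule inj_onI, rule ccontr)
    fix v w assume vw: "v \<in> S" "w \<in> S" "?l \<epsilon> v = ?l \<epsilon> w" "v \<noteq> w"
    have eq: "f v = f w" "\<epsilon> v = \<epsilon> w" using vw(1-3) by simp_all
    let ?m = "mate E v"
    have m: "?m \<in> S" "?m \<noteq> v" "f ?m = f v" "\<epsilon> ?m = (\<not> \<epsilon> v)"
     using mate_in[OF E(1) vw(1)] mate_neq[OF E(1) vw(1)] E(2) al(1) vw(1)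
     unfolding const_on_mate[OF E(1)] alternating_on_mate[OF E(1)] by blast+
    have "w \<noteq> ?m" using m(4) eq(2) by metis
    then have "card {v, w, ?m} = 3" using vw(4) m(2)[symmetric] by simp
    moreover have "card {v, w, ?m} \<le> card {x \<in> S. f x = f v}" by (rule card_mono) (use S vw m eq in auto)
    ultimately show False using le[of "f v"] by simp
   qed
   have sub: "?l \<epsilon> ` S \<subseteq> dcells" using f by auto
   have "card (?l \<epsilon> ` S) = card dcells" using card_image[OF inj] n by (simp add: card_cartesian_product)
   then have "?l \<epsilon> ` S = dcells" using card_subset_eq[OF _ sub] D by simp
   then have "?l \<epsilon> \<in> cell_maps S D" using inj sub by (auto simp: cell_maps_def bij_betw_def)
   moreover have "restrict (\<lambda>s. fst (?l \<epsilon> s)) S = f"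
   proof
    fix s show "restrict (\<lambda>s. fst (?l \<epsilon> s)) S s = f s" using PiE_arb[OF f, of s] by (cases "s \<in> S") simp_all
   qed
   moreover have "alternating_on W (\<lambda>s. snd (?l \<epsilon> s))"
    using al(2) mate_in[OF W] unfolding alternating_on_mate[OF W] by simp
   ultimately show "?l \<epsilon> \<in> ?G" by (simp add: map_fibre_def)
  qed
  show "(\<lambda>g. restrict (\<lambda>s. snd (g s)) S) \<in> ?G \<rightarrow> alternations S E W"
  proof
   fix g assume g: "g \<in> ?G"
   have gf: "g \<in> map_fibre S D f" using g by simp
   have "snd (g (mate E v)) = (\<not> snd (g v))" if v: "v \<in> S" for v
   proof -
    have m: "mate E v \<in> S" "mate E v \<noteq> v" using mate_in[OF E(1) v] mate_neq[OF E(1) v] by blast+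
    have "fst (g (mate E v)) = fst (g v)" using map_fibreD(2)[OF gf] v m(1) E(2) unfolding const_on_mate[OF E(1)] by metis
    moreover have "g (mate E v) \<noteq> g v"
     using inj_on_eq_iff[OF bij_betw_imp_inj_on[OF cell_mapsD[OF map_fibreD(1)[OF gf]]] m(1) v] m(2) by simp
    ultimately show ?thesis by (simp add: prod_eq_iff)
   qed
   then show "restrict (\<lambda>s. snd (g s)) S \<in> alternations S E W" using g mate_in[OF E(1)] mate_in[OF W]
    by (simp add: alternations_def alternating_on_mate[OF E(1)] alternating_on_mate[OF W])
  qed
  show "restrict (\<lambda>s. snd (?l \<epsilon> s)) S = \<epsilon>" if e: "\<epsilon> \<in> alternations S E W" for \<epsilon>
  proof
   fix s
   show "restrict (\<lambda>s. snd (?l \<epsilon> s)) S s = \<epsilon> s"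
    using e PiE_arb[of \<epsilon> S "\<lambda>_. UNIV" s] by (cases "s \<in> S") (simp_all add: alternations_def)
  qed
  show "?l (restrict (\<lambda>s. snd (g s)) S) = g" if g: "g \<in> ?G" for g
  proof
   fix s
   have gf: "g \<in> map_fibre S D f" using g by simp
   have gp: "g \<in> S \<rightarrow>\<^sub>E dcells" using map_fibreD(1)[OF gf] by (simp add: cell_maps_def)
   show "?l (restrict (\<lambda>s. snd (g s)) S) s = g s"
    using map_fibreD(2)[OF gf, of s] PiE_arb[OF gp, of s] by (cases "s \<in> S") (simp_all add: prod_eq_iff)
  qed
 qed
 from bij_betw_same_card[OF this] show ?thesis unfolding card_alternations[OF S E(1) W] by simp
qed

text \<open>Either \<open>f\<close> has no lift and the pairing sum vanishes as well, or the fibres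
  determine \<open>E\<close> and (-2)^n splits into (-1)^n and the number of alternating
  lifts.\<close>

lemma pairing_sum_map_fibre:
 assumes n: "card S = 2 * card D" and f: "f \<in> S \<rightarrow>\<^sub>E D"
 obtains (empty) "map_fibre S D f = {}" "pairing_sum S W f = 0"
 | (pairing) E where "E \<in> pairings S" "const_on E f"
   "pairing_sum S W f = (-1) ^ npoly E W * real (card {g \<in> map_fibre S D f. alternating_on W (\<lambda>s. snd (g s))})"
proof (cases "(\<forall>k. card {s \<in> S. f s = k} \<le> 2) \<and> (\<exists>E\<in>pairings S. const_on E f)")
 case True
 then obtain E where E: "E \<in> pairings S" "const_on E f" by blast
 have le: "card {s \<in> S. f s = k} \<le> 2" for k using True by blast
 have "pairing_sum S W f = (\<Sum>E'\<in>pairings S. if E' = E then (-2) ^ npoly E' W else 0)"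
  unfolding pairing_sum_def by (intro sum.cong refl if_cong) (use fibre_pairing_unique[OF S _ _ E le] E in blast)
 also have "\<dots> = (-2) ^ npoly E W" using E(1) finite_pairings[OF S] by simp
 also have "(-2 :: real) ^ npoly E W = (-1) ^ npoly E W * 2 ^ npoly E W" by (simp add: power_mult_distrib[symmetric])
 finally show thesis using pairing[OF E] card_alternating_map_fibre[OF n f le E] by simp
next
 case False
 then have "map_fibre S D f = {}" using map_fibre_pairing by blast
 moreover have "pairing_sum S W f = 0"
 proof (rule ccontr)
  assume nz: "pairing_sum S W f \<noteq> 0"
  then obtain E where "E \<in> pairings S" "const_on E f" unfolding pairing_sum_def by (elim sum_nonzeroE) (auto split: if_splits)
  then show False using False card_image_pairing_sum(2)[OF S W nz] by blast
 qed
 ultimately show thesis by (rule empty)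
qed

lemma map_fibre_sum:
 assumes n: "card S = 2 * card D" and f: "f \<in> S \<rightarrow>\<^sub>E D"
 shows "(\<Sum>g\<in>map_fibre S D f. \<Sum>\<sigma>\<in>level_perms y D.
   if \<forall>s\<in>S. g (mate W s) = mate (perm_pairs D \<sigma>) (g s) then of_int (sign \<sigma>) else 0 :: real) =
  (if const_on W (\<lambda>s. y (f s)) then (-1) ^ card D * pairing_sum S W f else 0)" (is "(\<Sum>g\<in>_. ?L g) = _")
proof (cases rule: pairing_sum_map_fibre[OF n f])
 case (2 E)
 have fin: "finite (map_fibre S D f)" using finite_cell_maps by (simp add: map_fibre_def)
 let ?c = "if const_on W (\<lambda>s. y (f s)) then (-1) ^ card D * (-1) ^ npoly E W else 0 :: real"
 have "?L g = (if alternating_on W (\<lambda>s. snd (g s)) then ?c else 0)" if g: "g \<in> map_fibre S D f" for g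
 proof -
  have 1: "const_on E (\<lambda>s. fst (g s))" using 2(2) const_on_cong[OF 2(1), of "\<lambda>s. fst (g s)" f] map_fibreD(2)[OF g] by blast
  have 2: "const_on W (\<lambda>s. y (fst (g s))) = const_on W (\<lambda>s. y (f s))"
   by (rule const_on_cong[OF W]) (simp add: map_fibreD(2)[OF g])
  show ?thesis unfolding sum_level_perms_image[OF map_fibreD(1)[OF g] \<open>E \<in> pairings S\<close> 1] 2 by simp
 qed
 then have "(\<Sum>g\<in>map_fibre S D f. ?L g) = (\<Sum>g\<in>map_fibre S D f. if alternating_on W (\<lambda>s. snd (g s)) then ?c else 0)"
  by (rule sum.cong[OF refl])
 also have "\<dots> = real (card {g \<in> map_fibre S D f. alternating_on W (\<lambda>s. snd (g s))}) * ?c"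
  using fin by (simp add: sum.If_cases Int_def)
 finally show ?thesis unfolding 2(3) by simp
qed simp

text \<open>Isomorphisms from \<open>(B, W)\<close> are counted, with sign, in two ways. For a fixed
  target their number is \<open>zmset\<close> or 0 according to the type, which produces
  \<open>tcoef\<close>; sorted by the underlying labelling \<open>f\<close> they produce the
  embedding sum.\<close>

lemma embedding_sum_full:
 assumes n: "card S = 2 * card D" and B: "B \<in> pairings S"
 shows "embedding_sum S B W D x y = (-1) ^ card D * (real (zmset (ptype B W)) * tcoef D x y (pairs_type B W))"
proof -
 let ?C = "\<lambda>g P Q. \<forall>s\<in>S. g (mate P s) = mate Q (g s)"
 let ?K = "\<lambda>f. if const_on B (\<lambda>s. x (f s)) then 1 else 0 :: real"
 let ?L = "\<lambda>g. \<Sum>\<sigma>\<in>level_perms y D. if ?C g W (perm_pairs D \<sigma>) then of_int (sign \<sigma>) else 0 :: real"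
 have X: "finite dcells" using D by simp
 have iso: "real (card (isos S B W dcells B' W')) = (\<Sum>g\<in>cell_maps S D. (if ?C g B B' then 1 else 0) * (if ?C g W W' then 1 else 0))" for B' W'
 proof -
  have "isos S B W dcells B' W' = {g \<in> cell_maps S D. ?C g B B' \<and> ?C g W W'}" by (auto simp: isos_def cell_maps_def)
  also have "real (card \<dots>) = (\<Sum>g\<in>cell_maps S D. if ?C g B B' \<and> ?C g W W' then 1 else 0)"
   using finite_cell_maps by (simp add: sum.If_cases Int_def)
  also have "\<dots> = (\<Sum>g\<in>cell_maps S D. (if ?C g B B' then 1 else 0) * (if ?C g W W' then 1 else 0))"
   by (rule sum.cong[OF refl]) simp
  finally show ?thesis .
 qed
 have "real (zmset (ptype B W)) * tcoef D x y (pairs_type B W) =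
   (\<Sum>B'\<in>level_pairings x D. \<Sum>\<sigma>\<in>level_perms y D. real (card (isos S B W dcells B' (perm_pairs D \<sigma>))) * of_int (sign \<sigma>))"
  unfolding tcoef_def sum_distrib_left
 proof (rule sum.cong[OF refl], rule sum.cong[OF refl])
  fix B' \<sigma> assume *: "B' \<in> level_pairings x D" "\<sigma> \<in> level_perms y D"
  show "real (zmset (ptype B W)) * (if pairs_type B' (perm_pairs D \<sigma>) = pairs_type B W then of_int (sign \<sigma>) else 0) =
    real (card (isos S B W dcells B' (perm_pairs D \<sigma>))) * of_int (sign \<sigma>)"
   unfolding card_isos[OF S B W X level_pairingsD[OF *(1)] perm_pairs_pairings[OF level_permsD[OF *(2)]]] pairs_type_eq_iff by auto
 qed
 also have "\<dots> = (\<Sum>B'\<in>level_pairings x D. \<Sum>\<sigma>\<in>level_perms y D. \<Sum>g\<in>cell_maps S D.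
   (if ?C g B B' then 1 else 0) * (if ?C g W (perm_pairs D \<sigma>) then of_int (sign \<sigma>) else 0))"
  unfolding iso sum_distrib_right by (rule sum.cong[OF refl], rule sum.cong[OF refl], rule sum.cong[OF refl]) simp
 also have "\<dots> = (\<Sum>g\<in>cell_maps S D. \<Sum>B'\<in>level_pairings x D. \<Sum>\<sigma>\<in>level_perms y D.
   (if ?C g B B' then 1 else 0) * (if ?C g W (perm_pairs D \<sigma>) then of_int (sign \<sigma>) else 0))"
  unfolding sum.swap[of _ "cell_maps S D"] ..
 also have "\<dots> = (\<Sum>g\<in>cell_maps S D. (\<Sum>B'\<in>level_pairings x D. if ?C g B B' then 1 else 0) * ?L g)"
  unfolding sum_distrib_left[symmetric] sum_distrib_right[symmetric] ..
 also have "\<dots> = (\<Sum>g\<in>cell_maps S D. ?K (\<lambda>s. fst (g s)) * ?L g)"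
  by (rule sum.cong[OF refl]) (simp only: sum_level_pairings_image[OF D B cell_mapsD])
 also have "\<dots> = (\<Sum>f\<in>S \<rightarrow>\<^sub>E D. \<Sum>g\<in>map_fibre S D f. ?K (\<lambda>s. fst (g s)) * ?L g)"
  unfolding map_fibre_def
 proof (rule sum.group[symmetric, OF finite_cell_maps, unfolded Collect_conj_eq[symmetric]])
  show "finite (S \<rightarrow>\<^sub>E D)" using S D by (intro finite_PiE) auto
  show "(\<lambda>g. restrict (\<lambda>s. fst (g s)) S) ` cell_maps S D \<subseteq> S \<rightarrow>\<^sub>E D"
  proof
   fix f assume "f \<in> (\<lambda>g. restrict (\<lambda>s. fst (g s)) S) ` cell_maps S D"
   then obtain g where g: "g \<in> cell_maps S D" "f = restrict (\<lambda>s. fst (g s)) S" by blast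
   have "fst (g s) \<in> D" if "s \<in> S" for s using bij_betwE[OF cell_mapsD[OF g(1)]] that by (metis mem_Times_iff)
   then show "f \<in> S \<rightarrow>\<^sub>E D" unfolding g(2) by simp
  qed
 qed
 also have "\<dots> = (\<Sum>f\<in>S \<rightarrow>\<^sub>E D. ?K f * (if const_on W (\<lambda>s. y (f s)) then (-1) ^ card D * pairing_sum S W f else 0))"
 proof (rule sum.cong[OF refl])
  fix f assume f: "f \<in> S \<rightarrow>\<^sub>E D"
  have "?K (\<lambda>s. fst (g s)) = ?K f" if g: "g \<in> map_fibre S D f" for g
   using const_on_cong[OF B, of "\<lambda>s. x (fst (g s))" "\<lambda>s. x (f s)"] map_fibreD(2)[OF g] by simp
  then have "(\<Sum>g\<in>map_fibre S D f. ?K (\<lambda>s. fst (g s)) * ?L g) = (\<Sum>g\<in>map_fibre S D f. ?K f * ?L g)"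
   by (intro sum.cong refl arg_cong2[where f = "(*)"])
  then show "(\<Sum>g\<in>map_fibre S D f. ?K (\<lambda>s. fst (g s)) * ?L g) =
    ?K f * (if const_on W (\<lambda>s. y (f s)) then (-1) ^ card D * pairing_sum S W f else 0)"
   unfolding sum_distrib_left[symmetric] map_fibre_sum[OF n f] .
 qed
 also have "\<dots> = (-1) ^ card D * embedding_sum S B W D x y"
  unfolding embedding_sum_def sum_distrib_left by (rule sum.cong[OF refl]) simp
 finally show ?thesis by (simp add: mult.assoc[symmetric] power_mult_distrib[symmetric])
qed

text \<open>Every contributing labelling is two-to-one, so it uses \<open>card S / 2\<close> boxes
  and survives the deletion of each of the others.\<close>

lemma embedding_sum_remove:
 "(\<Sum>d\<in>D. embedding_sum S B W (D - {d}) x y) = (real (card D) - real (card S) / 2) * embedding_sum S B W D x y"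
proof -
 let ?t = "\<lambda>f. if const_on B (\<lambda>s. x (f s)) \<and> const_on W (\<lambda>s. y (f s)) then pairing_sum S W f else 0"
 have fin: "finite (S \<rightarrow>\<^sub>E D)" using S D by (intro finite_PiE) auto
 have "(\<Sum>d\<in>D. embedding_sum S B W (D - {d}) x y) = (\<Sum>d\<in>D. \<Sum>f\<in>S \<rightarrow>\<^sub>E D. if d \<notin> f ` S then ?t f else 0)"
 proof (rule sum.cong[OF refl])
  fix d
  have "S \<rightarrow>\<^sub>E (D - {d}) = {f \<in> S \<rightarrow>\<^sub>E D. d \<notin> f ` S}" by (auto simp: PiE_iff extensional_def)
  then show "embedding_sum S B W (D - {d}) x y = (\<Sum>f\<in>S \<rightarrow>\<^sub>E D. if d \<notin> f ` S then ?t f else 0)"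
   unfolding embedding_sum_def by (simp only: sum.inter_filter[OF fin])
 qed
 also have "\<dots> = (\<Sum>f\<in>S \<rightarrow>\<^sub>E D. \<Sum>d\<in>D. if d \<notin> f ` S then ?t f else 0)" by (rule sum.swap)
 also have "\<dots> = (\<Sum>f\<in>S \<rightarrow>\<^sub>E D. (real (card D) - real (card S) / 2) * ?t f)"
 proof (rule sum.cong[OF refl])
  fix f assume f: "f \<in> S \<rightarrow>\<^sub>E D"
  have sub: "f ` S \<subseteq> D" using f by auto
  have "{d \<in> D. d \<notin> f ` S} = D - f ` S" by blast
  then have "(\<Sum>d\<in>D. if d \<notin> f ` S then ?t f else 0) = real (card (D - f ` S)) * ?t f"
   by (simp only: sum.inter_filter[OF D, symmetric] sum_constant)
  also have "card (D - f ` S) = card D - card (f ` S)" using S sub by (intro card_Diff_subset) auto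
  also have "real (card D - card (f ` S)) = real (card D) - real (card (f ` S))" using card_mono[OF D sub] by simp
  also have "(real (card D) - real (card (f ` S))) * ?t f = (real (card D) - real (card S) / 2) * ?t f"
  proof (cases "pairing_sum S W f = 0")
   case False
   then show ?thesis using card_image_pairing_sum(1)[OF S W False] by simp
  qed simp
  finally show "(\<Sum>d\<in>D. if d \<notin> f ` S then ?t f else 0) = (real (card D) - real (card S) / 2) * ?t f" .
 qed
 finally show ?thesis unfolding embedding_sum_def sum_distrib_left .
qed

lemma embedding_sum_small: "2 * card D < card S \<Longrightarrow> embedding_sum S B W D x y = 0"
 unfolding embedding_sum_def
proof (rule sum.neutral, rule ballI)
 fix f assume n: "2 * card D < card S" and f: "f \<in> S \<rightarrow>\<^sub>E D"
 have "card (f ` S) \<le> card D" using f by (intro card_mono[OF D]) auto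
 then have "pairing_sum S W f = 0" using card_image_pairing_sum(1)[OF S W, of f] n by linarith
 then show "(if const_on B (\<lambda>s. x (f s)) \<and> const_on W (\<lambda>s. y (f s)) then pairing_sum S W f else 0) = 0" by simp
qed

end

section \<open>Jack functions for \<open>\<alpha> = 1/2\<close>\<close>

text \<open>A column preserving pairing that respects \<open>h\<close> is a pairing that respects
  this combined label.\<close>

definition col_color :: "((nat \<times> nat) \<times> bool \<Rightarrow> nat) \<Rightarrow> (nat \<times> nat) \<times> bool \<Rightarrow> nat \<times> nat" where
 "col_color h v = (h v, snd (fst v))"

lemma pairing_sum_col_color:
 "(\<Sum>B\<in>level_pairings snd D. if const_on B h then (-2) ^ npoly B W else 0) = pairing_sum (D \<times> UNIV) W (col_color h)"
 if "finite D"
proof -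
 have fin: "finite (pairings (D \<times> (UNIV :: bool set)))" using that by (simp add: finite_pairings)
 have c: "const_on B (col_color h) \<longleftrightarrow> const_on B h \<and> const_on B (\<lambda>u. snd (fst u))" for B
 proof -
  have "col_color h = (\<lambda>u. (h u, snd (fst u)))" by (rule ext) (simp only: col_color_def)
  then show ?thesis by (simp only: const_on_Pair)
 qed
 have "pairing_sum (D \<times> UNIV) W (col_color h) =
   (\<Sum>B\<in>pairings (D \<times> UNIV). if const_on B (\<lambda>u. snd (fst u)) then (if const_on B h then (-2) ^ npoly B W else 0) else 0)"
  unfolding pairing_sum_def c by (intro sum.cong) auto
 also have "\<dots> = (\<Sum>B\<in>level_pairings snd D. if const_on B h then (-2) ^ npoly B W else 0)"
  unfolding level_pairings_def by (rule sum.inter_filter[OF fin, symmetric])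
 finally show ?thesis by simp
qed

lemma pexp_quaternionic:
 "pexp (sum_list l) (\<lambda>r. (-2) ^ length r * tcoef (boxes l) snd fst r) b =
  (\<Sum>h\<in>content_maps (boxes l) b. \<Sum>\<sigma>\<in>level_perms fst (boxes l). if const_on (perm_pairs (boxes l) \<sigma>) h
   then of_int (sign \<sigma>) * pairing_sum (boxes l \<times> UNIV) (perm_pairs (boxes l) \<sigma>) (col_color h) else 0)"
 unfolding pexp_tcoef[OF finite_boxes card_boxes] pairing_sum_col_color[OF finite_boxes] ..

lemma card_col_color:
 "card {u \<in> D \<times> UNIV. snd (fst u) = j \<and> h u = i} = card {u \<in> D \<times> UNIV. col_color h u = (i, j)}"
 by (intro arg_cong[where f = card]) (auto simp: col_color_def)

text \<open>Here the bound of two cells per colour and column comes from the vanishing of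
  \<open>pairing_sum\<close>, not from a cancellation of signs.\<close>

lemma quaternionic_triangular:
 assumes "is_partition l" "m \<in> partitions_of (sum_list l)"
  and "pexp (sum_list l) (\<lambda>r. (-2) ^ length r * tcoef (boxes l) snd fst r) (expo m) \<noteq> 0"
 shows "dominates l m"
proof -
 let ?D = "boxes l"
 obtain h where h: "h \<in> content_maps ?D (expo m)" "(\<Sum>\<sigma>\<in>level_perms fst ?D. if const_on (perm_pairs ?D \<sigma>) h
   then of_int (sign \<sigma>) * pairing_sum (?D \<times> UNIV) (perm_pairs ?D \<sigma>) (col_color h) else 0) \<noteq> 0"
  using assms(3) unfolding pexp_quaternionic by (rule sum_nonzeroE)
 obtain \<sigma> where s: "\<sigma> \<in> level_perms fst ?D" "(if const_on (perm_pairs ?D \<sigma>) h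
   then of_int (sign \<sigma>) * pairing_sum (?D \<times> UNIV) (perm_pairs ?D \<sigma>) (col_color h) else 0) \<noteq> 0"
  using h(2) by (rule sum_nonzeroE)
 have nz: "pairing_sum (?D \<times> UNIV) (perm_pairs ?D \<sigma>) (col_color h) \<noteq> 0" using s(2) by (auto split: if_splits)
 have "card {u \<in> ?D \<times> UNIV. snd (fst u) = j \<and> h u = i} \<le> 2" for i j
 proof (rule ccontr)
  assume "\<not> card {u \<in> ?D \<times> UNIV. snd (fst u) = j \<and> h u = i} \<le> 2"
  then have "card {u \<in> ?D \<times> UNIV. col_color h u = (i, j)} \<ge> 3" unfolding card_col_color by simp
  with nz show False
   using pairing_sum_eq_0[OF finite_cells perm_pairs_pairings[OF level_permsD[OF s(1)]], where \<kappa> = "col_color h" and k = "(i, j)"] by simp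
 qed
 then show ?thesis
  by (rule dominates_of_coloring[OF assms(1)]) (use assms(2) content_mapsD[OF h(1)] in \<open>auto simp: partitions_of_def\<close>)
qed

context
 fixes l :: "nat list"
 assumes l: "is_partition l"
begin

text \<open>Collects the terms of the Gaussian expectation that belong to one colouring
  \<open>h\<close> and one row permutation \<sigma>.\<close>

definition spin_fibre :: "((nat \<times> nat) \<times> bool \<Rightarrow> nat) \<Rightarrow> (nat \<times> nat \<Rightarrow> nat \<times> nat) \<Rightarrow> ((nat \<times> nat) \<times> bool \<Rightarrow> (nat \<times> nat) \<times> bool) set" where
 "spin_fibre h \<sigma> = {u \<in> level_perms (\<lambda>v. snd (fst v)) (cells l). restrict (\<lambda>v. fst (fst (u v))) (cells l) = h \<and> spin_match (boxes l) u \<sigma>}"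

lemma spin_fibreD:
 assumes "u \<in> spin_fibre h \<sigma>"
 shows "u permutes cells l" "v \<in> cells l \<Longrightarrow> fst (u v) = col_color h v" "spin_match (boxes l) u \<sigma>"
proof -
 have u: "u \<in> level_perms (\<lambda>v. snd (fst v)) (cells l)" "restrict (\<lambda>v. fst (fst (u v))) (cells l) = h" "spin_match (boxes l) u \<sigma>"
  using assms unfolding spin_fibre_def by simp_all
 show "u permutes cells l" by (rule level_permsD[OF u(1)])
 show "spin_match (boxes l) u \<sigma>" by (rule u(3))
 assume v: "v \<in> cells l"
 have "fst (fst (u v)) = h v" using fun_cong[OF u(2), of v] v by simp
 then show "fst (u v) = col_color h v" using level_perms_level[OF u(1), of v] by (simp add: col_color_def prod_eq_iff)
qed

lemma spin_fibre_const:
 assumes s: "\<sigma> \<in> level_perms fst (boxes l)" and u: "u \<in> spin_fibre h \<sigma>"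
 shows "const_on (perm_pairs (boxes l) \<sigma>) h" unfolding const_on_perm_pairs[OF level_permsD[OF s]]
proof
 fix d assume d: "d \<in> boxes l"
 then have sd: "\<sigma> d \<in> boxes l" using permutes_in_image[OF level_permsD[OF s]] by simp
 have "spin_row (u (\<sigma> d, True)) = nb (spin_row (u (d, False)))" using spin_fibreD(3)[OF u] d by (simp add: spin_match_def)
 then have "fst (fst (u (\<sigma> d, True))) = fst (fst (u (d, False)))" by (simp add: spin_row_def nb_def)
 then show "h (\<sigma> d, True) = h (d, False)"
  using spin_fibreD(2)[OF u, of "(\<sigma> d, True)"] spin_fibreD(2)[OF u, of "(d, False)"] d sd by (simp add: col_color_def)
qed

abbreviation cell_color :: "((nat \<times> nat) \<times> bool \<Rightarrow> nat) \<Rightarrow> (nat \<times> nat) \<times> bool \<Rightarrow> nat \<times> nat" where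
 "cell_color h \<equiv> restrict (col_color h) (cells l)"

lemma spin_fibre_restrict:
 assumes u: "u \<in> spin_fibre h \<sigma>"
 shows "restrict u (cells l) \<in> map_fibre (cells l) (boxes l) (cell_color h)"
proof -
 have bij: "bij_betw u (cells l) (cells l)" by (rule permutes_imp_bij[OF spin_fibreD(1)[OF u]])
 then have "bij_betw (restrict u (cells l)) (cells l) (cells l)" by (rule bij_betw_cong[THEN iffD1, rotated]) simp
 moreover have "restrict u (cells l) \<in> cells l \<rightarrow>\<^sub>E cells l" using bij_betwE[OF bij] by (simp add: PiE_iff)
 moreover have "restrict (\<lambda>v. fst (restrict u (cells l) v)) (cells l) = cell_color h"
  by (rule restrict_ext) (simp add: spin_fibreD(2)[OF u])
 ultimately show ?thesis unfolding map_fibre_def cell_maps_def by blast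
qed

text \<open>Permutations, the identity outside the diagram, are exchanged for extensional lifts.
  \<open>spin_match\<close> splits into constancy of \<open>h\<close>, assumed here, and alternation
  of the copies along the pairing of \<sigma>.\<close>

lemma spin_fibre_bij:
 assumes h: "h \<in> content_maps (boxes l) b" and s: "\<sigma> \<in> level_perms fst (boxes l)"
  and c: "const_on (perm_pairs (boxes l) \<sigma>) h"
 shows "bij_betw (\<lambda>u. restrict u (cells l)) (spin_fibre h \<sigma>)
  {g \<in> map_fibre (cells l) (boxes l) (cell_color h). alternating_on (perm_pairs (boxes l) \<sigma>) (\<lambda>v. snd (g v))}" (is "bij_betw _ _ ?G")
proof (rule bij_betwI[where g = "\<lambda>g v. if v \<in> cells l then g v else v"])
 note sp = level_permsD[OF s]
 show "(\<lambda>u. restrict u (cells l)) \<in> spin_fibre h \<sigma> \<rightarrow> ?G"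
 proof
  fix u assume u: "u \<in> spin_fibre h \<sigma>"
  have "alternating_on (perm_pairs (boxes l) \<sigma>) (\<lambda>v. snd (restrict u (cells l) v))"
  proof (rule alternating_on_perm_pairs)
   fix d assume d: "d \<in> boxes l"
   then have "spin_row (u (\<sigma> d, True)) = nb (spin_row (u (d, False)))" using spin_fibreD(3)[OF u] by (simp add: spin_match_def)
   then show "snd (restrict u (cells l) (\<sigma> d, True)) = (\<not> snd (restrict u (cells l) (d, False)))"
    using d permutes_in_image[OF sp, of d] by (simp add: spin_row_def nb_def)
  qed
  then show "restrict u (cells l) \<in> ?G" using spin_fibre_restrict[OF u] by blast
 qed
 show "(\<lambda>g v. if v \<in> cells l then g v else v) \<in> ?G \<rightarrow> spin_fibre h \<sigma>"
 proof
  fix g assume g: "g \<in> ?G"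
  let ?u = "\<lambda>v. if v \<in> cells l then g v else v"
  have gf: "g \<in> map_fibre (cells l) (boxes l) (cell_color h)" and al: "alternating_on (perm_pairs (boxes l) \<sigma>) (\<lambda>v. snd (g v))"
   using g by auto
  have bij: "bij_betw g (cells l) (cells l)" using gf by (simp add: map_fibre_def cell_maps_def)
  have eq: "restrict (\<lambda>s. fst (g s)) (cells l) = cell_color h" using gf by (simp add: map_fibre_def)
  have gv: "fst (g v) = col_color h v" if "v \<in> cells l" for v using fun_cong[OF eq, of v] that by simp
  have "bij_betw ?u (cells l) (cells l)" using bij by (rule bij_betw_cong[THEN iffD1, rotated]) simp
  then have "?u permutes cells l" by (rule bij_imp_permutes) simp
  then have "?u \<in> level_perms (\<lambda>v. snd (fst v)) (cells l)"
   by (rule level_permsI) (simp add: gv col_color_def)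
  moreover have "restrict (\<lambda>v. fst (fst (?u v))) (cells l) = h"
  proof
   fix v
   show "restrict (\<lambda>v. fst (fst (?u v))) (cells l) v = h v"
    using h PiE_arb[of h "cells l" "\<lambda>_. UNIV" v] gv[of v] by (cases "v \<in> cells l") (simp_all add: col_color_def content_maps_def)
  qed
  moreover have "spin_match (boxes l) ?u \<sigma>" unfolding spin_match_def
  proof
   fix d assume d: "d \<in> boxes l"
   then have sd: "\<sigma> d \<in> boxes l" using permutes_in_image[OF sp] by simp
   have "snd (g (\<sigma> d, True)) = (\<not> snd (g (d, False)))"
    using al d mate_perm_pairs(1)[OF sp d] unfolding alternating_on_mate[OF perm_pairs_pairings[OF sp]]
    by (metis SigmaI UNIV_I)
   moreover have "h (\<sigma> d, True) = h (d, False)" using c d unfolding const_on_perm_pairs[OF sp] by blast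
   ultimately show "spin_row (?u (\<sigma> d, True)) = nb (spin_row (?u (d, False)))"
    using d sd gv[of "(\<sigma> d, True)"] gv[of "(d, False)"] by (simp add: spin_row_def nb_def col_color_def)
  qed
  ultimately show "?u \<in> spin_fibre h \<sigma>" unfolding spin_fibre_def by blast
 qed
 show "(\<lambda>v. if v \<in> cells l then restrict u (cells l) v else v) = u" if u: "u \<in> spin_fibre h \<sigma>" for u
  by (rule ext) (use permutes_not_in[OF spin_fibreD(1)[OF u]] in simp)
 show "restrict (\<lambda>v. if v \<in> cells l then g v else v) (cells l) = g" if g: "g \<in> ?G" for g
 proof
  fix v
  have "g \<in> cells l \<rightarrow>\<^sub>E cells l" using g by (simp add: map_fibre_def cell_maps_def)
  from PiE_arb[OF this, of v] show "restrict (\<lambda>v. if v \<in> cells l then g v else v) (cells l) v = g v" by auto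
 qed
qed

text \<open>All terms of a fibre have the same sign by \<open>spin_sign\<close> and their number is
  the number of alternating lifts, which together make up \<open>pairing_sum\<close>. Both sides
  vanish if the labels leave the diagram or do not lift.\<close>

lemma spin_fibre_sum:
 assumes h: "h \<in> content_maps (boxes l) (expo l)" and s: "\<sigma> \<in> level_perms fst (boxes l)"
 shows "(\<Sum>u\<in>spin_fibre h \<sigma>. real_of_int (sign u * (\<Prod>d\<in>boxes l. sgb (snd (u (d, False)))))) =
  (-1) ^ sum_list l * (if const_on (perm_pairs (boxes l) \<sigma>) h
   then of_int (sign \<sigma>) * pairing_sum (cells l) (perm_pairs (boxes l) \<sigma>) (col_color h) else 0)"
proof -
 let ?W = "perm_pairs (boxes l) \<sigma>"
 note sp = level_permsD[OF s] and fin = finite_cells[of l]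
 note W = perm_pairs_pairings[OF sp]
 have n: "card (cells l) = 2 * card (boxes l)" by (simp add: card_cartesian_product)
 have ps: "pairing_sum (cells l) ?W (col_color h) = pairing_sum (cells l) ?W (cell_color h)" unfolding pairing_sum_def
  by (rule sum.cong[OF refl]) (use const_on_cong[of _ "cells l" "col_color h" "cell_color h"] in simp)
 have empty: ?thesis if "map_fibre (cells l) (boxes l) (cell_color h) = {}" "pairing_sum (cells l) ?W (cell_color h) = 0"
 proof -
  have "spin_fibre h \<sigma> = {}" using spin_fibre_restrict that(1) by blast
  then show ?thesis using that(2) by (simp add: ps)
 qed
 show ?thesis
 proof (cases "cell_color h \<in> cells l \<rightarrow>\<^sub>E boxes l")
  case True
  show ?thesis
  proof (cases rule: pairing_sum_map_fibre[OF fin W finite_boxes n True])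
   case (2 E)
   have val: "sign u * (\<Prod>d\<in>boxes l. sgb (snd (u (d, False)))) = (-1) ^ sum_list l * sign \<sigma> * (-1) ^ npoly E ?W"
    if u: "u \<in> spin_fibre h \<sigma>" for u unfolding card_boxes[symmetric]
   proof (rule spin_sign[OF finite_boxes spin_fibreD(1)[OF u] sp _ 2(1)])
    show "snd (u (\<sigma> d, True)) = (\<not> snd (u (d, False)))" if "d \<in> boxes l" for d
     using spin_fibreD(3)[OF u] that unfolding spin_match_def by (auto simp: spin_row_def nb_def)
    have "fst (u v) = cell_color h v" if "v \<in> cells l" for v using spin_fibreD(2)[OF u that] that by simp
    then show "const_on E (\<lambda>v. fst (u v))" using 2(2) const_on_cong[OF 2(1), of "\<lambda>v. fst (u v)" "cell_color h"] by blast
   qed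
   have "(\<Sum>u\<in>spin_fibre h \<sigma>. real_of_int (sign u * (\<Prod>d\<in>boxes l. sgb (snd (u (d, False)))))) =
     (\<Sum>u\<in>spin_fibre h \<sigma>. real_of_int ((-1) ^ sum_list l * sign \<sigma> * (-1) ^ npoly E ?W))"
    by (rule sum.cong[OF refl], rule arg_cong[where f = real_of_int], rule val)
   also have "\<dots> = real (card (spin_fibre h \<sigma>)) * ((-1) ^ sum_list l * of_int (sign \<sigma>) * (-1) ^ npoly E ?W)" by simp
   also have "\<dots> = (-1) ^ sum_list l * (if const_on ?W h then of_int (sign \<sigma>) * pairing_sum (cells l) ?W (col_color h) else 0)"
   proof (cases "const_on ?W h")
    case True
    show ?thesis unfolding bij_betw_same_card[OF spin_fibre_bij[OF h s True]] ps 2(3) using True by simp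
   next
    case False
    then have "spin_fibre h \<sigma> = {}" using spin_fibre_const[OF s] by blast
    then show ?thesis using False by simp
   qed
   finally show ?thesis .
  qed (rule empty)
 next
  case False
  have "map_fibre (cells l) (boxes l) (cell_color h) = {}"
  proof (rule ccontr)
   assume "map_fibre (cells l) (boxes l) (cell_color h) \<noteq> {}"
   then obtain g where g: "g \<in> map_fibre (cells l) (boxes l) (cell_color h)" by blast
   have "cell_color h v \<in> boxes l" if v: "v \<in> cells l" for v
   proof -
    have "fst (g v) = cell_color h v" by (rule map_fibreD(2)[OF fin W finite_boxes g v])
    moreover have "g v \<in> cells l" using g v bij_betwE by (fastforce simp: map_fibre_def cell_maps_def)
    ultimately show ?thesis by (metis mem_Times_iff)
   qed
   then show False using False by simp
  qed
  moreover have "pairing_sum (cells l) ?W (cell_color h) = 0"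
  proof (rule ccontr)
   assume "pairing_sum (cells l) ?W (cell_color h) \<noteq> 0"
   \<comment> \<open>A nonzero sum bounds each colour by two cells per column, and content
     \<open>l\<close> then keeps all labels inside the diagram.\<close>
   note le = card_image_pairing_sum(2)[OF fin W this[folded ps]]
   have "col_color h v \<in> boxes l" if "v \<in> cells l" for v unfolding col_color_def[of h v]
    by (rule extremal_color_lt[OF l _ content_mapsD[OF h] that]) (simp only: card_col_color le)
   then show False using False by simp
  qed
  ultimately show ?thesis by (rule empty)
 qed
qed

text \<open>The computation starts from the hook side: the expectation of the product of doubled
  minors is expanded by Wick's formula and sorted by row permutation and colouring.\<close>

lemma quaternionic_leading:
 "pexp (sum_list l) (\<lambda>r. (-2) ^ length r * tcoef (boxes l) snd fst r) (expo l) =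
  (-1) ^ sum_list l * (\<Prod>s\<in>boxes l. real (arm l s) + 2 * real (leg l s) + 2)"
proof -
 let ?D = "boxes l" and ?X = "cells l" and ?C = "content_maps (boxes l) (expo l)" and ?LP = "level_perms fst (boxes l)"
 let ?U = "level_perms (\<lambda>v. snd (fst v)) (cells l)"
 let ?h = "\<lambda>u. restrict (\<lambda>v. fst (fst (u v))) (cells l)"
 let ?g = "\<lambda>u. real_of_int (sign u * (\<Prod>d\<in>boxes l. sgb (snd (u (d, False)))))"
 have finU: "finite ?U" by (rule finite_level_perms[OF finite_cells])
 have hC: "?h ` ?U \<subseteq> ?C"
 proof
  fix h assume "h \<in> ?h ` ?U"
  then obtain u where u: "u \<in> ?U" "h = ?h u" by blast
  have "card {v \<in> ?X. h v = i} = 2 * lookup (expo l) i" for i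
  proof -
   have "{v \<in> ?X. h v = i} = {v \<in> ?X. fst (fst (u v)) = i}" by (rule Collect_cong) (simp add: u(2))
   then show ?thesis
    using card_bij_preimage[OF permutes_imp_bij[OF level_permsD[OF u(1)]], of "\<lambda>w. fst (fst w) = i"]
    by (simp only: card_row_cells)
  qed
  moreover have "h \<in> ?X \<rightarrow>\<^sub>E UNIV" unfolding u(2) by simp
  ultimately show "h \<in> ?C" by (simp add: content_maps_def)
 qed
 have "(\<Prod>s\<in>boxes l. real (arm l s) + 2 * real (leg l s) + 2) = qg.Ex (level_det ?X spin_row (\<lambda>v. snd (fst v)))"
  by (rule quaternionic_hook_product[OF l, symmetric])
 also have "\<dots> = (\<Sum>u\<in>?U. of_int (sign u) * qg.wick ?X (\<lambda>v. (spin_row v, spin_row (u v))))"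
  unfolding level_det_def qg.Ex_sum qg.Ex_of_int qg.Ex_prod_Var[OF finite_cells] ..
 also have "\<dots> = (\<Sum>u\<in>?U. \<Sum>\<sigma>\<in>?LP. if spin_match ?D u \<sigma> then ?g u else 0)"
  unfolding qg_wick[OF finite_boxes] sum_distrib_left by (intro sum.cong refl) auto
 also have "\<dots> = (\<Sum>\<sigma>\<in>?LP. \<Sum>u\<in>?U. if spin_match ?D u \<sigma> then ?g u else 0)" by (rule sum.swap)
 also have "\<dots> = (\<Sum>\<sigma>\<in>?LP. \<Sum>h\<in>?C. \<Sum>u\<in>spin_fibre h \<sigma>. ?g u)"
 proof (rule sum.cong[OF refl])
  fix \<sigma>
  have "(\<Sum>u\<in>?U. if spin_match ?D u \<sigma> then ?g u else 0) = (\<Sum>h\<in>?C. \<Sum>u | u \<in> ?U \<and> ?h u = h. if spin_match ?D u \<sigma> then ?g u else 0)"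
   by (rule sum.group[OF finU finite_content_maps[OF finite_boxes] hC, symmetric])
  also have "\<dots> = (\<Sum>h\<in>?C. \<Sum>u\<in>spin_fibre h \<sigma>. ?g u)"
  proof (rule sum.cong[OF refl])
   fix h
   have "spin_fibre h \<sigma> = {u \<in> {u. u \<in> ?U \<and> ?h u = h}. spin_match ?D u \<sigma>}" unfolding spin_fibre_def by blast
   then show "(\<Sum>u | u \<in> ?U \<and> ?h u = h. if spin_match ?D u \<sigma> then ?g u else 0) = (\<Sum>u\<in>spin_fibre h \<sigma>. ?g u)"
    using finU by (simp only: sum.inter_filter finite_Collect_conjI Collect_mem_eq simp_thms)
  qed
  finally show "(\<Sum>u\<in>?U. if spin_match ?D u \<sigma> then ?g u else 0) = (\<Sum>h\<in>?C. \<Sum>u\<in>spin_fibre h \<sigma>. ?g u)" .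
 qed
 also have "\<dots> = (\<Sum>\<sigma>\<in>?LP. \<Sum>h\<in>?C. (-1) ^ sum_list l * (if const_on (perm_pairs ?D \<sigma>) h
   then of_int (sign \<sigma>) * pairing_sum ?X (perm_pairs ?D \<sigma>) (col_color h) else 0))"
  by (rule sum.cong[OF refl], rule sum.cong[OF refl], rule spin_fibre_sum)
 also have "\<dots> = (-1) ^ sum_list l * pexp (sum_list l) (\<lambda>r. (-2) ^ length r * tcoef ?D snd fst r) (expo l)"
  unfolding pexp_quaternionic sum_distrib_left by (rule sum.swap)
 finally show ?thesis by (simp add: mult.assoc[symmetric] power_mult_distrib[symmetric])
qed

end

text \<open>With rows and columns exchanged in \<open>tcoef\<close>, the orthogonality argument
  makes the columns of \<open>m\<close> distinct along the rows of \<open>l\<close>. Read through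
  the inverse bijection \<open>g'\<close> this is a colouring of \<open>m\<close> by the rows of
  \<open>l\<close>, so the dominance is reversed.\<close>

lemma quaternionic_inner_dominates:
 assumes l: "is_partition l" and m: "is_partition m" "sum_list m = sum_list l"
  and nz: "(\<Sum>r\<in>partitions_of (sum_list l). tcoef (boxes l) snd fst r * tcoef (boxes m) snd fst r * (real (part_z r) * 2 ^ length r)) \<noteq> 0"
 shows "dominates m l"
proof -
 note fin = finite_boxes[of l] finite_boxes[of m]
 have c: "card (boxes l) = sum_list l" "card (boxes m) = sum_list l" using m by (simp_all add: card_boxes)
 obtain g :: "(nat \<times> nat) \<times> bool \<Rightarrow> (nat \<times> nat) \<times> bool" where g: "bij_betw g (cells l) (cells m)"
   "layer_injective (boxes l) fst (\<lambda>u. snd (fst (g u)))"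
  using isos_orthogonality[OF fin nz[unfolded tcoef_inner[OF fin c]]] by blast
 define g' where "g' = inv_into (cells l) g"
 have g': "bij_betw g' (cells m) (cells l)" unfolding g'_def by (rule bij_betw_inv_into[OF g(1)])
 have gg: "g (g' v) = v" if "v \<in> cells m" for v unfolding g'_def using bij_betw_inv_into_right[OF g(1) that] .
 show ?thesis
 proof (rule dominates_of_coloring[OF m(1) _ l m(2)[symmetric], where h = "\<lambda>v. fst (fst (g' v))"])
  fix i j
  have "{v \<in> cells m. snd (fst v) = j \<and> fst (fst (g' v)) = i} = {v \<in> cells m. fst (fst (g' v)) = i \<and> snd (fst (g (g' v))) = j}"
   by (rule Collect_cong) (use gg in metis)
  then show "card {v \<in> cells m. snd (fst v) = j \<and> fst (fst (g' v)) = i} \<le> 2"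
   using card_bij_preimage[OF g', of "\<lambda>u. fst (fst u) = i \<and> snd (fst (g u)) = j"]
    layer_injective_card_le[OF finite_boxes g(2), of i j] by (simp only:)
 next
  fix i
  show "card {v \<in> cells m. fst (fst (g' v)) = i} = 2 * lookup (expo l) i"
   using card_bij_preimage[OF g', of "\<lambda>v. fst (fst v) = i"] by (simp only: card_row_cells)
 qed
qed

lemma pexp_scale: "pexp n (\<lambda>r. c * a r) b = c * pexp n a b"
 by (simp add: pexp_def sum_distrib_left mult.assoc)

text \<open>A factor \<open>1 / 2\<close> per box turns arm + 2 leg + 2 into the hook factor for
  \<open>\<alpha> = 1 / 2\<close>, and the sign corrects that of the leading coefficient. The factor
  \<open>(-2) ^ length r\<close> enters the form squared and turns its weight
  \<open>(1 / 2) ^ length r\<close> into \<open>2 ^ length r\<close>, so orthogonality again counts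
  isomorphisms.\<close>

lemma jack_theta_quaternionic:
 assumes "is_partition l" "r \<in> partitions_of (sum_list l)"
 shows "jack_theta (1 / 2) r l = (-1 / 2) ^ sum_list l * ((-2) ^ length r * tcoef (boxes l) snd fst r)"
proof (rule jack_theta_eq[where \<theta> = "\<lambda>l r. (-1 / 2) ^ sum_list l * ((-2) ^ length r * tcoef (boxes l) snd fst r)"
   and c = "\<lambda>l. \<Prod>s\<in>boxes l. 1 / 2 * real (arm l s) + real (leg l s) + 1"])
 show "(\<Prod>s\<in>boxes l. 1 / 2 * real (arm l s) + real (leg l s) + 1) \<noteq> 0" for l
 proof -
  have "1 / 2 * real (arm l s) + real (leg l s) + 1 > 0" for s by (simp add: add_nonneg_pos)
  then show ?thesis by (simp add: finite_boxes less_imp_neq[symmetric])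
 qed
 show "dominates l m" if "is_partition l" "m \<in> partitions_of (sum_list l)"
  "pexp (sum_list l) (\<lambda>r. (-1 / 2) ^ sum_list l * ((-2) ^ length r * tcoef (boxes l) snd fst r)) (expo m) \<noteq> 0" for l m
  by (rule quaternionic_triangular[OF that(1,2)]) (use that(3) in \<open>simp add: pexp_scale\<close>)
 show "pexp (sum_list l) (\<lambda>r. (-1 / 2) ^ sum_list l * ((-2) ^ length r * tcoef (boxes l) snd fst r)) (expo l) =
   (\<Prod>s\<in>boxes l. 1 / 2 * real (arm l s) + real (leg l s) + 1)" if "is_partition l" for l
 proof -
  have "(\<Prod>s\<in>boxes l. real (arm l s) + 2 * real (leg l s) + 2) = (\<Prod>s\<in>boxes l. 2 * (1 / 2 * real (arm l s) + real (leg l s) + 1))"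
   by (intro prod.cong) auto
  also have "\<dots> = 2 ^ sum_list l * (\<Prod>s\<in>boxes l. 1 / 2 * real (arm l s) + real (leg l s) + 1)"
   by (simp only: prod.distrib prod_constant card_boxes)
  finally show ?thesis
   unfolding pexp_scale quaternionic_leading[OF that] by (simp add: mult.assoc[symmetric] power_mult_distrib[symmetric])
 qed
 show "(\<Sum>r\<in>partitions_of (sum_list l). (-1 / 2) ^ sum_list l * ((-2) ^ length r * tcoef (boxes l) snd fst r) *
   ((-1 / 2) ^ sum_list m * ((-2) ^ length r * tcoef (boxes m) snd fst r)) * (real (part_z r) * (1 / 2) ^ length r)) = 0"
  if *: "is_partition l" "is_partition m" "sum_list l = sum_list m" "l \<noteq> m" for l m
 proof -
  let ?I = "\<lambda>l m. \<Sum>r\<in>partitions_of (sum_list l). tcoef (boxes l) snd fst r * tcoef (boxes m) snd fst r * (real (part_z r) * 2 ^ length r)"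
  have "?I l m = 0"
  proof (rule ccontr)
   assume nz: "?I l m \<noteq> 0"
   have "dominates m l" by (rule quaternionic_inner_dominates[OF *(1,2) *(3)[symmetric] nz])
   moreover have "dominates l m"
    by (rule quaternionic_inner_dominates[OF *(2,1) *(3)]) (use nz *(3) in \<open>simp add: mult.commute mult.left_commute\<close>)
   ultimately show False using dominates_antisym * by blast
  qed
  moreover have "(\<Sum>r\<in>partitions_of (sum_list l). (-1 / 2) ^ sum_list l * ((-2) ^ length r * tcoef (boxes l) snd fst r) *
   ((-1 / 2) ^ sum_list m * ((-2) ^ length r * tcoef (boxes m) snd fst r)) * (real (part_z r) * (1 / 2) ^ length r)) =
   (-1 / 2) ^ sum_list l * (-1 / 2) ^ sum_list m * ?I l m" unfolding sum_distrib_left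
  proof (rule sum.cong[OF refl])
   fix r :: "nat list"
   have "(-2 :: real) ^ length r * (-2) ^ length r * (1 / 2) ^ length r = 2 ^ length r"
    by (simp only: power_mult_distrib[symmetric]) simp
   from this[symmetric] show "(-1 / 2) ^ sum_list l * ((-2) ^ length r * tcoef (boxes l) snd fst r) *
    ((-1 / 2) ^ sum_list m * ((-2) ^ length r * tcoef (boxes m) snd fst r)) * (real (part_z r) * (1 / 2) ^ length r) =
    (-1 / 2) ^ sum_list l * (-1 / 2) ^ sum_list m * (tcoef (boxes l) snd fst r * tcoef (boxes m) snd fst r * (real (part_z r) * 2 ^ length r))"
    by (simp only: mult_ac)
  qed
  ultimately show ?thesis by simp
 qed
qed (use assms in auto)

section \<open>Reduction to diagrams of full size\<close>

lemma pairs_type_eq_partition: "is_partition r \<Longrightarrow> pairs_type P Q = r \<longleftrightarrow> ptype P Q = mset r"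
proof
 assume r: "is_partition r" and *: "ptype P Q = mset r"
 have "sorted (rev r)" using r by (simp add: is_partition_def sorted_wrt_rev)
 then have "sort r = rev r" by (intro properties_for_sort) auto
 then show "pairs_type P Q = r" using * by (simp add: pairs_type_def ptype_def)
qed (metis mset_pairs_type)

lemma is_partition_append_one: "is_partition r \<Longrightarrow> is_partition (r @ [1])"
 by (auto simp: is_partition_def sorted_wrt_append Suc_le_eq) (metis gr0I)

definition digon :: "'d \<Rightarrow> ('d \<times> bool) set" where
 "digon d = {(d, False), (d, True)}"

context
 fixes D :: "'d set" and x y :: "'d \<Rightarrow> nat"
 assumes D: "finite D" and xy: "inj_on (\<lambda>d. (x d, y d)) D"
begin

text \<open>A polygon of length 2 is a pair common to \<open>B\<close> and the pairing of \<sigma>.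
  Its two boxes agree in \<open>x\<close> and in \<open>y\<close>, hence coincide by
  \<open>xy\<close>, so every part 1 of the type comes from a fixed box.\<close>

lemma card_digons:
 assumes B: "B \<in> level_pairings x D" and s: "\<sigma> \<in> level_perms y D"
 shows "card {d \<in> D. \<sigma> d = d \<and> digon d \<in> B} = count (ptype B (perm_pairs D \<sigma>)) 1"
proof -
 let ?W = "perm_pairs D \<sigma>" and ?X = "D \<times> (UNIV :: bool set)"
 have X: "finite ?X" using D by simp
 note Bp = level_pairingsD[OF B] and sp = level_permsD[OF s]
 note W = perm_pairs_pairings[OF sp]
 note fp = finite_polygons[OF X Bp W]
 have 1: "digon ` {d \<in> D. \<sigma> d = d \<and> digon d \<in> B} = {L \<in> polygons B ?W. card L div 2 = 1}"
 proof (intro equalityI subsetI)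
  fix L assume "L \<in> digon ` {d \<in> D. \<sigma> d = d \<and> digon d \<in> B}"
  then obtain d where d: "d \<in> D" "\<sigma> d = d" "digon d \<in> B" "L = digon d" by blast
  have "{(d, False), (d, True)} \<in> ?W" using d unfolding perm_pairs_def by force
  then have "L \<in> polygons B ?W" using polygons_contract_in(1)[OF Bp W, of "(d, False)" "(d, True)"] d(3,4) by (simp add: digon_def)
  moreover have "card L = 2" using d(4) by (simp add: digon_def)
  ultimately show "L \<in> {L \<in> polygons B ?W. card L div 2 = 1}" by simp
 next
  fix L assume "L \<in> {L \<in> polygons B ?W. card L div 2 = 1}"
  then have L: "L \<in> polygons B ?W" "card L div 2 = 1" by auto
  have "L \<noteq> {}" using L(2) by auto
  then obtain a where a: "a \<in> L" by blast
  note La = polygonD(1)[OF Bp W L(1) a] and aX = polygonD(2)[OF Bp W L(1) a]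
  have c2: "card L = 2" using even_polygon[OF X Bp W aX] L(2) unfolding La[symmetric] by presburger
  have LB: "mate B a \<in> L" "mate ?W a \<in> L" unfolding La using conn_mate[OF Bp W aX] by blast+
  have finL: "finite L" using c2 card.infinite by fastforce
  have eq: "{a, mate B a} = L" "{a, mate ?W a} = L"
   by (rule card_subset_eq[OF finL]; use a LB c2 mate_neq[OF Bp aX] mate_neq[OF W aX] in auto)+
  have LBW: "L \<in> B" "L \<in> ?W" using mate_pair[OF Bp aX] mate_pair[OF W aX] eq by simp_all
  then obtain d where d: "d \<in> D" "L = {(d, False), (\<sigma> d, True)}" unfolding perm_pairs_def by blast
  have "const_on B (\<lambda>u. x (fst u))" using B by (simp add: level_pairings_def)
  from this[unfolded const_on_def, rule_format, OF LBW(1)[unfolded d(2)]] have "x d = x (\<sigma> d)" by simp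
  moreover have "y (\<sigma> d) = y d" by (rule level_perms_level[OF s])
  moreover have "\<sigma> d \<in> D" using permutes_in_image[OF sp] d(1) by simp
  ultimately have "\<sigma> d = d" using inj_onD[OF xy, of "\<sigma> d" d] d(1) by simp
  then have "L = digon d" using d(2) by (simp add: digon_def)
  then show "L \<in> digon ` {d \<in> D. \<sigma> d = d \<and> digon d \<in> B}" using d(1) \<open>\<sigma> d = d\<close> LBW(1) by blast
 qed
 have "inj_on digon {d \<in> D. \<sigma> d = d \<and> digon d \<in> B}" by (rule inj_onI) (auto simp: digon_def doubleton_eq_iff)
 from card_image[OF this, symmetric] have "card {d \<in> D. \<sigma> d = d \<and> digon d \<in> B} = card {L \<in> polygons B ?W. card L div 2 = 1}"
  unfolding 1 .
 also have "\<dots> = count (ptype B ?W) 1" unfolding ptype_def count_image_mset using fp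
  by (simp add: vimage_def Int_def conj_commute)
 finally show ?thesis .
qed

text \<open>Adding back the digon of \<open>d\<close> identifies the terms for
  \<open>D - {d}\<close> with those terms for \<open>D\<close> that contain this digon and fix
  \<open>d\<close>; the type gains a part 1. Summed over \<open>d\<close>, each term is counted once
  for every part 1 of its type.\<close>

lemma tcoef_remove:
 assumes r: "is_partition r"
 shows "(\<Sum>d\<in>D. tcoef (D - {d}) x y r) = real (count_list r 1 + 1) * tcoef D x y (r @ [1])"
proof -
 note r1 = is_partition_append_one[OF r]
 let ?LB = "level_pairings x D" and ?LP = "level_perms y D"
 let ?t = "\<lambda>B \<sigma>. if pairs_type B (perm_pairs D \<sigma>) = r @ [1] then of_int (sign \<sigma>) else 0 :: real"
 note finB = finite_level_pairings[OF D, of x] and finP = finite_level_perms[OF D, of y]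
 have step: "tcoef (D - {d}) x y r = (\<Sum>B\<in>?LB. \<Sum>\<sigma>\<in>?LP. if \<sigma> d = d \<and> digon d \<in> B then ?t B \<sigma> else 0)" if d: "d \<in> D" for d
 proof -
  let ?D = "D - {d}"
  have DX: "?D \<times> UNIV = D \<times> UNIV - {(d, False), (d, True)}" by auto
  have perms: "level_perms y ?D = {\<sigma> \<in> ?LP. \<sigma> d = d}"
  proof (rule set_eqI)
   fix \<sigma>
   have "\<sigma> permutes ?D \<longleftrightarrow> \<sigma> permutes D \<and> \<sigma> d = d"
    using permutes_subset[of \<sigma> ?D D] permutes_not_in[of \<sigma> ?D d] permutes_superset[of \<sigma> D ?D] by auto
   then show "\<sigma> \<in> level_perms y ?D \<longleftrightarrow> \<sigma> \<in> {\<sigma> \<in> ?LP. \<sigma> d = d}" unfolding level_perms_def by blast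
  qed
  have B1: "insert (digon d) B \<in> {B \<in> ?LB. digon d \<in> B}" "insert (digon d) B - {digon d} = B" if B: "B \<in> level_pairings x ?D" for B
  proof -
   have Bp: "B \<in> pairings (D \<times> UNIV - {(d, False), (d, True)})" using level_pairingsD[OF B] unfolding DX .
   have "insert (digon d) B \<in> pairings (D \<times> UNIV)"
    unfolding digon_def by (rule pairings_insert'[OF Bp]) (use d in auto)
   moreover have "const_on (insert (digon d) B) (\<lambda>u. x (fst u))"
    using B unfolding digon_def const_on_insert level_pairings_def by simp
   ultimately show "insert (digon d) B \<in> {B \<in> ?LB. digon d \<in> B}" unfolding level_pairings_def by blast
   have "digon d \<notin> B" using pairings_cover[OF Bp] unfolding digon_def by blast
   then show "insert (digon d) B - {digon d} = B" by simp
  qed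
  have B2: "B - {digon d} \<in> level_pairings x ?D" "insert (digon d) (B - {digon d}) = B" if B: "B \<in> ?LB" "digon d \<in> B" for B
  proof -
   have "B - {digon d} \<in> pairings (?D \<times> UNIV)"
    unfolding DX using pairings_diff[OF level_pairingsD[OF B(1)], of "(d, False)" "(d, True)"] B(2) by (simp add: digon_def)
   moreover have "const_on (B - {digon d}) (\<lambda>u. x (fst u))" using B(1) by (auto simp: level_pairings_def const_on_def)
   ultimately show "B - {digon d} \<in> level_pairings x ?D" by (simp add: level_pairings_def)
   show "insert (digon d) (B - {digon d}) = B" using B(2) by blast
  qed
  have ty: "pairs_type (B - {digon d}) (perm_pairs ?D \<sigma>) = r \<longleftrightarrow> pairs_type B (perm_pairs D \<sigma>) = r @ [1]"
   if B: "B \<in> ?LB" "digon d \<in> B" and s: "\<sigma> \<in> ?LP" "\<sigma> d = d" for B \<sigma>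
  proof -
   note Bp = level_pairingsD[OF B(1)] and W = perm_pairs_pairings[OF level_permsD[OF s(1)]]
   have dW: "{(d, False), (d, True)} \<in> perm_pairs D \<sigma>" using d s(2) unfolding perm_pairs_def by force
   have inj: "inj_on (\<lambda>d. {(d, False), (\<sigma> d, True)}) D" by (rule inj_onI) (auto simp: doubleton_eq_iff)
   have "remove_pair {(d, False), (d, True)} (perm_pairs D \<sigma>) = perm_pairs D \<sigma> - {{(d, False), (d, True)}}"
    using dW by (simp add: remove_pair_def)
   also have "\<dots> = perm_pairs ?D \<sigma>"
    using inj_on_image_set_diff[OF inj, of D "{d}"] d s(2) unfolding perm_pairs_def by simp
   finally have "ptype B (perm_pairs D \<sigma>) = add_mset 1 (ptype (B - {digon d}) (perm_pairs ?D \<sigma>))"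
    using ptype_contract_in(1)[OF _ Bp W, of "(d, False)" "(d, True)"] B(2) dW D by (simp add: digon_def)
   then show ?thesis unfolding pairs_type_eq_partition[OF r] pairs_type_eq_partition[OF r1] by simp
  qed
  have "tcoef ?D x y r = (\<Sum>B | B \<in> ?LB \<and> digon d \<in> B. \<Sum>\<sigma>\<in>level_perms y ?D.
    if pairs_type (B - {digon d}) (perm_pairs ?D \<sigma>) = r then of_int (sign \<sigma>) else 0)"
   unfolding tcoef_def
   by (rule sum.reindex_bij_witness[where i = "\<lambda>B. B - {digon d}" and j = "insert (digon d)"]) (use B1 B2 in auto)
  also have "\<dots> = (\<Sum>B | B \<in> ?LB \<and> digon d \<in> B. \<Sum>\<sigma> | \<sigma> \<in> ?LP \<and> \<sigma> d = d. ?t B \<sigma>)"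
   unfolding perms by (intro sum.cong refl) (use ty in auto)
  also have "\<dots> = (\<Sum>B\<in>?LB. if digon d \<in> B then \<Sum>\<sigma>\<in>?LP. if \<sigma> d = d then ?t B \<sigma> else 0 else 0)"
   unfolding sum.inter_filter[OF finB] sum.inter_filter[OF finP] ..
  also have "\<dots> = (\<Sum>B\<in>?LB. \<Sum>\<sigma>\<in>?LP. if \<sigma> d = d \<and> digon d \<in> B then ?t B \<sigma> else 0)"
   by (rule sum.cong[OF refl]) (simp cong: if_cong)
  finally show ?thesis .
 qed
 have "(\<Sum>d\<in>D. tcoef (D - {d}) x y r) = (\<Sum>d\<in>D. \<Sum>B\<in>?LB. \<Sum>\<sigma>\<in>?LP. if \<sigma> d = d \<and> digon d \<in> B then ?t B \<sigma> else 0)"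
  by (rule sum.cong[OF refl step])
 also have "\<dots> = (\<Sum>B\<in>?LB. \<Sum>\<sigma>\<in>?LP. \<Sum>d\<in>D. if \<sigma> d = d \<and> digon d \<in> B then ?t B \<sigma> else 0)"
  by (subst sum.swap, rule sum.cong[OF refl], rule sum.swap)
 also have "\<dots> = (\<Sum>B\<in>?LB. \<Sum>\<sigma>\<in>?LP. real (count_list r 1 + 1) * ?t B \<sigma>)"
 proof (rule sum.cong[OF refl], rule sum.cong[OF refl])
  fix B \<sigma> assume BP: "B \<in> ?LB" "\<sigma> \<in> ?LP"
  have "(\<Sum>d\<in>D. if \<sigma> d = d \<and> digon d \<in> B then ?t B \<sigma> else 0) = real (count (ptype B (perm_pairs D \<sigma>)) 1) * ?t B \<sigma>"
   unfolding card_digons[OF BP, symmetric] by (simp only: sum.inter_filter[OF D, symmetric] sum_constant)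
  also have "\<dots> = real (count_list r 1 + 1) * ?t B \<sigma>"
   unfolding pairs_type_eq_partition[OF r1] by (simp add: count_mset)
  finally show "(\<Sum>d\<in>D. if \<sigma> d = d \<and> digon d \<in> B then ?t B \<sigma> else 0) = real (count_list r 1 + 1) * ?t B \<sigma>" .
 qed
 finally show ?thesis unfolding tcoef_def sum_distrib_left .
qed

end

lemma is_partition_append_ones: "is_partition r \<Longrightarrow> is_partition (r @ replicate j 1)"
proof (induction j)
 case (Suc j)
 have "r @ replicate (Suc j) 1 = (r @ replicate j 1) @ [1]" by (simp add: replicate_append_same)
 then show ?case using is_partition_append_one[OF Suc.IH[OF Suc.prems]] by simp
qed simp

text \<open>Both sides are compared with their sums over all deletions of one box. The left side
  gains the factor \<open>Suc j\<close>, the right side the multiplicity of the part 1, and the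
  binomial coefficient solves the resulting recursion.\<close>

lemma embedding_sum_eq:
 assumes S: "finite S" "B \<in> pairings S" "W \<in> pairings S" and D: "finite D" "inj_on (\<lambda>d. (x d, y d)) D"
  and n: "card S = 2 * k" "card D = k + j"
 shows "embedding_sum S B W D x y = (-1) ^ k * (real (zmset (ptype B W)) *
  (real ((j + count_list (pairs_type B W) 1) choose count_list (pairs_type B W) 1) * tcoef D x y (pairs_type B W @ replicate j 1)))"
 using D n(2)
proof (induction j arbitrary: D)
 case 0
 then show ?case using embedding_sum_full[OF S(1,3) 0(1) _ S(2), of x y] n(1) by simp
next
 case (Suc j)
 let ?p = "pairs_type B W" and ?m = "count_list (pairs_type B W) 1" and ?z = "real (zmset (ptype B W))"
 have p: "is_partition (?p @ replicate j 1)"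
  using pairs_type_partition[OF S n(1)] is_partition_append_ones by (simp add: partitions_of_def)
 have "real (Suc j) * embedding_sum S B W D x y = (\<Sum>d\<in>D. embedding_sum S B W (D - {d}) x y)"
  unfolding embedding_sum_remove[OF S(1,3) Suc.prems(1)] using n(1) Suc.prems(3) by simp
 also have "\<dots> = (\<Sum>d\<in>D. (-1) ^ k * (?z * (real ((j + ?m) choose ?m) * tcoef (D - {d}) x y (?p @ replicate j 1))))"
 proof (rule sum.cong[OF refl])
  fix d assume d: "d \<in> D"
  show "embedding_sum S B W (D - {d}) x y = (-1) ^ k * (?z * (real ((j + ?m) choose ?m) * tcoef (D - {d}) x y (?p @ replicate j 1)))"
   by (rule Suc.IH) (use Suc.prems d inj_on_subset[OF Suc.prems(2)] in auto)
 qed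
 also have "\<dots> = (-1) ^ k * (?z * (real ((j + ?m) choose ?m) * (\<Sum>d\<in>D. tcoef (D - {d}) x y (?p @ replicate j 1))))"
  unfolding sum_distrib_left ..
 also have "(\<Sum>d\<in>D. tcoef (D - {d}) x y (?p @ replicate j 1)) = real (?m + Suc j) * tcoef D x y (?p @ replicate (Suc j) 1)"
 proof -
  have "count_list (?p @ replicate j 1) 1 + 1 = ?m + Suc j" by (induction j) auto
  then show ?thesis unfolding tcoef_remove[OF Suc.prems(1,2) p] by (simp add: replicate_append_same)
 qed
 also have "(-1) ^ k * (?z * (real ((j + ?m) choose ?m) * (real (?m + Suc j) * tcoef D x y (?p @ replicate (Suc j) 1)))) =
   real (Suc j) * ((-1) ^ k * (?z * (real ((Suc j + ?m) choose ?m) * tcoef D x y (?p @ replicate (Suc j) 1))))"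
 proof -
  have "(Suc j + ?m) * ((j + ?m) choose ?m) = Suc j * ((Suc j + ?m) choose ?m)"
  proof -
   have "Suc j * (Suc (j + ?m) choose Suc j) = Suc (j + ?m) * (j + ?m choose j)" by (rule Suc_times_binomial)
   moreover have "j + ?m choose j = (j + ?m) choose ?m" using binomial_symmetric[of j "j + ?m"] by simp
   moreover have "Suc (j + ?m) choose Suc j = (Suc j + ?m) choose ?m" using binomial_symmetric[of "Suc j" "Suc j + ?m"] by simp
   ultimately show ?thesis by simp
  qed
  then have "((j + ?m) choose ?m) * (?m + Suc j) = Suc j * ((Suc j + ?m) choose ?m)" by (simp only: mult.commute add.commute)
  then have e: "real ((j + ?m) choose ?m) * real (?m + Suc j) = real (Suc j) * real ((Suc j + ?m) choose ?m)"
   by (simp only: of_nat_mult[symmetric])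
  have "real ((j + ?m) choose ?m) * (real (?m + Suc j) * t) = real (Suc j) * (real ((Suc j + ?m) choose ?m) * t)" for t
   by (simp only: mult.assoc[symmetric] e)
  then show ?thesis by (simp only: mult.left_commute)
 qed
 finally show ?case by simp
qed

section \<open>Embeddings of a map as labellings of its ground set\<close>

context
 fixes S :: "'a set" and P E :: "'a set set" and v :: "'a set"
 assumes P: "P \<in> pairings S" and E: "E \<in> pairings S" and v: "v \<in> polygons P E"
begin

lemma polygon_some: "(SOME s. s \<in> v) \<in> v"
proof -
 obtain s where "s \<in> S" "v = conn P E `` {s}" using v unfolding polygons_eq[OF P E] by blast
 then have "s \<in> v" by simp
 then show ?thesis by (rule someI)
qed

lemma polygon_edge: "s \<in> v \<Longrightarrow> s \<in> S" "s \<in> v \<Longrightarrow> {s, mate E s} \<subseteq> v"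
proof -
 assume s: "s \<in> v"
 show sS: "s \<in> S" by (rule polygonD(2)[OF P E v s])
 show "{s, mate E s} \<subseteq> v" using s conn_mate(2)[OF P E sS] unfolding polygonD(1)[OF P E v s] by blast
qed

lemma polygon_const: "const_on P h \<Longrightarrow> const_on E h \<Longrightarrow> s \<in> v \<Longrightarrow> t \<in> v \<Longrightarrow> h s = h t"
 using conn_const[OF P E, of s t h] polygonD(1)[OF P E v, of s] by blast

end

lemma pairing_const: "E \<in> pairings S \<Longrightarrow> const_on E f \<Longrightarrow> e \<in> E \<Longrightarrow> s \<in> e \<Longrightarrow> t \<in> e \<Longrightarrow> f s = f t"
proof -
 assume *: "E \<in> pairings S" "const_on E f" "e \<in> E" "s \<in> e" "t \<in> e"
 obtain a b where "e = {a, b}" using pairings_pairE[OF *(1,3)] by metis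
 moreover from this have "f a = f b" using *(2,3) unfolding const_on_def by blast
 ultimately show ?thesis using *(4,5) by auto
qed

lemma pairing_eq_mate: "E \<in> pairings S \<Longrightarrow> e \<in> E \<Longrightarrow> s \<in> e \<Longrightarrow> s \<in> S \<and> e = {s, mate E s}"
proof -
 assume *: "E \<in> pairings S" "e \<in> E" "s \<in> e"
 have s: "s \<in> S" using pairings_cover[OF *(1)] *(2,3) by blast
 then show ?thesis using pairings_uniq[OF *(1) *(2) mate_pair[OF *(1) s]] *(3) by blast
qed

text \<open>An embedding is determined by the boxes of its edges, because every vertex contains an
  edge and incidence fixes its row or column. Spread over the ground set, it is constant on edges,
  and the vertex conditions become constancy of the row on black pairs and of the column on white
  pairs.\<close>

lemma map_N_eq:
 assumes B: "B \<in> pairings S" and W: "W \<in> pairings S" and E: "E \<in> pairings S"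
 shows "map_N \<lparr>blacks = B, whites = W, edges = E\<rparr> lam =
  card {f \<in> S \<rightarrow>\<^sub>E boxes lam. const_on E f \<and> const_on B (\<lambda>s. fst (f s)) \<and> const_on W (\<lambda>s. snd (f s))}"
  (is "_ = card ?A")
proof -
 let ?G = "underlying_graph \<lparr>blacks = B, whites = W, edges = E\<rparr>"
 let ?r = "\<lambda>v. SOME s. s \<in> v"
 define F where "F f = (restrict (\<lambda>v. snd (f (?r v))) (polygons W E), restrict (\<lambda>v. fst (f (?r v))) (polygons B E),
   restrict (\<lambda>e. f (?r e)) E)" for f :: "'a \<Rightarrow> nat \<times> nat"
 define H where "H t = restrict (\<lambda>s. snd (snd t) {s, mate E s}) S"
  for t :: "('a set \<Rightarrow> nat) \<times> ('a set \<Rightarrow> nat) \<times> ('a set \<Rightarrow> nat \<times> nat)"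
 have G: "embeddings ?G lam = {(c, r, x). c \<in> polygons W E \<rightarrow>\<^sub>E columns lam \<and> r \<in> polygons B E \<rightarrow>\<^sub>E rows lam \<and> x \<in> E \<rightarrow>\<^sub>E boxes lam \<and>
   (\<forall>e\<in>E. (\<forall>v\<in>polygons B E. e \<subseteq> v \<longrightarrow> fst (x e) = r v) \<and> (\<forall>v\<in>polygons W E. e \<subseteq> v \<longrightarrow> snd (x e) = c v))}"
  by (simp add: embeddings_def underlying_graph_def black_vertices_def white_vertices_def)
 have re: "?r e \<in> e" if e: "e \<in> E" for e
 proof -
  obtain a b where "e = {a, b}" using pairings_pairE[OF E e] by metis
  then show ?thesis by (metis insertI1 someI)
 qed
 have eS: "{s, mate E s} \<in> E" if "s \<in> S" for s by (rule mate_pair[OF E that])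
 have box: "fst p \<in> rows lam" "snd p \<in> columns lam" if p: "p \<in> boxes lam" for p
 proof -
  have p': "fst p < length lam" "snd p < lam ! fst p" using p by (auto simp: boxes_def)
  then show "fst p \<in> rows lam" by (simp add: rows_def)
  have "fst p \<in> {i. i < length lam \<and> snd p < lam ! i}" using p' by simp
  then have "col_length lam (snd p) > 0" unfolding col_length_def card_gt_0_iff by auto
  then show "snd p \<in> columns lam" by (simp add: columns_def)
 qed
 have 1: "F f \<in> embeddings ?G lam" if f: "f \<in> ?A" for f
 proof -
  have fS: "f s \<in> boxes lam" if "s \<in> S" for s using f that by auto
  have cE: "const_on E f" and cB: "const_on B (\<lambda>s. fst (f s))" and cW: "const_on W (\<lambda>s. snd (f s))" using f by auto
  have inc: "h (f (?r e)) = h (f (?r v))" if "P \<in> pairings S" "const_on P (\<lambda>s. h (f s))" "e \<in> E" "v \<in> polygons P E" "e \<subseteq> v"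
   for e v P and h :: "nat \<times> nat \<Rightarrow> nat"
  proof (rule polygon_const[OF that(1) E that(4,2)])
   show "const_on E (\<lambda>s. h (f s))" using cE by (auto simp: const_on_def)
  qed (use re[OF that(3)] that(5) polygon_some[OF that(1) E that(4)] in auto)
  have c1: "snd (f (?r v)) \<in> columns lam" if v: "v \<in> polygons W E" for v
   by (rule box(2)[OF fS[OF polygon_edge(1)[OF W E v polygon_some[OF W E v]]]])
  have c2: "fst (f (?r v)) \<in> rows lam" if v: "v \<in> polygons B E" for v
   by (rule box(1)[OF fS[OF polygon_edge(1)[OF B E v polygon_some[OF B E v]]]])
  have c3: "f (?r e) \<in> boxes lam" if e: "e \<in> E" for e using fS pairing_eq_mate[OF E e re[OF e]] by blast
  show ?thesis unfolding G F_def using c1 c2 c3 inc[OF B cB] inc[OF W cW] by simp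
 qed
 have 2: "H t \<in> ?A" if t: "t \<in> embeddings ?G lam" for t
 proof -
  obtain c r x where tx: "t = (c, r, x)" by (cases t)
  have x: "x \<in> E \<rightarrow>\<^sub>E boxes lam" and ib: "\<And>e v. e \<in> E \<Longrightarrow> v \<in> polygons B E \<Longrightarrow> e \<subseteq> v \<Longrightarrow> fst (x e) = r v"
   and iw: "\<And>e v. e \<in> E \<Longrightarrow> v \<in> polygons W E \<Longrightarrow> e \<subseteq> v \<Longrightarrow> snd (x e) = c v"
   using t unfolding G tx by auto
  have Hs: "H t s = x {s, mate E s}" if "s \<in> S" for s using that by (simp add: H_def tx)
  have mt: "h (H t (mate P s)) = h (H t s)" if P: "P \<in> pairings S" and s: "s \<in> S"
   and i: "\<And>e v. e \<in> E \<Longrightarrow> v \<in> polygons P E \<Longrightarrow> e \<subseteq> v \<Longrightarrow> h (x e) = q v" for P s q and h :: "nat \<times> nat \<Rightarrow> nat"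
  proof -
   let ?v = "conn P E `` {s}"
   have v: "?v \<in> polygons P E" using s by (simp add: polygons_eq[OF P E])
   have m: "s \<in> ?v" "mate P s \<in> ?v" using conn_mate(1)[OF P E s] by auto
   show ?thesis unfolding Hs[OF s] Hs[OF mate_in[OF P s]]
    using i[OF eS[OF s] v polygon_edge(2)[OF P E v m(1)]] i[OF eS[OF mate_in[OF P s]] v polygon_edge(2)[OF P E v m(2)]] by simp
  qed
  have "H t \<in> S \<rightarrow>\<^sub>E boxes lam"
  proof (rule PiE_I)
   show "H t s \<in> boxes lam" if "s \<in> S" for s unfolding Hs[OF that] using PiE_mem[OF x eS[OF that]] .
   show "H t s = undefined" if "s \<notin> S" for s using that by (simp add: H_def)
  qed
  moreover have "const_on E (H t)" unfolding const_on_mate[OF E]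
  proof
   fix s assume s: "s \<in> S"
   show "H t (mate E s) = H t s"
    unfolding Hs[OF s] Hs[OF mate_in[OF E s]] mate_mate[OF E s] by (simp only: insert_commute)
  qed
  moreover have "\<And>s. s \<in> S \<Longrightarrow> fst (H t (mate B s)) = fst (H t s)" "\<And>s. s \<in> S \<Longrightarrow> snd (H t (mate W s)) = snd (H t s)"
   using mt[of B _ fst r, OF B _ ib] mt[of W _ snd c, OF W _ iw] by blast+
  ultimately show ?thesis by (simp add: const_on_mate[OF B] const_on_mate[OF W])
 qed
 have "bij_betw F ?A (embeddings ?G lam)"
 proof (rule bij_betwI[where g = H])
  show "F \<in> ?A \<rightarrow> embeddings ?G lam" using 1 by blast
  show "H \<in> embeddings ?G lam \<rightarrow> ?A" using 2 by blast
  show "H (F f) = f" if f: "f \<in> ?A" for f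
  proof
   fix s
   have fA: "f \<in> S \<rightarrow>\<^sub>E boxes lam" "const_on E f" using f by auto
   show "H (F f) s = f s"
   proof (cases "s \<in> S")
    case True
    have "f (?r {s, mate E s}) = f s" by (rule pairing_const[OF E fA(2) eS[OF True] re[OF eS[OF True]]]) simp
    then show ?thesis using True eS[OF True] by (simp add: H_def F_def)
   next
    case False
    then show ?thesis using PiE_arb[OF fA(1)] by (simp add: H_def)
   qed
  qed
  show "F (H t) = t" if t: "t \<in> embeddings ?G lam" for t
  proof -
   obtain c r x where tx: "t = (c, r, x)" by (cases t)
   have x: "x \<in> E \<rightarrow>\<^sub>E boxes lam" and c: "c \<in> polygons W E \<rightarrow>\<^sub>E columns lam" and r: "r \<in> polygons B E \<rightarrow>\<^sub>E rows lam"
    and ib: "\<And>e v. e \<in> E \<Longrightarrow> v \<in> polygons B E \<Longrightarrow> e \<subseteq> v \<Longrightarrow> fst (x e) = r v"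
    and iw: "\<And>e v. e \<in> E \<Longrightarrow> v \<in> polygons W E \<Longrightarrow> e \<subseteq> v \<Longrightarrow> snd (x e) = c v"
    using t unfolding G tx by auto
   have Hs: "H t s = x {s, mate E s}" if "s \<in> S" for s using that by (simp add: H_def tx)
   have pt: "restrict (\<lambda>v. h (H t (?r v))) (polygons P E) = q" if P: "P \<in> pairings S" and q: "q \<in> polygons P E \<rightarrow>\<^sub>E Y"
    and i: "\<And>e v. e \<in> E \<Longrightarrow> v \<in> polygons P E \<Longrightarrow> e \<subseteq> v \<Longrightarrow> h (x e) = q v" for P q Y and h :: "nat \<times> nat \<Rightarrow> nat"
   proof
    fix v
    show "restrict (\<lambda>v. h (H t (?r v))) (polygons P E) v = q v"
    proof (cases "v \<in> polygons P E")
     case True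
     note s = polygon_some[OF P E True]
     note sS = polygon_edge(1)[OF P E True s]
     show ?thesis using True i[OF eS[OF sS] True polygon_edge(2)[OF P E True s]] by (simp add: Hs[OF sS])
    next
     case False
     then show ?thesis using PiE_arb[OF q] by simp
    qed
   qed
   have "restrict (\<lambda>e. H t (?r e)) E = x"
   proof
    fix e
    show "restrict (\<lambda>e. H t (?r e)) E e = x e"
    proof (cases "e \<in> E")
     case True
     have "?r e \<in> S" "e = {?r e, mate E (?r e)}" using pairing_eq_mate[OF E True re[OF True]] by blast+
     then show ?thesis using True Hs[of "?r e"] by simp
    next
     case False
     then show ?thesis using PiE_arb[OF x] by simp
    qed
   qed
   then show ?thesis using pt[of B r _ fst, OF B r ib] pt[of W c _ snd, OF W c iw] unfolding F_def tx by simp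
  qed
 qed
 from bij_betw_same_card[OF this] show ?thesis by (simp add: map_N_def graph_N_def)
qed

text \<open>White vertices carry the factor -2 in the first sum, black ones in the second, where
  rows and columns therefore change roles.\<close>

lemma sum_embeddings:
 assumes S: "finite S" and B: "B \<in> pairings S" and W: "W \<in> pairings S"
 shows "(\<Sum>E\<in>pairings S. (-2) ^ npoly E W * real (map_N \<lparr>blacks = B, whites = W, edges = E\<rparr> lam)) = embedding_sum S B W (boxes lam) fst snd"
  and "(\<Sum>E\<in>pairings S. (-2) ^ npoly E B * real (map_N \<lparr>blacks = B, whites = W, edges = E\<rparr> lam)) = embedding_sum S W B (boxes lam) snd fst"
proof -
 let ?F = "S \<rightarrow>\<^sub>E boxes lam"
 let ?c = "\<lambda>f. const_on B (\<lambda>s. fst (f s)) \<and> const_on W (\<lambda>s. snd (f s))"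
 have fin: "finite ?F" using S finite_boxes by (intro finite_PiE) auto
 have *: "(\<Sum>E\<in>pairings S. (-2) ^ npoly E Q * real (map_N \<lparr>blacks = B, whites = W, edges = E\<rparr> lam)) =
  (\<Sum>f\<in>?F. if ?c f then pairing_sum S Q f else 0)" for Q
 proof -
  have "(\<Sum>E\<in>pairings S. (-2) ^ npoly E Q * real (map_N \<lparr>blacks = B, whites = W, edges = E\<rparr> lam)) =
   (\<Sum>E\<in>pairings S. \<Sum>f\<in>?F. if ?c f then if const_on E f then (-2) ^ npoly E Q else 0 else 0)"
  proof (rule sum.cong[OF refl])
   fix E assume E: "E \<in> pairings S"
   have "real (card {f \<in> ?F. const_on E f \<and> ?c f}) = (\<Sum>f\<in>?F. if const_on E f \<and> ?c f then 1 else 0)"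
    using fin by (simp add: sum.If_cases Int_def)
   then show "(-2) ^ npoly E Q * real (map_N \<lparr>blacks = B, whites = W, edges = E\<rparr> lam) =
     (\<Sum>f\<in>?F. if ?c f then if const_on E f then (-2) ^ npoly E Q else 0 else 0)"
    unfolding map_N_eq[OF B W E] by (simp only: sum_distrib_left) (rule sum.cong[OF refl], simp)
  qed
  also have "\<dots> = (\<Sum>f\<in>?F. \<Sum>E\<in>pairings S. if ?c f then if const_on E f then (-2) ^ npoly E Q else 0 else 0)" by (rule sum.swap)
  also have "\<dots> = (\<Sum>f\<in>?F. if ?c f then pairing_sum S Q f else 0)"
  proof (rule sum.cong[OF refl])
   fix f
   show "(\<Sum>E\<in>pairings S. if ?c f then if const_on E f then (-2) ^ npoly E Q else 0 else 0) = (if ?c f then pairing_sum S Q f else 0)"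
    by (cases "?c f") (simp_all only: pairing_sum_def if_True if_False sum.neutral_const simp_thms)
  qed
  finally show ?thesis .
 qed
 show "(\<Sum>E\<in>pairings S. (-2) ^ npoly E W * real (map_N \<lparr>blacks = B, whites = W, edges = E\<rparr> lam)) = embedding_sum S B W (boxes lam) fst snd"
  unfolding * embedding_sum_def ..
 show "(\<Sum>E\<in>pairings S. (-2) ^ npoly E B * real (map_N \<lparr>blacks = B, whites = W, edges = E\<rparr> lam)) = embedding_sum S W B (boxes lam) snd fst"
  unfolding * embedding_sum_def by (rule sum.cong[OF refl]) (simp add: conj_commute)
qed

lemma powr_half_diff:
 assumes "(a :: real) > 0"
 shows "a powr (- ((real k - real l) / 2)) = sqrt a ^ l / sqrt a ^ k"
proof -
 have p: "sqrt a ^ j = a powr (real j / 2)" for j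
  using assms by (simp add: powr_half_sqrt[symmetric] powr_realpow[symmetric] powr_powr)
 have "- ((real k - real l) / 2) = real l / 2 - real k / 2" by (simp add: field_simps)
 then show ?thesis unfolding p by (simp only: powr_diff)
qed

theorem theorem5p1:
  fixes \<alpha> :: real and \<pi> lam :: "nat list" and S :: "'a set" and B W :: "'a set set"
  assumes "\<alpha> \<in> {1 / 2, 2}"
    and "is_partition \<pi>" and "is_partition lam"
    and "finite S" and "B \<in> pairings S" and "W \<in> pairings S"
    and "pairs_type B W = \<pi>"
  shows "jack_Ch \<alpha> \<pi> lam =
    (-1) ^ length \<pi> *
    (\<Sum>M\<in>{\<lparr>blacks = B, whites = W, edges = E\<rparr> | E. E \<in> pairings S}.
        (- (1 / sqrt \<alpha>)) ^ card (black_vertices M) * sqrt \<alpha> ^ card (white_vertices M)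
        * map_weight \<alpha> M * real (map_N M lam))"
proof -
 note S = assms(4) and B = assms(5) and W = assms(6)
 let ?M = "\<lambda>E. \<lparr>blacks = B, whites = W, edges = E\<rparr>"
 let ?g = "jack_gamma \<alpha>" and ?l = "length \<pi>" and ?k = "sum_list \<pi>" and ?n = "sum_list lam" and ?D = "boxes lam"
 let ?bin = "real ((?n - ?k + count_list \<pi> 1) choose count_list \<pi> 1)"
 let ?r = "\<pi> @ replicate (?n - ?k) 1"
 have k: "card S = 2 * ?k" using sum_ptype[OF S B W] assms(7) by (metis mset_pairs_type sum_mset_sum_list)
 have z: "real (zmset (ptype B W)) = real (part_z \<pi>) * 2 ^ ?l" "real (zmset (ptype W B)) = real (part_z \<pi>) * 2 ^ ?l"
  "pairs_type W B = \<pi>" using zmset_part_z[of \<pi>] mset_pairs_type[of B W] assms(7) polygons_commute[of W B]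
  by (auto simp: ptype_def pairs_type_def)
 have r: "?r \<in> partitions_of ?n" if "?k \<le> ?n"
  using is_partition_append_ones[OF assms(2)] that by (simp add: partitions_of_def sum_list_replicate)
 have inj: "inj_on (\<lambda>d. (fst d, snd d)) ?D" "inj_on (\<lambda>d. (snd d, fst d)) ?D" by (auto simp: inj_on_def)
 have D: "finite ?D" "card ?D = ?k + (?n - ?k)" if "?k \<le> ?n" using that by (simp_all add: finite_boxes card_boxes)
 have a0: "\<alpha> > 0" using assms(1) by auto
 \<comment> \<open>A map has \<open>?k\<close> edges, half the size of the ground set, and
   \<open>?l\<close> faces.\<close>
 have wt: "map_weight \<alpha> (?M E) * ?g ^ (npoly B E + npoly W E) = ?g ^ (?k + ?l)" if E: "E \<in> pairings S" and g2: "?g ^ 2 = 1 / 2" for E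
 proof -
  have "genus_map S (?M E)" using B W E by (simp add: genus_map_def)
  from map_weight_eq[OF S this g2] show ?thesis using card_pairing[OF S E] k length_pairs_type[of B W] assms(7)
   by (simp add: black_vertices_def white_vertices_def faces_def)
 qed
 have "{?M E | E. E \<in> pairings S} = ?M ` pairings S" by blast
 moreover have "inj_on ?M (pairings S)" by (simp add: inj_on_def)
 ultimately have RHS: "(\<Sum>M\<in>{?M E | E. E \<in> pairings S}. (- (1 / sqrt \<alpha>)) ^ card (black_vertices M) * sqrt \<alpha> ^ card (white_vertices M)
    * map_weight \<alpha> M * real (map_N M lam)) =
   (\<Sum>E\<in>pairings S. (- (1 / sqrt \<alpha>)) ^ npoly B E * sqrt \<alpha> ^ npoly W E * map_weight \<alpha> (?M E) * real (map_N (?M E) lam))"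
  by (simp add: sum.reindex black_vertices_def white_vertices_def)
 \<comment> \<open>The part common to both values of \<alpha>: \<open>vert\<close> isolates the
   factor -2 of the colour selected by \<open>Q\<close>, \<open>F\<close> is the embedding sum,
   \<open>t\<close> the coefficient \<open>tcoef\<close>, and \<open>theta\<close> the remaining
   comparison of scalars with the Jack coefficient.\<close>
 have main: ?thesis
  if g2: "?g ^ 2 = 1 / 2"
   and vert: "\<And>E. (- (1 / sqrt \<alpha>)) ^ npoly B E * sqrt \<alpha> ^ npoly W E = (-2) ^ npoly E Q * ?g ^ (npoly B E + npoly W E)"
   and emb: "(\<Sum>E\<in>pairings S. (-2) ^ npoly E Q * real (map_N (?M E) lam)) = F"
   and F: "?k \<le> ?n \<Longrightarrow> F = (-1) ^ ?k * (real (part_z \<pi>) * 2 ^ ?l * (?bin * t))" "\<not> ?k \<le> ?n \<Longrightarrow> F = 0"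
   and theta: "?k \<le> ?n \<Longrightarrow> (-1) ^ ?l * ?g ^ (?k + ?l) * (-1) ^ ?k * 2 ^ ?l * t = sqrt \<alpha> ^ ?l / sqrt \<alpha> ^ ?k * jack_theta \<alpha> ?r lam"
  for Q F t
 proof -
  have "(\<Sum>E\<in>pairings S. (- (1 / sqrt \<alpha>)) ^ npoly B E * sqrt \<alpha> ^ npoly W E * map_weight \<alpha> (?M E) * real (map_N (?M E) lam)) =
   (\<Sum>E\<in>pairings S. ?g ^ (?k + ?l) * ((-2) ^ npoly E Q * real (map_N (?M E) lam)))"
  proof (rule sum.cong[OF refl])
   fix E assume E: "E \<in> pairings S"
   show "(- (1 / sqrt \<alpha>)) ^ npoly B E * sqrt \<alpha> ^ npoly W E * map_weight \<alpha> (?M E) * real (map_N (?M E) lam) =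
    ?g ^ (?k + ?l) * ((-2) ^ npoly E Q * real (map_N (?M E) lam))"
    unfolding wt[OF E g2, symmetric] vert by (simp only: mult_ac)
  qed
  also have "\<dots> = ?g ^ (?k + ?l) * F" unfolding emb[symmetric] sum_distrib_left ..
  finally have R: "(-1) ^ ?l * (\<Sum>M\<in>{?M E | E. E \<in> pairings S}. (- (1 / sqrt \<alpha>)) ^ card (black_vertices M)
    * sqrt \<alpha> ^ card (white_vertices M) * map_weight \<alpha> M * real (map_N M lam)) = (-1) ^ ?l * (?g ^ (?k + ?l) * F)"
   unfolding RHS by (simp only:)
  show ?thesis
  proof (cases "?k \<le> ?n")
   case True
   have "(-1) ^ ?l * (?g ^ (?k + ?l) * F) = (-1) ^ ?l * ?g ^ (?k + ?l) * (-1) ^ ?k * 2 ^ ?l * t * (?bin * real (part_z \<pi>))"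
    unfolding F(1)[OF True] by (simp only: mult_ac)
   also have "\<dots> = jack_Ch \<alpha> \<pi> lam"
    unfolding theta[OF True] jack_Ch_def if_P[OF True] powr_half_diff[OF a0] by (simp only: mult_ac)
   finally show ?thesis unfolding R by (rule sym)
  next
   case False
   then show ?thesis unfolding R F(2)[OF False] jack_Ch_def by simp
  qed
 qed
 consider (two) "\<alpha> = 2" | (half) "\<alpha> = 1 / 2" using assms(1) by blast
 then show ?thesis
 proof cases
  case two
  \<comment> \<open>For \<open>\<alpha> = 2\<close> the value of \<gamma> is
    \<open>-1 / sqrt 2\<close>: black vertices weigh \<gamma> and white ones
    \<open>-2 * \<gamma>\<close>.\<close>
  have g: "- (1 / sqrt \<alpha>) = ?g" "sqrt \<alpha> = -2 * ?g" "?g ^ 2 = 1 / 2"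
   by (simp_all add: two jack_gamma_def real_div_sqrt power_divide)
  show ?thesis
  proof (rule main[OF g(3) _ sum_embeddings(1)[OF S B W], where t = "tcoef ?D fst snd ?r"])
   show "(- (1 / sqrt \<alpha>)) ^ npoly B E * sqrt \<alpha> ^ npoly W E = (-2) ^ npoly E W * ?g ^ (npoly B E + npoly W E)" for E
    unfolding g(1) unfolding g(2) polygons_commute[of E W] power_mult_distrib power_add by (simp only: mult_ac)
   show "embedding_sum S B W ?D fst snd = (-1) ^ ?k * (real (part_z \<pi>) * 2 ^ ?l * (?bin * tcoef ?D fst snd ?r))" if "?k \<le> ?n"
    unfolding embedding_sum_eq[OF S B W D(1)[OF that] inj(1) k D(2)[OF that]] assms(7) z(1) ..
   show "embedding_sum S B W ?D fst snd = 0" if "\<not> ?k \<le> ?n"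
    using embedding_sum_small[OF S W finite_boxes, of lam B fst snd] that by (simp add: k card_boxes)
   have "(-1) ^ ?l * ?g ^ (?k + ?l) * (-1) ^ ?k * 2 ^ ?l = (- ?g * 2) ^ ?l * (- ?g) ^ ?k"
    by (simp only: power_add power_mult_distrib power_minus[of ?g] mult_ac)
   also have "- ?g * 2 = sqrt \<alpha>" using g(2) by simp
   also have "- ?g = 1 / sqrt \<alpha>" using g(1) by simp
   finally have c: "(-1) ^ ?l * ?g ^ (?k + ?l) * (-1) ^ ?k * 2 ^ ?l = sqrt \<alpha> ^ ?l / sqrt \<alpha> ^ ?k" by (simp add: power_one_over)
   show "(-1) ^ ?l * ?g ^ (?k + ?l) * (-1) ^ ?k * 2 ^ ?l * tcoef ?D fst snd ?r = sqrt \<alpha> ^ ?l / sqrt \<alpha> ^ ?k * jack_theta \<alpha> ?r lam"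
    if "?k \<le> ?n" unfolding c unfolding two jack_theta_real[OF assms(3) r[OF that]] ..
  qed
 next
  case half
  have s: "sqrt \<alpha> = 1 / sqrt 2" by (simp add: half real_sqrt_divide)
  \<comment> \<open>For \<open>\<alpha> = 1 / 2\<close> the value of \<gamma> is
    \<open>1 / sqrt 2\<close>, and the two colours change roles.\<close>
  have g: "- (1 / sqrt \<alpha>) = -2 * ?g" "sqrt \<alpha> = ?g" "?g ^ 2 = 1 / 2"
   unfolding jack_gamma_def s by (simp_all add: half real_div_sqrt field_simps power_divide)
  show ?thesis
  proof (rule main[OF g(3) _ sum_embeddings(2)[OF S B W], where t = "tcoef ?D snd fst ?r"])
   show "(- (1 / sqrt \<alpha>)) ^ npoly B E * sqrt \<alpha> ^ npoly W E = (-2) ^ npoly E B * ?g ^ (npoly B E + npoly W E)" for E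
    unfolding g(1) unfolding g(2) polygons_commute[of E B] power_mult_distrib power_add by (simp only: mult_ac)
   show "embedding_sum S W B ?D snd fst = (-1) ^ ?k * (real (part_z \<pi>) * 2 ^ ?l * (?bin * tcoef ?D snd fst ?r))" if "?k \<le> ?n"
    unfolding embedding_sum_eq[OF S W B D(1)[OF that] inj(2) k D(2)[OF that]] z(2,3) ..
   show "embedding_sum S W B ?D snd fst = 0" if "\<not> ?k \<le> ?n"
    using embedding_sum_small[OF S B finite_boxes, of lam W snd fst] that by (simp add: k card_boxes)
   show "(-1) ^ ?l * ?g ^ (?k + ?l) * (-1) ^ ?k * 2 ^ ?l * tcoef ?D snd fst ?r = sqrt \<alpha> ^ ?l / sqrt \<alpha> ^ ?k * jack_theta \<alpha> ?r lam"
    if kn: "?k \<le> ?n"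
   proof -
    have n: "?n = ?k + (?n - ?k)" using kn by simp
    \<comment> \<open>Each added part 1 contributes \<open>(-1 / 2) * (-2) = 1\<close>, so the
      scaling depends only on \<pi> and not on the size of \<open>lam\<close>.\<close>
    have "(-1 / 2) ^ ?n * (-2) ^ length ?r = (-1 / 2 :: real) ^ ?k * ((-1 / 2) * (-2)) ^ (?n - ?k) * (-2) ^ ?l"
     by (subst n) (simp only: length_append length_replicate power_add power_mult_distrib mult_ac)
    then have 1: "(-1 / 2) ^ ?n * (-2) ^ length ?r = (-1 / 2 :: real) ^ ?k * (-2) ^ ?l" by simp
    have gp: "?g \<noteq> 0" using g(3) by auto
    have "?g = 1 / 2 / ?g" using g(3) gp by (simp add: field_simps power2_eq_square)
    then have 2: "?g ^ ?k = (1 / 2) ^ ?k / ?g ^ ?k" by (metis power_divide)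
    have "(-1) ^ ?l * ?g ^ (?k + ?l) * (-1) ^ ?k * 2 ^ ?l = ?g ^ ?l * ?g ^ ?k * ((-1) ^ ?k * ((-1) * 2) ^ ?l)"
     by (simp only: power_add power_mult_distrib mult_ac)
    also have "\<dots> = ?g ^ ?l / ?g ^ ?k * (((-1) * (1 / 2)) ^ ?k * (-2) ^ ?l)"
     unfolding power_mult_distrib[of "-1" "1 / 2"] by (subst 2) simp
    also have "((-1) * (1 / 2)) ^ ?k * (-2) ^ ?l = (-1 / 2) ^ ?n * (-2 :: real) ^ length ?r" unfolding 1 by simp
    finally show ?thesis
     unfolding g(2) unfolding half jack_theta_quaternionic[OF assms(3) r[OF kn]] by (simp only: mult.assoc)
   qed
  qed
 qed
qed

end
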